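(* Let $k$ be a commutative ring and let $R$ and $S$ be $k$-algebras. Fix an $R|S$-coalgebroid $C$, and let $F:R\text{-}\mathsf{Mod}\text{-}R\to S\text{-}\mathsf{Mod}\text{-}S$ and $\cdot:\mathsf{Mod}\text{-}S\times\mathsf{Mod}\text{-}R\to\mathsf{Mod}\text{-}S$ be the cocontinuous opmonoidal functor and the closed oplax right $(\mathsf{Mod}\text{-}R)$-actegory that correspond to $C$. Then the following structures are equivalent (that is, the categories they form, with structure-preserving morphisms, are equivalent): (i) a comodule in $\mathsf{Mod}\text{-}S$ for the $R|S$-coalgebroid $C$; (ii) a cocontinuous ($k$-linear) comodule $Y:\mathsf{Mod}\text{-}R\to\mathsf{Mod}\text{-}S$ for the opmonoidal functor $F$; (iii) a cocontinuous ($k$-linear) oplax morphism of oplax right $(\mathsf{Mod}\text{-}R)$-actegories $Y:\mathsf{Mod}\text{-}R\to\mathsf{Mod}\text{-}S$ from $\mathsf{Mod}\text{-}R$, acting on itself by its right skew monoidal product $\odot$, into the actegory $(\mathsf{Mod}\text{-}S,\cdot)$.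
   Context: All tensor products without subscript are over $k$; bimodules are $k$-central; $A\text{-}\mathsf{Mod}\text{-}B$ is the category of left-$A$ right-$B$ bimodules and $\mathsf{Mod}\text{-}R$ that of right $R$-modules. Sweedler notation $\delta(c)=\sum c_{(1)}\otimes c_{(2)}$ is used. An $R|S$-coalgebroid is a module $C$ in $(R\otimes S)\text{-}\mathsf{Mod}\text{-}(R\otimes S)$ with maps $\delta:C\to C\otimes_SC$ and $\varepsilon:C\to S$ such that: $\delta(scs')=\sum sc_{(1)}\otimes c_{(2)}s'$; $\delta(rcr')=\sum c_{(1)}r'\otimes rc_{(2)}$; $\varepsilon(scs')=s\varepsilon(c)s'$; $\sum rc_{(1)}\otimes c_{(2)}=\sum c_{(1)}\otimes c_{(2)}r$; $\varepsilon(rc)=\varepsilon(cr)$; and $(C,\varepsilon,\delta)$ is a comonoid in $S\text{-}\mathsf{Mod}\text{-}S$. (i) A comodule for $C$ in $\mathsf{Mod}\text{-}S$ is a right $S$-module $X$ with a morphism $X\to X\otimes_SC$ of right $S$-modules that is coassociative and counital for the comonoid $(C,\varepsilon,\delta)$ in $S\text{-}\mathsf{Mod}\text{-}S$. The opmonoidal functor $F$ corresponding to $C$ is $F(M)=M\otimes_{R^{\mathrm{op}}\otimes R}C$ (the quotient of $M\otimes C$ by $rmr'\otimes c\sim m\otimes r'cr$), with $F(M\otimes_RN)\to F(M)\otimes_SF(N)$, $(m\otimes n)\otimes c\mapsto\sum(m\otimes c_{(1)})\otimes(n\otimes c_{(2)})$, and $F(R)\to S$, $r\otimes c\mapsto\varepsilon(rc)$.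 The right skew monoidal structure on $\mathsf{Mod}\text{-}R$: $A\odot B=A\otimes B$ (with $R$ acting on $B$), unit $R$, canonical associator $A\odot(B\odot B')\cong(A\odot B)\odot B'$, left unitor $B\to R\odot B$, $b\mapsto1\otimes b$, right unitor $A\odot R\to A$, $a\otimes r\mapsto ar$. It is an oplax right actegory on itself via $\odot$, its associator and its right unitor. The oplax actegory corresponding to $C$ is $M\cdot N=(M\otimes N)\otimes_{S\otimes R}C$ (using only the left $S$-, left $R$- and right $S$-actions on $C$), with $a^2:M\cdot(N\odot P)\to(M\cdot N)\cdot P$, $(m\otimes n\otimes p)\otimes c\mapsto\sum\big(((m\otimes n)\otimes c_{(1)})\otimes p\big)\otimes c_{(2)}$, and $a^0:M\cdot R\to M$, $(m\otimes r)\otimes c\mapsto m\,\varepsilon(rc)$. (ii) A comodule for $F$ is a functor $Y:\mathsf{Mod}\text{-}R\to\mathsf{Mod}\text{-}S$ with natural maps $y:Y(X\otimes_RM)\to Y(X)\otimes_SF(M)$ ($X\in\mathsf{Mod}\text{-}R$, $M\in R\text{-}\mathsf{Mod}\text{-}R$) such that the two maps $Y(X\otimes_RM\otimes_RN)\to Y(X)\otimes_SF(M)\otimes_SF(N)$, one obtained by applying $y$ twice, the other by applying $y$ once followed by the opmonoidal constraint of $F$, coincide, and such that $Y(X)\cong Y(X\otimes_RR)\to Y(X)\otimes_SF(R)\to Y(X)\otimes_SS\cong Y(X)$ is the identity. (iii) An oplax morphism is a functor $Y$ with natural maps $y:Y(A\odot B)\to Y(A)\cdot B$ such that $(y_{A,B}\cdot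 B')\,y_{A\odot B,B'}\,Y(\alpha)=a^2\,y_{A,B\odot B'}$ as maps $Y(A\odot(B\odot B'))\to(Y(A)\cdot B)\cdot B'$, where $\alpha$ is the associator, and $a^0\,y_{A,R}=Y(\rho_A):Y(A\odot R)\to Y(A)$. Morphisms in (i) are comodule maps; in (ii) and (iii) natural transformations $Y\Rightarrow Y'$ compatible with $y,y'$. *)

(*
  The type variable 'u plays the role of the universe: a set is small if it is (the size of) a
  subset of 'u, and all rings, modules and diagrams are carried by such sets.  The main theorem
  assumes 'u to be infinite, which makes the small modules closed under tensor products and under
  small colimits.
*)

theory Defs
  imports "HOL-Algebra.Free_Abelian_Groups" "HOL-Algebra.Module"
begin

section \<open>Categories\<close>

text \<open>Hom-sets of different pairs of objects may overlap, so operations on morphisms are told the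
  objects involved: \<^term>\<open>Cmp A x y z g f\<close> is the composite of \<^term>\<open>f\<close>, from \<^term>\<open>x\<close> to
  \<^term>\<open>y\<close>, with \<^term>\<open>g\<close>, from \<^term>\<open>y\<close> to \<^term>\<open>z\<close>.\<close>

record ('o, 'm) cat =
  Obj :: "'o set"
  Hom :: "'o \<Rightarrow> 'o \<Rightarrow> 'm set"
  Idn :: "'o \<Rightarrow> 'm"
  Cmp :: "'o \<Rightarrow> 'o \<Rightarrow> 'o \<Rightarrow> 'm \<Rightarrow> 'm \<Rightarrow> 'm"

locale category =
  fixes A :: "('o, 'm) cat"
  assumes Idn_closed: "x \<in> Obj A \<Longrightarrow> Idn A x \<in> Hom A x x"
    and Cmp_closed: "\<lbrakk>x \<in> Obj A; y \<in> Obj A; z \<in> Obj A; f \<in> Hom A x y; g \<in> Hom A y z\<rbrakk>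
      \<Longrightarrow> Cmp A x y z g f \<in> Hom A x z"
    and Cmp_Idn_left: "\<lbrakk>x \<in> Obj A; y \<in> Obj A; f \<in> Hom A x y\<rbrakk> \<Longrightarrow> Cmp A x y y (Idn A y) f = f"
    and Cmp_Idn_right: "\<lbrakk>x \<in> Obj A; y \<in> Obj A; f \<in> Hom A x y\<rbrakk> \<Longrightarrow> Cmp A x x y f (Idn A x) = f"
    and Cmp_assoc: "\<lbrakk>w \<in> Obj A; x \<in> Obj A; y \<in> Obj A; z \<in> Obj A;
        f \<in> Hom A w x; g \<in> Hom A x y; h \<in> Hom A y z\<rbrakk>
      \<Longrightarrow> Cmp A w x z (Cmp A x y z h g) f = Cmp A w y z h (Cmp A w x y g f)"

record ('o, 'm, 'p, 'n) ftor =
  fob :: "'o \<Rightarrow> 'p"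
  fhom :: "'o \<Rightarrow> 'o \<Rightarrow> 'm \<Rightarrow> 'n"

locale cat_functor = dom: category A + cod: category B
  for A :: "('o, 'm) cat" and B :: "('p, 'n) cat" +
  fixes F :: "('o, 'm, 'p, 'n, 'z) ftor_scheme"
  assumes fob_closed: "x \<in> Obj A \<Longrightarrow> fob F x \<in> Obj B"
    and fhom_closed: "\<lbrakk>x \<in> Obj A; y \<in> Obj A; f \<in> Hom A x y\<rbrakk>
      \<Longrightarrow> fhom F x y f \<in> Hom B (fob F x) (fob F y)"
    and fhom_Idn: "x \<in> Obj A \<Longrightarrow> fhom F x x (Idn A x) = Idn B (fob F x)"
    and fhom_Cmp: "\<lbrakk>x \<in> Obj A; y \<in> Obj A; z \<in> Obj A; f \<in> Hom A x y; g \<in> Hom A y z\<rbrakk>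
      \<Longrightarrow> fhom F x z (Cmp A x y z g f)
        = Cmp B (fob F x) (fob F y) (fob F z) (fhom F y z g) (fhom F x y f)"

definition id_ftor :: "('o, 'm, 'o, 'm) ftor" where
  "id_ftor = \<lparr>fob = (\<lambda>x. x), fhom = (\<lambda>x y f. f)\<rparr>"

definition comp_ftor :: "('p, 'n, 'q, 'l) ftor \<Rightarrow> ('o, 'm, 'p, 'n) ftor \<Rightarrow> ('o, 'm, 'q, 'l) ftor" where
  "comp_ftor G F = \<lparr>fob = (\<lambda>x. fob G (fob F x)),
     fhom = (\<lambda>x y f. fhom G (fob F x) (fob F y) (fhom F x y f))\<rparr>"

text \<open>Natural transformations are \<^term>\<open>undefined\<close> outside the objects of the source category, so
  that equality of transformations is equality of their components.\<close>

definition nat_trans ::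
  "('o, 'm) cat \<Rightarrow> ('p, 'n) cat \<Rightarrow> ('o, 'm, 'p, 'n) ftor \<Rightarrow> ('o, 'm, 'p, 'n) ftor \<Rightarrow> ('o \<Rightarrow> 'n) set" where
  "nat_trans A B F G = {t \<in> extensional (Obj A).
     (\<forall>x \<in> Obj A. t x \<in> Hom B (fob F x) (fob G x)) \<and>
     (\<forall>x \<in> Obj A. \<forall>y \<in> Obj A. \<forall>f \<in> Hom A x y.
        Cmp B (fob F x) (fob G x) (fob G y) (fhom G x y f) (t x)
      = Cmp B (fob F x) (fob F y) (fob G y) (t y) (fhom F x y f))}"

definition is_iso :: "('o, 'm) cat \<Rightarrow> 'o \<Rightarrow> 'o \<Rightarrow> 'm \<Rightarrow> bool" where
  "is_iso A x y f \<longleftrightarrow> f \<in> Hom A x y \<and>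
     (\<exists>g \<in> Hom A y x. Cmp A x y x g f = Idn A x \<and> Cmp A y x y f g = Idn A y)"

definition naturally_isomorphic ::
  "('o, 'm) cat \<Rightarrow> ('p, 'n) cat \<Rightarrow> ('o, 'm, 'p, 'n) ftor \<Rightarrow> ('o, 'm, 'p, 'n) ftor \<Rightarrow> bool" where
  "naturally_isomorphic A B F G \<longleftrightarrow>
     (\<exists>t \<in> nat_trans A B F G. \<forall>x \<in> Obj A. is_iso B (fob F x) (fob G x) (t x))"

definition equivalent_categories :: "('o, 'm) cat \<Rightarrow> ('p, 'n) cat \<Rightarrow> bool" where
  "equivalent_categories A B \<longleftrightarrow>
     (\<exists>F G. cat_functor A B F \<and> cat_functor B A G \<and>
        naturally_isomorphic A A (comp_ftor G F) id_ftor \<and>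
        naturally_isomorphic B B (comp_ftor F G) id_ftor)"

definition cocone ::
  "('j, 'i) cat \<Rightarrow> ('o, 'm) cat \<Rightarrow> ('j, 'i, 'o, 'm) ftor \<Rightarrow> 'o \<Rightarrow> ('j \<Rightarrow> 'm) \<Rightarrow> bool" where
  "cocone J A D L c \<longleftrightarrow> L \<in> Obj A \<and> (\<forall>j \<in> Obj J. c j \<in> Hom A (fob D j) L) \<and>
     (\<forall>i \<in> Obj J. \<forall>j \<in> Obj J. \<forall>u \<in> Hom J i j.
        Cmp A (fob D i) (fob D j) L (c j) (fhom D i j u) = c i)"

definition is_colimit ::
  "('j, 'i) cat \<Rightarrow> ('o, 'm) cat \<Rightarrow> ('j, 'i, 'o, 'm) ftor \<Rightarrow> 'o \<Rightarrow> ('j \<Rightarrow> 'm) \<Rightarrow> bool" where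
  "is_colimit J A D L c \<longleftrightarrow> cocone J A D L c \<and>
     (\<forall>N d. cocone J A D N d \<longrightarrow>
        (\<exists>!h. h \<in> Hom A L N \<and> (\<forall>j \<in> Obj J. Cmp A (fob D j) L N h (c j) = d j)))"


section \<open>Algebras and modules\<close>

locale k_algebra = module k A + ring A
  for k :: "'k ring" and A :: "('k, 'a) module" +
  assumes smult_mult_left:
      "\<lbrakk>a \<in> carrier k; x \<in> carrier A; y \<in> carrier A\<rbrakk>
        \<Longrightarrow> (a \<odot>\<^bsub>A\<^esub> x) \<otimes>\<^bsub>A\<^esub> y = a \<odot>\<^bsub>A\<^esub> (x \<otimes>\<^bsub>A\<^esub> y)"
    and smult_mult_right:
      "\<lbrakk>a \<in> carrier k; x \<in> carrier A; y \<in> carrier A\<rbrakk>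
        \<Longrightarrow> x \<otimes>\<^bsub>A\<^esub> (a \<odot>\<^bsub>A\<^esub> y) = a \<odot>\<^bsub>A\<^esub> (x \<otimes>\<^bsub>A\<^esub> y)"

definition scal :: "('k, 'a) module \<Rightarrow> 'k \<Rightarrow> 'a" where
  "scal A a = a \<odot>\<^bsub>A\<^esub> \<one>\<^bsub>A\<^esub>"

text \<open>As in \<^type>\<open>module\<close> of the library, the additive group of a module is a \<^type>\<open>ring\<close> record
  whose multiplicative fields are ignored.\<close>

record 'u rmodule = "'u ring" +
  ract :: "'u \<Rightarrow> 'u \<Rightarrow> 'u" (infixl "\<triangleleft>\<index>" 70)

record 'u bimodule = "'u rmodule" +
  lact :: "'u \<Rightarrow> 'u \<Rightarrow> 'u" (infixr "\<triangleright>\<index>" 75)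

locale right_module = R: ring R + M: abelian_group M
  for R :: "('u, 'r) ring_scheme" and M :: "('u, 'm) rmodule_scheme" +
  assumes ract_closed: "\<lbrakk>m \<in> carrier M; r \<in> carrier R\<rbrakk> \<Longrightarrow> m \<triangleleft>\<^bsub>M\<^esub> r \<in> carrier M"
    and ract_add: "\<lbrakk>m \<in> carrier M; m' \<in> carrier M; r \<in> carrier R\<rbrakk>
      \<Longrightarrow> (m \<oplus>\<^bsub>M\<^esub> m') \<triangleleft>\<^bsub>M\<^esub> r = m \<triangleleft>\<^bsub>M\<^esub> r \<oplus>\<^bsub>M\<^esub> m' \<triangleleft>\<^bsub>M\<^esub> r"
    and ract_add_scalar: "\<lbrakk>m \<in> carrier M; r \<in> carrier R; r' \<in> carrier R\<rbrakk>
      \<Longrightarrow> m \<triangleleft>\<^bsub>M\<^esub> (r \<oplus>\<^bsub>R\<^esub> r') = m \<triangleleft>\<^bsub>M\<^esub> r \<oplus>\<^bsub>M\<^esub> m \<triangleleft>\<^bsub>M\<^esub> r'"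
    and ract_mult: "\<lbrakk>m \<in> carrier M; r \<in> carrier R; r' \<in> carrier R\<rbrakk>
      \<Longrightarrow> m \<triangleleft>\<^bsub>M\<^esub> (r \<otimes>\<^bsub>R\<^esub> r') = m \<triangleleft>\<^bsub>M\<^esub> r \<triangleleft>\<^bsub>M\<^esub> r'"
    and ract_one: "m \<in> carrier M \<Longrightarrow> m \<triangleleft>\<^bsub>M\<^esub> \<one>\<^bsub>R\<^esub> = m"

locale left_module = R: ring R + M: abelian_group M
  for R :: "('u, 'r) ring_scheme" and M :: "('u, 'm) bimodule_scheme" +
  assumes lact_closed: "\<lbrakk>r \<in> carrier R; m \<in> carrier M\<rbrakk> \<Longrightarrow> r \<triangleright>\<^bsub>M\<^esub> m \<in> carrier M"
    and lact_add: "\<lbrakk>r \<in> carrier R; m \<in> carrier M; m' \<in> carrier M\<rbrakk>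
      \<Longrightarrow> r \<triangleright>\<^bsub>M\<^esub> (m \<oplus>\<^bsub>M\<^esub> m') = (r \<triangleright>\<^bsub>M\<^esub> m) \<oplus>\<^bsub>M\<^esub> (r \<triangleright>\<^bsub>M\<^esub> m')"
    and lact_add_scalar: "\<lbrakk>r \<in> carrier R; r' \<in> carrier R; m \<in> carrier M\<rbrakk>
      \<Longrightarrow> (r \<oplus>\<^bsub>R\<^esub> r') \<triangleright>\<^bsub>M\<^esub> m = (r \<triangleright>\<^bsub>M\<^esub> m) \<oplus>\<^bsub>M\<^esub> (r' \<triangleright>\<^bsub>M\<^esub> m)"
    and lact_mult: "\<lbrakk>r \<in> carrier R; r' \<in> carrier R; m \<in> carrier M\<rbrakk>
      \<Longrightarrow> (r \<otimes>\<^bsub>R\<^esub> r') \<triangleright>\<^bsub>M\<^esub> m = r \<triangleright>\<^bsub>M\<^esub> (r' \<triangleright>\<^bsub>M\<^esub> m)"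
    and lact_one: "m \<in> carrier M \<Longrightarrow> \<one>\<^bsub>R\<^esub> \<triangleright>\<^bsub>M\<^esub> m = m"

locale k_bimodule = R: k_algebra k R + S: k_algebra k S + left_module R M + right_module S M
  for k :: "'k ring" and R :: "('k, 'u) module" and S :: "('k, 'u) module"
    and M :: "('u, 'm) bimodule_scheme" +
  assumes actions_commute: "\<lbrakk>r \<in> carrier R; m \<in> carrier M; s \<in> carrier S\<rbrakk>
      \<Longrightarrow> (r \<triangleright>\<^bsub>M\<^esub> m) \<triangleleft>\<^bsub>M\<^esub> s = r \<triangleright>\<^bsub>M\<^esub> (m \<triangleleft>\<^bsub>M\<^esub> s)"
    and k_central: "\<lbrakk>a \<in> carrier k; m \<in> carrier M\<rbrakk> \<Longrightarrow> scal R a \<triangleright>\<^bsub>M\<^esub> m = m \<triangleleft>\<^bsub>M\<^esub> scal S a"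

definition regular_rmodule :: "('k, 'u) module \<Rightarrow> 'u rmodule" where
  "regular_rmodule R = ring.extend (ring.truncate R) (rmodule.fields (monoid.mult R))"

definition regular_bimodule :: "('k, 'u) module \<Rightarrow> 'u bimodule" where
  "regular_bimodule R = rmodule.extend (regular_rmodule R) (bimodule.fields (monoid.mult R))"

definition rhom ::
  "('k, 'u) module \<Rightarrow> ('u, 'm) rmodule_scheme \<Rightarrow> ('u, 'n) rmodule_scheme \<Rightarrow> ('u \<Rightarrow> 'u) set" where
  "rhom R M N = {f \<in> extensional (carrier M). f \<in> hom (add_monoid M) (add_monoid N) \<and>
     (\<forall>m \<in> carrier M. \<forall>r \<in> carrier R. f (m \<triangleleft>\<^bsub>M\<^esub> r) = f m \<triangleleft>\<^bsub>N\<^esub> r)}"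

definition bihom ::
  "('k, 'u) module \<Rightarrow> ('k, 'u) module \<Rightarrow> ('u, 'm) bimodule_scheme \<Rightarrow> ('u, 'n) bimodule_scheme
     \<Rightarrow> ('u \<Rightarrow> 'u) set" where
  "bihom R S M N = {f \<in> rhom S M N.
     \<forall>r \<in> carrier R. \<forall>m \<in> carrier M. f (r \<triangleright>\<^bsub>M\<^esub> m) = r \<triangleright>\<^bsub>N\<^esub> f m}"

definition RMod :: "('k, 'u) module \<Rightarrow> ('u rmodule, 'u \<Rightarrow> 'u) cat" where
  "RMod R = \<lparr>Obj = {M. right_module R M}, Hom = rhom R,
     Idn = (\<lambda>M. \<lambda>m \<in> carrier M. m), Cmp = (\<lambda>L M N g f. compose (carrier L) g f)\<rparr>"

definition Bimod ::
  "'k ring \<Rightarrow> ('k, 'u) module \<Rightarrow> ('k, 'u) module \<Rightarrow> ('u bimodule, 'u \<Rightarrow> 'u) cat" where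
  "Bimod k R S = \<lparr>Obj = {M. k_bimodule k R S M}, Hom = bihom R S,
     Idn = (\<lambda>M. \<lambda>m \<in> carrier M. m), Cmp = (\<lambda>L M N g f. compose (carrier L) g f)\<rparr>"

type_synonym 'u mod_ftor = "('u rmodule, 'u \<Rightarrow> 'u, 'u rmodule, 'u \<Rightarrow> 'u) ftor"

definition k_linear ::
  "'k ring \<Rightarrow> ('k, 'u) module \<Rightarrow> ('k, 'u) module \<Rightarrow> 'u mod_ftor \<Rightarrow> bool" where
  "k_linear k R S Y \<longleftrightarrow> (\<forall>M \<in> Obj (RMod R). \<forall>N \<in> Obj (RMod R).
     (\<forall>f \<in> rhom R M N. \<forall>g \<in> rhom R M N.
        fhom Y M N (\<lambda>m \<in> carrier M. f m \<oplus>\<^bsub>N\<^esub> g m)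
      = (\<lambda>x \<in> carrier (fob Y M). fhom Y M N f x \<oplus>\<^bsub>fob Y N\<^esub> fhom Y M N g x)) \<and>
     (\<forall>f \<in> rhom R M N. \<forall>a \<in> carrier k.
        fhom Y M N (\<lambda>m \<in> carrier M. f m \<triangleleft>\<^bsub>N\<^esub> scal R a)
      = (\<lambda>x \<in> carrier (fob Y M). fhom Y M N f x \<triangleleft>\<^bsub>fob Y N\<^esub> scal S a)))"

text \<open>Cocontinuity is preservation of all colimits of small diagrams, the shape of a small diagram
  being a category whose objects and morphisms are elements of \<^typ>\<open>'u\<close>.\<close>

definition cocontinuous ::
  "('k, 'u) module \<Rightarrow> ('k, 'u) module \<Rightarrow> 'u mod_ftor \<Rightarrow> bool" where
  "cocontinuous R S Y \<longleftrightarrow>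
     (\<forall>(J :: ('u, 'u) cat) D L c. cat_functor J (RMod R) D \<and> is_colimit J (RMod R) D L c \<longrightarrow>
        is_colimit J (RMod S) (comp_ftor Y D) (fob Y L) (\<lambda>j. fhom Y (fob D j) L (c j)))"

definition cocontinuous_linear_functor ::
  "'k ring \<Rightarrow> ('k, 'u) module \<Rightarrow> ('k, 'u) module \<Rightarrow> 'u mod_ftor \<Rightarrow> bool" where
  "cocontinuous_linear_functor k R S Y \<longleftrightarrow>
     cat_functor (RMod R) (RMod S) Y \<and> k_linear k R S Y \<and> cocontinuous R S Y"


section \<open>Tensor products\<close>

text \<open>For a set \<^term>\<open>\<rho>\<close> of pairs \<^term>\<open>((a, b), (a', b'))\<close>, \<^term>\<open>tens \<rho> A B\<close> is the abelian group
  generated by the symbols $a \otimes b$ subject to biadditivity and to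
  $a \otimes b = a' \otimes b'$ for these pairs; all tensor products below are of this form.
  The quotient \<^term>\<open>tens_quot \<rho> A B\<close> of the free abelian group is carried over to the universe
  \<^typ>\<open>'u\<close> along an injection, which exists if \<^typ>\<open>'u\<close> is infinite.\<close>

type_synonym 'u bal = "(('u \<times> 'u) \<times> ('u \<times> 'u)) set"

definition tens_relators ::
  "'u bal \<Rightarrow> ('u, 'a) ring_scheme \<Rightarrow> ('u, 'b) ring_scheme \<Rightarrow> ('u \<times> 'u \<Rightarrow>\<^sub>0 int) set" where
  "tens_relators \<rho> A B =
     {frag_of (a \<oplus>\<^bsub>A\<^esub> a', b) - frag_of (a, b) - frag_of (a', b) |a a' b.
        a \<in> carrier A \<and> a' \<in> carrier A \<and> b \<in> carrier B} \<union>
     {frag_of (a, b \<oplus>\<^bsub>B\<^esub> b') - frag_of (a, b) - frag_of (a, b') |a b b'.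
        a \<in> carrier A \<and> b \<in> carrier B \<and> b' \<in> carrier B} \<union>
     {frag_of p - frag_of q |p q. (p, q) \<in> \<rho>}"

definition tens_sub ::
  "'u bal \<Rightarrow> ('u, 'a) ring_scheme \<Rightarrow> ('u, 'b) ring_scheme \<Rightarrow> ('u \<times> 'u \<Rightarrow>\<^sub>0 int) set" where
  "tens_sub \<rho> A B =
     generate (free_Abelian_group (carrier A \<times> carrier B)) (tens_relators \<rho> A B)"

definition tens_quot ::
  "'u bal \<Rightarrow> ('u, 'a) ring_scheme \<Rightarrow> ('u, 'b) ring_scheme \<Rightarrow> ('u \<times> 'u \<Rightarrow>\<^sub>0 int) set monoid" where
  "tens_quot \<rho> A B = free_Abelian_group (carrier A \<times> carrier B) Mod tens_sub \<rho> A B"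

definition tens_code ::
  "'u bal \<Rightarrow> ('u, 'a) ring_scheme \<Rightarrow> ('u, 'b) ring_scheme \<Rightarrow> ('u \<times> 'u \<Rightarrow>\<^sub>0 int) set \<Rightarrow> 'u" where
  "tens_code \<rho> A B = (SOME e. inj_on e (carrier (tens_quot \<rho> A B)))"

definition tens :: "'u bal \<Rightarrow> ('u, 'a) ring_scheme \<Rightarrow> ('u, 'b) ring_scheme \<Rightarrow> 'u ring" where
  "tens \<rho> A B =
     (let Q = tens_quot \<rho> A B; e = tens_code \<rho> A B; d = inv_into (carrier Q) e in
      \<lparr>carrier = e ` carrier Q, monoid.mult = undefined, monoid.one = undefined,
       ring.zero = e \<one>\<^bsub>Q\<^esub>, ring.add = (\<lambda>x y. e (d x \<otimes>\<^bsub>Q\<^esub> d y))\<rparr>)"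

definition pure ::
  "'u bal \<Rightarrow> ('u, 'a) ring_scheme \<Rightarrow> ('u, 'b) ring_scheme \<Rightarrow> 'u \<Rightarrow> 'u \<Rightarrow> 'u" where
  "pure \<rho> A B a b = tens_code \<rho> A B
     (tens_sub \<rho> A B #>\<^bsub>free_Abelian_group (carrier A \<times> carrier B)\<^esub> frag_of (a, b))"

text \<open>The map of abelian groups out of \<^term>\<open>tens \<rho> A B\<close> given by $a \otimes b \mapsto f(a,b)$.\<close>

definition tlift ::
  "'u bal \<Rightarrow> ('u, 'a) ring_scheme \<Rightarrow> ('u, 'b) ring_scheme \<Rightarrow> ('u, 'g) ring_scheme
     \<Rightarrow> ('u \<Rightarrow> 'u \<Rightarrow> 'u) \<Rightarrow> 'u \<Rightarrow> 'u" where
  "tlift \<rho> A B G f = (THE h. h \<in> extensional (carrier (tens \<rho> A B)) \<and>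
     h \<in> hom (add_monoid (tens \<rho> A B)) (add_monoid G) \<and>
     (\<forall>a \<in> carrier A. \<forall>b \<in> carrier B. h (pure \<rho> A B a b) = f a b))"

subsection \<open>Tensor products over a ring\<close>

definition over_ring ::
  "('k, 'u) module \<Rightarrow> ('u, 'x) rmodule_scheme \<Rightarrow> ('u, 'm) bimodule_scheme \<Rightarrow> 'u bal" where
  "over_ring R X M = {((x \<triangleleft>\<^bsub>X\<^esub> r, m), (x, r \<triangleright>\<^bsub>M\<^esub> m)) |x r m.
     x \<in> carrier X \<and> r \<in> carrier R \<and> m \<in> carrier M}"

abbreviation rpure where "rpure R X M \<equiv> pure (over_ring R X M) X M"
abbreviation rlift where "rlift R X M \<equiv> tlift (over_ring R X M) X M"

definition rtensor ::
  "('k, 'u) module \<Rightarrow> ('u, 'x) rmodule_scheme \<Rightarrow> ('u, 'm) bimodule_scheme \<Rightarrow> 'u rmodule" where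
  "rtensor R X M = (let T = tens (over_ring R X M) X M in
     ring.extend T (rmodule.fields
       (\<lambda>t s. rlift R X M T (\<lambda>x m. rpure R X M x (m \<triangleleft>\<^bsub>M\<^esub> s)) t)))"

definition bitensor ::
  "('k, 'u) module \<Rightarrow> ('u, 'x) bimodule_scheme \<Rightarrow> ('u, 'm) bimodule_scheme \<Rightarrow> 'u bimodule" where
  "bitensor R X M = (let T = rtensor R X M in
     rmodule.extend T (bimodule.fields
       (\<lambda>s t. rlift R X M T (\<lambda>x m. rpure R X M (s \<triangleright>\<^bsub>X\<^esub> x) m) t)))"

definition rtensor_map ::
  "('k, 'u) module \<Rightarrow> ('u, 'x) rmodule_scheme \<Rightarrow> ('u, 'm) bimodule_scheme
     \<Rightarrow> ('u, 'y) rmodule_scheme \<Rightarrow> ('u, 'n) bimodule_scheme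
     \<Rightarrow> ('u \<Rightarrow> 'u) \<Rightarrow> ('u \<Rightarrow> 'u) \<Rightarrow> 'u \<Rightarrow> 'u" where
  "rtensor_map R X M X' M' f g =
     rlift R X M (rtensor R X' M') (\<lambda>x m. rpure R X' M' (f x) (g m))"

definition rassoc ::
  "('k, 'u) module \<Rightarrow> ('u, 'x) rmodule_scheme \<Rightarrow> ('u, 'm) bimodule_scheme
     \<Rightarrow> ('u, 'n) bimodule_scheme \<Rightarrow> 'u \<Rightarrow> 'u" where
  "rassoc R X M N = (let T = rtensor R (rtensor R X M) N in
     rlift R X (bitensor R M N) T (\<lambda>x. rlift R M N T
       (\<lambda>m n. rpure R (rtensor R X M) N (rpure R X M x m) n)))"

definition runit :: "('k, 'u) module \<Rightarrow> ('u, 'x) rmodule_scheme \<Rightarrow> 'u \<Rightarrow> 'u" where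
  "runit R X = rlift R X (regular_bimodule R) X (\<lambda>x r. x \<triangleleft>\<^bsub>X\<^esub> r)"

definition runit_inv :: "('k, 'u) module \<Rightarrow> ('u, 'x) rmodule_scheme \<Rightarrow> 'u \<Rightarrow> 'u" where
  "runit_inv R X = (\<lambda>x \<in> carrier X. rpure R X (regular_bimodule R) x \<one>\<^bsub>R\<^esub>)"

subsection \<open>Tensor products over the ground ring\<close>

definition over_k ::
  "'k ring \<Rightarrow> ('k, 'u) module \<Rightarrow> ('k, 'u) module
     \<Rightarrow> ('u, 'm) rmodule_scheme \<Rightarrow> ('u, 'n) rmodule_scheme \<Rightarrow> 'u bal" where
  "over_k k S R M N = {((m \<triangleleft>\<^bsub>M\<^esub> scal S a, n), (m, n \<triangleleft>\<^bsub>N\<^esub> scal R a)) |m a n.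
     m \<in> carrier M \<and> a \<in> carrier k \<and> n \<in> carrier N}"

abbreviation ktens where "ktens k S R M N \<equiv> tens (over_k k S R M N) M N"
abbreviation kpure where "kpure k S R M N \<equiv> pure (over_k k S R M N) M N"
abbreviation klift where "klift k S R M N \<equiv> tlift (over_k k S R M N) M N"

definition odot ::
  "'k ring \<Rightarrow> ('k, 'u) module \<Rightarrow> 'u rmodule \<Rightarrow> 'u rmodule \<Rightarrow> 'u rmodule" where
  "odot k R A B = (let T = ktens k R R A B in
     ring.extend T (rmodule.fields
       (\<lambda>t r. klift k R R A B T (\<lambda>a b. kpure k R R A B a (b \<triangleleft>\<^bsub>B\<^esub> r)) t)))"

definition odot_map ::
  "'k ring \<Rightarrow> ('k, 'u) module \<Rightarrow> 'u rmodule \<Rightarrow> 'u rmodule \<Rightarrow> 'u rmodule \<Rightarrow> 'u rmodule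
     \<Rightarrow> ('u \<Rightarrow> 'u) \<Rightarrow> ('u \<Rightarrow> 'u) \<Rightarrow> 'u \<Rightarrow> 'u" where
  "odot_map k R A B A' B' f g =
     klift k R R A B (odot k R A' B') (\<lambda>a b. kpure k R R A' B' (f a) (g b))"

definition odot_assoc ::
  "'k ring \<Rightarrow> ('k, 'u) module \<Rightarrow> 'u rmodule \<Rightarrow> 'u rmodule \<Rightarrow> 'u rmodule \<Rightarrow> 'u \<Rightarrow> 'u" where
  "odot_assoc k R A B B' = (let T = odot k R (odot k R A B) B' in
     klift k R R A (odot k R B B') T (\<lambda>a. klift k R R B B' T
       (\<lambda>b b'. kpure k R R (odot k R A B) B' (kpure k R R A B a b) b')))"

definition odot_runit :: "'k ring \<Rightarrow> ('k, 'u) module \<Rightarrow> 'u rmodule \<Rightarrow> 'u \<Rightarrow> 'u" where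
  "odot_runit k R A = klift k R R A (regular_rmodule R) A (\<lambda>a r. a \<triangleleft>\<^bsub>A\<^esub> r)"


section \<open>Coalgebroids and their comodules\<close>

text \<open>An $(R\otimes S)$-bimodule is given by its actions of $R$ and $S$ on both sides, all of which
  commute and which restrict to the same action of \<^term>\<open>k\<close>.  The inherited bimodule structure of
  the record is the one over \<^term>\<open>S\<close>.\<close>

record 'u coalg = "'u bimodule" +
  ractR :: "'u \<Rightarrow> 'u \<Rightarrow> 'u" (infixl "\<unlhd>\<index>" 70)
  lactR :: "'u \<Rightarrow> 'u \<Rightarrow> 'u" (infixr "\<unrhd>\<index>" 75)
  comul :: "'u \<Rightarrow> 'u"
  counit :: "'u \<Rightarrow> 'u"

definition R_part :: "'u coalg \<Rightarrow> 'u bimodule" where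
  "R_part C = rmodule.extend (ring.extend (ring.truncate C) (rmodule.fields (ractR C)))
     (bimodule.fields (lactR C))"

locale coalgebroid_module =
  S_part: k_bimodule k S S C + R_part: k_bimodule k R R "R_part C"
  for k :: "'k ring" and R :: "('k, 'u) module" and S :: "('k, 'u) module" and C :: "'u coalg" +
  assumes lact_lactR: "\<lbrakk>s \<in> carrier S; r \<in> carrier R; c \<in> carrier C\<rbrakk>
      \<Longrightarrow> s \<triangleright>\<^bsub>C\<^esub> (r \<unrhd>\<^bsub>C\<^esub> c) = r \<unrhd>\<^bsub>C\<^esub> (s \<triangleright>\<^bsub>C\<^esub> c)"
    and lact_ractR: "\<lbrakk>s \<in> carrier S; r \<in> carrier R; c \<in> carrier C\<rbrakk>
      \<Longrightarrow> s \<triangleright>\<^bsub>C\<^esub> (c \<unlhd>\<^bsub>C\<^esub> r) = (s \<triangleright>\<^bsub>C\<^esub> c) \<unlhd>\<^bsub>C\<^esub> r"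
    and ract_lactR: "\<lbrakk>s \<in> carrier S; r \<in> carrier R; c \<in> carrier C\<rbrakk>
      \<Longrightarrow> (r \<unrhd>\<^bsub>C\<^esub> c) \<triangleleft>\<^bsub>C\<^esub> s = r \<unrhd>\<^bsub>C\<^esub> (c \<triangleleft>\<^bsub>C\<^esub> s)"
    and ract_ractR: "\<lbrakk>s \<in> carrier S; r \<in> carrier R; c \<in> carrier C\<rbrakk>
      \<Longrightarrow> (c \<triangleleft>\<^bsub>C\<^esub> s) \<unlhd>\<^bsub>C\<^esub> r = (c \<unlhd>\<^bsub>C\<^esub> r) \<triangleleft>\<^bsub>C\<^esub> s"
    and k_actions_agree: "\<lbrakk>a \<in> carrier k; c \<in> carrier C\<rbrakk> \<Longrightarrow> scal R a \<unrhd>\<^bsub>C\<^esub> c = scal S a \<triangleright>\<^bsub>C\<^esub> c"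

locale coalgebroid = coalgebroid_module k R S C
  for k :: "'k ring" and R :: "('k, 'u) module" and S :: "('k, 'u) module" and C :: "'u coalg" +
  assumes comul_hom: "comul C \<in> hom (add_monoid C) (add_monoid (bitensor S C C))"
    and counit_hom: "counit C \<in> hom (add_monoid C) (add_monoid S)"
    and comul_S: "\<lbrakk>s \<in> carrier S; c \<in> carrier C; s' \<in> carrier S\<rbrakk>
      \<Longrightarrow> comul C ((s \<triangleright>\<^bsub>C\<^esub> c) \<triangleleft>\<^bsub>C\<^esub> s')
        = rlift S C C (bitensor S C C) (\<lambda>x y. rpure S C C (s \<triangleright>\<^bsub>C\<^esub> x) (y \<triangleleft>\<^bsub>C\<^esub> s')) (comul C c)"
    and comul_R: "\<lbrakk>r \<in> carrier R; c \<in> carrier C; r' \<in> carrier R\<rbrakk>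
      \<Longrightarrow> comul C ((r \<unrhd>\<^bsub>C\<^esub> c) \<unlhd>\<^bsub>C\<^esub> r')
        = rlift S C C (bitensor S C C) (\<lambda>x y. rpure S C C (x \<unlhd>\<^bsub>C\<^esub> r') (r \<unrhd>\<^bsub>C\<^esub> y)) (comul C c)"
    and counit_S: "\<lbrakk>s \<in> carrier S; c \<in> carrier C; s' \<in> carrier S\<rbrakk>
      \<Longrightarrow> counit C ((s \<triangleright>\<^bsub>C\<^esub> c) \<triangleleft>\<^bsub>C\<^esub> s') = s \<otimes>\<^bsub>S\<^esub> counit C c \<otimes>\<^bsub>S\<^esub> s'"
    and comul_balanced: "\<lbrakk>r \<in> carrier R; c \<in> carrier C\<rbrakk>
      \<Longrightarrow> rlift S C C (bitensor S C C) (\<lambda>x y. rpure S C C (r \<unrhd>\<^bsub>C\<^esub> x) y) (comul C c)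
        = rlift S C C (bitensor S C C) (\<lambda>x y. rpure S C C x (y \<unlhd>\<^bsub>C\<^esub> r)) (comul C c)"
    and counit_R: "\<lbrakk>r \<in> carrier R; c \<in> carrier C\<rbrakk>
      \<Longrightarrow> counit C (r \<unrhd>\<^bsub>C\<^esub> c) = counit C (c \<unlhd>\<^bsub>C\<^esub> r)"
    and coassociative: "c \<in> carrier C
      \<Longrightarrow> rtensor_map S C C (bitensor S C C) C (comul C) (\<lambda>y. y) (comul C c)
        = rassoc S C C C (rtensor_map S C C C (bitensor S C C) (\<lambda>x. x) (comul C) (comul C c))"
    and counital_left: "c \<in> carrier C
      \<Longrightarrow> rlift S C C C (\<lambda>x y. counit C x \<triangleright>\<^bsub>C\<^esub> y) (comul C c) = c"
    and counital_right: "c \<in> carrier C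
      \<Longrightarrow> rlift S C C C (\<lambda>x y. x \<triangleleft>\<^bsub>C\<^esub> counit C y) (comul C c) = c"

text \<open>A comodule in $\mathsf{Mod}\text{-}S$ is a pair of a module and its coaction.\<close>

definition coalgebroid_comodule ::
  "('k, 'u) module \<Rightarrow> 'u coalg \<Rightarrow> 'u rmodule \<times> ('u \<Rightarrow> 'u) \<Rightarrow> bool" where
  "coalgebroid_comodule S C = (\<lambda>(X, \<xi>).
     right_module S X \<and> \<xi> \<in> rhom S X (rtensor S X C) \<and>
     (\<forall>x \<in> carrier X. rtensor_map S X C (rtensor S X C) C \<xi> (\<lambda>c. c) (\<xi> x)
        = rassoc S X C C (rtensor_map S X C X (bitensor S C C) (\<lambda>x. x) (comul C) (\<xi> x))) \<and>
     (\<forall>x \<in> carrier X. rlift S X C X (\<lambda>x c. x \<triangleleft>\<^bsub>X\<^esub> counit C c) (\<xi> x) = x))"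

definition coalgebroid_comodules ::
  "('k, 'u) module \<Rightarrow> 'u coalg \<Rightarrow> ('u rmodule \<times> ('u \<Rightarrow> 'u), 'u \<Rightarrow> 'u) cat" where
  "coalgebroid_comodules S C = \<lparr>
     Obj = {X\<xi>. coalgebroid_comodule S C X\<xi>},
     Hom = (\<lambda>(X, \<xi>) (X', \<xi>'). {f \<in> rhom S X X'. \<forall>x \<in> carrier X.
        \<xi>' (f x) = rtensor_map S X C X' C f (\<lambda>c. c) (\<xi> x)}),
     Idn = (\<lambda>(X, \<xi>). Idn (RMod S) X),
     Cmp = (\<lambda>(X, \<xi>) (X', \<xi>') (X'', \<xi>''). Cmp (RMod S) X X' X'')\<rparr>"


section \<open>Opmonoidal functors and their comodules\<close>

text \<open>The data of an opmonoidal functor $F$ between categories of bimodules: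
  \<^term>\<open>op2 F M N\<close> is the constraint $F(M \otimes_R N) \to F(M) \otimes_S F(N)$ and
  \<^term>\<open>op0 F\<close> is $F(R) \to S$.\<close>

record 'u opmon = "('u bimodule, 'u \<Rightarrow> 'u, 'u bimodule, 'u \<Rightarrow> 'u) ftor" +
  op2 :: "'u bimodule \<Rightarrow> 'u bimodule \<Rightarrow> 'u \<Rightarrow> 'u"
  op0 :: "'u \<Rightarrow> 'u"

definition over_enveloping :: "('k, 'u) module \<Rightarrow> 'u bimodule \<Rightarrow> 'u coalg \<Rightarrow> 'u bal" where
  "over_enveloping R M C = {(((r \<triangleright>\<^bsub>M\<^esub> m) \<triangleleft>\<^bsub>M\<^esub> r', c), (m, (r' \<unrhd>\<^bsub>C\<^esub> c) \<unlhd>\<^bsub>C\<^esub> r)) |r m r' c.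
     r \<in> carrier R \<and> m \<in> carrier M \<and> r' \<in> carrier R \<and> c \<in> carrier C}"

abbreviation epure where "epure R M C \<equiv> pure (over_enveloping R M C) M C"
abbreviation elift where "elift R M C \<equiv> tlift (over_enveloping R M C) M C"

definition F_ob :: "('k, 'u) module \<Rightarrow> 'u coalg \<Rightarrow> 'u bimodule \<Rightarrow> 'u bimodule" where
  "F_ob R C M = (let T = tens (over_enveloping R M C) M C in
     rmodule.extend
       (ring.extend T (rmodule.fields
         (\<lambda>t s. elift R M C T (\<lambda>m c. epure R M C m (c \<triangleleft>\<^bsub>C\<^esub> s)) t)))
       (bimodule.fields
         (\<lambda>s t. elift R M C T (\<lambda>m c. epure R M C m (s \<triangleright>\<^bsub>C\<^esub> c)) t)))"

definition opmon_of :: "('k, 'u) module \<Rightarrow> ('k, 'u) module \<Rightarrow> 'u coalg \<Rightarrow> 'u opmon" where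
  "opmon_of R S C = \<lparr>
     fob = F_ob R C,
     fhom = (\<lambda>M M' g. elift R M C (F_ob R C M') (\<lambda>m c. epure R M' C (g m) c)),
     op2 = (\<lambda>M N. let T = bitensor S (F_ob R C M) (F_ob R C N) in
       elift R (bitensor R M N) C T (\<lambda>t c. rlift R M N T (\<lambda>m n. rlift S C C T
         (\<lambda>c1 c2. rpure S (F_ob R C M) (F_ob R C N) (epure R M C m c1) (epure R N C n c2))
         (comul C c)) t)),
     op0 = elift R (regular_bimodule R) C S (\<lambda>r c. counit C (r \<unrhd>\<^bsub>C\<^esub> c))\<rparr>"

definition opmon_comodule ::
  "'k ring \<Rightarrow> ('k, 'u) module \<Rightarrow> ('k, 'u) module \<Rightarrow> 'u opmon
     \<Rightarrow> 'u mod_ftor \<times> ('u rmodule \<Rightarrow> 'u bimodule \<Rightarrow> 'u \<Rightarrow> 'u) \<Rightarrow> bool" where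
  "opmon_comodule k R S F = (\<lambda>(Y, y).
     cat_functor (RMod R) (RMod S) Y \<and>
     (\<forall>X \<in> Obj (RMod R). \<forall>M \<in> Obj (Bimod k R R).
        y X M \<in> rhom S (fob Y (rtensor R X M)) (rtensor S (fob Y X) (fob F M))) \<and>
     (\<forall>X \<in> Obj (RMod R). \<forall>X' \<in> Obj (RMod R). \<forall>M \<in> Obj (Bimod k R R). \<forall>M' \<in> Obj (Bimod k R R).
        \<forall>f \<in> rhom R X X'. \<forall>g \<in> bihom R R M M'. \<forall>z \<in> carrier (fob Y (rtensor R X M)).
          rtensor_map S (fob Y X) (fob F M) (fob Y X') (fob F M')
            (fhom Y X X' f) (fhom F M M' g) (y X M z)
        = y X' M' (fhom Y (rtensor R X M) (rtensor R X' M')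
            (rtensor_map R X M X' M' f g) z)) \<and>
     (\<forall>X \<in> Obj (RMod R). \<forall>M \<in> Obj (Bimod k R R). \<forall>N \<in> Obj (Bimod k R R).
        \<forall>z \<in> carrier (fob Y (rtensor R X (bitensor R M N))).
          rtensor_map S (fob Y (rtensor R X M)) (fob F N)
            (rtensor S (fob Y X) (fob F M)) (fob F N) (y X M) (\<lambda>w. w)
            (y (rtensor R X M) N
              (fhom Y (rtensor R X (bitensor R M N)) (rtensor R (rtensor R X M) N)
                (rassoc R X M N) z))
        = rassoc S (fob Y X) (fob F M) (fob F N)
            (rtensor_map S (fob Y X) (fob F (bitensor R M N))
              (fob Y X) (bitensor S (fob F M) (fob F N)) (\<lambda>w. w) (op2 F M N)
              (y X (bitensor R M N) z))) \<and>
     (\<forall>X \<in> Obj (RMod R). \<forall>x \<in> carrier (fob Y X).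
        runit S (fob Y X)
          (rtensor_map S (fob Y X) (fob F (regular_bimodule R))
            (fob Y X) (regular_bimodule S) (\<lambda>w. w) (op0 F)
            (y X (regular_bimodule R)
              (fhom Y X (rtensor R X (regular_bimodule R)) (runit_inv R X) x)))
        = x))"

definition cocontinuous_opmon_comodules ::
  "'k ring \<Rightarrow> ('k, 'u) module \<Rightarrow> ('k, 'u) module \<Rightarrow> 'u opmon
     \<Rightarrow> ('u mod_ftor \<times> ('u rmodule \<Rightarrow> 'u bimodule \<Rightarrow> 'u \<Rightarrow> 'u), 'u rmodule \<Rightarrow> 'u \<Rightarrow> 'u) cat" where
  "cocontinuous_opmon_comodules k R S F = \<lparr>
     Obj = {(Y, y). opmon_comodule k R S F (Y, y) \<and> cocontinuous_linear_functor k R S Y},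
     Hom = (\<lambda>(Y, y) (Y', y'). {t \<in> nat_trans (RMod R) (RMod S) Y Y'.
        \<forall>X \<in> Obj (RMod R). \<forall>M \<in> Obj (Bimod k R R). \<forall>z \<in> carrier (fob Y (rtensor R X M)).
          y' X M (t (rtensor R X M) z)
        = rtensor_map S (fob Y X) (fob F M) (fob Y' X) (fob F M) (t X) (\<lambda>w. w) (y X M z)}),
     Idn = (\<lambda>(Y, y). \<lambda>X \<in> Obj (RMod R). Idn (RMod S) (fob Y X)),
     Cmp = (\<lambda>(Y, y) (Y', y') (Y'', y'') u t. \<lambda>X \<in> Obj (RMod R).
        Cmp (RMod S) (fob Y X) (fob Y' X) (fob Y'' X) (u X) (t X))\<rparr>"


section \<open>Oplax actegories and their oplax morphisms\<close>

text \<open>The data of an oplax right action of $(\mathsf{Mod}\text{-}R, \odot)$ on a category of right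
  modules, with the constraints
  $a^2 : M \cdot (N \odot P) \to (M \cdot N) \cdot P$ and $a^0 : M \cdot R \to M$.\<close>

record 'u actegory =
  act_ob :: "'u rmodule \<Rightarrow> 'u rmodule \<Rightarrow> 'u rmodule"
  act_map :: "'u rmodule \<Rightarrow> 'u rmodule \<Rightarrow> 'u rmodule \<Rightarrow> 'u rmodule
    \<Rightarrow> ('u \<Rightarrow> 'u) \<Rightarrow> ('u \<Rightarrow> 'u) \<Rightarrow> 'u \<Rightarrow> 'u"
  act2 :: "'u rmodule \<Rightarrow> 'u rmodule \<Rightarrow> 'u rmodule \<Rightarrow> 'u \<Rightarrow> 'u"
  act0 :: "'u rmodule \<Rightarrow> 'u \<Rightarrow> 'u"

definition self_actegory :: "'k ring \<Rightarrow> ('k, 'u) module \<Rightarrow> 'u actegory" where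
  "self_actegory k R = \<lparr>act_ob = odot k R, act_map = odot_map k R,
     act2 = odot_assoc k R, act0 = odot_runit k R\<rparr>"

text \<open>The element $s \otimes r$ of $S \otimes R$ acts on $M \otimes N$ by
  $(m \otimes n)(s \otimes r) = ms \otimes nr$ and on \<^term>\<open>C\<close> by $(s \otimes r)c = src$.  As these
  elements generate $S \otimes R$ additively, it suffices to be balanced with respect to them.\<close>

definition SR_act ::
  "'k ring \<Rightarrow> ('k, 'u) module \<Rightarrow> ('k, 'u) module \<Rightarrow> 'u rmodule \<Rightarrow> 'u rmodule
     \<Rightarrow> 'u \<Rightarrow> 'u \<Rightarrow> 'u \<Rightarrow> 'u" where
  "SR_act k S R M N s r = klift k S R M N (ktens k S R M N)
     (\<lambda>m n. kpure k S R M N (m \<triangleleft>\<^bsub>M\<^esub> s) (n \<triangleleft>\<^bsub>N\<^esub> r))"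

definition over_SR ::
  "'k ring \<Rightarrow> ('k, 'u) module \<Rightarrow> ('k, 'u) module \<Rightarrow> 'u coalg \<Rightarrow> 'u rmodule \<Rightarrow> 'u rmodule \<Rightarrow> 'u bal" where
  "over_SR k S R C M N = {((SR_act k S R M N s r t, c), (t, s \<triangleright>\<^bsub>C\<^esub> (r \<unrhd>\<^bsub>C\<^esub> c))) |t s r c.
     t \<in> carrier (ktens k S R M N) \<and> s \<in> carrier S \<and> r \<in> carrier R \<and> c \<in> carrier C}"

abbreviation apure where
  "apure k S R C M N \<equiv> pure (over_SR k S R C M N) (ktens k S R M N) C"
abbreviation alift where
  "alift k S R C M N \<equiv> tlift (over_SR k S R C M N) (ktens k S R M N) C"

definition dot ::
  "'k ring \<Rightarrow> ('k, 'u) module \<Rightarrow> ('k, 'u) module \<Rightarrow> 'u coalg \<Rightarrow> 'u rmodule \<Rightarrow> 'u rmodule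
     \<Rightarrow> 'u rmodule" where
  "dot k S R C M N = (let T = tens (over_SR k S R C M N) (ktens k S R M N) C in
     ring.extend T (rmodule.fields
       (\<lambda>t s. alift k S R C M N T (\<lambda>u c. apure k S R C M N u (c \<triangleleft>\<^bsub>C\<^esub> s)) t)))"

definition actegory_of ::
  "'k ring \<Rightarrow> ('k, 'u) module \<Rightarrow> ('k, 'u) module \<Rightarrow> 'u coalg \<Rightarrow> 'u actegory" where
  "actegory_of k R S C = \<lparr>
     act_ob = dot k S R C,
     act_map = (\<lambda>M N M' N' f g. alift k S R C M N (dot k S R C M' N')
       (\<lambda>t c. apure k S R C M' N'
         (klift k S R M N (ktens k S R M' N') (\<lambda>m n. kpure k S R M' N' (f m) (g n)) t) c)),
     act2 = (\<lambda>M N P. let MN = dot k S R C M N; T = dot k S R C MN P in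
       alift k S R C M (odot k R N P) T (\<lambda>t c.
         klift k S R M (odot k R N P) T (\<lambda>m u. klift k R R N P T (\<lambda>n p. rlift S C C T
           (\<lambda>c1 c2. apure k S R C MN P
             (kpure k S R MN P (apure k S R C M N (kpure k S R M N m n) c1) p) c2)
           (comul C c)) u) t)),
     act0 = (\<lambda>M. alift k S R C M (regular_rmodule R) M (\<lambda>t c.
       klift k S R M (regular_rmodule R) M (\<lambda>m r. m \<triangleleft>\<^bsub>M\<^esub> counit C (r \<unrhd>\<^bsub>C\<^esub> c)) t))\<rparr>"

text \<open>Oplax morphisms from an oplax $(\mathsf{Mod}\text{-}R)$-actegory \<^term>\<open>P\<close> on
  $\mathsf{Mod}\text{-}R$ to one \<^term>\<open>Q\<close> on $\mathsf{Mod}\text{-}S$.\<close>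

definition oplax_morphism ::
  "'k ring \<Rightarrow> ('k, 'u) module \<Rightarrow> ('k, 'u) module \<Rightarrow> 'u actegory \<Rightarrow> 'u actegory
     \<Rightarrow> 'u mod_ftor \<times> ('u rmodule \<Rightarrow> 'u rmodule \<Rightarrow> 'u \<Rightarrow> 'u) \<Rightarrow> bool" where
  "oplax_morphism k R S P Q = (\<lambda>(Y, y).
     cat_functor (RMod R) (RMod S) Y \<and>
     (\<forall>A \<in> Obj (RMod R). \<forall>B \<in> Obj (RMod R).
        y A B \<in> rhom S (fob Y (act_ob P A B)) (act_ob Q (fob Y A) B)) \<and>
     (\<forall>A \<in> Obj (RMod R). \<forall>A' \<in> Obj (RMod R). \<forall>B \<in> Obj (RMod R). \<forall>B' \<in> Obj (RMod R).
        \<forall>f \<in> rhom R A A'. \<forall>g \<in> rhom R B B'. \<forall>z \<in> carrier (fob Y (act_ob P A B)).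
          act_map Q (fob Y A) B (fob Y A') B' (fhom Y A A' f) g (y A B z)
        = y A' B' (fhom Y (act_ob P A B) (act_ob P A' B') (act_map P A B A' B' f g) z)) \<and>
     (\<forall>A \<in> Obj (RMod R). \<forall>B \<in> Obj (RMod R). \<forall>B' \<in> Obj (RMod R).
        \<forall>z \<in> carrier (fob Y (act_ob P A (odot k R B B'))).
          act_map Q (fob Y (act_ob P A B)) B' (act_ob Q (fob Y A) B) B' (y A B) (\<lambda>b \<in> carrier B'. b)
            (y (act_ob P A B) B'
              (fhom Y (act_ob P A (odot k R B B')) (act_ob P (act_ob P A B) B') (act2 P A B B') z))
        = act2 Q (fob Y A) B B' (y A (odot k R B B') z)) \<and>
     (\<forall>A \<in> Obj (RMod R). \<forall>z \<in> carrier (fob Y (act_ob P A (regular_rmodule R))).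
        act0 Q (fob Y A) (y A (regular_rmodule R) z)
      = fhom Y (act_ob P A (regular_rmodule R)) A (act0 P A) z))"

definition cocontinuous_oplax_morphisms ::
  "'k ring \<Rightarrow> ('k, 'u) module \<Rightarrow> ('k, 'u) module \<Rightarrow> 'u actegory \<Rightarrow> 'u actegory
     \<Rightarrow> ('u mod_ftor \<times> ('u rmodule \<Rightarrow> 'u rmodule \<Rightarrow> 'u \<Rightarrow> 'u), 'u rmodule \<Rightarrow> 'u \<Rightarrow> 'u) cat" where
  "cocontinuous_oplax_morphisms k R S P Q = \<lparr>
     Obj = {(Y, y). oplax_morphism k R S P Q (Y, y) \<and> cocontinuous_linear_functor k R S Y},
     Hom = (\<lambda>(Y, y) (Y', y'). {t \<in> nat_trans (RMod R) (RMod S) Y Y'.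
        \<forall>A \<in> Obj (RMod R). \<forall>B \<in> Obj (RMod R). \<forall>z \<in> carrier (fob Y (act_ob P A B)).
          y' A B (t (act_ob P A B) z)
        = act_map Q (fob Y A) B (fob Y' A) B (t A) (\<lambda>b \<in> carrier B. b) (y A B z)}),
     Idn = (\<lambda>(Y, y). \<lambda>A \<in> Obj (RMod R). Idn (RMod S) (fob Y A)),
     Cmp = (\<lambda>(Y, y) (Y', y') (Y'', y'') u t. \<lambda>A \<in> Obj (RMod R).
        Cmp (RMod S) (fob Y A) (fob Y' A) (fob Y'' A) (u A) (t A))\<rparr>"

end

(*
  Let iota_a : R -> A be the map r |-> ar.  By Eilenberg and Watts, a cocontinuous functor Y is
  generated by the elements Y(iota_a)(x) with x in Y(R) and a in A, and maps out of Y(A) may be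
  prescribed on them.  This is shown directly, by writing A as the colimit of copies of R^2, indexed
  by the pairs of elements of A.

  Both (ii) and (iii) consist of functors Y with maps y from Y(A * M) to Y(A) # M, and in both cases
  there is a module M0, free on one generator u, for which N # M0 is the tensor product of N and C
  over S.  Since every element of M is the image of u, naturality shows that y is determined by its
  component at R and M0, hence by the coaction xi on X = Y(R) obtained by restricting this
  component along Y(iota_{1*u}).  Conversely, a comodule (X, xi) becomes an R-S-bimodule by
  r x = x_(0) eps(r x_(1)), and Y is the tensor product with X over R.
*)

theory Submission
  imports Defs
begin

section \<open>Additive and biadditive maps\<close>

text \<open>The counit axiom carries much of the weight: at R it says that the left R-action on Y(R)
  coming from functoriality, x -> Y(iota_r)(x), is the one defined by the coaction. So a comodule
  remembers its bimodule structure, and comodule maps are R-linear. Conversely, coassociativity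
  yields \<xi>(r x) = x_(0) \<otimes> r x_(1) and r x_(0) \<otimes> x_(1) = x_(0) \<otimes> x_(1) r;
  the first rule makes y well defined on the tensor product of A * M and X over R, the second on A *
  M itself.

  The main obstacle is size. Cocontinuity of tensoring with X would follow from the right adjoint
  Hom(X, -), but the set of all linear maps need not be small. It is replaced by a small module made
  of the maps that a given cocone provides.

  The generator M0 is R in (iii), but in (ii) it is the bimodule R \<otimes> R, for which F(R
  \<otimes> R) is C.

  Each of (ii) and (iii) is compared with (i) by a fully faithful and essentially surjective
  functor, evaluation at R; (ii) and (iii) are then linked through a chosen inverse.\<close>

definition additive :: "('a, 'x) ring_scheme \<Rightarrow> ('b, 'y) ring_scheme \<Rightarrow> ('a \<Rightarrow> 'b) \<Rightarrow> bool" where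
  "additive A B f \<longleftrightarrow> f \<in> hom (add_monoid A) (add_monoid B)"

lemma additiveI:
  assumes "\<And>a. a \<in> carrier A \<Longrightarrow> f a \<in> carrier B"
    and "\<And>a b. \<lbrakk>a \<in> carrier A; b \<in> carrier A\<rbrakk> \<Longrightarrow> f (a \<oplus>\<^bsub>A\<^esub> b) = f a \<oplus>\<^bsub>B\<^esub> f b"
  shows "additive A B f"
  using assms by (auto simp: additive_def hom_def)

lemma additive_closed: "additive A B f \<Longrightarrow> a \<in> carrier A \<Longrightarrow> f a \<in> carrier B"
  by (auto simp: additive_def hom_def)

lemma additive_add:
  "additive A B f \<Longrightarrow> a \<in> carrier A \<Longrightarrow> b \<in> carrier A \<Longrightarrow> f (a \<oplus>\<^bsub>A\<^esub> b) = f a \<oplus>\<^bsub>B\<^esub> f b"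
  by (auto simp: additive_def hom_def)

lemma additive_group_hom:
  "\<lbrakk>additive A B f; abelian_group A; abelian_group B\<rbrakk> \<Longrightarrow> group_hom (add_monoid A) (add_monoid B) f"
  by (simp add: additive_def group_hom_def group_hom_axioms_def abelian_group.a_group)

lemma additive_zero: "\<lbrakk>additive A B f; abelian_group A; abelian_group B\<rbrakk> \<Longrightarrow> f \<zero>\<^bsub>A\<^esub> = \<zero>\<^bsub>B\<^esub>"
  using group_hom.hom_one[OF additive_group_hom] by fastforce

lemma additive_a_inv:
  assumes "additive A B f" "abelian_group A" "abelian_group B" "a \<in> carrier A"
  shows "f (\<ominus>\<^bsub>A\<^esub> a) = \<ominus>\<^bsub>B\<^esub> f a"
  using group_hom.hom_inv[OF additive_group_hom, OF assms(1-3)] assms(4) by (simp add: a_inv_def)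

lemma additive_compose:
  "\<lbrakk>additive A B f; additive B D g\<rbrakk> \<Longrightarrow> additive A D (\<lambda>a. g (f a))"
  by (intro additiveI) (simp_all add: additive_closed additive_add)

lemma additive_cong:
  assumes "abelian_group A" "\<And>a. a \<in> carrier A \<Longrightarrow> f a = g a"
  shows "additive A B f = additive A B g"
proof -
  interpret A: abelian_group A by fact
  show ?thesis unfolding additive_def hom_def
    by (auto simp: Pi_def assms(2))
qed

lemma additive_id: "additive A A (\<lambda>a. a)"
  by (auto simp: additive_def hom_def)

lemma additive_sum_maps:
  assumes "additive A B f" "additive A B g" "abelian_group B"
  shows "additive A B (\<lambda>a. f a \<oplus>\<^bsub>B\<^esub> g a)"
proof -
  interpret B: abelian_group B by fact
  show ?thesis
    by (rule additiveI)
      (auto simp: additive_closed[OF assms(1)] additive_closed[OF assms(2)]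
        additive_add[OF assms(1)] additive_add[OF assms(2)] B.a_ac)
qed

definition biadditive ::
  "('a, 'x) ring_scheme \<Rightarrow> ('b, 'y) ring_scheme \<Rightarrow> ('c, 'z) ring_scheme \<Rightarrow> ('a \<Rightarrow> 'b \<Rightarrow> 'c) \<Rightarrow> bool"
  where "biadditive A B G f \<longleftrightarrow>
    (\<forall>a \<in> carrier A. additive B G (f a)) \<and> (\<forall>b \<in> carrier B. additive A G (\<lambda>a. f a b))"

lemma biadditiveI:
  assumes "\<And>a b. \<lbrakk>a \<in> carrier A; b \<in> carrier B\<rbrakk> \<Longrightarrow> f a b \<in> carrier G"
    and "\<And>a a' b. \<lbrakk>a \<in> carrier A; a' \<in> carrier A; b \<in> carrier B\<rbrakk> \<Longrightarrow> f (a \<oplus>\<^bsub>A\<^esub> a') b = f a b \<oplus>\<^bsub>G\<^esub> f a' b"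
    and "\<And>a b b'. \<lbrakk>a \<in> carrier A; b \<in> carrier B; b' \<in> carrier B\<rbrakk> \<Longrightarrow> f a (b \<oplus>\<^bsub>B\<^esub> b') = f a b \<oplus>\<^bsub>G\<^esub> f a b'"
  shows "biadditive A B G f"
  using assms by (auto simp: biadditive_def intro!: additiveI)

lemma biadditive_closed:
  "\<lbrakk>biadditive A B G f; a \<in> carrier A; b \<in> carrier B\<rbrakk> \<Longrightarrow> f a b \<in> carrier G"
  by (auto simp: biadditive_def dest: additive_closed)

lemma biadditive_add_left:
  "\<lbrakk>biadditive A B G f; a \<in> carrier A; a' \<in> carrier A; b \<in> carrier B\<rbrakk>
    \<Longrightarrow> f (a \<oplus>\<^bsub>A\<^esub> a') b = f a b \<oplus>\<^bsub>G\<^esub> f a' b"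
  by (auto simp: biadditive_def dest: additive_add)

lemma biadditive_add_right:
  "\<lbrakk>biadditive A B G f; a \<in> carrier A; b \<in> carrier B; b' \<in> carrier B\<rbrakk>
    \<Longrightarrow> f a (b \<oplus>\<^bsub>B\<^esub> b') = f a b \<oplus>\<^bsub>G\<^esub> f a b'"
  by (auto simp: biadditive_def dest: additive_add)

text \<open>One tensor product occurs in several records: as a bare group, with a right action, and
  with actions on both sides. This relation carries facts about additive maps and lifts from one
  form to another.\<close>

definition same_group :: "('a, 'x) ring_scheme \<Rightarrow> ('a, 'y) ring_scheme \<Rightarrow> bool" where
  "same_group A B \<longleftrightarrow>
     carrier A = carrier B \<and> (\<oplus>\<^bsub>A\<^esub>) = (\<oplus>\<^bsub>B\<^esub>) \<and> \<zero>\<^bsub>A\<^esub> = \<zero>\<^bsub>B\<^esub>"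

lemma same_group_abelian:
  assumes "same_group A B" "abelian_group A"
  shows "abelian_group B"
proof -
  interpret A: abelian_group A by fact
  have eq: "carrier B = carrier A" "(\<oplus>\<^bsub>B\<^esub>) = (\<oplus>\<^bsub>A\<^esub>)" "\<zero>\<^bsub>B\<^esub> = \<zero>\<^bsub>A\<^esub>"
    using assms by (simp_all add: same_group_def)
  show ?thesis
    by (rule abelian_groupI; unfold eq) (auto simp: A.a_assoc intro: A.a_comm A.l_neg)
qed

lemma same_group_additive:
  "same_group A B \<Longrightarrow> additive A G f = additive B G f"
  "same_group A B \<Longrightarrow> additive G A f' = additive G B f'"
  by (simp_all add: additive_def same_group_def hom_def)

lemma same_group_biadditive:
  "same_group A B \<Longrightarrow> biadditive G H A f = biadditive G H B f"
  by (simp add: biadditive_def same_group_additive)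

lemma same_group_tlift: "same_group A B \<Longrightarrow> tlift \<rho> G H A f = tlift \<rho> G H B f"
  by (simp add: tlift_def same_group_def hom_def)

section \<open>Balanced tensor products\<close>

locale universe =
  fixes universe :: "'u itself"
  assumes infinite_universe: "infinite (UNIV :: 'u set)"
begin

lemma pairs_eqpoll: "(UNIV :: ('u \<times> 'u) set) \<approx> (UNIV :: 'u set)"
  using card_of_Times_same_infinite[OF infinite_universe] by (simp add: eqpoll_iff_card_of_ordIso)

text \<open>The free abelian group on an infinite set has the cardinality of that set, and
  \<open>'u \<times> 'u\<close> is equipotent to \<open>'u\<close>. Tensor products are quotients of
  groups of this kind, which is why they can be coded in \<open>'u\<close>.\<close>

lemma free_pairs_lepoll: "carrier (free_Abelian_group (I :: ('u \<times> 'u) set)) \<lesssim> (UNIV :: 'u set)"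
proof -
  have "carrier (free_Abelian_group I) \<lesssim> carrier (free_Abelian_group (UNIV :: ('u \<times> 'u) set))"
    by (rule subset_imp_lepoll) auto
  also have "\<dots> \<approx> (UNIV :: ('u \<times> 'u) set)"
    by (rule eqpoll_free_Abelian_group_infinite)
      (use infinite_universe in \<open>auto simp: finite_prod\<close>)
  also note pairs_eqpoll
  finally show ?thesis .
qed

end

section \<open>Universal property of balanced tensor products\<close>

locale balanced_tensor = universe "TYPE('u)" + A: abelian_group A + B: abelian_group B
  for A :: "('u, 'a) ring_scheme" and B :: "('u, 'b) ring_scheme" +
  fixes \<rho> :: "'u bal"
  assumes \<rho>_subset: "\<rho> \<subseteq> (carrier A \<times> carrier B) \<times> (carrier A \<times> carrier B)"
begin

abbreviation FG where "FG \<equiv> free_Abelian_group (carrier A \<times> carrier B)"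
abbreviation K where "K \<equiv> tens_sub \<rho> A B"
abbreviation Q where "Q \<equiv> tens_quot \<rho> A B"

lemma relators_closed: "tens_relators \<rho> A B \<subseteq> carrier FG"
proof -
  have "Poly_Mapping.keys (frag_of p - frag_of q - frag_of q') \<subseteq> {p, q, q'}" 
     "Poly_Mapping.keys (frag_of p - frag_of q) \<subseteq> {p, q}" for p q q' :: "'u \<times> 'u"
    using keys_diff[of "frag_of p - frag_of q" "frag_of q'"] keys_diff[of "frag_of p" "frag_of q"]
    by (simp_all add: keys_frag_of) blast+
  then show ?thesis
    unfolding tens_relators_def using \<rho>_subset by (fastforce simp: subset_iff)
qed

lemma K_subgroup: "subgroup K FG"
  unfolding tens_sub_def by (rule group.generate_is_subgroup) (use relators_closed in auto)

lemma K_normal: "K \<lhd> FG"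
  using comm_group.subgroup_imp_normal[OF abelian_free_Abelian_group K_subgroup] .

lemma carrier_Q: "carrier Q = (\<lambda>u. K #>\<^bsub>FG\<^esub> u) ` carrier FG"
  by (auto simp: tens_quot_def FactGroup_def RCOSETS_def)

text \<open>A quotient is no larger than the group that it comes from, so the choice made in
  \<open>tens_code\<close> has a witness.\<close>

lemma code_inj: "inj_on (tens_code \<rho> A B) (carrier Q)"
proof -
  have "carrier Q \<lesssim> carrier FG"
    unfolding carrier_Q by (rule image_lepoll)
  also note free_pairs_lepoll
  finally have "\<exists>e :: _ \<Rightarrow> 'u. inj_on e (carrier Q)"
    unfolding lepoll_def by blast
  then show ?thesis
    unfolding tens_code_def by (rule someI_ex)
qed

text \<open>The quotient map followed by the coding into \<open>'u\<close>. With it, elements of the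
  coded tensor product can be treated as classes of formal sums of pairs.\<close>

definition proj where "proj u = tens_code \<rho> A B (K #>\<^bsub>FG\<^esub> u)"

lemma pure_proj: "pure \<rho> A B a b = proj (frag_of (a, b))"
  by (simp add: pure_def proj_def)

lemma carrier_tens: "carrier (tens \<rho> A B) = proj ` carrier FG"
  by (simp add: tens_def Let_def carrier_Q proj_def image_image)

lemma proj_add:
  assumes "u \<in> carrier FG" "v \<in> carrier FG"
  shows "proj (u + v) = proj u \<oplus>\<^bsub>tens \<rho> A B\<^esub> proj v"
proof -
  have "(K #>\<^bsub>FG\<^esub> u) \<otimes>\<^bsub>Q\<^esub> (K #>\<^bsub>FG\<^esub> v) = K #>\<^bsub>FG\<^esub> (u + v)"
    using normal.rcos_sum[OF K_normal assms] by (simp add: tens_quot_def FactGroup_def)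
  moreover have "inv_into (carrier Q) (tens_code \<rho> A B) (proj w) = K #>\<^bsub>FG\<^esub> w" if "w \<in> carrier FG" for w
    unfolding proj_def using that by (intro inv_into_f_f code_inj) (simp add: carrier_Q)
  ultimately show ?thesis
    using assms by (simp add: tens_def Let_def proj_def)
qed

lemma proj_zero: "proj 0 = \<zero>\<^bsub>tens \<rho> A B\<^esub>"
proof -
  have "\<one>\<^bsub>Q\<^esub> = K #>\<^bsub>FG\<^esub> 0"
    using group.coset_mult_one[OF group_free_Abelian_group subgroup.subset[OF K_subgroup]]
    by (simp add: tens_quot_def FactGroup_def)
  then show ?thesis by (simp add: tens_def Let_def proj_def)
qed

lemma proj_eq_iff:
  assumes "u \<in> carrier FG" "v \<in> carrier FG"
  shows "proj u = proj v \<longleftrightarrow> u - v \<in> K"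
proof -
  have "proj u = proj v \<longleftrightarrow> K #>\<^bsub>FG\<^esub> u = K #>\<^bsub>FG\<^esub> v"
    unfolding proj_def using inj_on_eq_iff[OF code_inj] assms by (simp add: carrier_Q)
  also have "\<dots> \<longleftrightarrow> u \<in> K #>\<^bsub>FG\<^esub> v"
    using group.repr_independence[OF group_free_Abelian_group _ _ K_subgroup] 
      group.rcos_self[OF group_free_Abelian_group _ K_subgroup] assms by metis
  also have "\<dots> \<longleftrightarrow> u - v \<in> K"
    by (auto simp: r_coset_def) (metis diff_add_cancel)
  finally show ?thesis .
qed

lemma abelian_tens: "abelian_group (tens \<rho> A B)"
proof (rule abelian_groupI; unfold carrier_tens)
  fix x assume "x \<in> proj ` carrier FG"
  then obtain u where u: "u \<in> carrier FG" "x = proj u" by blast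
  then have "- u \<in> carrier FG" by (simp add: keys_minus)
  then show "\<exists>y\<in>proj ` carrier FG. y \<oplus>\<^bsub>tens \<rho> A B\<^esub> x = \<zero>\<^bsub>tens \<rho> A B\<^esub>"
    using u by (intro bexI[of _ "proj (- u)"]) (auto simp flip: proj_add proj_zero)
next
  show "\<zero>\<^bsub>tens \<rho> A B\<^esub> \<in> proj ` carrier FG"
    unfolding proj_zero[symmetric] by (intro imageI) simp
next
  fix x y assume "x \<in> proj ` carrier FG" "y \<in> proj ` carrier FG"
  then obtain u v where uv: "x = proj u" "y = proj v" "u \<in> carrier FG" "v \<in> carrier FG" by blast
  have "u + v \<in> carrier FG" using keys_add[of u v] uv by auto
  then show "x \<oplus>\<^bsub>tens \<rho> A B\<^esub> y \<in> proj ` carrier FG"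
    unfolding uv(1,2) proj_add[OF uv(3,4), symmetric] by (rule imageI)
  show "x \<oplus>\<^bsub>tens \<rho> A B\<^esub> y = y \<oplus>\<^bsub>tens \<rho> A B\<^esub> x"
    using uv by (simp flip: proj_add add: add.commute)
next
  fix x y z assume "x \<in> proj ` carrier FG" "y \<in> proj ` carrier FG" "z \<in> proj ` carrier FG"
  then obtain u v w where uv: "x = proj u" "y = proj v" "z = proj w"
     "u \<in> carrier FG" "v \<in> carrier FG" "w \<in> carrier FG" by blast
  have "u + v \<in> carrier FG" "v + w \<in> carrier FG"
    using keys_add[of u v] keys_add[of v w] uv by auto
  with uv show "x \<oplus>\<^bsub>tens \<rho> A B\<^esub> y \<oplus>\<^bsub>tens \<rho> A B\<^esub> z = x \<oplus>\<^bsub>tens \<rho> A B\<^esub> (y \<oplus>\<^bsub>tens \<rho> A B\<^esub> z)"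
    by (simp add: add.assoc flip: proj_add)
next
  fix x assume "x \<in> proj ` carrier FG"
  then obtain u where u: "u \<in> carrier FG" "x = proj u" by blast
  have "0 \<in> carrier FG" by simp
  show "\<zero>\<^bsub>tens \<rho> A B\<^esub> \<oplus>\<^bsub>tens \<rho> A B\<^esub> x = x"
    unfolding u(2) proj_zero[symmetric] proj_add[OF _ u(1), OF \<open>0 \<in> carrier FG\<close>, symmetric] by simp
qed

sublocale T: abelian_group "tens \<rho> A B" by (rule abelian_tens)

lemma pure_closed: "\<lbrakk>a \<in> carrier A; b \<in> carrier B\<rbrakk> \<Longrightarrow> pure \<rho> A B a b \<in> carrier (tens \<rho> A B)"
  by (auto simp: pure_proj carrier_tens)

lemma relator_in_K: "u \<in> tens_relators \<rho> A B \<Longrightarrow> u \<in> K"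
  unfolding tens_sub_def by (rule generate.incl)

lemma pure_add_left:
  assumes "a \<in> carrier A" "a' \<in> carrier A" "b \<in> carrier B"
  shows "pure \<rho> A B (a \<oplus>\<^bsub>A\<^esub> a') b = pure \<rho> A B a b \<oplus>\<^bsub>tens \<rho> A B\<^esub> pure \<rho> A B a' b"
proof -
  have "frag_of (a \<oplus>\<^bsub>A\<^esub> a', b) - frag_of (a, b) - frag_of (a', b) \<in> K"
    using assms by (intro relator_in_K) (unfold tens_relators_def, blast)
  moreover have "frag_of (a, b) + frag_of (a', b) \<in> carrier FG"
    using keys_add[of "frag_of (a, b)" "frag_of (a', b)"] assms by (auto simp: keys_frag_of)
  ultimately show ?thesis
    using assms unfolding pure_proj
    by (subst proj_add[symmetric]) (simp_all add: proj_eq_iff diff_diff_eq)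
qed

lemma pure_add_right:
  assumes "a \<in> carrier A" "b \<in> carrier B" "b' \<in> carrier B"
  shows "pure \<rho> A B a (b \<oplus>\<^bsub>B\<^esub> b') = pure \<rho> A B a b \<oplus>\<^bsub>tens \<rho> A B\<^esub> pure \<rho> A B a b'"
proof -
  have "frag_of (a, b \<oplus>\<^bsub>B\<^esub> b') - frag_of (a, b) - frag_of (a, b') \<in> K"
    using assms by (intro relator_in_K) (unfold tens_relators_def, blast)
  moreover have "frag_of (a, b) + frag_of (a, b') \<in> carrier FG"
    using keys_add[of "frag_of (a, b)" "frag_of (a, b')"] assms by (auto simp: keys_frag_of)
  ultimately show ?thesis
    using assms unfolding pure_proj
    by (subst proj_add[symmetric]) (simp_all add: proj_eq_iff diff_diff_eq)
qed

lemma pure_biadditive: "biadditive A B (tens \<rho> A B) (pure \<rho> A B)"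
  by (intro biadditiveI pure_closed pure_add_left pure_add_right)

lemma pure_balanced:
  assumes "((a, b), (a', b')) \<in> \<rho>"
  shows "pure \<rho> A B a b = pure \<rho> A B a' b'"
proof -
  have "frag_of (a, b) - frag_of (a', b') \<in> K"
    using assms by (intro relator_in_K) (unfold tens_relators_def, blast)
  then show ?thesis
    using assms \<rho>_subset unfolding pure_proj by (subst proj_eq_iff) auto
qed

lemma pure_zero: "pure \<rho> A B \<zero>\<^bsub>A\<^esub> \<zero>\<^bsub>B\<^esub> = \<zero>\<^bsub>tens \<rho> A B\<^esub>"
  using additive_zero[OF _ A.abelian_group_axioms abelian_tens, of "\<lambda>a. pure \<rho> A B a \<zero>\<^bsub>B\<^esub>"] pure_biadditive
  by (simp add: biadditive_def)

text \<open>Zero is the pure tensor of two zeros and the negative of a pure tensor is pure, so sums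
  of pure tensors exhaust the group and the induction has only two cases.\<close>

lemma tens_induct [consumes 1, case_names pure add]:
  assumes t: "t \<in> carrier (tens \<rho> A B)"
    and pure: "\<And>a b. \<lbrakk>a \<in> carrier A; b \<in> carrier B\<rbrakk> \<Longrightarrow> P (pure \<rho> A B a b)"
    and add: "\<And>u v. \<lbrakk>u \<in> carrier (tens \<rho> A B); v \<in> carrier (tens \<rho> A B); P u; P v\<rbrakk>
      \<Longrightarrow> P (u \<oplus>\<^bsub>tens \<rho> A B\<^esub> v)"
  shows "P t"
proof -
  have neg: "\<ominus>\<^bsub>tens \<rho> A B\<^esub> pure \<rho> A B a b = pure \<rho> A B (\<ominus>\<^bsub>A\<^esub> a) b"
    if "a \<in> carrier A" "b \<in> carrier B" for a b
    using additive_a_inv[OF _ A.abelian_group_axioms abelian_tens, of "\<lambda>a. pure \<rho> A B a b" a] pure_biadditive that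
    by (simp add: biadditive_def)
  have zero: "\<ominus>\<^bsub>tens \<rho> A B\<^esub> \<zero>\<^bsub>tens \<rho> A B\<^esub> = \<zero>\<^bsub>tens \<rho> A B\<^esub>"
    by (rule T.minus_equality) auto
  \<comment> \<open>Induction on the free group passes through differences, so the claim is
    strengthened to cover negatives as well.\<close>
  have "P (proj u) \<and> P (\<ominus>\<^bsub>tens \<rho> A B\<^esub> proj u)"
    if "Poly_Mapping.keys u \<subseteq> carrier A \<times> carrier B" for u
    using that
  proof (rule free_Abelian_group_induct)
    show "P (proj 0) \<and> P (\<ominus>\<^bsub>tens \<rho> A B\<^esub> proj 0)"
      using pure[of "\<zero>\<^bsub>A\<^esub>" "\<zero>\<^bsub>B\<^esub>"] unfolding proj_zero zero by (simp add: pure_zero)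
  next
    fix x y
    assume *: "Poly_Mapping.keys x \<subseteq> carrier A \<times> carrier B" "Poly_Mapping.keys y \<subseteq> carrier A \<times> carrier B"
      "P (proj x) \<and> P (\<ominus>\<^bsub>tens \<rho> A B\<^esub> proj x)" "P (proj y) \<and> P (\<ominus>\<^bsub>tens \<rho> A B\<^esub> proj y)"
    have "- y \<in> carrier FG" using * by (simp add: keys_minus)
    then have minus: "proj (- y) = \<ominus>\<^bsub>tens \<rho> A B\<^esub> proj y"
      using * proj_add[of "- y" y]
      by (intro T.minus_equality[symmetric]) (auto simp: carrier_tens proj_zero)
    have c: "proj x \<in> carrier (tens \<rho> A B)" "proj y \<in> carrier (tens \<rho> A B)"
      using * by (auto simp: carrier_tens)
    have "proj (x - y) = proj x \<oplus>\<^bsub>tens \<rho> A B\<^esub> \<ominus>\<^bsub>tens \<rho> A B\<^esub> proj y"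
      using * proj_add[of x "- y"] \<open>- y \<in> carrier FG\<close> minus by simp
    moreover from this c have "\<ominus>\<^bsub>tens \<rho> A B\<^esub> proj (x - y) = \<ominus>\<^bsub>tens \<rho> A B\<^esub> proj x \<oplus>\<^bsub>tens \<rho> A B\<^esub> proj y"
      by (simp add: T.minus_add)
    ultimately show "P (proj (x - y)) \<and> P (\<ominus>\<^bsub>tens \<rho> A B\<^esub> proj (x - y))"
      using * c by (auto intro!: add)
  next
    fix p assume "p \<in> carrier A \<times> carrier B"
    then obtain a b where "p = (a, b)" "a \<in> carrier A" "b \<in> carrier B" by blast
    then show "P (proj (frag_of p)) \<and> P (\<ominus>\<^bsub>tens \<rho> A B\<^esub> proj (frag_of p))"
      using pure[of a b] pure[of "\<ominus>\<^bsub>A\<^esub> a" b] neg[of a b] by (auto simp: pure_proj)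
  qed
  with t show ?thesis by (auto simp: carrier_tens)
qed

lemma tens_hom_eq:
  assumes "additive (tens \<rho> A B) G h" "additive (tens \<rho> A B) G h'"
    and "\<And>a b. \<lbrakk>a \<in> carrier A; b \<in> carrier B\<rbrakk> \<Longrightarrow> h (pure \<rho> A B a b) = h' (pure \<rho> A B a b)"
    and "t \<in> carrier (tens \<rho> A B)"
  shows "h t = h' t"
  using assms(4) by (induction rule: tens_induct) (auto simp: assms additive_add[OF assms(1)] additive_add[OF assms(2)])

text \<open>Existence descends from the free group. Uniqueness holds because pure tensors generate
  and extensionality fixes the values outside the carrier; it is what gives the description in
  \<open>tlift\<close> a meaning.\<close>

lemma tlift_exists:
  assumes "abelian_group G" "biadditive A B G f"
    and "\<And>a b a' b'. ((a, b), (a', b')) \<in> \<rho> \<Longrightarrow> f a b = f a' b'"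
  shows "\<exists>!h. h \<in> extensional (carrier (tens \<rho> A B)) \<and>
     h \<in> hom (add_monoid (tens \<rho> A B)) (add_monoid G) \<and>
     (\<forall>a \<in> carrier A. \<forall>b \<in> carrier B. h (pure \<rho> A B a b) = f a b)"
proof -
  interpret G: abelian_group G by fact
  obtain h where h: "h \<in> hom FG (add_monoid G)"
    "\<And>p. p \<in> carrier A \<times> carrier B \<Longrightarrow> h (frag_of p) = case_prod f p"
    using comm_group.free_Abelian_group_universal[OF G.a_comm_group, of "case_prod f" "carrier A \<times> carrier B"]
      biadditive_closed[OF assms(2)] by (auto simp: image_subset_iff)
  interpret h: group_hom FG "add_monoid G" h
    using h(1) by (simp add: group_hom_def group_hom_axioms_def G.a_group)
  have h_add: "h (u + v) = h u \<oplus>\<^bsub>G\<^esub> h v" if "u \<in> carrier FG" "v \<in> carrier FG" for u v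
    using h.hom_mult[OF that] by simp
  have h_closed: "h u \<in> carrier G" if "u \<in> carrier FG" for u
    using h.hom_closed[OF that] by simp
  have h_diff: "h (u - v) = h u \<ominus>\<^bsub>G\<^esub> h v" if "u \<in> carrier FG" "v \<in> carrier FG" for u v
  proof -
    have "- v \<in> carrier FG" using that by (simp add: keys_minus)
    moreover have "h (- v) = \<ominus>\<^bsub>G\<^esub> h v"
      using h.hom_inv[OF that(2)] that(2) by (simp add: a_inv_def)
    ultimately show ?thesis
      using h_add[OF that(1), of "- v"] by (simp add: G.minus_eq)
  qed
  have frag_diff: "Poly_Mapping.keys (frag_of p - frag_of q) \<subseteq> carrier A \<times> carrier B" if "p \<in> carrier A \<times> carrier B" "q \<in> carrier A \<times> carrier B" for p q
    using keys_diff[of "frag_of p" "frag_of q"] that by (auto simp: keys_frag_of)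
  have cancel: "x \<oplus>\<^bsub>G\<^esub> y \<ominus>\<^bsub>G\<^esub> x \<ominus>\<^bsub>G\<^esub> y = \<zero>\<^bsub>G\<^esub>" if "x \<in> carrier G" "y \<in> carrier G" for x y
  proof -
    have "x \<oplus>\<^bsub>G\<^esub> y \<ominus>\<^bsub>G\<^esub> x = y"
      unfolding G.a_comm[OF that] using that by (simp add: G.minus_eq G.a_assoc G.r_neg)
    then show ?thesis using that by (simp add: G.minus_eq G.r_neg)
  qed
  have rel: "h u = \<zero>\<^bsub>G\<^esub>" if "u \<in> tens_relators \<rho> A B" for u
    using that unfolding tens_relators_def
  proof (elim UnE CollectE exE conjE)
    fix a a' b assume *: "u = frag_of (a \<oplus>\<^bsub>A\<^esub> a', b) - frag_of (a, b) - frag_of (a', b)"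
      "a \<in> carrier A" "a' \<in> carrier A" "b \<in> carrier B"
    then show ?thesis
      using biadditive_closed[OF assms(2)]
      by (simp add: h_diff frag_diff h(2) biadditive_add_left[OF assms(2)] cancel)
  next
    fix a b b' assume *: "u = frag_of (a, b \<oplus>\<^bsub>B\<^esub> b') - frag_of (a, b) - frag_of (a, b')"
      "a \<in> carrier A" "b \<in> carrier B" "b' \<in> carrier B"
    then show ?thesis
      using biadditive_closed[OF assms(2)]
      by (simp add: h_diff frag_diff h(2) biadditive_add_right[OF assms(2)] cancel)
  next
    fix p q assume *: "u = frag_of p - frag_of q" "(p, q) \<in> \<rho>"
    have pq: "p \<in> carrier A \<times> carrier B" "q \<in> carrier A \<times> carrier B"
      using *(2) \<rho>_subset by blast+
    moreover have "case_prod f p = case_prod f q"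
      using assms(3) *(2) by (cases p; cases q) simp
    ultimately have "h (frag_of p) = h (frag_of q)" by (simp add: h(2))
    with pq show ?thesis using * h_closed by (simp add: h_diff G.minus_eq G.r_neg)
  qed
  \<comment> \<open>The kernel is a subgroup containing all relators, hence it contains the subgroup
    \<open>K\<close> that they generate.\<close>
  have ker: "h u = \<zero>\<^bsub>G\<^esub>" if "u \<in> K" for u
  proof -
    have "K \<subseteq> kernel FG (add_monoid G) h"
      unfolding tens_sub_def
      by (rule group.generate_subgroup_incl[OF group_free_Abelian_group _ h.subgroup_kernel])
        (use rel relators_closed in \<open>auto simp: kernel_def simp del: carrier_free_Abelian_group_iff\<close>)
    with that show ?thesis by (auto simp: kernel_def)
  qed
  have wd: "h u = h v" if "proj u = proj v" "u \<in> carrier FG" "v \<in> carrier FG" for u v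
  proof -
    have "u - v \<in> K" using that by (simp add: proj_eq_iff)
    then show ?thesis
      using h_add[of "u - v" v] ker[of "u - v"] subgroup.mem_carrier[OF K_subgroup, of "u - v"] that h_closed
      by simp
  qed
  \<comment> \<open>\<open>h\<close> is constant on classes by \<open>wd\<close>, so any
    representative serves; the restriction makes \<open>g\<close> extensional.\<close>
  define g where "g = (\<lambda>t \<in> carrier (tens \<rho> A B). h (SOME u. u \<in> carrier FG \<and> proj u = t))"
  have g: "g (proj u) = h u" if "u \<in> carrier FG" for u
  proof -
    have "(SOME w. w \<in> carrier FG \<and> proj w = proj u) \<in> carrier FG \<and> proj (SOME w. w \<in> carrier FG \<and> proj w = proj u) = proj u"
      by (rule someI[of _ u]) (use that in simp)
    then have "h (SOME w. w \<in> carrier FG \<and> proj w = proj u) = h u"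
      using wd that by blast
    moreover have "proj u \<in> carrier (tens \<rho> A B)" using that unfolding carrier_tens by blast
    ultimately show ?thesis by (simp add: g_def)
  qed
  have g_add: "additive (tens \<rho> A B) G g"
  proof (rule additiveI; unfold carrier_tens)
    fix a b assume "a \<in> proj ` carrier FG" "b \<in> proj ` carrier FG"
    then obtain u v where uv: "a = proj u" "b = proj v" "u \<in> carrier FG" "v \<in> carrier FG" by blast
    moreover have "u + v \<in> carrier FG" using keys_add[of u v] uv by auto
    ultimately show "g (a \<oplus>\<^bsub>tens \<rho> A B\<^esub> b) = g a \<oplus>\<^bsub>G\<^esub> g b"
      using g[of "u + v"] g[of u] g[of v] h_add[of u v] proj_add[of u v] by simp
  qed (auto simp: g h_closed)
  show ?thesis
  proof (rule ex1I[of _ g])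
    show "g \<in> extensional (carrier (tens \<rho> A B)) \<and> g \<in> hom (add_monoid (tens \<rho> A B)) (add_monoid G) \<and>
      (\<forall>a\<in>carrier A. \<forall>b\<in>carrier B. g (pure \<rho> A B a b) = f a b)"
      using g_add by (auto simp: additive_def pure_proj g h(2)) (simp add: g_def)
  next
    fix g' assume g': "g' \<in> extensional (carrier (tens \<rho> A B)) \<and> g' \<in> hom (add_monoid (tens \<rho> A B)) (add_monoid G) \<and>
      (\<forall>a\<in>carrier A. \<forall>b\<in>carrier B. g' (pure \<rho> A B a b) = f a b)"
    show "g' = g"
    proof (rule extensionalityI[of _ "carrier (tens \<rho> A B)"])
      fix t assume "t \<in> carrier (tens \<rho> A B)"
      then show "g' t = g t"
        using g' g_add by (intro tens_hom_eq[of G g' g t]) (auto simp: additive_def pure_proj g h(2))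
    qed (use g' in \<open>auto simp: g_def\<close>)
  qed
qed

lemma tlift:
  assumes "abelian_group G" "biadditive A B G f"
    and "\<And>a b a' b'. ((a, b), (a', b')) \<in> \<rho> \<Longrightarrow> f a b = f a' b'"
  shows tlift_extensional: "tlift \<rho> A B G f \<in> extensional (carrier (tens \<rho> A B))"
    and tlift_additive: "additive (tens \<rho> A B) G (tlift \<rho> A B G f)"
    and tlift_pure: "\<lbrakk>a \<in> carrier A; b \<in> carrier B\<rbrakk> \<Longrightarrow> tlift \<rho> A B G f (pure \<rho> A B a b) = f a b"
  using theI'[OF tlift_exists[OF assms]] unfolding tlift_def additive_def by auto

end

section \<open>Modules and linear maps\<close>

text \<open>Linear maps without the extensionality demanded by \<open>rhom\<close>, so that
  composites and \<lambda>-terms can be used as they stand. \<open>rlin_restrict\<close> leads back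
  to \<open>rhom\<close>.\<close>

definition rlin ::
  "('u, 'r) ring_scheme \<Rightarrow> ('u, 'm) rmodule_scheme \<Rightarrow> ('u, 'n) rmodule_scheme \<Rightarrow> ('u \<Rightarrow> 'u) \<Rightarrow> bool" where
  "rlin U M N f \<longleftrightarrow> additive M N f \<and>
     (\<forall>m \<in> carrier M. \<forall>r \<in> carrier U. f (m \<triangleleft>\<^bsub>M\<^esub> r) = f m \<triangleleft>\<^bsub>N\<^esub> r)"

definition llin ::
  "('u, 'r) ring_scheme \<Rightarrow> ('u, 'm) bimodule_scheme \<Rightarrow> ('u, 'n) bimodule_scheme \<Rightarrow> ('u \<Rightarrow> 'u) \<Rightarrow> bool" where
  "llin U M N f \<longleftrightarrow> additive M N f \<and>
     (\<forall>r \<in> carrier U. \<forall>m \<in> carrier M. f (r \<triangleright>\<^bsub>M\<^esub> m) = r \<triangleright>\<^bsub>N\<^esub> f m)"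

lemma rhom_iff: "f \<in> rhom U M N \<longleftrightarrow> f \<in> extensional (carrier M) \<and> rlin U M N f"
  by (auto simp: rhom_def rlin_def additive_def)

lemma rhom_rlin: "f \<in> rhom U M N \<Longrightarrow> rlin U M N f"
  by (simp add: rhom_iff)

lemma rhom_ext:
  "\<lbrakk>f \<in> rhom U M N; g \<in> rhom U M N'; \<And>m. m \<in> carrier M \<Longrightarrow> f m = g m\<rbrakk> \<Longrightarrow> f = g"
  by (auto simp: rhom_iff intro: extensionalityI)

lemma rlin_additive: "rlin U M N f \<Longrightarrow> additive M N f"
  by (simp add: rlin_def)

lemma rlin_closed: "\<lbrakk>rlin U M N f; m \<in> carrier M\<rbrakk> \<Longrightarrow> f m \<in> carrier N"
  by (auto simp: rlin_def additive_closed)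

lemma rlin_add:
  "\<lbrakk>rlin U M N f; m \<in> carrier M; m' \<in> carrier M\<rbrakk> \<Longrightarrow> f (m \<oplus>\<^bsub>M\<^esub> m') = f m \<oplus>\<^bsub>N\<^esub> f m'"
  by (auto simp: rlin_def additive_add)

lemma rlin_ract:
  "\<lbrakk>rlin U M N f; m \<in> carrier M; r \<in> carrier U\<rbrakk> \<Longrightarrow> f (m \<triangleleft>\<^bsub>M\<^esub> r) = f m \<triangleleft>\<^bsub>N\<^esub> r"
  by (auto simp: rlin_def)

lemma rlinI:
  "\<lbrakk>additive M N f; \<And>m r. \<lbrakk>m \<in> carrier M; r \<in> carrier U\<rbrakk> \<Longrightarrow> f (m \<triangleleft>\<^bsub>M\<^esub> r) = f m \<triangleleft>\<^bsub>N\<^esub> r\<rbrakk> \<Longrightarrow> rlin U M N f"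
  by (auto simp: rlin_def)

lemma rlin_compose: "\<lbrakk>rlin U L M f; rlin U M N g\<rbrakk> \<Longrightarrow> rlin U L N (\<lambda>x. g (f x))"
  by (auto simp: rlin_def additive_compose additive_closed)

lemma rlin_id: "rlin U M M (\<lambda>x. x)"
  by (simp add: rlin_def additive_id)

lemma right_module_abelian: "right_module U M \<Longrightarrow> abelian_group M"
  by (rule right_module.axioms(2))

lemma rlin_cong:
  assumes "right_module U M" "\<And>m. m \<in> carrier M \<Longrightarrow> f m = g m"
  shows "rlin U M N f = rlin U M N g"
  using additive_cong[OF right_module_abelian[OF assms(1)], of f g N] right_module.ract_closed[OF assms(1)]
  by (auto simp: rlin_def assms(2))

lemma rlin_restrict:
  assumes "right_module U M" "rlin U M N f"
  shows "(\<lambda>m \<in> carrier M. f m) \<in> rhom U M N"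
  using assms(2) rlin_cong[OF assms(1), of "\<lambda>m \<in> carrier M. f m" f N] by (simp add: rhom_iff)

lemma rhom_compose:
  assumes "right_module U L" "f \<in> rhom U L M" "g \<in> rhom U M N"
  shows "compose (carrier L) g f \<in> rhom U L N"
  unfolding compose_def
  by (intro rlin_restrict assms rlin_compose[of U L M f N g]) (use assms in \<open>simp_all add: rhom_rlin\<close>)

lemma rhom_id: "right_module U M \<Longrightarrow> (\<lambda>m \<in> carrier M. m) \<in> rhom U M M"
  by (rule rlin_restrict[OF _ rlin_id])

lemma category_RMod: "category (RMod U)"
proof
  fix w x y z f g h
  assume "w \<in> Obj (RMod U)" "x \<in> Obj (RMod U)" "y \<in> Obj (RMod U)" "z \<in> Obj (RMod U)"
    "f \<in> Hom (RMod U) w x" "g \<in> Hom (RMod U) x y" "h \<in> Hom (RMod U) y z"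
  then show "Cmp (RMod U) w x z (Cmp (RMod U) x y z h g) f = Cmp (RMod U) w y z h (Cmp (RMod U) w x y g f)"
    by (auto simp: RMod_def compose_def rhom_iff rlin_closed)
next
  fix x y f assume *: "x \<in> Obj (RMod U)" "y \<in> Obj (RMod U)" "f \<in> Hom (RMod U) x y"
  show "Cmp (RMod U) x y y (Idn (RMod U) y) f = f" "Cmp (RMod U) x x y f (Idn (RMod U) x) = f"
    by (rule extensionalityI[of _ "carrier x"];
      use * in \<open>auto simp: RMod_def compose_def rhom_iff rlin_closed\<close>)+
qed (auto simp: RMod_def rhom_compose rhom_id)

text \<open>Two commuting actions with no reference to \<open>k\<close>. Centrality is treated
  separately, for comodules in \<open>Xb_central\<close> and for the objects of \<open>Bimod\<close>
  through \<open>k_bimoduleI\<close>.\<close>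

definition bimod ::
  "('u, 'r) ring_scheme \<Rightarrow> ('u, 's) ring_scheme \<Rightarrow> ('u, 'm) bimodule_scheme \<Rightarrow> bool" where
  "bimod T U M \<longleftrightarrow> left_module T M \<and> right_module U M \<and>
     (\<forall>t \<in> carrier T. \<forall>m \<in> carrier M. \<forall>u \<in> carrier U.
       (t \<triangleright>\<^bsub>M\<^esub> m) \<triangleleft>\<^bsub>M\<^esub> u = t \<triangleright>\<^bsub>M\<^esub> (m \<triangleleft>\<^bsub>M\<^esub> u))"

lemma k_bimodule_bimod: "k_bimodule k T U M \<Longrightarrow> bimod T U M"
  unfolding bimod_def
  by (auto dest: k_bimodule.axioms k_bimodule.actions_commute)

section \<open>Tensor products over a ring\<close>

lemma over_ring_subset:
  assumes "right_module T X" "left_module T M"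
  shows "over_ring T X M \<subseteq> (carrier X \<times> carrier M) \<times> (carrier X \<times> carrier M)"
  using right_module.ract_closed[OF assms(1)] left_module.lact_closed[OF assms(2)]
  by (auto simp: over_ring_def)

lemma same_group_rtensor: "same_group (tens (over_ring T X M) X M) (rtensor T X M)"
  by (simp add: rtensor_def Let_def same_group_def ring.defs)

text \<open>Simplification always passes from \<open>bitensor\<close> to \<open>rtensor\<close>, so
  that only the left action still mentions the bimodule record.\<close>

lemma bitensor_simps [simp]:
  "carrier (bitensor T X M) = carrier (rtensor T X M)"
  "(\<oplus>\<^bsub>bitensor T X M\<^esub>) = (\<oplus>\<^bsub>rtensor T X M\<^esub>)"
  "\<zero>\<^bsub>bitensor T X M\<^esub> = \<zero>\<^bsub>rtensor T X M\<^esub>"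
  "ract (bitensor T X M) = ract (rtensor T X M)"
  by (simp_all add: bitensor_def Let_def rmodule.defs)

lemma same_group_bitensor: "same_group (bitensor T X M) (rtensor T X M)"
  by (simp add: same_group_def)

lemma additive_bitensor [simp]:
  "additive (bitensor T X M) G f = additive (rtensor T X M) G f"
  "additive G' (bitensor T X M) g = additive G' (rtensor T X M) g"
  "biadditive A B (bitensor T X M) f' = biadditive A B (rtensor T X M) f'"
  by (rule same_group_additive[OF same_group_bitensor] same_group_biadditive[OF same_group_bitensor])+

lemma tlift_bitensor [simp]: "tlift \<rho> A B (bitensor T X M) f = tlift \<rho> A B (rtensor T X M) f"
  by (rule same_group_tlift[OF same_group_bitensor])

text \<open>Serves to simplify a function under a lift at arbitrary tensors, for instance to drop an
  action by \<one>.\<close>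

lemma tlift_cong:
  "(\<And>a b. \<lbrakk>a \<in> carrier A; b \<in> carrier B\<rbrakk> \<Longrightarrow> f a b = g a b) \<Longrightarrow> tlift \<rho> A B G f = tlift \<rho> A B G g"
  unfolding tlift_def by (simp cong: ball_cong conj_cong)

context universe
begin

section \<open>The tensor product over a ring as a right module\<close>

context
  fixes T :: "('k, 'u) module" and X :: "('u, 'x) rmodule_scheme" and M :: "('u, 'm) bimodule_scheme"
  assumes X: "right_module T X" and M: "left_module T M"
begin

interpretation X: right_module T X by (rule X)
interpretation M: left_module T M by (rule M)
interpretation B: balanced_tensor X M "over_ring T X M"
  by unfold_locales (rule over_ring_subset[OF X M])

lemmas same_rt = same_group_rtensor[of T X M]

lemma rt_carrier: "carrier (tens (over_ring T X M) X M) = carrier (rtensor T X M)"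
  using same_rt by (simp add: same_group_def)

lemma rt_add: "(\<oplus>\<^bsub>tens (over_ring T X M) X M\<^esub>) = (\<oplus>\<^bsub>rtensor T X M\<^esub>)"
  using same_rt by (simp add: same_group_def)

lemma rt_abelian: "abelian_group (rtensor T X M)"
  using same_group_abelian[OF same_rt B.abelian_tens] .

lemma rpure_closed: "\<lbrakk>x \<in> carrier X; m \<in> carrier M\<rbrakk> \<Longrightarrow> rpure T X M x m \<in> carrier (rtensor T X M)"
  using B.pure_closed by (simp add: rt_carrier)

lemma rpure_biadditive: "biadditive X M (rtensor T X M) (rpure T X M)"
  using B.pure_biadditive by (simp add: same_group_biadditive[OF same_rt])

lemmas rpure_add = biadditive_add_left[OF rpure_biadditive] biadditive_add_right[OF rpure_biadditive]

lemma rpure_balanced: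
  "\<lbrakk>x \<in> carrier X; t \<in> carrier T; m \<in> carrier M\<rbrakk>
    \<Longrightarrow> rpure T X M (x \<triangleleft>\<^bsub>X\<^esub> t) m = rpure T X M x (t \<triangleright>\<^bsub>M\<^esub> m)"
  by (rule B.pure_balanced) (unfold over_ring_def, blast)

lemma rt_induct [consumes 1, case_names pure add]:
  assumes "z \<in> carrier (rtensor T X M)"
    and "\<And>x m. \<lbrakk>x \<in> carrier X; m \<in> carrier M\<rbrakk> \<Longrightarrow> P (rpure T X M x m)"
    and "\<And>u v. \<lbrakk>u \<in> carrier (rtensor T X M); v \<in> carrier (rtensor T X M); P u; P v\<rbrakk>
      \<Longrightarrow> P (u \<oplus>\<^bsub>rtensor T X M\<^esub> v)"
  shows "P z"
  using B.tens_induct[unfolded rt_carrier rt_add, of z P] assms by blast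

text \<open>The standard method below: module axioms, linearity and coherence are phrased as
  equations between two additive maps and then tested on pure tensors.\<close>

lemma rt_hom_eq:
  assumes "additive (rtensor T X M) G h" "additive (rtensor T X M) G h'"
    and "\<And>x m. \<lbrakk>x \<in> carrier X; m \<in> carrier M\<rbrakk> \<Longrightarrow> h (rpure T X M x m) = h' (rpure T X M x m)"
    and "z \<in> carrier (rtensor T X M)"
  shows "h z = h' z"
  using assms(4)
  by (induction rule: rt_induct) (auto simp: assms additive_add[OF assms(1)] additive_add[OF assms(2)])

lemma rlift:
  assumes "abelian_group G" "biadditive X M G f"
    and "\<And>x t m. \<lbrakk>x \<in> carrier X; t \<in> carrier T; m \<in> carrier M\<rbrakk> \<Longrightarrow> f (x \<triangleleft>\<^bsub>X\<^esub> t) m = f x (t \<triangleright>\<^bsub>M\<^esub> m)"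
  shows rlift_extensional: "rlift T X M G f \<in> extensional (carrier (rtensor T X M))"
    and rlift_additive: "additive (rtensor T X M) G (rlift T X M G f)"
    and rlift_pure: "\<lbrakk>x \<in> carrier X; m \<in> carrier M\<rbrakk> \<Longrightarrow> rlift T X M G f (rpure T X M x m) = f x m"
proof -
  have bal: "f a b = f a' b'" if "((a, b), (a', b')) \<in> over_ring T X M" for a b a' b'
    using that assms(3) by (auto simp: over_ring_def)
  show "rlift T X M G f \<in> extensional (carrier (rtensor T X M))"
    using B.tlift_extensional[OF assms(1,2) bal] by (simp add: rt_carrier)
  show "additive (rtensor T X M) G (rlift T X M G f)"
    using B.tlift_additive[OF assms(1,2) bal] by (simp add: same_group_additive[OF same_rt])
  show "\<lbrakk>x \<in> carrier X; m \<in> carrier M\<rbrakk> \<Longrightarrow> rlift T X M G f (rpure T X M x m) = f x m"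
    using B.tlift_pure[OF assms(1,2) bal] .
qed

context
  fixes U :: "('k, 'u) module"
  assumes bim: "bimod T U M"
begin

interpretation Mr: right_module U M using bim by (simp add: bimod_def)

text \<open>The definition lifts into the bare group \<open>tens\<close>. The target is replaced by
  \<open>rtensor\<close> so that the lemmas on \<open>rlift\<close> apply.\<close>

lemma rt_ract_eq: "z \<triangleleft>\<^bsub>rtensor T X M\<^esub> u = rlift T X M (rtensor T X M) (\<lambda>x m. rpure T X M x (m \<triangleleft>\<^bsub>M\<^esub> u)) z"
proof -
  have "z \<triangleleft>\<^bsub>rtensor T X M\<^esub> u
      = rlift T X M (tens (over_ring T X M) X M) (\<lambda>x m. rpure T X M x (m \<triangleleft>\<^bsub>M\<^esub> u)) z"
    by (simp add: rtensor_def Let_def ring.defs rmodule.defs)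
  then show ?thesis by (simp only: same_group_tlift[OF same_rt])
qed

lemma rt_ract:
  assumes u: "u \<in> carrier U"
  shows rt_ract_additive: "additive (rtensor T X M) (rtensor T X M) (\<lambda>z. z \<triangleleft>\<^bsub>rtensor T X M\<^esub> u)"
    and rt_ract_pure: "\<lbrakk>x \<in> carrier X; m \<in> carrier M\<rbrakk>
      \<Longrightarrow> rpure T X M x m \<triangleleft>\<^bsub>rtensor T X M\<^esub> u = rpure T X M x (m \<triangleleft>\<^bsub>M\<^esub> u)"
proof -
  have 1: "biadditive X M (rtensor T X M) (\<lambda>x m. rpure T X M x (m \<triangleleft>\<^bsub>M\<^esub> u))"
    using u by (intro biadditiveI) (auto simp: rpure_closed rpure_add Mr.ract_closed Mr.ract_add)
  have 2: "rpure T X M (x \<triangleleft>\<^bsub>X\<^esub> t) (m \<triangleleft>\<^bsub>M\<^esub> u) = rpure T X M x ((t \<triangleright>\<^bsub>M\<^esub> m) \<triangleleft>\<^bsub>M\<^esub> u)"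
    if "x \<in> carrier X" "t \<in> carrier T" "m \<in> carrier M" for x t m
    using that u bim by (simp add: bimod_def rpure_balanced Mr.ract_closed)
  show "additive (rtensor T X M) (rtensor T X M) (\<lambda>z. z \<triangleleft>\<^bsub>rtensor T X M\<^esub> u)"
    unfolding rt_ract_eq by (rule rlift_additive[OF rt_abelian 1, OF 2])
  show "\<lbrakk>x \<in> carrier X; m \<in> carrier M\<rbrakk>
      \<Longrightarrow> rpure T X M x m \<triangleleft>\<^bsub>rtensor T X M\<^esub> u = rpure T X M x (m \<triangleleft>\<^bsub>M\<^esub> u)"
    unfolding rt_ract_eq by (rule rlift_pure[OF rt_abelian 1, OF 2])
qed

lemma rt_right_module: "right_module U (rtensor T X M)"
proof -
  interpret rt: abelian_group "rtensor T X M" by (rule rt_abelian)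
  note ract = additive_closed[OF rt_ract_additive] additive_add[OF rt_ract_additive] rt_ract_pure
  show ?thesis
  proof
    fix z r r' assume z: "z \<in> carrier (rtensor T X M)" and r: "r \<in> carrier U" "r' \<in> carrier U"
    show "z \<triangleleft>\<^bsub>rtensor T X M\<^esub> (r \<oplus>\<^bsub>U\<^esub> r') = z \<triangleleft>\<^bsub>rtensor T X M\<^esub> r \<oplus>\<^bsub>rtensor T X M\<^esub> z \<triangleleft>\<^bsub>rtensor T X M\<^esub> r'"
      by (rule rt_hom_eq[OF rt_ract_additive additive_sum_maps[OF rt_ract_additive rt_ract_additive rt_abelian] _ z])
        (use r in \<open>simp_all add: ract Mr.ract_add_scalar Mr.ract_closed rpure_add\<close>)
    show "z \<triangleleft>\<^bsub>rtensor T X M\<^esub> (r \<otimes>\<^bsub>U\<^esub> r') = z \<triangleleft>\<^bsub>rtensor T X M\<^esub> r \<triangleleft>\<^bsub>rtensor T X M\<^esub> r'"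
      by (rule rt_hom_eq[OF rt_ract_additive additive_compose[OF rt_ract_additive rt_ract_additive] _ z])
        (use r in \<open>simp_all add: ract Mr.ract_mult Mr.ract_closed\<close>)
  next
    fix z assume z: "z \<in> carrier (rtensor T X M)"
    show "z \<triangleleft>\<^bsub>rtensor T X M\<^esub> \<one>\<^bsub>U\<^esub> = z"
      by (rule rt_hom_eq[OF rt_ract_additive additive_id _ z])
        (simp_all add: ract Mr.ract_one)
  qed (simp_all add: ract)
qed

lemma rt_rlin:
  assumes "right_module U N" "additive (rtensor T X M) N h"
    and "\<And>x m u. \<lbrakk>x \<in> carrier X; m \<in> carrier M; u \<in> carrier U\<rbrakk>
      \<Longrightarrow> h (rpure T X M x (m \<triangleleft>\<^bsub>M\<^esub> u)) = h (rpure T X M x m) \<triangleleft>\<^bsub>N\<^esub> u"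
  shows "rlin U (rtensor T X M) N h"
proof (rule rlinI[OF assms(2)])
  fix z u assume z: "z \<in> carrier (rtensor T X M)" and u: "u \<in> carrier U"
  have "additive N N (\<lambda>n. n \<triangleleft>\<^bsub>N\<^esub> u)"
    using u by (auto intro!: additiveI simp: right_module.ract_closed[OF assms(1)] right_module.ract_add[OF assms(1)])
  from additive_compose[OF assms(2) this]
  show "h (z \<triangleleft>\<^bsub>rtensor T X M\<^esub> u) = h z \<triangleleft>\<^bsub>N\<^esub> u"
    by (rule rt_hom_eq[OF additive_compose[OF rt_ract_additive[OF u] assms(2)]])
      (use u z in \<open>simp_all add: rt_ract_pure assms(3)\<close>)
qed

end

end

section \<open>Tensor products of bimodules\<close>

context
  fixes T U :: "('k, 'u) module" and X :: "('u, 'x) bimodule_scheme" and M :: "('u, 'm) bimodule_scheme"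
    and V :: "('k, 'u) module"
  assumes X: "bimod V T X" and M: "bimod T U M"
begin

interpretation Xl: left_module V X using X by (simp add: bimod_def)
interpretation Xr: right_module T X using X by (simp add: bimod_def)
interpretation Ml: left_module T M using M by (simp add: bimod_def)
interpretation Mr: right_module U M using M by (simp add: bimod_def)

lemmas rm = Xr.right_module_axioms Ml.left_module_axioms

text \<open>The action of V on X commutes with the action of T over which the tensor product is
  balanced, so it descends.\<close>

lemma bt_lact:
  assumes v: "v \<in> carrier V"
  shows bt_lact_additive: "additive (rtensor T X M) (rtensor T X M) (\<lambda>z. v \<triangleright>\<^bsub>bitensor T X M\<^esub> z)"
    and bt_lact_pure: "\<lbrakk>x \<in> carrier X; m \<in> carrier M\<rbrakk>
      \<Longrightarrow> v \<triangleright>\<^bsub>bitensor T X M\<^esub> rpure T X M x m = rpure T X M (v \<triangleright>\<^bsub>X\<^esub> x) m"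
proof -
  have eq: "v \<triangleright>\<^bsub>bitensor T X M\<^esub> z = rlift T X M (rtensor T X M) (\<lambda>x m. rpure T X M (v \<triangleright>\<^bsub>X\<^esub> x) m) z" for z
    by (simp add: bitensor_def Let_def rmodule.defs bimodule.defs)
  have 1: "biadditive X M (rtensor T X M) (\<lambda>x m. rpure T X M (v \<triangleright>\<^bsub>X\<^esub> x) m)"
    using v by (intro biadditiveI)
      (auto simp: rpure_closed[OF rm] rpure_add[OF rm] Xl.lact_closed Xl.lact_add)
  have 2: "rpure T X M (v \<triangleright>\<^bsub>X\<^esub> (x \<triangleleft>\<^bsub>X\<^esub> t)) m = rpure T X M (v \<triangleright>\<^bsub>X\<^esub> x) (t \<triangleright>\<^bsub>M\<^esub> m)"
    if "x \<in> carrier X" "t \<in> carrier T" "m \<in> carrier M" for x t m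
    using that v X by (simp add: bimod_def rpure_balanced[OF rm, symmetric] Xl.lact_closed)
  show "additive (rtensor T X M) (rtensor T X M) (\<lambda>z. v \<triangleright>\<^bsub>bitensor T X M\<^esub> z)"
    unfolding eq by (rule rlift_additive[OF rm rt_abelian[OF rm] 1, OF 2])
  show "\<lbrakk>x \<in> carrier X; m \<in> carrier M\<rbrakk>
      \<Longrightarrow> v \<triangleright>\<^bsub>bitensor T X M\<^esub> rpure T X M x m = rpure T X M (v \<triangleright>\<^bsub>X\<^esub> x) m"
    unfolding eq by (rule rlift_pure[OF rm rt_abelian[OF rm] 1, OF 2])
qed

lemma bt_bimod: "bimod V U (bitensor T X M)"
proof -
  interpret rt: right_module U "rtensor T X M" by (rule rt_right_module[OF rm M])
  interpret bt: abelian_group "bitensor T X M"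
    by (rule same_group_abelian[OF _ rt.M.abelian_group_axioms]) (simp add: same_group_def)
  note lact = additive_closed[OF bt_lact_additive] additive_add[OF bt_lact_additive] bt_lact_pure
  have "right_module U (bitensor T X M)"
    by unfold_locales
      (simp_all add: rt.ract_closed rt.ract_add rt.ract_add_scalar rt.ract_mult rt.ract_one)
  moreover have "left_module V (bitensor T X M)"
  proof
    fix z r r' assume z: "z \<in> carrier (bitensor T X M)" and r: "r \<in> carrier V" "r' \<in> carrier V"
    then have z: "z \<in> carrier (rtensor T X M)" by simp
    show "(r \<oplus>\<^bsub>V\<^esub> r') \<triangleright>\<^bsub>bitensor T X M\<^esub> z = (r \<triangleright>\<^bsub>bitensor T X M\<^esub> z) \<oplus>\<^bsub>bitensor T X M\<^esub> (r' \<triangleright>\<^bsub>bitensor T X M\<^esub> z)"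
      unfolding bitensor_simps
      by (rule rt_hom_eq[OF rm bt_lact_additive additive_sum_maps[OF bt_lact_additive bt_lact_additive rt_abelian[OF rm]] _ z])
        (use r in \<open>simp_all add: lact Xl.lact_add_scalar Xl.lact_closed rpure_add[OF rm]\<close>)
    show "(r \<otimes>\<^bsub>V\<^esub> r') \<triangleright>\<^bsub>bitensor T X M\<^esub> z = r \<triangleright>\<^bsub>bitensor T X M\<^esub> (r' \<triangleright>\<^bsub>bitensor T X M\<^esub> z)"
      by (rule rt_hom_eq[OF rm bt_lact_additive additive_compose[OF bt_lact_additive bt_lact_additive] _ z])
        (use r in \<open>simp_all add: lact Xl.lact_mult Xl.lact_closed\<close>)
  next
    fix z assume "z \<in> carrier (bitensor T X M)"
    then have z: "z \<in> carrier (rtensor T X M)" by simp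
    show "\<one>\<^bsub>V\<^esub> \<triangleright>\<^bsub>bitensor T X M\<^esub> z = z"
      by (rule rt_hom_eq[OF rm bt_lact_additive additive_id _ z])
        (simp_all add: lact Xl.lact_one)
  qed (simp_all add: lact)
  moreover have "(v \<triangleright>\<^bsub>bitensor T X M\<^esub> z) \<triangleleft>\<^bsub>bitensor T X M\<^esub> u = v \<triangleright>\<^bsub>bitensor T X M\<^esub> (z \<triangleleft>\<^bsub>bitensor T X M\<^esub> u)"
    if "v \<in> carrier V" "z \<in> carrier (rtensor T X M)" "u \<in> carrier U" for v z u
    unfolding bitensor_simps
    by (rule rt_hom_eq[OF rm additive_compose[OF bt_lact_additive rt_ract_additive[OF rm M]]
          additive_compose[OF rt_ract_additive[OF rm M] bt_lact_additive] _ that(2)])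
      (use that in \<open>simp_all add: lact rt_ract_pure[OF rm M] Xl.lact_closed Mr.ract_closed\<close>)
  ultimately show ?thesis by (simp add: bimod_def)
qed

end

section \<open>Functoriality of the tensor product over a ring\<close>

context
  fixes T :: "('k, 'u) module" and X :: "('u, 'x) rmodule_scheme" and M :: "('u, 'm) bimodule_scheme"
    and X' :: "('u, 'y) rmodule_scheme" and M' :: "('u, 'n) bimodule_scheme" and f g :: "'u \<Rightarrow> 'u"
  assumes X: "right_module T X" and M: "left_module T M"
    and X': "right_module T X'" and M': "left_module T M'"
    and f: "rlin T X X' f" and g: "llin T M M' g"
begin

lemma rtensor_map:
  shows rtensor_map_extensional: "rtensor_map T X M X' M' f g \<in> extensional (carrier (rtensor T X M))"
    and rtensor_map_additive: "additive (rtensor T X M) (rtensor T X' M') (rtensor_map T X M X' M' f g)"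
    and rtensor_map_pure: "\<lbrakk>x \<in> carrier X; m \<in> carrier M\<rbrakk>
      \<Longrightarrow> rtensor_map T X M X' M' f g (rpure T X M x m) = rpure T X' M' (f x) (g m)"
proof -
  have g': "additive M M' g" using g by (simp add: llin_def)
  have 1: "biadditive X M (rtensor T X' M') (\<lambda>x m. rpure T X' M' (f x) (g m))"
    by (intro biadditiveI) (simp_all add: rlin_closed[OF f] rlin_add[OF f] additive_closed[OF g']
        additive_add[OF g'] rpure_closed[OF X' M'] rpure_add[OF X' M'])
  have 2: "rpure T X' M' (f (x \<triangleleft>\<^bsub>X\<^esub> t)) (g m) = rpure T X' M' (f x) (g (t \<triangleright>\<^bsub>M\<^esub> m))"
    if "x \<in> carrier X" "t \<in> carrier T" "m \<in> carrier M" for x t m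
    using that g by (simp add: rlin_ract[OF f] llin_def rpure_balanced[OF X' M'] rlin_closed[OF f] additive_closed[OF g'])
  note * = rlift[OF X M rt_abelian[OF X' M'] 1 2, folded rtensor_map_def]
  show "rtensor_map T X M X' M' f g \<in> extensional (carrier (rtensor T X M))" by (rule *(1))
  show "additive (rtensor T X M) (rtensor T X' M') (rtensor_map T X M X' M' f g)" by (rule *(2))
  show "\<lbrakk>x \<in> carrier X; m \<in> carrier M\<rbrakk>
      \<Longrightarrow> rtensor_map T X M X' M' f g (rpure T X M x m) = rpure T X' M' (f x) (g m)" by (rule *(3))
qed

lemma rtensor_map_rlin:
  fixes U :: "('k, 'u) module"
  assumes "bimod T U M" "bimod T U M'" "rlin U M M' g"
  shows "rlin U (rtensor T X M) (rtensor T X' M') (rtensor_map T X M X' M' f g)"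
proof (rule rt_rlin[OF X M assms(1) rt_right_module[OF X' M' assms(2)] rtensor_map_additive])
  have r: "right_module U M" using assms(1) by (simp add: bimod_def)
  fix x m u assume *: "x \<in> carrier X" "m \<in> carrier M" "u \<in> carrier U"
  then show "rtensor_map T X M X' M' f g (rpure T X M x (m \<triangleleft>\<^bsub>M\<^esub> u))
    = rtensor_map T X M X' M' f g (rpure T X M x m) \<triangleleft>\<^bsub>rtensor T X' M'\<^esub> u"
    using right_module.ract_closed[OF r]
    by (simp add: rtensor_map_pure rlin_ract[OF assms(3)] rt_ract_pure[OF X' M' assms(2)] rlin_closed[OF f] rlin_closed[OF assms(3)])
qed

end

section \<open>The associator\<close>

context
  fixes T U :: "('k, 'u) module" and X :: "('u, 'x) rmodule_scheme"
    and M :: "('u, 'm) bimodule_scheme" and N :: "('u, 'n) bimodule_scheme"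
  assumes X: "right_module T X" and M: "bimod T T M" and N: "bimod T U N"
begin

text \<open>A lift within a lift. The inner one is balanced because T acts on
  \<open>rtensor T X M\<close> through M, the outer one because T acts on
  \<open>bitensor T M N\<close> from the left through M.\<close>

lemma rassoc:
  shows rassoc_extensional: "rassoc T X M N \<in> extensional (carrier (rtensor T X (bitensor T M N)))"
    and rassoc_rlin: "rlin U (rtensor T X (bitensor T M N)) (rtensor T (rtensor T X M) N) (rassoc T X M N)"
    and rassoc_pure: "\<lbrakk>x \<in> carrier X; m \<in> carrier M; n \<in> carrier N\<rbrakk>
      \<Longrightarrow> rassoc T X M N (rpure T X (bitensor T M N) x (rpure T M N m n))
        = rpure T (rtensor T X M) N (rpure T X M x m) n"
proof -
  interpret X: right_module T X by (rule X)
  have Ml: "left_module T M" and Mr: "right_module T M" and Nl: "left_module T N" and Nr: "right_module U N"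
    using M N by (auto simp: bimod_def)
  interpret Ml: left_module T M by (rule Ml)
  interpret Mr: right_module T M by (rule Mr)
  interpret Nl: left_module T N by (rule Nl)
  interpret Nr: right_module U N by (rule Nr)
  have XM: "right_module T (rtensor T X M)" by (rule rt_right_module[OF X Ml M])
  have MN: "bimod T U (bitensor T M N)" by (rule bt_bimod[OF M N])
  then have MNl: "left_module T (bitensor T M N)" by (simp add: bimod_def)
  interpret MNl: left_module T "bitensor T M N" by (rule MNl)
  let ?T = "rtensor T (rtensor T X M) N"
  let ?f = "\<lambda>x m n. rpure T (rtensor T X M) N (rpure T X M x m) n"
  let ?l = "\<lambda>x. rlift T M N ?T (?f x)"
  have ab: "abelian_group ?T" by (rule rt_abelian[OF XM Nl])
  have 1: "biadditive M N ?T (?f x)" if "x \<in> carrier X" for x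
    using that by (intro biadditiveI) (simp_all add: rpure_closed[OF XM Nl] rpure_closed[OF X Ml] rpure_add[OF X Ml] rpure_add[OF XM Nl])
  have 2: "?f x (m \<triangleleft>\<^bsub>M\<^esub> t) n = ?f x m (t \<triangleright>\<^bsub>N\<^esub> n)"
    if "x \<in> carrier X" "m \<in> carrier M" "t \<in> carrier T" "n \<in> carrier N" for x m t n
    using that by (simp add: rt_ract_pure[OF X Ml M, symmetric] rpure_balanced[OF XM Nl] rpure_closed[OF X Ml])
  have l: "additive (rtensor T M N) ?T (?l x)" "m \<in> carrier M \<Longrightarrow> n \<in> carrier N \<Longrightarrow> ?l x (rpure T M N m n) = ?f x m n"
    if "x \<in> carrier X" for x m n
    using rlift_additive[OF Mr Nl ab 1[OF that], OF 2[OF that]] rlift_pure[OF Mr Nl ab 1[OF that], OF 2[OF that]] by auto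
  have 3: "biadditive X (bitensor T M N) ?T ?l"
  proof (intro biadditiveI; (unfold bitensor_simps)?)
    fix x x' z assume *: "x \<in> carrier X" "x' \<in> carrier X" "z \<in> carrier (rtensor T M N)"
    then have xx: "x \<oplus>\<^bsub>X\<^esub> x' \<in> carrier X" by simp
    show "?l (x \<oplus>\<^bsub>X\<^esub> x') z = ?l x z \<oplus>\<^bsub>?T\<^esub> ?l x' z"
      by (rule rt_hom_eq[OF Mr Nl l(1)[OF xx] additive_sum_maps[OF l(1)[OF *(1)] l(1)[OF *(2)] ab] _ *(3)])
        (use * in \<open>simp_all add: l(2) rpure_add[OF X Ml] rpure_add[OF XM Nl] rpure_closed[OF X Ml]\<close>)
  qed (auto simp: additive_closed[OF l(1)] additive_add[OF l(1)])
  have 4: "?l (x \<triangleleft>\<^bsub>X\<^esub> t) z = ?l x (t \<triangleright>\<^bsub>bitensor T M N\<^esub> z)"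
    if *: "x \<in> carrier X" "t \<in> carrier T" "z \<in> carrier (bitensor T M N)" for x t z
    by (rule rt_hom_eq[OF Mr Nl l(1)[OF X.ract_closed[OF *(1,2)]]
          additive_compose[OF bt_lact_additive[OF M N *(2)] l(1)[OF *(1)]]])
      (use * in \<open>simp_all add: l(2) bt_lact_pure[OF M N] rpure_balanced[OF X Ml] X.ract_closed Ml.lact_closed\<close>)
  note lift = rlift[where f = ?l, OF X MNl ab 3, OF 4, folded rassoc_def[of T X M N, unfolded Let_def]]
  show "rassoc T X M N \<in> extensional (carrier (rtensor T X (bitensor T M N)))"
    by (rule lift(1))
  show pure: "\<lbrakk>x \<in> carrier X; m \<in> carrier M; n \<in> carrier N\<rbrakk>
      \<Longrightarrow> rassoc T X M N (rpure T X (bitensor T M N) x (rpure T M N m n))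
        = rpure T (rtensor T X M) N (rpure T X M x m) n" for x m n
    using lift(3)[OF _ _ _, of x "rpure T M N m n"] by (simp add: rpure_closed[OF Mr Nl] l(2))
  show "rlin U (rtensor T X (bitensor T M N)) ?T (rassoc T X M N)"
  proof (rule rt_rlin[OF X MNl MN rt_right_module[OF XM Nl N] lift(2)])
    fix x z u assume x: "x \<in> carrier X" and z: "z \<in> carrier (bitensor T M N)" and u: "u \<in> carrier U"
    have z': "z \<in> carrier (rtensor T M N)" using z by simp
    interpret Tr: right_module U ?T by (rule rt_right_module[OF XM Nl N])
    have "rassoc T X M N (rpure T X (bitensor T M N) x (z \<triangleleft>\<^bsub>rtensor T M N\<^esub> u)) = ?l x (z \<triangleleft>\<^bsub>rtensor T M N\<^esub> u)"
      using lift(3)[OF _ _ _ x, of "z \<triangleleft>\<^bsub>rtensor T M N\<^esub> u"] z' u right_module.ract_closed[OF rt_right_module[OF Mr Nl N]] by simp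
    also have "\<dots> = ?l x z \<triangleleft>\<^bsub>?T\<^esub> u"
      using rlin_ract[OF rt_rlin[OF Mr Nl N Tr.right_module_axioms l(1)[OF x]] z' u] x
      by (simp add: l(2) Nr.ract_closed rt_ract_pure[OF XM Nl N] rpure_closed[OF X Ml])
    also have "?l x z = rassoc T X M N (rpure T X (bitensor T M N) x z)"
      using lift(3)[OF _ _ _ x z] by simp
    finally show "rassoc T X M N (rpure T X (bitensor T M N) x (z \<triangleleft>\<^bsub>bitensor T M N\<^esub> u)) =
       rassoc T X M N (rpure T X (bitensor T M N) x z) \<triangleleft>\<^bsub>?T\<^esub> u" by simp
  qed
qed

end

end

section \<open>Functors on module categories\<close>

lemma RMod_simps [simp]:
  "Obj (RMod U) = {M. right_module U M}" "Hom (RMod U) = rhom U"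
  "Idn (RMod U) M = (\<lambda>m \<in> carrier M. m)" "Cmp (RMod U) L M N g f = compose (carrier L) g f"
  by (simp_all add: RMod_def)

lemma comp_ftor_simps [simp]:
  "fob (comp_ftor G F) x = fob G (fob F x)"
  "fhom (comp_ftor G F) x y f = fhom G (fob F x) (fob F y) (fhom F x y f)"
  by (simp_all add: comp_ftor_def)

lemma regular_rmodule_simps [simp]:
  "carrier (regular_rmodule U) = carrier U" "(\<oplus>\<^bsub>regular_rmodule U\<^esub>) = (\<oplus>\<^bsub>U\<^esub>)"
  "\<zero>\<^bsub>regular_rmodule U\<^esub> = \<zero>\<^bsub>U\<^esub>" "x \<triangleleft>\<^bsub>regular_rmodule U\<^esub> y = x \<otimes>\<^bsub>U\<^esub> y"
  by (simp_all add: regular_rmodule_def ring.defs rmodule.defs)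

lemma regular_right_module:
  assumes "ring U" shows "right_module U (regular_rmodule U)"
proof -
  interpret ring U by fact
  interpret M: abelian_group "regular_rmodule U"
    by (rule same_group_abelian[OF _ abelian_group_axioms]) (simp add: same_group_def)
  show ?thesis
    by unfold_locales (simp_all add: l_distr r_distr m_assoc)
qed

definition tensor_ftor :: "('k, 'u) module \<Rightarrow> ('u, 'x) bimodule_scheme \<Rightarrow> 'u mod_ftor" where
  "tensor_ftor T X = \<lparr>fob = (\<lambda>A. rtensor T A X), fhom = (\<lambda>A B f. rtensor_map T A X B X f (\<lambda>x. x))\<rparr>"

lemma tensor_ftor_simps [simp]:
  "fob (tensor_ftor T X) A = rtensor T A X"
  "fhom (tensor_ftor T X) A B f = rtensor_map T A X B X f (\<lambda>x. x)"
  by (simp_all add: tensor_ftor_def)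

lemma llin_id: "llin T M M (\<lambda>m. m)"
  by (simp add: llin_def additive_id)

lemma (in universe) two_elements: obtains a b :: 'u where "a \<noteq> b"
proof -
  have "\<not> (UNIV :: 'u set) \<subseteq> {undefined}"
    using finite_subset[of "UNIV :: 'u set" "{undefined}"] infinite_universe by fastforce
  then obtain b :: 'u where "b \<noteq> undefined" by blast
  then show thesis by (rule that)
qed

text \<open>Lists of pairs will represent finite sums of maps in \<open>tensor_curry\<close>; this
  bounds the number of maps obtained.\<close>

lemma (in universe) lists_lepoll: "(UNIV :: ('u \<times> 'u) list set) \<lesssim> (UNIV :: 'u set)"
proof -
  obtain p :: "'u \<times> 'u \<Rightarrow> 'u" where p: "inj p"
    using pairs_eqpoll unfolding eqpoll_def bij_betw_def by blast
  obtain c d :: 'u where cd: "c \<noteq> d" by (rule two_elements)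
  \<comment> \<open>\<open>c\<close> and \<open>d\<close> are tags: they tell the code of the empty
    list from the codes of the others.\<close>
  define e where "e = rec_list (p (c, c)) (\<lambda>a _ n. p (d, p (p a, n)))"
  have e: "e [] = p (c, c)" "e (a # xs) = p (d, p (p a, e xs))" for a xs
    by (simp_all add: e_def)
  have inj: "e xs = e ys \<Longrightarrow> xs = ys" for xs ys
  proof (induction xs arbitrary: ys)
    case Nil then show ?case using cd by (cases ys) (simp_all add: e inj_eq[OF p])
  next
    case (Cons a xs)
    have "ys \<noteq> []" using Cons.prems cd by (auto simp: e inj_eq[OF p])
    then obtain b zs where ys: "ys = b # zs" by (cases ys) auto
    then have ab: "a = b" and "e xs = e zs" using Cons.prems by (simp_all add: e inj_eq[OF p])
    from Cons.IH[OF this(2)] show ?case by (simp only: ys ab)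
  qed
  show ?thesis unfolding lepoll_def by (intro exI[of _ e] conjI injI inj) simp_all
qed

context universe
begin

section \<open>Tensoring with a bimodule as a k-linear functor\<close>

context
  fixes T U :: "('k, 'u) module" and X :: "('u, 'x) bimodule_scheme"
  assumes X: "bimod T U X"
begin

lemma Xlr: "left_module T X" "right_module U X"
  using X by (auto simp: bimod_def)

interpretation X: left_module T X by (rule Xlr)
interpretation XU: right_module U X by (rule Xlr)

lemma tensor_map_rhom:
  assumes "right_module T A" "right_module T B" "f \<in> rhom T A B"
  shows "rtensor_map T A X B X f (\<lambda>x. x) \<in> rhom U (rtensor T A X) (rtensor T B X)"
  unfolding rhom_iff
  using rtensor_map_extensional[OF assms(1) Xlr(1) assms(2) Xlr(1) rhom_rlin[OF assms(3)] llin_id]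
    rtensor_map_rlin[OF assms(1) Xlr(1) assms(2) Xlr(1) rhom_rlin[OF assms(3)] llin_id X X rlin_id] by blast

lemma tensor_map_pure:
  assumes "right_module T A" "right_module T B" "f \<in> rhom T A B" "a \<in> carrier A" "x \<in> carrier X"
  shows "rtensor_map T A X B X f (\<lambda>x. x) (rpure T A X a x) = rpure T B X (f a) x"
  using rtensor_map_pure[OF assms(1) Xlr(1) assms(2) Xlr(1) rhom_rlin[OF assms(3)] llin_id assms(4,5)] .

lemma tensor_rhom_eq:
  assumes "right_module T A" "h \<in> rhom U (rtensor T A X) N" "h' \<in> rhom U (rtensor T A X) N"
    and "\<And>a x. \<lbrakk>a \<in> carrier A; x \<in> carrier X\<rbrakk> \<Longrightarrow> h (rpure T A X a x) = h' (rpure T A X a x)"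
  shows "h = h'"
  by (rule rhom_ext[OF assms(2,3)], rule rt_hom_eq[OF assms(1) Xlr(1)])
    (use assms in \<open>auto simp: rhom_iff rlin_def\<close>)

lemma tensor_cat_functor: "cat_functor (RMod T) (RMod U) (tensor_ftor T X)"
proof -
  interpret dom: category "RMod T" by (rule category_RMod)
  interpret cod: category "RMod U" by (rule category_RMod)
  show ?thesis
  proof
    fix A assume "A \<in> Obj (RMod T)"
    then have A: "right_module T A" by simp
    show "fob (tensor_ftor T X) A \<in> Obj (RMod U)"
      by (simp add: rt_right_module[OF A Xlr(1) X])
    show "fhom (tensor_ftor T X) A A (Idn (RMod T) A) = Idn (RMod U) (fob (tensor_ftor T X) A)"
      by (rule tensor_rhom_eq[where N = "rtensor T A X", OF A])
        (simp_all add: tensor_map_rhom[OF A A] rhom_id[OF A] rhom_id[OF rt_right_module[OF A Xlr(1) X]]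
          tensor_map_pure[OF A A] rpure_closed[OF A Xlr(1)])
  next
    fix A B f assume "A \<in> Obj (RMod T)" "B \<in> Obj (RMod T)" "f \<in> Hom (RMod T) A B"
    then show "fhom (tensor_ftor T X) A B f \<in> Hom (RMod U) (fob (tensor_ftor T X) A) (fob (tensor_ftor T X) B)"
      by (simp add: tensor_map_rhom)
  next
    fix A B D f g assume "A \<in> Obj (RMod T)" "B \<in> Obj (RMod T)" "D \<in> Obj (RMod T)"
      "f \<in> Hom (RMod T) A B" "g \<in> Hom (RMod T) B D"
    then have A: "right_module T A" and B: "right_module T B" and D: "right_module T D"
      and f: "f \<in> rhom T A B" and g: "g \<in> rhom T B D" by auto
    have gf: "compose (carrier A) g f \<in> rhom T A D" by (rule rhom_compose[OF A f g])
    have "rtensor_map T A X D X (compose (carrier A) g f) (\<lambda>x. x) =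
      compose (carrier (rtensor T A X)) (rtensor_map T B X D X g (\<lambda>x. x)) (rtensor_map T A X B X f (\<lambda>x. x))"
    proof (rule tensor_rhom_eq[OF A tensor_map_rhom[OF A D gf]
          rhom_compose[OF rt_right_module[OF A Xlr(1) X] tensor_map_rhom[OF A B f] tensor_map_rhom[OF B D g]]])
      fix a x assume "a \<in> carrier A" "x \<in> carrier X"
      then show "rtensor_map T A X D X (compose (carrier A) g f) (\<lambda>x. x) (rpure T A X a x) =
        compose (carrier (rtensor T A X)) (rtensor_map T B X D X g (\<lambda>x. x)) (rtensor_map T A X B X f (\<lambda>x. x)) (rpure T A X a x)"
        by (simp add: compose_eq tensor_map_pure[OF A D gf] tensor_map_pure[OF A B f] tensor_map_pure[OF B D g]
            rpure_closed[OF A Xlr(1)] rlin_closed[OF rhom_rlin[OF f]])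
    qed
    then show "fhom (tensor_ftor T X) A D (Cmp (RMod T) A B D g f) =
      Cmp (RMod U) (fob (tensor_ftor T X) A) (fob (tensor_ftor T X) B) (fob (tensor_ftor T X) D)
        (fhom (tensor_ftor T X) B D g) (fhom (tensor_ftor T X) A B f)" by simp
  qed
qed

text \<open>A scalar acting on A crosses the tensor sign to X, where centrality turns it into the
  right action of S-type on the product, that is, of U.\<close>

lemma tensor_k_linear:
  assumes "k_algebra k T" "k_algebra k U"
    and central: "\<And>a x. \<lbrakk>a \<in> carrier k; x \<in> carrier X\<rbrakk> \<Longrightarrow> scal T a \<triangleright>\<^bsub>X\<^esub> x = x \<triangleleft>\<^bsub>X\<^esub> scal U a"
  shows "k_linear k T U (tensor_ftor T X)"
proof -
  interpret T: k_algebra k T by fact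
  interpret U: k_algebra k U by fact
  have scal: "scal T a \<in> carrier T" "scal U a \<in> carrier U" if "a \<in> carrier k" for a
    using that by (simp_all add: scal_def T.smult_closed U.smult_closed)
  show ?thesis
    unfolding k_linear_def RMod_simps mem_Collect_eq tensor_ftor_simps
  proof (intro ballI conjI)
    fix A B f g assume "A \<in> {M. right_module T M}" "B \<in> {M. right_module T M}"
      and f: "f \<in> rhom T A B" and g: "g \<in> rhom T A B"
    then have A: "right_module T A" and B: "right_module T B" by auto
    interpret B: right_module T B by fact
    note rm = rt_right_module[OF A Xlr(1) X] rt_right_module[OF B Xlr(1) X]
    have fg: "(\<lambda>a\<in>carrier A. f a \<oplus>\<^bsub>B\<^esub> g a) \<in> rhom T A B"
      using rhom_rlin[OF f] rhom_rlin[OF g]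
      by (intro rlin_restrict[OF A] rlinI additive_sum_maps B.M.abelian_group_axioms)
        (auto simp: rlin_additive rlin_ract B.ract_add rlin_closed)
    show "rtensor_map T A X B X (\<lambda>a\<in>carrier A. f a \<oplus>\<^bsub>B\<^esub> g a) (\<lambda>x. x) =
      (\<lambda>x\<in>carrier (rtensor T A X). rtensor_map T A X B X f (\<lambda>x. x) x \<oplus>\<^bsub>rtensor T B X\<^esub> rtensor_map T A X B X g (\<lambda>x. x) x)"
    proof (rule extensionalityI[of _ "carrier (rtensor T A X)"])
      fix z assume z: "z \<in> carrier (rtensor T A X)"
      have "rtensor_map T A X B X (\<lambda>a\<in>carrier A. f a \<oplus>\<^bsub>B\<^esub> g a) (\<lambda>x. x) z =
          rtensor_map T A X B X f (\<lambda>x. x) z \<oplus>\<^bsub>rtensor T B X\<^esub> rtensor_map T A X B X g (\<lambda>x. x) z"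
        by (rule rt_hom_eq[OF A Xlr(1) _ additive_sum_maps _ z])
          (use tensor_map_rhom[OF A B f] tensor_map_rhom[OF A B g] tensor_map_rhom[OF A B fg] rt_abelian[OF B Xlr(1)] in \<open>simp_all add: rlin_additive[OF rhom_rlin] rlin_closed[OF rhom_rlin[OF f]] rlin_closed[OF rhom_rlin[OF g]] del: restrict_apply
            add: tensor_map_pure[OF A B f] tensor_map_pure[OF A B g] tensor_map_pure[OF A B fg] restrict_apply' rpure_add[OF B Xlr(1)]\<close>)
      with z show "rtensor_map T A X B X (\<lambda>a\<in>carrier A. f a \<oplus>\<^bsub>B\<^esub> g a) (\<lambda>x. x) z =
        (\<lambda>x\<in>carrier (rtensor T A X). rtensor_map T A X B X f (\<lambda>x. x) x \<oplus>\<^bsub>rtensor T B X\<^esub> rtensor_map T A X B X g (\<lambda>x. x) x) z"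
        by simp
    qed (use tensor_map_rhom[OF A B fg] in \<open>simp_all add: rhom_iff\<close>)
  next
    fix A B f a assume "A \<in> {M. right_module T M}" "B \<in> {M. right_module T M}"
      and f: "f \<in> rhom T A B" and a: "a \<in> carrier k"
    then have A: "right_module T A" and B: "right_module T B" by auto
    interpret A: right_module T A by fact
    interpret B: right_module T B by fact
    have comm: "scal T a \<otimes>\<^bsub>T\<^esub> r = r \<otimes>\<^bsub>T\<^esub> scal T a" if "r \<in> carrier T" for r
      using a that by (simp add: scal_def T.smult_mult_left T.smult_mult_right)
    have fa: "(\<lambda>m\<in>carrier A. f m \<triangleleft>\<^bsub>B\<^esub> scal T a) \<in> rhom T A B"
      using rhom_rlin[OF f]
      by (intro rlin_restrict[OF A] rlinI additiveI)
        (use a scal in \<open>auto simp: rlin_additive rlin_ract rlin_add B.ract_add B.ract_closed rlin_closed comm B.ract_mult[symmetric]\<close>)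
    have sc: "additive (rtensor T B X) (rtensor T B X) (\<lambda>z. z \<triangleleft>\<^bsub>rtensor T B X\<^esub> scal U a)"
      using rt_ract_additive[OF B Xlr(1) X] scal a by blast
    show "rtensor_map T A X B X (\<lambda>m\<in>carrier A. f m \<triangleleft>\<^bsub>B\<^esub> scal T a) (\<lambda>x. x) =
      (\<lambda>x\<in>carrier (rtensor T A X). rtensor_map T A X B X f (\<lambda>x. x) x \<triangleleft>\<^bsub>rtensor T B X\<^esub> scal U a)"
    proof (rule extensionalityI[of _ "carrier (rtensor T A X)"])
      fix z assume z: "z \<in> carrier (rtensor T A X)"
      have "rtensor_map T A X B X (\<lambda>m\<in>carrier A. f m \<triangleleft>\<^bsub>B\<^esub> scal T a) (\<lambda>x. x) z =
          rtensor_map T A X B X f (\<lambda>x. x) z \<triangleleft>\<^bsub>rtensor T B X\<^esub> scal U a"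
        by (rule rt_hom_eq[OF A Xlr(1) _ additive_compose[OF _ sc] _ z])
          (use tensor_map_rhom[OF A B f] tensor_map_rhom[OF A B fa] a scal in \<open>simp_all add: rlin_additive[OF rhom_rlin]
              rlin_closed[OF rhom_rlin[OF f]] del: restrict_apply
            add: restrict_apply' tensor_map_pure[OF A B f] tensor_map_pure[OF A B fa] rpure_balanced[OF B Xlr(1)]
            rt_ract_pure[OF B Xlr(1) X] central\<close>)
      with z show "rtensor_map T A X B X (\<lambda>m\<in>carrier A. f m \<triangleleft>\<^bsub>B\<^esub> scal T a) (\<lambda>x. x) z =
        (\<lambda>x\<in>carrier (rtensor T A X). rtensor_map T A X B X f (\<lambda>x. x) x \<triangleleft>\<^bsub>rtensor T B X\<^esub> scal U a) z"
        by simp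
    qed (use tensor_map_rhom[OF A B fa] in \<open>simp_all add: rhom_iff\<close>)
  qed
qed

section \<open>Cocontinuity of tensoring with a bimodule\<close>

text \<open>The maps from \<^term>\<open>X\<close> to \<^term>\<open>N\<close> need not fit into the universe, but those which are finite
  sums of members of a small family, here of the maps $x \mapsto d_j(m \otimes x)$, do.  They form the
  module \<^term>\<open>P\<close>, whose elements are decoded by \<^term>\<open>ev\<close>.\<close>

definition curried where
  "curried N J D d P e ev \<longleftrightarrow> right_module T P \<and> (\<forall>j \<in> J. e j \<in> rhom T (D j) P) \<and>
     (\<forall>j \<in> J. \<forall>m \<in> carrier (D j). \<forall>x \<in> carrier X. ev (e j m) x = d j (rpure T (D j) X m x)) \<and>
     (\<forall>p \<in> carrier P. \<forall>q \<in> carrier P. (\<forall>x \<in> carrier X. ev p x = ev q x) \<longrightarrow> p = q) \<and>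
     (\<forall>(L :: 'u rmodule) g. right_module T L \<and> g \<in> rhom T L P \<longrightarrow>
       (\<exists>h \<in> rhom U (rtensor T L X) N. \<forall>l \<in> carrier L. \<forall>x \<in> carrier X. h (rpure T L X l x) = ev (g l) x))"

text \<open>A list of pairs (j, m) stands for the sum of the maps x -> d j (m \<otimes> x).
  Concatenating lists adds these maps, negating the entries m negates them, and letting r act on the
  entries amounts to composing with x -> r x, because the tensor products are balanced. So the
  represented maps form a right T-module, and it is small since lists are.\<close>

lemma tensor_curry:
  fixes N :: "('u, 'n) rmodule_scheme" and J :: "'u set" and D :: "'u \<Rightarrow> ('u, 'y) rmodule_scheme"
  assumes N: "right_module U N" and D: "\<And>j. j \<in> J \<Longrightarrow> right_module T (D j)"
    and d: "\<And>j. j \<in> J \<Longrightarrow> d j \<in> rhom U (rtensor T (D j) X) N"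
  shows "\<exists>(P :: 'u rmodule) e ev. curried N J D d P e ev"
proof -
  interpret N: right_module U N by (rule N)
  have Nab: "abelian_group N" by (rule N.M.abelian_group_axioms)
  note dl = rhom_rlin[OF d]
  define \<beta> where "\<beta> j m x = d j (rpure T (D j) X m x)" for j m x
  note p = rpure_closed[OF D Xlr(1)] rpure_add[OF D Xlr(1)]
  have \<beta>: "biadditive (D j) X N (\<beta> j)" if "j \<in> J" for j
    using that by (intro biadditiveI) (simp_all add: \<beta>_def rlin_closed[OF dl] rlin_add[OF dl] p)
  have bal: "\<beta> j (m \<triangleleft>\<^bsub>D j\<^esub> r) x = \<beta> j m (r \<triangleright>\<^bsub>X\<^esub> x)"
    if "j \<in> J" "m \<in> carrier (D j)" "r \<in> carrier T" "x \<in> carrier X" for j m r x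
    using that by (simp add: \<beta>_def rpure_balanced[OF D Xlr(1)])
  have lin: "\<beta> j m (x \<triangleleft>\<^bsub>X\<^esub> s) = \<beta> j m x \<triangleleft>\<^bsub>N\<^esub> s"
    if "j \<in> J" "m \<in> carrier (D j)" "x \<in> carrier X" "s \<in> carrier U" for j m x s
    using that by (simp add: \<beta>_def rt_ract_pure[OF D Xlr(1) X, symmetric] rlin_ract[OF dl] p)
  have neg: "\<beta> j (\<ominus>\<^bsub>D j\<^esub> m) x = \<ominus>\<^bsub>N\<^esub> \<beta> j m x" if "j \<in> J" "m \<in> carrier (D j)" "x \<in> carrier X" for j m x
    by (rule additive_a_inv[OF _ right_module_abelian[OF D[OF that(1)]] Nab that(2)])
      (use \<beta>[OF that(1)] that(3) in \<open>simp add: biadditive_def\<close>)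
  define I where "I = (SIGMA j:J. carrier (D j))"
  define H where "H xs x = foldr (\<lambda>(j, m) n. \<beta> j m x \<oplus>\<^bsub>N\<^esub> n) xs \<zero>\<^bsub>N\<^esub>" for xs x
  have H: "H [] x = \<zero>\<^bsub>N\<^esub>" "H ((j, m) # xs) x = \<beta> j m x \<oplus>\<^bsub>N\<^esub> H xs x" for j m xs x
    by (simp_all add: H_def)
  have I_D: "j \<in> J" "m \<in> carrier (D j)" if "(j, m) \<in> I" for j m using that by (auto simp: I_def)
  note I = I_D biadditive_closed[OF \<beta>]
  have Hc: "H xs x \<in> carrier N" if "set xs \<subseteq> I" "x \<in> carrier X" for xs x
    using that by (induction xs) (auto simp: H I)
  have H_append: "H (xs @ ys) x = H xs x \<oplus>\<^bsub>N\<^esub> H ys x" if "set xs \<subseteq> I" "set ys \<subseteq> I" "x \<in> carrier X" for xs ys x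
    using that by (induction xs) (auto simp: H I Hc N.M.a_assoc)
  have H_add: "H xs (x \<oplus>\<^bsub>X\<^esub> x') = H xs x \<oplus>\<^bsub>N\<^esub> H xs x'" if "set xs \<subseteq> I" "x \<in> carrier X" "x' \<in> carrier X" for xs x x'
    using that by (induction xs) (auto simp: H I Hc biadditive_add_right[OF \<beta>] N.M.a_ac)
  have zero: "\<zero>\<^bsub>N\<^esub> \<triangleleft>\<^bsub>N\<^esub> s = \<zero>\<^bsub>N\<^esub>" if "s \<in> carrier U" for s
    by (rule additive_zero[of N N "\<lambda>n. n \<triangleleft>\<^bsub>N\<^esub> s", OF additiveI Nab Nab]) (simp_all add: that N.ract_closed N.ract_add)
  have H_ract: "H xs (x \<triangleleft>\<^bsub>X\<^esub> s) = H xs x \<triangleleft>\<^bsub>N\<^esub> s" if "set xs \<subseteq> I" "x \<in> carrier X" "s \<in> carrier U" for xs x s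
    using that by (induction xs) (auto simp: H I Hc lin zero N.ract_add)
  let ?act = "\<lambda>r. map (\<lambda>(j, m). (j, m \<triangleleft>\<^bsub>D j\<^esub> r))" and ?neg = "map (\<lambda>(j, m). (j, \<ominus>\<^bsub>D j\<^esub> m))"
  have H_act: "set (?act r xs) \<subseteq> I \<and> (\<forall>x \<in> carrier X. H (?act r xs) x = H xs (r \<triangleright>\<^bsub>X\<^esub> x))"
    if "set xs \<subseteq> I" "r \<in> carrier T" for r xs
    using that by (induction xs) (auto simp: H bal I_def right_module.ract_closed[OF D])
  have minus_zero: "\<ominus>\<^bsub>N\<^esub> \<zero>\<^bsub>N\<^esub> = \<zero>\<^bsub>N\<^esub>" by (rule N.M.minus_equality) simp_all
  have H_neg: "set (?neg xs) \<subseteq> I \<and> (\<forall>x \<in> carrier X. H (?neg xs) x = \<ominus>\<^bsub>N\<^esub> H xs x)" if "set xs \<subseteq> I" for xs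
    using that by (induction xs)
      (auto simp: H neg minus_zero biadditive_closed[OF \<beta>] N.M.minus_add Hc I_def abelian_group.a_inv_closed[OF right_module_abelian[OF D]])
  define \<Phi> where "\<Phi> xs = (\<lambda>x \<in> carrier X. H xs x)" for xs
  \<comment> \<open>Only represented maps are coded, and there are at most as many of them as lists.
    The set of all linear maps from X to N might be too large for \<open>'u\<close>.\<close>
  have "\<Phi> ` {xs. set xs \<subseteq> I} \<lesssim> {xs. set xs \<subseteq> I}" by (rule image_lepoll)
  also have "{xs. set xs \<subseteq> I} \<lesssim> (UNIV :: ('u \<times> 'u) list set)" by (rule subset_imp_lepoll) simp
  also note lists_lepoll
  finally obtain \<epsilon> :: "('u \<Rightarrow> 'u) \<Rightarrow> 'u" where \<epsilon>: "inj_on \<epsilon> (\<Phi> ` {xs. set xs \<subseteq> I})" unfolding lepoll_def by blast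
  define ev where "ev = inv_into (\<Phi> ` {xs. set xs \<subseteq> I}) \<epsilon>"
  define \<phi> where "\<phi> xs = \<epsilon> (\<Phi> xs)" for xs
  have ev: "ev (\<phi> xs) x = H xs x" if "set xs \<subseteq> I" "x \<in> carrier X" for xs x
    using inv_into_f_f[OF \<epsilon>, of "\<Phi> xs"] that by (simp add: ev_def \<phi>_def \<Phi>_def)
  define P :: "'u rmodule" where "P = \<lparr>carrier = \<phi> ` {xs. set xs \<subseteq> I}, monoid.mult = undefined, one = undefined, ring.zero = \<phi> [],
    add = (\<lambda>p q. \<epsilon> (\<lambda>x \<in> carrier X. ev p x \<oplus>\<^bsub>N\<^esub> ev q x)), ract = (\<lambda>p r. \<epsilon> (\<lambda>x \<in> carrier X. ev p (r \<triangleright>\<^bsub>X\<^esub> x)))\<rparr>"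
  have P_E: "\<exists>xs. set xs \<subseteq> I \<and> p = \<phi> xs" if "p \<in> carrier P" for p
    using that by (auto simp: P_def)
  have P_I: "\<phi> xs \<in> carrier P" if "set xs \<subseteq> I" for xs using that by (auto simp: P_def)
  have P_add: "\<phi> xs \<oplus>\<^bsub>P\<^esub> \<phi> ys = \<phi> (xs @ ys)" if "set xs \<subseteq> I" "set ys \<subseteq> I" for xs ys
    unfolding P_def \<phi>_def[of "xs @ ys"] \<Phi>_def
    using that by (simp add: ev H_append cong: restrict_cong)
  have P_ract: "\<phi> xs \<triangleleft>\<^bsub>P\<^esub> r = \<phi> (?act r xs)" if "set xs \<subseteq> I" "r \<in> carrier T" for xs r
    unfolding P_def \<phi>_def[of "?act r xs"] \<Phi>_def
    using that H_act[OF that] by (simp add: ev X.lact_closed cong: restrict_cong)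
  \<comment> \<open>Elements of \<open>P\<close> are compared through their values, which reduces
    the module axioms for \<open>P\<close> to those for N and X.\<close>
  have inj: "p = q" if pq: "p \<in> carrier P" "q \<in> carrier P" "\<And>x. x \<in> carrier X \<Longrightarrow> ev p x = ev q x" for p q
  proof -
    obtain xs ys where *: "set xs \<subseteq> I" "p = \<phi> xs" "set ys \<subseteq> I" "q = \<phi> ys" using P_E[OF pq(1)] P_E[OF pq(2)] by blast
    then have "\<Phi> xs = \<Phi> ys" unfolding \<Phi>_def using pq(3) by (intro restrict_ext) (simp add: ev)
    then show ?thesis by (simp add: * \<phi>_def)
  qed
  have evP: "ev (p \<oplus>\<^bsub>P\<^esub> q) x = ev p x \<oplus>\<^bsub>N\<^esub> ev q x" "p \<oplus>\<^bsub>P\<^esub> q \<in> carrier P"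
    if "p \<in> carrier P" "q \<in> carrier P" "x \<in> carrier X" for p q x
    using P_E[OF that(1)] P_E[OF that(2)] that(3) by (auto simp: P_add ev H_append P_I)
  have evr: "ev (p \<triangleleft>\<^bsub>P\<^esub> r) x = ev p (r \<triangleright>\<^bsub>X\<^esub> x)" "p \<triangleleft>\<^bsub>P\<^esub> r \<in> carrier P"
    if "p \<in> carrier P" "r \<in> carrier T" "x \<in> carrier X" for p r x
    using P_E[OF that(1)] that(2,3) H_act[OF _ that(2)] by (auto simp: P_ract ev X.lact_closed P_I)
  have ev_lin: "rlin U X N (ev p)" if p: "p \<in> carrier P" for p
    using P_E[OF p] by (intro rlinI additiveI) (auto simp: ev Hc H_add H_ract XU.ract_closed)
  note evl = additive_closed[OF rlin_additive[OF ev_lin]] additive_add[OF rlin_additive[OF ev_lin]]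
  \<comment> \<open>Closure was stated together with evaluation at a point of X; zero is taken as
    that point.\<close>
  note cl = evP(2)[OF _ _ X.M.zero_closed] evr(2)[OF _ _ X.M.zero_closed]
  have z: "\<zero>\<^bsub>P\<^esub> = \<phi> []" by (simp add: P_def)
  interpret P: abelian_group P
  proof (rule abelian_groupI)
    fix p assume "p \<in> carrier P"
    then obtain xs where xs: "set xs \<subseteq> I" "p = \<phi> xs" using P_E by blast
    show "\<zero>\<^bsub>P\<^esub> \<oplus>\<^bsub>P\<^esub> p = p" using P_add[of "[]" xs] xs by (simp add: z)
    have n: "set (?neg xs) \<subseteq> I" "set (?neg xs @ xs) \<subseteq> I" using H_neg[OF xs(1)] xs(1) by simp_all
    have "\<phi> (?neg xs @ xs) = \<phi> []"
      by (rule inj) (use H_neg[OF xs(1)] xs(1) n in \<open>simp_all add: P_I ev H_append Hc H N.M.l_neg\<close>)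
    then show "\<exists>q\<in>carrier P. q \<oplus>\<^bsub>P\<^esub> p = \<zero>\<^bsub>P\<^esub>"
      using P_add[OF n(1) xs(1)] P_I[OF n(1)] by (auto simp: z xs(2))
  next
    fix p q assume pq: "p \<in> carrier P" "q \<in> carrier P"
    then show "p \<oplus>\<^bsub>P\<^esub> q = q \<oplus>\<^bsub>P\<^esub> p"
      by (intro inj[of "p \<oplus>\<^bsub>P\<^esub> q" "q \<oplus>\<^bsub>P\<^esub> p"]) (simp_all add: cl evP evl N.M.a_comm)
    fix r assume "r \<in> carrier P"
    with pq show "p \<oplus>\<^bsub>P\<^esub> q \<oplus>\<^bsub>P\<^esub> r = p \<oplus>\<^bsub>P\<^esub> (q \<oplus>\<^bsub>P\<^esub> r)"
      by (intro inj[of "p \<oplus>\<^bsub>P\<^esub> q \<oplus>\<^bsub>P\<^esub> r" "p \<oplus>\<^bsub>P\<^esub> (q \<oplus>\<^bsub>P\<^esub> r)"]) (simp_all add: cl evP evl N.M.a_assoc)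
    show "p \<oplus>\<^bsub>P\<^esub> q \<in> carrier P" by (rule cl(1)[OF pq])
  next
    show "\<zero>\<^bsub>P\<^esub> \<in> carrier P" unfolding z by (rule P_I) simp
  qed
  have P: "right_module T P"
    by unfold_locales
      (assumption | (rule inj)?; simp add: cl evP evr evl X.lact_closed X.lact_mult X.lact_one X.lact_add_scalar)+
  define e where "e j = (\<lambda>m \<in> carrier (D j). \<phi> [(j, m)])" for j
  have e_ev: "ev (e j m) x = \<beta> j m x" "e j m \<in> carrier P" if "j \<in> J" "m \<in> carrier (D j)" "x \<in> carrier X" for j m x
    using that by (simp_all add: e_def ev P_I I_def H biadditive_closed[OF \<beta>])
  note e_cl = e_ev(2)[OF _ _ X.M.zero_closed]
  have e: "e j \<in> rhom T (D j) P" if j: "j \<in> J" for j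
    unfolding rhom_iff
  proof (intro conjI rlinI additiveI)
    interpret Dj: right_module T "D j" by (rule D[OF j])
    show "e j \<in> extensional (carrier (D j))" by (simp add: e_def)
    fix m assume m: "m \<in> carrier (D j)"
    then show "e j m \<in> carrier P" using j by (simp add: e_cl)
    show "e j (m \<triangleleft>\<^bsub>D j\<^esub> r) = e j m \<triangleleft>\<^bsub>P\<^esub> r" if r: "r \<in> carrier T" for r
      by (rule inj) (use m r j in \<open>simp_all add: e_cl cl Dj.ract_closed e_ev(1) evr(1) X.lact_closed bal\<close>)
    show "e j (m \<oplus>\<^bsub>D j\<^esub> m') = e j m \<oplus>\<^bsub>P\<^esub> e j m'" if m': "m' \<in> carrier (D j)" for m'
      by (rule inj) (use m m' j in \<open>simp_all add: e_cl cl e_ev(1) evP(1) biadditive_add_left[OF \<beta>]\<close>)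
  qed
  have lift: "\<exists>h \<in> rhom U (rtensor T L X) N. \<forall>l \<in> carrier L. \<forall>x \<in> carrier X. h (rpure T L X l x) = ev (g l) x"
    if L: "right_module T L" and g: "g \<in> rhom T L P" for L :: "'u rmodule" and g
  proof -
    note gl = rhom_rlin[OF g]
    have f: "biadditive L X N (\<lambda>l x. ev (g l) x)"
      by (intro biadditiveI) (simp_all add: evl evP rlin_closed[OF gl] rlin_add[OF gl])
    have fb: "ev (g (l \<triangleleft>\<^bsub>L\<^esub> r)) x = ev (g l) (r \<triangleright>\<^bsub>X\<^esub> x)" if "l \<in> carrier L" "r \<in> carrier T" "x \<in> carrier X" for l r x
      using that by (simp add: rlin_ract[OF gl] evr rlin_closed[OF gl])
    let ?h = "rlift T L X N (\<lambda>l x. ev (g l) x)"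
    have hp: "\<lbrakk>l \<in> carrier L; x \<in> carrier X\<rbrakk> \<Longrightarrow> ?h (rpure T L X l x) = ev (g l) x" for l x
      by (rule rlift_pure[OF L Xlr(1) Nab f, OF fb])
    have "rlin U (rtensor T L X) N ?h"
      by (rule rt_rlin[OF L Xlr(1) X N rlift_additive[OF L Xlr(1) Nab f, OF fb]])
        (simp_all add: hp XU.ract_closed rlin_ract[OF ev_lin] rlin_closed[OF gl])
    moreover have "?h \<in> extensional (carrier (rtensor T L X))"
      by (rule rlift_extensional[OF L Xlr(1) Nab f, OF fb])
    ultimately show ?thesis using hp by (intro bexI[of _ ?h]) (simp_all add: rhom_iff)
  qed
  have "curried N J D d P e ev"
    unfolding curried_def
  proof (intro conjI ballI allI impI)
    show "ev (e j m) x = d j (rpure T (D j) X m x)" if "j \<in> J" "m \<in> carrier (D j)" "x \<in> carrier X" for j m x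
      using e_ev(1)[OF that] by (simp only: \<beta>_def)
    show "p = q" if "p \<in> carrier P" "q \<in> carrier P" "\<forall>x \<in> carrier X. ev p x = ev q x" for p q
      by (rule inj[OF that(1,2)]) (rule bspec[OF that(3)])
    show "\<exists>h \<in> rhom U (rtensor T L X) N. \<forall>l \<in> carrier L. \<forall>x \<in> carrier X. h (rpure T L X l x) = ev (g l) x"
      if "right_module T L \<and> g \<in> rhom T L P" for L :: "'u rmodule" and g
      using that by (intro lift) simp_all
  qed (rule P, rule e)
  then show ?thesis by blast
qed

text \<open>The module of \<open>tensor_curry\<close> stands in for Hom(X, N). A cocone on the
  tensored diagram becomes a cocone on the diagram itself, factors through L, and the factorization
  is uncurried.\<close>

lemma tensor_colimit:
  fixes J :: "('u, 'u) cat"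
  assumes J: "cat_functor J (RMod T) D" and col: "is_colimit J (RMod T) D L c"
  shows "is_colimit J (RMod U) (comp_ftor (tensor_ftor T X) D) (rtensor T L X)
    (\<lambda>j. rtensor_map T (fob D j) X L X (c j) (\<lambda>x. x))"
proof -
  interpret D: cat_functor J "RMod T" D by (rule J)
  have D: "right_module T (fob D j)" if "j \<in> Obj J" for j using D.fob_closed[OF that] by simp
  have L: "right_module T L" and c: "\<And>j. j \<in> Obj J \<Longrightarrow> c j \<in> rhom T (fob D j) L"
    and cc: "\<And>i j u. \<lbrakk>i \<in> Obj J; j \<in> Obj J; u \<in> Hom J i j\<rbrakk> \<Longrightarrow> compose (carrier (fob D i)) (c j) (fhom D i j u) = c i"
    using col by (auto simp: is_colimit_def cocone_def)
  have Du: "fhom D i j u \<in> rhom T (fob D i) (fob D j)" if "i \<in> Obj J" "j \<in> Obj J" "u \<in> Hom J i j" for i j u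
    using D.fhom_closed[OF that] by simp
  note c_cl = rlin_closed[OF rhom_rlin[OF c]]
  have LX: "right_module U (rtensor T L X)" by (rule rt_right_module[OF L Xlr(1) X])
  let ?c = "\<lambda>j. rtensor_map T (fob D j) X L X (c j) (\<lambda>x. x)"
  have cX: "?c j \<in> rhom U (rtensor T (fob D j) X) (rtensor T L X)" if "j \<in> Obj J" for j
    by (rule tensor_map_rhom[OF D[OF that] L c[OF that]])
  note DX = rt_right_module[OF D Xlr(1) X] and pD = rpure_closed[OF D Xlr(1)]
  interpret F: cat_functor "RMod T" "RMod U" "tensor_ftor T X" by (rule tensor_cat_functor)
  have cocone: "cocone J (RMod U) (comp_ftor (tensor_ftor T X) D) (rtensor T L X) ?c"
    unfolding cocone_def
  proof (intro conjI ballI)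
    fix i j u assume "i \<in> Obj J" "j \<in> Obj J" "u \<in> Hom J i j"
    then show "Cmp (RMod U) (fob (comp_ftor (tensor_ftor T X) D) i) (fob (comp_ftor (tensor_ftor T X) D) j)
        (rtensor T L X) (?c j) (fhom (comp_ftor (tensor_ftor T X) D) i j u) = ?c i"
      using F.fhom_Cmp[of "fob D i" "fob D j" L "fhom D i j u" "c j"] L D c Du by (simp add: cc)
  qed (use LX cX in simp_all)
  \<comment> \<open>The universal property of L with the cocone condition tested pointwise; it is
    applied once for existence and once for uniqueness.\<close>
  have univ: "\<exists>!h. h \<in> rhom T L P \<and> (\<forall>j\<in>Obj J. compose (carrier (fob D j)) h (c j) = e j)"
    if P: "right_module T P" and e: "\<And>j. j \<in> Obj J \<Longrightarrow> e j \<in> rhom T (fob D j) P"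
      and ee: "\<And>i j u m. \<lbrakk>i \<in> Obj J; j \<in> Obj J; u \<in> Hom J i j; m \<in> carrier (fob D i)\<rbrakk> \<Longrightarrow> e j (fhom D i j u m) = e i m"
    for P :: "'u rmodule" and e
  proof -
    have "compose (carrier (fob D i)) (e j) (fhom D i j u) = e i" if "i \<in> Obj J" "j \<in> Obj J" "u \<in> Hom J i j" for i j u
      by (rule rhom_ext[OF rhom_compose[OF D[OF that(1)] Du[OF that] e[OF that(2)]] e[OF that(1)]])
        (simp add: compose_eq ee[OF that])
    then have "cocone J (RMod T) D P e" unfolding cocone_def using P e by simp
    then show ?thesis using col unfolding is_colimit_def by simp
  qed
  show ?thesis
    unfolding is_colimit_def
  proof (intro conjI allI impI cocone ex_ex1I)
    fix N d assume "cocone J (RMod U) (comp_ftor (tensor_ftor T X) D) N d"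
    then have N: "right_module U N" and d: "\<And>j. j \<in> Obj J \<Longrightarrow> d j \<in> rhom U (rtensor T (fob D j) X) N"
      and dc: "\<And>i j u. \<lbrakk>i \<in> Obj J; j \<in> Obj J; u \<in> Hom J i j\<rbrakk> \<Longrightarrow>
        compose (carrier (rtensor T (fob D i) X)) (d j) (rtensor_map T (fob D i) X (fob D j) X (fhom D i j u) (\<lambda>x. x)) = d i"
      by (auto simp: cocone_def)
    have "\<exists>(P :: 'u rmodule) e ev. curried N (Obj J) (fob D) d P e ev" by (rule tensor_curry[OF N D d])
    then obtain P :: "'u rmodule" and e and ev :: "'u \<Rightarrow> 'u \<Rightarrow> 'u" where cur: "curried N (Obj J) (fob D) d P e ev" by blast
    then have P: "right_module T P"
      and e: "\<And>j. j \<in> Obj J \<Longrightarrow> e j \<in> rhom T (fob D j) P"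
      and ev_e: "\<And>j m x. \<lbrakk>j \<in> Obj J; m \<in> carrier (fob D j); x \<in> carrier X\<rbrakk> \<Longrightarrow> ev (e j m) x = d j (rpure T (fob D j) X m x)"
      and inj: "\<And>p q. \<lbrakk>p \<in> carrier P; q \<in> carrier P; \<And>x. x \<in> carrier X \<Longrightarrow> ev p x = ev q x\<rbrakk> \<Longrightarrow> p = q"
      by (simp_all add: curried_def)
    have eq: "e j (fhom D i j u m) = e i m"
      if i: "i \<in> Obj J" and j: "j \<in> Obj J" and u: "u \<in> Hom J i j" and m: "m \<in> carrier (fob D i)" for i j u m
    proof (rule inj)
      have um: "fhom D i j u m \<in> carrier (fob D j)" by (rule rlin_closed[OF rhom_rlin[OF Du[OF i j u]] m])
      then show "e j (fhom D i j u m) \<in> carrier P" "e i m \<in> carrier P"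
        using rlin_closed[OF rhom_rlin[OF e]] i j m by simp_all
      fix x assume x: "x \<in> carrier X"
      have "d i (rpure T (fob D i) X m x) = d j (rpure T (fob D j) X (fhom D i j u m) x)"
        unfolding dc[OF i j u, symmetric]
        using m x by (simp add: compose_eq pD[OF i] tensor_map_pure[OF D[OF i] D[OF j] Du[OF i j u]])
      then show "ev (e j (fhom D i j u m)) x = ev (e i m) x"
        using um m i j x by (simp add: ev_e)
    qed
    have "\<exists>!h. h \<in> rhom T L P \<and> (\<forall>j\<in>Obj J. compose (carrier (fob D j)) h (c j) = e j)"
    proof (rule univ[of P e])
      show "e j \<in> rhom T (fob D j) P" if "j \<in> Obj J" for j by (rule e[OF that])
      show "e j (fhom D i j u m) = e i m"
        if "i \<in> Obj J" "j \<in> Obj J" "u \<in> Hom J i j" "m \<in> carrier (fob D i)" for i j u m by (rule eq[OF that])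
    qed (rule P)
    then obtain g where g: "g \<in> rhom T L P"
      and gc: "\<And>j. j \<in> Obj J \<Longrightarrow> compose (carrier (fob D j)) g (c j) = e j" by blast
    obtain h where h: "h \<in> rhom U (rtensor T L X) N"
      and hp: "\<And>l x. \<lbrakk>l \<in> carrier L; x \<in> carrier X\<rbrakk> \<Longrightarrow> h (rpure T L X l x) = ev (g l) x"
      using cur[unfolded curried_def, THEN conjunct2, THEN conjunct2, THEN conjunct2, THEN conjunct2, rule_format, OF conjI, OF L g] by blast
    have "compose (carrier (rtensor T (fob D j) X)) h (?c j) = d j" if j: "j \<in> Obj J" for j
    proof (rule tensor_rhom_eq[OF D[OF j] rhom_compose[OF DX[OF j] cX[OF j] h] d[OF j]])
      fix m x assume m: "m \<in> carrier (fob D j)" and x: "x \<in> carrier X"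
      have "g (c j m) = e j m" using fun_cong[OF gc[OF j], of m] m by (simp add: compose_eq)
      then show "compose (carrier (rtensor T (fob D j) X)) h (?c j) (rpure T (fob D j) X m x) = d j (rpure T (fob D j) X m x)"
        using m x j by (simp add: compose_eq pD tensor_map_pure[OF D[OF j] L c[OF j]] hp c_cl ev_e)
    qed
    with h show "\<exists>h. h \<in> Hom (RMod U) (rtensor T L X) N \<and> (\<forall>j\<in>Obj J. Cmp (RMod U) (fob (comp_ftor (tensor_ftor T X) D) j) (rtensor T L X) N h (?c j) = d j)"
      by (intro exI[of _ h]) simp
  next
    fix N d h h' assume "cocone J (RMod U) (comp_ftor (tensor_ftor T X) D) N d"
    then have N: "right_module U N" by (simp add: cocone_def)
    assume "h \<in> Hom (RMod U) (rtensor T L X) N \<and>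
          (\<forall>j\<in>Obj J. Cmp (RMod U) (fob (comp_ftor (tensor_ftor T X) D) j) (rtensor T L X) N h (?c j) = d j)"
      and "h' \<in> Hom (RMod U) (rtensor T L X) N \<and>
          (\<forall>j\<in>Obj J. Cmp (RMod U) (fob (comp_ftor (tensor_ftor T X) D) j) (rtensor T L X) N h' (?c j) = d j)"
    then have h: "h \<in> rhom U (rtensor T L X) N" and h': "h' \<in> rhom U (rtensor T L X) N"
      and hh': "\<And>j. j \<in> Obj J \<Longrightarrow> compose (carrier (rtensor T (fob D j) X)) h (?c j) = compose (carrier (rtensor T (fob D j) X)) h' (?c j)"
      by auto
    have hpc: "h (rpure T L X (c j m) x) = h' (rpure T L X (c j m) x)"
      if j: "j \<in> Obj J" and "m \<in> carrier (fob D j)" "x \<in> carrier X" for j m x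
      using fun_cong[OF hh'[OF j], of "rpure T (fob D j) X m x"] that
      by (simp add: compose_eq pD tensor_map_pure[OF D[OF j] L c[OF j]])
    \<comment> \<open>To compare \<open>h\<close> and \<open>h'\<close> they must be curried into
      the same module, so they are made members of one family indexed by \<open>'u\<close>:
      \<open>h\<close> at the index \<open>a\<close>, \<open>h'\<close> at every other.\<close>
    obtain a b :: 'u where ab: "a \<noteq> b" by (rule two_elements)
    let ?d = "\<lambda>j. if j = a then h else h'"
    have d: "?d j \<in> rhom U (rtensor T L X) N" for j using h h' by simp
    have "\<exists>(P :: 'u rmodule) e ev. curried N UNIV (\<lambda>_. L) ?d P e ev" by (rule tensor_curry[OF N L d])
    then obtain P :: "'u rmodule" and e and ev :: "'u \<Rightarrow> 'u \<Rightarrow> 'u" where "curried N UNIV (\<lambda>_. L) ?d P e ev" by blast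
    then have P: "right_module T P" and e: "\<And>j. e j \<in> rhom T L P"
      and ev_e: "\<And>j m x. \<lbrakk>m \<in> carrier L; x \<in> carrier X\<rbrakk> \<Longrightarrow> ev (e j m) x = ?d j (rpure T L X m x)"
      and inj: "\<And>p q. \<lbrakk>p \<in> carrier P; q \<in> carrier P; \<And>x. x \<in> carrier X \<Longrightarrow> ev p x = ev q x\<rbrakk> \<Longrightarrow> p = q"
      by (simp_all add: curried_def del: if_split)
    note e_cl = rlin_closed[OF rhom_rlin[OF e]]
    have eq: "e a (c j m) = e b (c j m)" if "j \<in> Obj J" "m \<in> carrier (fob D j)" for j m
      by (rule inj) (use that ab in \<open>simp_all add: e_cl c_cl ev_e hpc\<close>)
    \<comment> \<open>The curried maps \<open>e a\<close> and \<open>e b\<close> restrict to the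
      same cocone, so uniqueness at L identifies them.\<close>
    have "\<exists>!g. g \<in> rhom T L P \<and> (\<forall>j\<in>Obj J. compose (carrier (fob D j)) g (c j) = compose (carrier (fob D j)) (e b) (c j))"
    proof (rule univ[of P "\<lambda>j. compose (carrier (fob D j)) (e b) (c j)"])
      show "compose (carrier (fob D j)) (e b) (c j) \<in> rhom T (fob D j) P" if "j \<in> Obj J" for j
        by (rule rhom_compose[OF D[OF that] c[OF that] e])
    next
      fix i j u m assume *: "i \<in> Obj J" "j \<in> Obj J" "u \<in> Hom J i j" and m: "m \<in> carrier (fob D i)"
      then show "compose (carrier (fob D j)) (e b) (c j) (fhom D i j u m) = compose (carrier (fob D i)) (e b) (c i) m"
        using fun_cong[OF cc[OF *], of m] rlin_closed[OF rhom_rlin[OF Du[OF *]] m] by (simp add: compose_eq)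
    qed (rule P)
    moreover have "compose (carrier (fob D j)) (e a) (c j) = compose (carrier (fob D j)) (e b) (c j)" if "j \<in> Obj J" for j
      by (rule rhom_ext[OF rhom_compose[OF D[OF that] c[OF that] e] rhom_compose[OF D[OF that] c[OF that] e]])
        (simp add: compose_eq eq[OF that])
    ultimately have ee: "e a = e b" using e by blast
    show "h = h'"
      by (rule tensor_rhom_eq[OF L h h']) (use ev_e[of _ _ a] ev_e[of _ _ b] ab in \<open>simp add: ee\<close>)
  qed
qed

end

end

section \<open>The Eilenberg-Watts presentation\<close>

definition iota :: "('k, 'u) module \<Rightarrow> ('u, 'm) rmodule_scheme \<Rightarrow> 'u \<Rightarrow> 'u \<Rightarrow> 'u" where
  "iota U A a = (\<lambda>r \<in> carrier U. a \<triangleleft>\<^bsub>A\<^esub> r)"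

lemma iota_rhom:
  assumes "right_module U A" "a \<in> carrier A"
  shows "iota U A a \<in> rhom U (regular_rmodule U) A"
proof -
  interpret right_module U A by fact
  show ?thesis
    unfolding iota_def regular_rmodule_simps(1)[of U, symmetric]
    by (intro rlin_restrict regular_right_module rlinI additiveI)
      (simp_all add: assms(2) ract_closed ract_add_scalar ract_mult R.ring_axioms)
qed

lemma rhom_iota:
  assumes "right_module U A" "right_module U B" "f \<in> rhom U A B" "a \<in> carrier A"
  shows "compose (carrier (regular_rmodule U)) f (iota U A a) = iota U B (f a)"
  using rlin_ract[OF rhom_rlin[OF assms(3)] assms(4)]
  by (auto simp: compose_def iota_def restrict_def fun_eq_iff)

lemma iota_one:
  assumes "ring U" shows "iota U (regular_rmodule U) \<one>\<^bsub>U\<^esub> = (\<lambda>r \<in> carrier (regular_rmodule U). r)"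
proof -
  interpret ring U by fact
  show ?thesis by (auto simp: iota_def restrict_def fun_eq_iff)
qed

text \<open>Pairs are coded into \<open>'u\<close> so that R^2 is a module of the universe and pairs
  of elements can index a small diagram.\<close>

definition pair_code :: "'u \<times> 'u \<Rightarrow> 'u" where "pair_code = (SOME e. inj e)"
definition fst2 :: "'u \<Rightarrow> 'u" where "fst2 x = fst (inv_into UNIV pair_code x)"
definition snd2 :: "'u \<Rightarrow> 'u" where "snd2 x = snd (inv_into UNIV pair_code x)"

lemma (in universe) pair_code_inj: "inj (pair_code :: 'u \<times> 'u \<Rightarrow> 'u)"
proof -
  have "\<exists>e :: 'u \<times> 'u \<Rightarrow> 'u. inj e"
    using pairs_eqpoll unfolding eqpoll_def bij_betw_def by blast
  then show ?thesis unfolding pair_code_def by (rule someI_ex)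
qed

lemma (in universe) pair_code [simp]:
  "fst2 (pair_code (a, b)) = (a :: 'u)" "snd2 (pair_code (a, b)) = (b :: 'u)"
  "pair_code (a, b) = (pair_code (c, d) :: 'u) \<longleftrightarrow> a = c \<and> b = d"
  using inj_eq[OF pair_code_inj, of "(a, b)" "(c, d)"] by (simp_all add: fst2_def snd2_def inv_f_f[OF pair_code_inj])

definition free2 :: "('k, 'u) module \<Rightarrow> 'u rmodule" where
  "free2 U = \<lparr>carrier = pair_code ` (carrier U \<times> carrier U), monoid.mult = undefined, one = undefined,
     ring.zero = pair_code (\<zero>\<^bsub>U\<^esub>, \<zero>\<^bsub>U\<^esub>),
     add = (\<lambda>x y. pair_code (fst2 x \<oplus>\<^bsub>U\<^esub> fst2 y, snd2 x \<oplus>\<^bsub>U\<^esub> snd2 y)),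
     ract = (\<lambda>x r. pair_code (fst2 x \<otimes>\<^bsub>U\<^esub> r, snd2 x \<otimes>\<^bsub>U\<^esub> r))\<rparr>"

lemma free2_simps [simp]:
  "carrier (free2 U) = pair_code ` (carrier U \<times> carrier U)"
  "\<zero>\<^bsub>free2 U\<^esub> = pair_code (\<zero>\<^bsub>U\<^esub>, \<zero>\<^bsub>U\<^esub>)"
  "x \<oplus>\<^bsub>free2 U\<^esub> y = pair_code (fst2 x \<oplus>\<^bsub>U\<^esub> fst2 y, snd2 x \<oplus>\<^bsub>U\<^esub> snd2 y)"
  "x \<triangleleft>\<^bsub>free2 U\<^esub> r = pair_code (fst2 x \<otimes>\<^bsub>U\<^esub> r, snd2 x \<otimes>\<^bsub>U\<^esub> r)"
  by (simp_all add: free2_def)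

text \<open>The map R^2 -> A given by the row of two elements of A that j codes. These maps are the
  legs of the colimit cocone on A.\<close>

definition col :: "('k, 'u) module \<Rightarrow> ('u, 'm) rmodule_scheme \<Rightarrow> 'u \<Rightarrow> 'u \<Rightarrow> 'u" where
  "col U A j = (\<lambda>z \<in> carrier (free2 U). fst2 j \<triangleleft>\<^bsub>A\<^esub> fst2 z \<oplus>\<^bsub>A\<^esub> snd2 j \<triangleleft>\<^bsub>A\<^esub> snd2 z)"

section \<open>Maps out of the free module of rank two\<close>

locale two_algebras = universe "TYPE('u)" + R: k_algebra k R + S: k_algebra k S
  for k :: "'k ring" and R S :: "('k, 'u) module"
begin

abbreviation "Reg \<equiv> regular_rmodule R"
abbreviation "R2 \<equiv> free2 R"
abbreviation "e1 \<equiv> pair_code (\<one>\<^bsub>R\<^esub>, \<zero>\<^bsub>R\<^esub>)"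
abbreviation "e2 \<equiv> pair_code (\<zero>\<^bsub>R\<^esub>, \<one>\<^bsub>R\<^esub>)"

lemma Reg: "right_module R Reg"
  by (rule regular_right_module) (rule R.ring_axioms)

lemma R2: "right_module R R2"
proof -
  interpret M: abelian_group R2
  proof (rule abelian_groupI)
    fix x assume "x \<in> carrier R2"
    then show "\<exists>y\<in>carrier R2. y \<oplus>\<^bsub>R2\<^esub> x = \<zero>\<^bsub>R2\<^esub>"
      by (intro bexI[of _ "pair_code (\<ominus>\<^bsub>R\<^esub> fst2 x, \<ominus>\<^bsub>R\<^esub> snd2 x)"]) (auto simp: R.l_neg)
  qed (auto simp: R.a_ac)
  show ?thesis
    by unfold_locales (auto simp: R.l_distr R.r_distr R.m_assoc)
qed

lemma e12: "e1 \<in> carrier R2" "e2 \<in> carrier R2" "fst2 e1 = \<one>\<^bsub>R\<^esub>" "snd2 e1 = \<zero>\<^bsub>R\<^esub>" "fst2 e2 = \<zero>\<^bsub>R\<^esub>" "snd2 e2 = \<one>\<^bsub>R\<^esub>"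
  by auto

lemma ract_zero_right:
  assumes "right_module R A" "a \<in> carrier A" shows "a \<triangleleft>\<^bsub>A\<^esub> \<zero>\<^bsub>R\<^esub> = \<zero>\<^bsub>A\<^esub>"
proof -
  interpret A: right_module R A by fact
  show ?thesis
    by (rule additive_zero[of R A "\<lambda>r. a \<triangleleft>\<^bsub>A\<^esub> r"])
      (use assms(2) in \<open>auto intro!: additiveI A.M.abelian_group_axioms R.abelian_group_axioms simp: A.ract_closed A.ract_add_scalar\<close>)
qed

context
  fixes A :: "('u, 'm) rmodule_scheme"
  assumes A: "right_module R A"
begin

interpretation A: right_module R A by (rule A)

lemma col_rhom:
  assumes "a \<in> carrier A" "b \<in> carrier A"
  shows "col R A (pair_code (a, b)) \<in> rhom R R2 A"
  unfolding col_def
  by (intro rlin_restrict R2 rlinI additiveI)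
    (use assms in \<open>auto simp: A.ract_closed A.ract_add_scalar A.ract_mult A.ract_add A.M.a_ac\<close>)

lemma col_e:
  assumes "a \<in> carrier A" "b \<in> carrier A"
  shows "col R A (pair_code (a, b)) e1 = a" "col R A (pair_code (a, b)) e2 = b"
  using assms by (simp_all add: col_def e12 A.ract_one ract_zero_right[OF A] image_iff del: free2_simps)

lemma rhom_R2:
  assumes f: "f \<in> rhom R R2 A" and z: "z \<in> carrier R2"
  shows "f z = f e1 \<triangleleft>\<^bsub>A\<^esub> fst2 z \<oplus>\<^bsub>A\<^esub> f e2 \<triangleleft>\<^bsub>A\<^esub> snd2 z"
proof -
  interpret F: right_module R R2 by (rule R2)
  note fl = rhom_rlin[OF f]
  obtain a b where ab: "z = pair_code (a, b)" "a \<in> carrier R" "b \<in> carrier R" using z by auto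
  then have "z = (e1 \<triangleleft>\<^bsub>R2\<^esub> a) \<oplus>\<^bsub>R2\<^esub> (e2 \<triangleleft>\<^bsub>R2\<^esub> b)" by simp
  also have "f \<dots> = f (e1 \<triangleleft>\<^bsub>R2\<^esub> a) \<oplus>\<^bsub>A\<^esub> f (e2 \<triangleleft>\<^bsub>R2\<^esub> b)"
    by (rule rlin_add[OF fl]) (intro F.ract_closed ab e12)+
  also have "\<dots> = f e1 \<triangleleft>\<^bsub>A\<^esub> a \<oplus>\<^bsub>A\<^esub> f e2 \<triangleleft>\<^bsub>A\<^esub> b"
    using rlin_ract[OF fl] e12 ab by (simp del: free2_simps)
  finally show ?thesis using ab by simp
qed

lemma rhom_R2_ext:
  assumes "f \<in> rhom R R2 A" "g \<in> rhom R R2 A" "f e1 = g e1" "f e2 = g e2"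
  shows "f = g"
  by (rule rhom_ext[OF assms(1,2)]) (simp only: rhom_R2[OF assms(1)] rhom_R2[OF assms(2)] assms)

end

section \<open>Modules as small colimits of free modules of rank two\<close>

text \<open>The elements of a module \<^term>\<open>A\<close>, taken in pairs, form a diagram of copies of the free module of
  rank two.  Rank two is needed for cocones to be additive.\<close>

definition elems_cat :: "('u, 'm) rmodule_scheme \<Rightarrow> (('u \<Rightarrow> 'u) \<Rightarrow> 'u) \<Rightarrow> ('u, 'u) cat" where
  "elems_cat A \<epsilon> = \<lparr>Obj = pair_code ` (carrier A \<times> carrier A),
     Hom = (\<lambda>i j. \<epsilon> ` {f \<in> rhom R R2 R2. compose (carrier R2) (col R A j) f = col R A i}),
     Idn = (\<lambda>j. \<epsilon> (\<lambda>z \<in> carrier R2. z)),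
     Cmp = (\<lambda>i j l g f. \<epsilon> (compose (carrier R2) (inv_into (rhom R R2 R2) \<epsilon> g) (inv_into (rhom R R2 R2) \<epsilon> f)))\<rparr>"

definition elems_diagram :: "(('u \<Rightarrow> 'u) \<Rightarrow> 'u) \<Rightarrow> ('u, 'u, 'u rmodule, 'u \<Rightarrow> 'u) ftor" where
  "elems_diagram \<epsilon> = \<lparr>fob = (\<lambda>j. R2), fhom = (\<lambda>i j. inv_into (rhom R R2 R2) \<epsilon>)\<rparr>"

lemma elems_simps [simp]:
  "Obj (elems_cat A \<epsilon>) = pair_code ` (carrier A \<times> carrier A)" "fob (elems_diagram \<epsilon>) j = R2"
  by (simp_all add: elems_cat_def elems_diagram_def)

text \<open>A linear map out of R^2 is determined by the images of the two basis vectors. Hence the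
  endomorphisms of R^2 embed in \<open>'u\<close>, as the smallness of the diagram requires.\<close>

definition rank2_code :: "('u \<Rightarrow> 'u) \<Rightarrow> 'u" where
  "rank2_code f = pair_code (f e1, f e2)"

lemma rank2_code_inj: "inj_on rank2_code (rhom R R2 R2)"
  unfolding rank2_code_def by (rule inj_onI) (simp add: rhom_R2_ext[OF R2])

lemma decode: "f \<in> rhom R R2 R2 \<Longrightarrow> inv_into (rhom R R2 R2) rank2_code (rank2_code f) = f"
  by (rule inv_into_f_f[OF rank2_code_inj])

context
  fixes A :: "'u rmodule"
  assumes A: "right_module R A"
begin

interpretation A: right_module R A by (rule A)

text \<open>Decoding undoes coding on linear endomorphisms of R^2, so the laws of the index category
  and of the functor both come from composition in \<open>RMod R\<close>.\<close>

lemma elems_diagram_functor: "cat_functor (elems_cat A rank2_code) (RMod R) (elems_diagram rank2_code)"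
proof -
  interpret cod: category "RMod R" by (rule category_RMod)
  have ass: "compose (carrier R2) (compose (carrier R2) h g) f = compose (carrier R2) h (compose (carrier R2) g f)"
    if "f \<in> rhom R R2 R2" "g \<in> rhom R R2 R2" "h \<in> rhom R R2 M" "right_module R M" for f g h and M :: "'u rmodule"
    using cod.Cmp_assoc[of R2 R2 R2 M f g h] that R2 by simp
  have idl: "compose (carrier R2) (\<lambda>z \<in> carrier R2. z) f = f" if "f \<in> rhom R R2 R2" for f
    using cod.Cmp_Idn_left[of R2 R2 f] that R2 by simp
  have idr: "compose (carrier R2) f (\<lambda>z \<in> carrier R2. z) = f" if "f \<in> rhom R R2 M" "right_module R M" for f and M :: "'u rmodule"
    using cod.Cmp_Idn_right[of R2 M f] that R2 by simp
  have colA: "col R A j \<in> rhom R R2 A" if "j \<in> pair_code ` (carrier A \<times> carrier A)" for j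
    using that col_rhom[OF A] by auto
  note comp = rhom_compose[OF R2]
  show ?thesis
  proof
    fix w x y z f g h assume "w \<in> Obj (elems_cat A rank2_code)" "x \<in> Obj (elems_cat A rank2_code)"
      "y \<in> Obj (elems_cat A rank2_code)" "z \<in> Obj (elems_cat A rank2_code)"
      "f \<in> Hom (elems_cat A rank2_code) w x" "g \<in> Hom (elems_cat A rank2_code) x y" "h \<in> Hom (elems_cat A rank2_code) y z"
    then show "Cmp (elems_cat A rank2_code) w x z (Cmp (elems_cat A rank2_code) x y z h g) f =
      Cmp (elems_cat A rank2_code) w y z h (Cmp (elems_cat A rank2_code) w x y g f)"
      by (auto simp: elems_cat_def decode comp ass[OF _ _ _ R2] simp del: free2_simps)
  next
    fix x y z f g assume "x \<in> Obj (elems_cat A rank2_code)"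
      "y \<in> Obj (elems_cat A rank2_code)" "z \<in> Obj (elems_cat A rank2_code)"
      "f \<in> Hom (elems_cat A rank2_code) x y" "g \<in> Hom (elems_cat A rank2_code) y z"
    then show "Cmp (elems_cat A rank2_code) x y z g f \<in> Hom (elems_cat A rank2_code) x z"
      and "fhom (elems_diagram rank2_code) x z (Cmp (elems_cat A rank2_code) x y z g f) =
       Cmp (RMod R) (fob (elems_diagram rank2_code) x) (fob (elems_diagram rank2_code) y)
          (fob (elems_diagram rank2_code) z) (fhom (elems_diagram rank2_code) y z g) (fhom (elems_diagram rank2_code) x y f)"
      by (auto simp: elems_cat_def elems_diagram_def decode comp ass[OF _ _ colA A, symmetric]
          simp del: free2_simps intro!: imageI)
  qed (auto simp: elems_cat_def elems_diagram_def decode comp rhom_id[OF R2] idl idr[OF _ R2] idr[OF _ A] R2 colA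
      simp del: free2_simps intro!: imageI)
qed

text \<open>The factorization of a cocone \<open>d\<close> must send a to the value of the leg at
  (a, 0) on the first basis vector. Compatibility with the transition maps recovers all legs from
  these values.\<close>

lemma elems_colimit:
  "is_colimit (elems_cat A rank2_code) (RMod R) (elems_diagram rank2_code) A (col R A)"
proof -
  let ?J = "elems_cat A rank2_code" and ?D = "elems_diagram rank2_code"
  have cocone: "cocone ?J (RMod R) ?D A (col R A)"
    unfolding cocone_def
    by (auto simp: A elems_cat_def elems_diagram_def decode simp del: free2_simps intro: col_rhom[OF A])
  show ?thesis
    unfolding is_colimit_def
  proof (intro conjI allI impI cocone)
    fix N d assume "cocone ?J (RMod R) ?D N d"
    then have N: "right_module R N" and d: "\<And>a b. \<lbrakk>a \<in> carrier A; b \<in> carrier A\<rbrakk> \<Longrightarrow> d (pair_code (a, b)) \<in> rhom R R2 N"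
      and dc: "\<And>a b a' b' f. \<lbrakk>a \<in> carrier A; b \<in> carrier A; a' \<in> carrier A; b' \<in> carrier A; f \<in> rhom R R2 R2;
        compose (carrier R2) (col R A (pair_code (a', b'))) f = col R A (pair_code (a, b))\<rbrakk>
        \<Longrightarrow> compose (carrier R2) (d (pair_code (a', b'))) f = d (pair_code (a, b))"
      by (auto simp: cocone_def elems_cat_def elems_diagram_def decode simp del: free2_simps)
    define \<phi> where "\<phi> = (\<lambda>a \<in> carrier A. d (pair_code (a, \<zero>\<^bsub>A\<^esub>)) e1)"
    interpret F: right_module R R2 by (rule R2)
    \<comment> \<open>The matrix \<open>?f\<close> with columns z and 0 is a transition map from the
      index consisting of the image of z and zero to the index (a, b); the cocone condition for it,
      evaluated at \<open>e1\<close>, is the claim.\<close>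
    have key: "\<phi> (col R A (pair_code (a, b)) z) = d (pair_code (a, b)) z"
      if ab: "a \<in> carrier A" "b \<in> carrier A" and z: "z \<in> carrier R2" for a b z
    proof -
      let ?f = "col R R2 (pair_code (z, \<zero>\<^bsub>R2\<^esub>))"
      note cl = rhom_rlin[OF col_rhom[OF A ab]]
      have z0: "\<zero>\<^bsub>R2\<^esub> \<in> carrier R2" by (rule F.M.zero_closed)
      have f: "?f \<in> rhom R R2 R2" by (rule col_rhom[OF R2 z z0])
      have c0: "col R A (pair_code (a, b)) \<zero>\<^bsub>R2\<^esub> = \<zero>\<^bsub>A\<^esub>"
        by (rule additive_zero[OF rlin_additive[OF cl] F.M.abelian_group_axioms A.M.abelian_group_axioms])
      have cz: "col R A (pair_code (a, b)) z \<in> carrier A" by (rule rlin_closed[OF cl z])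
      have "compose (carrier R2) (col R A (pair_code (a, b))) ?f = col R A (pair_code (col R A (pair_code (a, b)) z, \<zero>\<^bsub>A\<^esub>))"
        by (rule rhom_R2_ext[OF A rhom_compose[OF R2 f col_rhom[OF A ab]] col_rhom[OF A cz A.M.zero_closed]])
          (simp_all only: compose_eq[OF e12(1)] compose_eq[OF e12(2)] col_e[OF R2 z z0] col_e[OF A cz A.M.zero_closed] c0)
      from dc[OF cz A.M.zero_closed ab f this]
      have "d (pair_code (col R A (pair_code (a, b)) z, \<zero>\<^bsub>A\<^esub>)) e1 = d (pair_code (a, b)) (?f e1)"
        using compose_eq[OF e12(1)] by metis
      then show ?thesis using cz col_e[OF R2 z z0] by (simp add: \<phi>_def del: free2_simps)
    qed
    have \<phi>: "\<phi> \<in> rhom R A N"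
      unfolding \<phi>_def
    proof (intro rlin_restrict A rlinI additiveI)
      fix a assume a: "a \<in> carrier A"
      note d0 = rhom_rlin[OF d[OF a A.M.zero_closed]]
      show "d (pair_code (a, \<zero>\<^bsub>A\<^esub>)) e1 \<in> carrier N"
        by (rule rlin_closed[OF d0 e12(1)])
      fix r assume r: "r \<in> carrier R"
      have er: "e1 \<triangleleft>\<^bsub>R2\<^esub> r \<in> carrier R2" by (rule F.ract_closed[OF e12(1) r])
      have "col R A (pair_code (a, \<zero>\<^bsub>A\<^esub>)) (e1 \<triangleleft>\<^bsub>R2\<^esub> r) = a \<triangleleft>\<^bsub>A\<^esub> r"
        using rlin_ract[OF rhom_rlin[OF col_rhom[OF A a A.M.zero_closed]] e12(1) r] by (simp only: col_e[OF A a A.M.zero_closed])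
      with key[OF a A.M.zero_closed er] show "d (pair_code (a \<triangleleft>\<^bsub>A\<^esub> r, \<zero>\<^bsub>A\<^esub>)) e1 = d (pair_code (a, \<zero>\<^bsub>A\<^esub>)) e1 \<triangleleft>\<^bsub>N\<^esub> r"
        using A.ract_closed[OF a r] rlin_ract[OF d0 e12(1) r] by (simp add: \<phi>_def del: free2_simps)
    next
      fix a b assume a: "a \<in> carrier A" and b: "b \<in> carrier A"
      note dl = rhom_rlin[OF d[OF a b]] and cl = rhom_rlin[OF col_rhom[OF A a b]]
      \<comment> \<open>Since a and b are the images of \<open>e1\<close> and \<open>e2\<close>
        under a single leg, linearity of \<open>d\<close> at (a, b) yields additivity of
        \<open>\<phi>\<close>.\<close>
      have 1: "\<phi> a = d (pair_code (a, b)) e1" "\<phi> b = d (pair_code (a, b)) e2"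
        using key[OF a b e12(1)] key[OF a b e12(2)] by (simp_all only: col_e[OF A a b])
      have "\<phi> (a \<oplus>\<^bsub>A\<^esub> b) = d (pair_code (a, b)) (e1 \<oplus>\<^bsub>R2\<^esub> e2)"
        using key[OF a b F.M.a_closed[OF e12(1,2)]] by (simp only: rlin_add[OF cl e12(1,2)] col_e[OF A a b])
      also have "\<dots> = \<phi> a \<oplus>\<^bsub>N\<^esub> \<phi> b" by (simp only: 1 rlin_add[OF dl e12(1,2)])
      finally show "d (pair_code (a \<oplus>\<^bsub>A\<^esub> b, \<zero>\<^bsub>A\<^esub>)) e1 = d (pair_code (a, \<zero>\<^bsub>A\<^esub>)) e1 \<oplus>\<^bsub>N\<^esub> d (pair_code (b, \<zero>\<^bsub>A\<^esub>)) e1"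
        using a b by (simp add: \<phi>_def)
    qed
    show "\<exists>!h. h \<in> Hom (RMod R) A N \<and> (\<forall>j\<in>Obj ?J. Cmp (RMod R) (fob ?D j) A N h (col R A j) = d j)"
    proof (rule ex1I[of _ \<phi>])
      have "compose (carrier R2) \<phi> (col R A (pair_code (a, b))) = d (pair_code (a, b))"
        if ab: "a \<in> carrier A" "b \<in> carrier A" for a b
        by (rule rhom_ext[OF rhom_compose[OF R2 col_rhom[OF A ab] \<phi>] d[OF ab]])
          (simp only: compose_eq key[OF ab])
      then show "\<phi> \<in> Hom (RMod R) A N \<and> (\<forall>j\<in>Obj ?J. Cmp (RMod R) (fob ?D j) A N \<phi> (col R A j) = d j)"
        using \<phi> by (auto simp del: free2_simps)
    next
      fix h assume "h \<in> Hom (RMod R) A N \<and> (\<forall>j\<in>Obj ?J. Cmp (RMod R) (fob ?D j) A N h (col R A j) = d j)"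
      then have h: "h \<in> rhom R A N"
        and hc: "\<And>a b. \<lbrakk>a \<in> carrier A; b \<in> carrier A\<rbrakk> \<Longrightarrow> compose (carrier R2) h (col R A (pair_code (a, b))) = d (pair_code (a, b))"
        by (auto simp del: free2_simps)
      show "h = \<phi>"
      proof (rule rhom_ext[OF h \<phi>])
        fix a assume a: "a \<in> carrier A"
        show "h a = \<phi> a"
          using fun_cong[OF hc[OF a A.M.zero_closed], of e1] a
          unfolding compose_eq[OF e12(1)] col_e[OF A a A.M.zero_closed] by (simp add: \<phi>_def)
      qed
    qed
  qed
qed

end

end

section \<open>Cocontinuous functors described by generators\<close>

locale watts = two_algebras k R S
  for k :: "'k ring" and R S :: "('k, 'u) module" +
  fixes Y :: "'u mod_ftor"
  assumes Y: "cocontinuous_linear_functor k R S Y"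
begin

sublocale Yf: cat_functor "RMod R" "RMod S" Y
  using Y by (simp add: cocontinuous_linear_functor_def)

lemma Y_mod: "right_module R A \<Longrightarrow> right_module S (fob Y A)"
  using Yf.fob_closed by simp

lemma Y_hom: "\<lbrakk>right_module R A; right_module R B; f \<in> rhom R A B\<rbrakk> \<Longrightarrow> fhom Y A B f \<in> rhom S (fob Y A) (fob Y B)"
  using Yf.fhom_closed by simp

lemma Y_closed: "\<lbrakk>right_module R A; right_module R B; f \<in> rhom R A B; x \<in> carrier (fob Y A)\<rbrakk>
    \<Longrightarrow> fhom Y A B f x \<in> carrier (fob Y B)"
  using Y_hom rhom_rlin rlin_closed by metis

lemma Y_id: "\<lbrakk>right_module R A; x \<in> carrier (fob Y A)\<rbrakk> \<Longrightarrow> fhom Y A A (\<lambda>a \<in> carrier A. a) x = x"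
  using Yf.fhom_Idn[of A] by simp

lemma Y_comp:
  "\<lbrakk>right_module R A; right_module R B; right_module R D; f \<in> rhom R A B; g \<in> rhom R B D; x \<in> carrier (fob Y A)\<rbrakk>
    \<Longrightarrow> fhom Y A D (compose (carrier A) g f) x = fhom Y B D g (fhom Y A B f x)"
  using Yf.fhom_Cmp[of A B D f g] by (simp add: compose_eq)

lemma Y_sum:
  "\<lbrakk>right_module R A; right_module R B; f \<in> rhom R A B; g \<in> rhom R A B; x \<in> carrier (fob Y A)\<rbrakk>
    \<Longrightarrow> fhom Y A B (\<lambda>m\<in>carrier A. f m \<oplus>\<^bsub>B\<^esub> g m) x = fhom Y A B f x \<oplus>\<^bsub>fob Y B\<^esub> fhom Y A B g x"
  using Y by (simp add: cocontinuous_linear_functor_def k_linear_def)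

lemma Y_iota: "\<lbrakk>right_module R A; a \<in> carrier A\<rbrakk> \<Longrightarrow> rlin S (fob Y Reg) (fob Y A) (fhom Y Reg A (iota R A a))"
  using Y_hom[OF Reg _ iota_rhom] rhom_rlin by blast

lemma Y_iota_add:
  assumes A: "right_module R A" and "a \<in> carrier A" "b \<in> carrier A" "x \<in> carrier (fob Y Reg)"
  shows "fhom Y Reg A (iota R A (a \<oplus>\<^bsub>A\<^esub> b)) x = fhom Y Reg A (iota R A a) x \<oplus>\<^bsub>fob Y A\<^esub> fhom Y Reg A (iota R A b) x"
proof -
  interpret A: right_module R A by (rule A)
  have "iota R A (a \<oplus>\<^bsub>A\<^esub> b) = (\<lambda>r \<in> carrier Reg. iota R A a r \<oplus>\<^bsub>A\<^esub> iota R A b r)"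
    using assms by (auto simp: iota_def restrict_def fun_eq_iff A.ract_add)
  then show ?thesis using Y_sum[OF Reg A iota_rhom[OF A assms(2)] iota_rhom[OF A assms(3)] assms(4)] by (simp only:)
qed

lemma Y_iota_comp:
  assumes "right_module R A" "right_module R B" "f \<in> rhom R A B" "a \<in> carrier A" "x \<in> carrier (fob Y Reg)"
  shows "fhom Y A B f (fhom Y Reg A (iota R A a) x) = fhom Y Reg B (iota R B (f a)) x"
  using Y_comp[OF Reg assms(1,2) iota_rhom[OF assms(1,4)] assms(3,5)] unfolding rhom_iota[OF assms(1-4)] by simp

lemma Y_iota_ract:
  assumes A: "right_module R A" and "a \<in> carrier A" "r \<in> carrier R" "x \<in> carrier (fob Y Reg)"
  shows "fhom Y Reg A (iota R A (a \<triangleleft>\<^bsub>A\<^esub> r)) x = fhom Y Reg A (iota R A a) (fhom Y Reg Reg (iota R Reg r) x)"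
  using Y_iota_comp[OF Reg A iota_rhom] assms by (simp add: iota_def)

lemma Y_iota_one: "x \<in> carrier (fob Y Reg) \<Longrightarrow> fhom Y Reg Reg (iota R Reg \<one>\<^bsub>R\<^esub>) x = x"
  using Y_id[OF Reg] iota_one[OF R.ring_axioms] by simp

definition p1 where "p1 = (\<lambda>z \<in> carrier R2. fst2 z)"
definition p2 where "p2 = (\<lambda>z \<in> carrier R2. snd2 z)"

lemma p12: "p1 \<in> rhom R R2 Reg" "p2 \<in> rhom R R2 Reg"
  unfolding p1_def p2_def by (intro rlin_restrict R2 rlinI additiveI; auto)+

text \<open>Write h as the sum of \<open>p1\<close> followed by iota of h e1 and \<open>p2\<close>
  followed by iota of h e2, and use that Y is additive on parallel maps. Thus the elements
  Y(iota_b)(x) account for everything that comes from Y(R^2).\<close>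

lemma Y_R2:
  assumes B: "right_module R B" and h: "h \<in> rhom R R2 B" and z: "z \<in> carrier (fob Y R2)"
  shows "fhom Y R2 B h z = fhom Y Reg B (iota R B (h e1)) (fhom Y R2 Reg p1 z)
    \<oplus>\<^bsub>fob Y B\<^esub> fhom Y Reg B (iota R B (h e2)) (fhom Y R2 Reg p2 z)"
proof -
  have he: "h e1 \<in> carrier B" "h e2 \<in> carrier B" using rlin_closed[OF rhom_rlin[OF h]] e12 by auto
  note i = iota_rhom[OF B he(1)] iota_rhom[OF B he(2)]
  have "h = (\<lambda>z \<in> carrier R2. compose (carrier R2) (iota R B (h e1)) p1 z \<oplus>\<^bsub>B\<^esub> compose (carrier R2) (iota R B (h e2)) p2 z)"
  proof (rule extensionalityI[of _ "carrier R2"])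
    fix z assume z: "z \<in> carrier R2"
    then have "fst2 z \<in> carrier R" "snd2 z \<in> carrier R" by auto
    then show "h z = (\<lambda>z \<in> carrier R2. compose (carrier R2) (iota R B (h e1)) p1 z \<oplus>\<^bsub>B\<^esub> compose (carrier R2) (iota R B (h e2)) p2 z) z"
      using z rhom_R2[OF B h z] by (simp add: compose_eq p1_def p2_def iota_def del: free2_simps)
  qed (use h in \<open>simp_all add: rhom_iff\<close>)
  then have "fhom Y R2 B h z = fhom Y R2 B (\<lambda>z \<in> carrier R2. compose (carrier R2) (iota R B (h e1)) p1 z
      \<oplus>\<^bsub>B\<^esub> compose (carrier R2) (iota R B (h e2)) p2 z) z" by simp
  also have "\<dots> = fhom Y R2 B (compose (carrier R2) (iota R B (h e1)) p1) z
      \<oplus>\<^bsub>fob Y B\<^esub> fhom Y R2 B (compose (carrier R2) (iota R B (h e2)) p2) z"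
    by (rule Y_sum[OF R2 B rhom_compose[OF R2 p12(1) i(1)] rhom_compose[OF R2 p12(2) i(2)] z])
  finally show ?thesis
    unfolding Y_comp[OF R2 Reg B p12(1) i(1) z] Y_comp[OF R2 Reg B p12(2) i(2) z] .
qed

context
  fixes A N :: "'u rmodule"
  assumes A: "right_module R A" and N: "right_module S N"
begin

interpretation A: right_module R A by (rule A)
interpretation N: right_module S N by (rule N)

lemma Y_colimit: "is_colimit (elems_cat A rank2_code) (RMod S) (comp_ftor Y (elems_diagram rank2_code)) (fob Y A)
    (\<lambda>j. fhom Y R2 A (col R A j))"
  using Y elems_diagram_functor[OF A] elems_colimit[OF A]
  unfolding cocontinuous_linear_functor_def cocontinuous_def by (fastforce simp: elems_diagram_def)

lemma Y_colimit_unique: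
  assumes "cocone (elems_cat A rank2_code) (RMod S) (comp_ftor Y (elems_diagram rank2_code)) N d"
  shows "\<exists>!g. g \<in> rhom S (fob Y A) N \<and>
      (\<forall>j\<in>pair_code ` (carrier A \<times> carrier A). compose (carrier (fob Y R2)) g (fhom Y R2 A (col R A j)) = d j)"
  using Y_colimit assms unfolding is_colimit_def by simp

text \<open>Removes the coding from the cocone condition, so that transition maps are again plain
  endomorphisms of R^2.\<close>

lemma Y_cocone_iff:
  "cocone (elems_cat A rank2_code) (RMod S) (comp_ftor Y (elems_diagram rank2_code)) N d \<longleftrightarrow>
     (\<forall>a \<in> carrier A. \<forall>b \<in> carrier A. d (pair_code (a, b)) \<in> rhom S (fob Y R2) N) \<and>
     (\<forall>a \<in> carrier A. \<forall>b \<in> carrier A. \<forall>a' \<in> carrier A. \<forall>b' \<in> carrier A. \<forall>f \<in> rhom R R2 R2.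
        compose (carrier R2) (col R A (pair_code (a', b'))) f = col R A (pair_code (a, b)) \<longrightarrow>
        compose (carrier (fob Y R2)) (d (pair_code (a', b'))) (fhom Y R2 R2 f) = d (pair_code (a, b)))"
  by (auto simp: cocone_def elems_cat_def elems_diagram_def decode N simp del: free2_simps)

text \<open>By \<open>Y_R2\<close> the two maps agree after composition with every leg Y(col), and
  the legs form a colimit cocone because Y preserves the colimit.\<close>

lemma watts_eq:
  assumes h: "rlin S (fob Y A) N h" and h': "rlin S (fob Y A) N h'"
    and eq: "\<And>a x. \<lbrakk>a \<in> carrier A; x \<in> carrier (fob Y Reg)\<rbrakk>
      \<Longrightarrow> h (fhom Y Reg A (iota R A a) x) = h' (fhom Y Reg A (iota R A a) x)"
    and z: "z \<in> carrier (fob Y A)"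
  shows "h z = h' z"
proof -
  let ?h = "\<lambda>z \<in> carrier (fob Y A). h z" and ?h' = "\<lambda>z \<in> carrier (fob Y A). h' z"
  note YA = Y_mod[OF A]
  let ?d = "\<lambda>j. compose (carrier (fob Y R2)) ?h (fhom Y R2 A (col R A j))"
  note H = rlin_restrict[OF YA h] rlin_restrict[OF YA h']
  have c: "col R A (pair_code (a, b)) \<in> rhom R R2 A" if "a \<in> carrier A" "b \<in> carrier A" for a b
    by (rule col_rhom[OF A that])
  have hh': "compose (carrier (fob Y R2)) ?h' (fhom Y R2 A (col R A (pair_code (a, b)))) = ?d (pair_code (a, b))"
    if ab: "a \<in> carrier A" "b \<in> carrier A" for a b
  proof (rule rhom_ext[OF rhom_compose[OF Y_mod[OF R2] Y_hom[OF R2 A c[OF ab]] H(2)]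
        rhom_compose[OF Y_mod[OF R2] Y_hom[OF R2 A c[OF ab]] H(1)]])
    fix z assume z: "z \<in> carrier (fob Y R2)"
    have p: "fhom Y R2 Reg p1 z \<in> carrier (fob Y Reg)" "fhom Y R2 Reg p2 z \<in> carrier (fob Y Reg)"
      using Y_closed[OF R2 Reg] p12 z by auto
    note cl = rlin_closed[OF Y_iota[OF A ab(1)] p(1)] rlin_closed[OF Y_iota[OF A ab(2)] p(2)]
    show "compose (carrier (fob Y R2)) ?h' (fhom Y R2 A (col R A (pair_code (a, b)))) z = ?d (pair_code (a, b)) z"
      unfolding compose_eq[OF z] restrict_apply'[OF Y_closed[OF R2 A c[OF ab] z]]
      by (simp only: Y_R2[OF A c[OF ab] z] col_e[OF A ab] rlin_add[OF h cl] rlin_add[OF h' cl] eq[OF ab(1) p(1)] eq[OF ab(2) p(2)])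
  qed
  have "cocone (elems_cat A rank2_code) (RMod S) (comp_ftor Y (elems_diagram rank2_code)) N ?d"
    unfolding Y_cocone_iff
  proof (intro conjI ballI impI)
    fix a b a' b' f assume ab: "a \<in> carrier A" "b \<in> carrier A" "a' \<in> carrier A" "b' \<in> carrier A"
      and f: "f \<in> rhom R R2 R2" and cf: "compose (carrier R2) (col R A (pair_code (a', b'))) f = col R A (pair_code (a, b))"
    show "compose (carrier (fob Y R2)) (?d (pair_code (a', b'))) (fhom Y R2 R2 f) = ?d (pair_code (a, b))"
      unfolding cf[symmetric]
      by (rule extensionalityI[of _ "carrier (fob Y R2)"])
        (simp_all add: compose_eq Y_comp[OF R2 R2 A f c[OF ab(3,4)]] Y_closed[OF R2 R2 f] del: free2_simps)
  qed (use rhom_compose[OF Y_mod[OF R2] Y_hom[OF R2 A c] H(1)] in blast)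
  then have "\<exists>!g. g \<in> rhom S (fob Y A) N \<and>
      (\<forall>j\<in>pair_code ` (carrier A \<times> carrier A). compose (carrier (fob Y R2)) g (fhom Y R2 A (col R A j)) = ?d j)"
    by (rule Y_colimit_unique)
  then have "?h = ?h'" using H hh' by blast
  from fun_cong[OF this, of z] show ?thesis using z by simp
qed

text \<open>On Y(R^2) the prescription extends by means of the two projections to R; the relations
  assumed for f make the resulting maps a cocone, and the preserved colimit glues them.\<close>

lemma watts_exists:
  assumes f: "biadditive A (fob Y Reg) N f"
    and lin: "\<And>a x s. \<lbrakk>a \<in> carrier A; x \<in> carrier (fob Y Reg); s \<in> carrier S\<rbrakk> \<Longrightarrow> f a (x \<triangleleft>\<^bsub>fob Y Reg\<^esub> s) = f a x \<triangleleft>\<^bsub>N\<^esub> s"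
    and bal: "\<And>a r x. \<lbrakk>a \<in> carrier A; r \<in> carrier R; x \<in> carrier (fob Y Reg)\<rbrakk>
      \<Longrightarrow> f (a \<triangleleft>\<^bsub>A\<^esub> r) x = f a (fhom Y Reg Reg (iota R Reg r) x)"
  obtains h where "h \<in> rhom S (fob Y A) N"
    and "\<And>a x. \<lbrakk>a \<in> carrier A; x \<in> carrier (fob Y Reg)\<rbrakk> \<Longrightarrow> h (fhom Y Reg A (iota R A a) x) = f a x"
proof -
  define d where "d j = (\<lambda>z \<in> carrier (fob Y R2). f (fst2 j) (fhom Y R2 Reg p1 z) \<oplus>\<^bsub>N\<^esub> f (snd2 j) (fhom Y R2 Reg p2 z))" for j
  interpret Y2: right_module S "fob Y R2" by (rule Y_mod[OF R2])
  note P = rhom_rlin[OF Y_hom[OF R2 Reg p12(1)]] rhom_rlin[OF Y_hom[OF R2 Reg p12(2)]]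
  note Pc = rlin_closed[OF P(1)] rlin_closed[OF P(2)]
  note fc = biadditive_closed[OF f] and fa = biadditive_add_left[OF f] biadditive_add_right[OF f]
  have d: "d (pair_code (a, b)) \<in> rhom S (fob Y R2) N" if ab: "a \<in> carrier A" "b \<in> carrier A" for a b
    unfolding d_def
    by (intro rlin_restrict Y_mod[OF R2] rlinI additiveI)
      (use ab in \<open>simp_all add: fc fa Pc rlin_add[OF P(1)] rlin_add[OF P(2)] rlin_ract[OF P(1)] rlin_ract[OF P(2)] lin N.ract_add N.M.a_ac del: free2_simps\<close>)
  have "cocone (elems_cat A rank2_code) (RMod S) (comp_ftor Y (elems_diagram rank2_code)) N d"
    unfolding Y_cocone_iff
  proof (intro conjI ballI impI d)
    fix a b a' b' g assume ab: "a \<in> carrier A" "b \<in> carrier A" "a' \<in> carrier A" "b' \<in> carrier A"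
      and g: "g \<in> rhom R R2 R2" and cg: "compose (carrier R2) (col R A (pair_code (a', b'))) g = col R A (pair_code (a, b))"
    note c' = col_rhom[OF A ab(3,4)] and gl = rhom_rlin[OF g]
    have ge: "g e1 \<in> carrier R2" "g e2 \<in> carrier R2" using rlin_closed[OF gl] e12 by auto
    then have g4: "fst2 (g e1) \<in> carrier R" "snd2 (g e1) \<in> carrier R" "fst2 (g e2) \<in> carrier R" "snd2 (g e2) \<in> carrier R" by auto
    \<comment> \<open>The transition map \<open>g\<close> is a 2 x 2 matrix whose entries express a
      and b through a' and b'. By \<open>bal\<close> these entries can be moved from the first
      argument of f to the second, where Y(g) puts them.\<close>
    have "a = col R A (pair_code (a', b')) (g e1)" "b = col R A (pair_code (a', b')) (g e2)"
      using col_e[OF A ab(1,2)] compose_eq[OF e12(1), of "col R A (pair_code (a', b'))" g]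
        compose_eq[OF e12(2), of "col R A (pair_code (a', b'))" g] unfolding cg by simp_all
    then have a: "a = a' \<triangleleft>\<^bsub>A\<^esub> fst2 (g e1) \<oplus>\<^bsub>A\<^esub> b' \<triangleleft>\<^bsub>A\<^esub> snd2 (g e1)" and b: "b = a' \<triangleleft>\<^bsub>A\<^esub> fst2 (g e2) \<oplus>\<^bsub>A\<^esub> b' \<triangleleft>\<^bsub>A\<^esub> snd2 (g e2)"
      using ge by (simp_all add: col_def del: free2_simps)
    note pg = rhom_compose[OF R2 g p12(1)] rhom_compose[OF R2 g p12(2)]
    show "compose (carrier (fob Y R2)) (d (pair_code (a', b'))) (fhom Y R2 R2 g) = d (pair_code (a, b))"
    proof (rule rhom_ext[OF rhom_compose[OF Y_mod[OF R2] Y_hom[OF R2 R2 g] d[OF ab(3,4)]] d[OF ab(1,2)]])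
      fix z assume z: "z \<in> carrier (fob Y R2)"
      let ?z1 = "fhom Y R2 Reg p1 z" and ?z2 = "fhom Y R2 Reg p2 z"
      have gz: "fhom Y R2 R2 g z \<in> carrier (fob Y R2)" by (rule Y_closed[OF R2 R2 g z])
      have *: "fhom Y R2 Reg p1 (fhom Y R2 R2 g z) = fhom Y Reg Reg (iota R Reg (fst2 (g e1))) ?z1
            \<oplus>\<^bsub>fob Y Reg\<^esub> fhom Y Reg Reg (iota R Reg (fst2 (g e2))) ?z2"
        "fhom Y R2 Reg p2 (fhom Y R2 R2 g z) = fhom Y Reg Reg (iota R Reg (snd2 (g e1))) ?z1
            \<oplus>\<^bsub>fob Y Reg\<^esub> fhom Y Reg Reg (iota R Reg (snd2 (g e2))) ?z2"
        unfolding Y_comp[OF R2 R2 Reg g p12(1) z, symmetric] Y_comp[OF R2 R2 Reg g p12(2) z, symmetric]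
          Y_R2[OF Reg pg(1) z] Y_R2[OF Reg pg(2) z] compose_eq[OF e12(1)] compose_eq[OF e12(2)]
        using ge by (simp_all add: p1_def p2_def del: free2_simps)
      have ic: "fhom Y Reg Reg (iota R Reg r) x \<in> carrier (fob Y Reg)" if "r \<in> carrier R" "x \<in> carrier (fob Y Reg)" for r x
        using rlin_closed[OF Y_iota[OF Reg]] that by simp
      show "compose (carrier (fob Y R2)) (d (pair_code (a', b'))) (fhom Y R2 R2 g) z = d (pair_code (a, b)) z"
        unfolding compose_eq[OF z] d_def pair_code restrict_apply'[OF gz] restrict_apply'[OF z] *
        using ab z g4 by (simp add: a b fa fc ic Pc A.ract_closed bal N.M.a_ac del: free2_simps)
    qed
  qed
  then have "\<exists>!g. g \<in> rhom S (fob Y A) N \<and>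
      (\<forall>j\<in>pair_code ` (carrier A \<times> carrier A). compose (carrier (fob Y R2)) g (fhom Y R2 A (col R A j)) = d j)"
    by (rule Y_colimit_unique)
  then obtain h where h: "h \<in> rhom S (fob Y A) N" and
    hc: "\<And>a b. \<lbrakk>a \<in> carrier A; b \<in> carrier A\<rbrakk> \<Longrightarrow> compose (carrier (fob Y R2)) h (fhom Y R2 A (col R A (pair_code (a, b)))) = d (pair_code (a, b))"
    by blast
  have "h (fhom Y Reg A (iota R A a) x) = f a x" if a: "a \<in> carrier A" and x: "x \<in> carrier (fob Y Reg)" for a x
  proof -
    \<comment> \<open>iota_a factors as iota of \<open>e1\<close> followed by the leg at (a, 0), so
      the value of \<open>h\<close> on the generator can be read off from \<open>d\<close>.\<close>
    let ?i = "iota R R2 e1"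
    have i: "?i \<in> rhom R Reg R2" by (rule iota_rhom[OF R2 e12(1)])
    note c = col_rhom[OF A a A.M.zero_closed]
    have ix: "fhom Y Reg R2 ?i x \<in> carrier (fob Y R2)" by (rule Y_closed[OF Reg R2 i x])
    have "fhom Y Reg A (iota R A a) x = fhom Y R2 A (col R A (pair_code (a, \<zero>\<^bsub>A\<^esub>))) (fhom Y Reg R2 ?i x)"
      using Y_iota_comp[OF R2 A c e12(1) x] by (simp only: col_e[OF A a A.M.zero_closed])
    then have "h (fhom Y Reg A (iota R A a) x) = d (pair_code (a, \<zero>\<^bsub>A\<^esub>)) (fhom Y Reg R2 ?i x)"
      unfolding hc[OF a A.M.zero_closed, symmetric] by (simp only: compose_eq[OF ix])
    also have "\<dots> = f a (fhom Y Reg Reg (iota R Reg (p1 e1)) x) \<oplus>\<^bsub>N\<^esub> f \<zero>\<^bsub>A\<^esub> (fhom Y Reg Reg (iota R Reg (p2 e1)) x)"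
      unfolding d_def pair_code restrict_apply'[OF ix] Y_iota_comp[OF R2 Reg p12(1) e12(1) x] Y_iota_comp[OF R2 Reg p12(2) e12(1) x] ..
    also have "\<dots> = f a x"
    proof -
      have p: "p1 e1 = \<one>\<^bsub>R\<^esub>" "p2 e1 = \<zero>\<^bsub>R\<^esub>" using e12(1) by (simp_all add: p1_def p2_def del: free2_simps)
      have c0: "fhom Y Reg Reg (iota R Reg \<zero>\<^bsub>R\<^esub>) x \<in> carrier (fob Y Reg)"
        using rlin_closed[OF Y_iota[OF Reg] x] by simp
      have "f \<zero>\<^bsub>A\<^esub> (fhom Y Reg Reg (iota R Reg \<zero>\<^bsub>R\<^esub>) x) = \<zero>\<^bsub>N\<^esub>"
        by (rule additive_zero[of A N "\<lambda>a. f a (fhom Y Reg Reg (iota R Reg \<zero>\<^bsub>R\<^esub>) x)"])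
          (use f c0 in \<open>simp_all add: biadditive_def A.M.abelian_group_axioms N.M.abelian_group_axioms\<close>)
      then show ?thesis unfolding p using a x by (simp add: Y_iota_one fc)
    qed
    finally show ?thesis .
  qed
  with h show ?thesis using that by blast
qed

end

end

section \<open>Coalgebroids and the action on a comodule\<close>

lemma R_part_simps [simp]:
  "carrier (R_part C) = carrier C" "(\<oplus>\<^bsub>R_part C\<^esub>) = (\<oplus>\<^bsub>C\<^esub>)" "\<zero>\<^bsub>R_part C\<^esub> = \<zero>\<^bsub>C\<^esub>"
  "lact (R_part C) = lactR C" "ract (R_part C) = ractR C"
  by (simp_all add: R_part_def ring.defs rmodule.defs bimodule.defs)

locale coalgebroid_setting = two_algebras k R S + C: coalgebroid k R S C
  for k :: "'k ring" and R S :: "('k, 'u) module" and C :: "'u coalg"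
begin

lemma C_bimod: "bimod S S C"
  by (rule k_bimodule_bimod[of k]) unfold_locales

lemma C_mod: "right_module S C" "left_module S C" "abelian_group C"
  using C_bimod by (auto simp: bimod_def left_module_def)

lemma C_closed [simp]:
  "\<lbrakk>s \<in> carrier S; c \<in> carrier C\<rbrakk> \<Longrightarrow> s \<triangleright>\<^bsub>C\<^esub> c \<in> carrier C"
  "\<lbrakk>s \<in> carrier S; c \<in> carrier C\<rbrakk> \<Longrightarrow> c \<triangleleft>\<^bsub>C\<^esub> s \<in> carrier C"
  "\<lbrakk>r \<in> carrier R; c \<in> carrier C\<rbrakk> \<Longrightarrow> r \<unrhd>\<^bsub>C\<^esub> c \<in> carrier C"
  "\<lbrakk>r \<in> carrier R; c \<in> carrier C\<rbrakk> \<Longrightarrow> c \<unlhd>\<^bsub>C\<^esub> r \<in> carrier C"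
  using C.R_part.lact_closed C.R_part.ract_closed by (simp_all add: C.S_part.lact_closed C.S_part.ract_closed)

lemma R_act:
  "\<lbrakk>r \<in> carrier R; c \<in> carrier C; c' \<in> carrier C\<rbrakk> \<Longrightarrow> r \<unrhd>\<^bsub>C\<^esub> (c \<oplus>\<^bsub>C\<^esub> c') = r \<unrhd>\<^bsub>C\<^esub> c \<oplus>\<^bsub>C\<^esub> r \<unrhd>\<^bsub>C\<^esub> c'"
  "\<lbrakk>r \<in> carrier R; c \<in> carrier C; c' \<in> carrier C\<rbrakk> \<Longrightarrow> (c \<oplus>\<^bsub>C\<^esub> c') \<unlhd>\<^bsub>C\<^esub> r = c \<unlhd>\<^bsub>C\<^esub> r \<oplus>\<^bsub>C\<^esub> c' \<unlhd>\<^bsub>C\<^esub> r"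
  "\<lbrakk>r \<in> carrier R; r' \<in> carrier R; c \<in> carrier C\<rbrakk> \<Longrightarrow> (r \<oplus>\<^bsub>R\<^esub> r') \<unrhd>\<^bsub>C\<^esub> c = r \<unrhd>\<^bsub>C\<^esub> c \<oplus>\<^bsub>C\<^esub> r' \<unrhd>\<^bsub>C\<^esub> c"
  "\<lbrakk>r \<in> carrier R; r' \<in> carrier R; c \<in> carrier C\<rbrakk> \<Longrightarrow> c \<unlhd>\<^bsub>C\<^esub> (r \<oplus>\<^bsub>R\<^esub> r') = c \<unlhd>\<^bsub>C\<^esub> r \<oplus>\<^bsub>C\<^esub> c \<unlhd>\<^bsub>C\<^esub> r'"
  "\<lbrakk>r \<in> carrier R; r' \<in> carrier R; c \<in> carrier C\<rbrakk> \<Longrightarrow> (r \<otimes>\<^bsub>R\<^esub> r') \<unrhd>\<^bsub>C\<^esub> c = r \<unrhd>\<^bsub>C\<^esub> (r' \<unrhd>\<^bsub>C\<^esub> c)"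
  "\<lbrakk>r \<in> carrier R; r' \<in> carrier R; c \<in> carrier C\<rbrakk> \<Longrightarrow> c \<unlhd>\<^bsub>C\<^esub> (r \<otimes>\<^bsub>R\<^esub> r') = c \<unlhd>\<^bsub>C\<^esub> r \<unlhd>\<^bsub>C\<^esub> r'"
  "c \<in> carrier C \<Longrightarrow> \<one>\<^bsub>R\<^esub> \<unrhd>\<^bsub>C\<^esub> c = c"
  "c \<in> carrier C \<Longrightarrow> c \<unlhd>\<^bsub>C\<^esub> \<one>\<^bsub>R\<^esub> = c"
  "\<lbrakk>r \<in> carrier R; r' \<in> carrier R; c \<in> carrier C\<rbrakk> \<Longrightarrow> (r \<unrhd>\<^bsub>C\<^esub> c) \<unlhd>\<^bsub>C\<^esub> r' = r \<unrhd>\<^bsub>C\<^esub> (c \<unlhd>\<^bsub>C\<^esub> r')"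
  using C.R_part.lact_add C.R_part.ract_add C.R_part.lact_add_scalar C.R_part.ract_add_scalar C.R_part.lact_mult C.R_part.ract_mult C.R_part.lact_one C.R_part.ract_one
    C.R_part.actions_commute by simp_all

lemma lactR_lin: "r \<in> carrier R \<Longrightarrow> llin S C C (lactR C r)" "r \<in> carrier R \<Longrightarrow> rlin S C C (lactR C r)"
  by (auto simp: llin_def rlin_def R_act C.lact_lactR C.ract_lactR intro!: additiveI)

lemma ractR_lin: "r \<in> carrier R \<Longrightarrow> llin S C C (\<lambda>c. c \<unlhd>\<^bsub>C\<^esub> r)" "r \<in> carrier R \<Longrightarrow> rlin S C C (\<lambda>c. c \<unlhd>\<^bsub>C\<^esub> r)"
  by (auto simp: llin_def rlin_def R_act C.lact_ractR C.ract_ractR intro!: additiveI)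

lemma counit_additive: "additive C S (counit C)"
  using C.counit_hom by (simp add: additive_def)

lemma counit_closed [simp]: "c \<in> carrier C \<Longrightarrow> counit C c \<in> carrier S"
  by (rule additive_closed[OF counit_additive])

lemma counit_act:
  "\<lbrakk>s \<in> carrier S; c \<in> carrier C\<rbrakk> \<Longrightarrow> counit C (s \<triangleright>\<^bsub>C\<^esub> c) = s \<otimes>\<^bsub>S\<^esub> counit C c"
  "\<lbrakk>s \<in> carrier S; c \<in> carrier C\<rbrakk> \<Longrightarrow> counit C (c \<triangleleft>\<^bsub>C\<^esub> s) = counit C c \<otimes>\<^bsub>S\<^esub> s"
  using C.counit_S[of s c "\<one>\<^bsub>S\<^esub>"] C.counit_S[of "\<one>\<^bsub>S\<^esub>" c s] by (simp_all add: C.S_part.ract_one C.S_part.lact_one)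

lemma comul_additive: "additive C (rtensor S C C) (comul C)"
  using C.comul_hom additive_bitensor(2)[of C S C C "comul C"] unfolding additive_def by blast

lemma comul_closed [simp]: "c \<in> carrier C \<Longrightarrow> comul C c \<in> carrier (rtensor S C C)"
  by (rule additive_closed[OF comul_additive])

abbreviation mapC where "mapC N N' f \<equiv> rtensor_map S N C N' C f (\<lambda>c. c)"
abbreviation mapR where "mapR N g \<equiv> rtensor_map S N C N C (\<lambda>n. n) g"
abbreviation pu where "pu N \<equiv> rpure S N C"

lemma NC_mod: "right_module S N \<Longrightarrow> right_module S (rtensor S N C)"
  by (rule rt_right_module[OF _ C_mod(2) C_bimod])

lemma pu:
  assumes "right_module S N"
  shows pu_closed: "\<lbrakk>n \<in> carrier N; c \<in> carrier C\<rbrakk> \<Longrightarrow> pu N n c \<in> carrier (rtensor S N C)"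
    and pu_add: "\<lbrakk>n \<in> carrier N; n' \<in> carrier N; c \<in> carrier C\<rbrakk> \<Longrightarrow> pu N (n \<oplus>\<^bsub>N\<^esub> n') c = pu N n c \<oplus>\<^bsub>rtensor S N C\<^esub> pu N n' c"
      "\<lbrakk>n \<in> carrier N; c \<in> carrier C; c' \<in> carrier C\<rbrakk> \<Longrightarrow> pu N n (c \<oplus>\<^bsub>C\<^esub> c') = pu N n c \<oplus>\<^bsub>rtensor S N C\<^esub> pu N n c'"
    and pu_balanced: "\<lbrakk>n \<in> carrier N; s \<in> carrier S; c \<in> carrier C\<rbrakk> \<Longrightarrow> pu N (n \<triangleleft>\<^bsub>N\<^esub> s) c = pu N n (s \<triangleright>\<^bsub>C\<^esub> c)"
    and pu_ract: "\<lbrakk>n \<in> carrier N; s \<in> carrier S; c \<in> carrier C\<rbrakk> \<Longrightarrow> pu N n c \<triangleleft>\<^bsub>rtensor S N C\<^esub> s = pu N n (c \<triangleleft>\<^bsub>C\<^esub> s)"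
  by (fact rpure_closed[OF assms C_mod(2)] rpure_add[OF assms C_mod(2)] rpure_balanced[OF assms C_mod(2)])+
    (simp add: rt_ract_pure[OF assms C_mod(2) C_bimod])

lemma NC_eq:
  assumes "right_module S N" "additive (rtensor S N C) G h" "additive (rtensor S N C) G h'"
    and "\<And>n c. \<lbrakk>n \<in> carrier N; c \<in> carrier C\<rbrakk> \<Longrightarrow> h (pu N n c) = h' (pu N n c)"
    and "z \<in> carrier (rtensor S N C)"
  shows "h z = h' z"
  by (rule rt_hom_eq[OF assms(1) C_mod(2) assms(2-5)])

lemma mapC:
  assumes "right_module S N" "right_module S N'" "rlin S N N' f"
  shows mapC_rlin: "rlin S (rtensor S N C) (rtensor S N' C) (mapC N N' f)"
    and mapC_pure: "\<lbrakk>n \<in> carrier N; c \<in> carrier C\<rbrakk> \<Longrightarrow> mapC N N' f (pu N n c) = pu N' (f n) c"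
  by (fact rtensor_map_rlin[OF assms(1) C_mod(2) assms(2) C_mod(2) assms(3) llin_id C_bimod C_bimod rlin_id]
    rtensor_map_pure[OF assms(1) C_mod(2) assms(2) C_mod(2) assms(3) llin_id])+

lemma mapR:
  assumes "right_module S N" "llin S C C g"
  shows mapR_additive: "additive (rtensor S N C) (rtensor S N C) (mapR N g)"
    and mapR_pure: "\<lbrakk>n \<in> carrier N; c \<in> carrier C\<rbrakk> \<Longrightarrow> mapR N g (pu N n c) = pu N n (g c)"
  by (fact rtensor_map_additive[OF assms(1) C_mod(2) assms(1) C_mod(2) rlin_id assms(2)]
    rtensor_map_pure[OF assms(1) C_mod(2) assms(1) C_mod(2) rlin_id assms(2)])+

lemma mapC_comp:
  assumes N: "right_module S N" and N': "right_module S N'" and N'': "right_module S N''"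
    and f: "rlin S N N' f" and g: "rlin S N' N'' g" and z: "z \<in> carrier (rtensor S N C)"
  shows "mapC N' N'' g (mapC N N' f z) = mapC N N'' (\<lambda>n. g (f n)) z"
  by (rule NC_eq[OF N additive_compose[OF rlin_additive[OF mapC_rlin[OF N N' f]] rlin_additive[OF mapC_rlin[OF N' N'' g]]]
      rlin_additive[OF mapC_rlin[OF N N'' rlin_compose[OF f g]]] _ z])
    (simp add: mapC_pure[OF N N' f] mapC_pure[OF N' N'' g] mapC_pure[OF N N'' rlin_compose[OF f g]] rlin_closed[OF f])

text \<open>Functions that agree on the carrier may be exchanged even at tensors which are not pure;
  this drops restrictions and recognises composites.\<close>

lemma mapC_cong: "(\<And>n. n \<in> carrier N \<Longrightarrow> f n = g n) \<Longrightarrow> mapC N N' f z = mapC N N' g z"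
  unfolding rtensor_map_def by (subst tlift_cong[of N C "\<lambda>x m. rpure S N' C (f x) m" "\<lambda>x m. rpure S N' C (g x) m"]) auto

lemma mapC_id:
  assumes N: "right_module S N" and z: "z \<in> carrier (rtensor S N C)"
  shows "mapC N N (\<lambda>n. n) z = z"
  by (rule NC_eq[OF N rlin_additive[OF mapC_rlin[OF N N rlin_id]] additive_id _ z])
    (simp add: mapC_pure[OF N N rlin_id])

lemma mapC_mapR:
  assumes N: "right_module S N" and N': "right_module S N'" and f: "rlin S N N' f" and g: "llin S C C g"
    and z: "z \<in> carrier (rtensor S N C)"
  shows "mapC N N' f (mapR N g z) = mapR N' g (mapC N N' f z)"
proof -
  have gc: "c \<in> carrier C \<Longrightarrow> g c \<in> carrier C" for c using g by (auto simp: llin_def additive_closed)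
  show ?thesis
    by (rule NC_eq[OF N additive_compose[OF mapR_additive[OF N g] rlin_additive[OF mapC_rlin[OF N N' f]]]
        additive_compose[OF rlin_additive[OF mapC_rlin[OF N N' f]] mapR_additive[OF N' g]] _ z])
      (simp add: mapC_pure[OF N N' f] mapR_pure[OF N g] mapR_pure[OF N' g] rlin_closed[OF f] gc)
qed

lemma comul_lin: "llin S C (bitensor S C C) (comul C)" "rlin S C (bitensor S C C) (comul C)"
proof -
  have "comul C (s \<triangleright>\<^bsub>C\<^esub> c) = s \<triangleright>\<^bsub>bitensor S C C\<^esub> comul C c" if s: "s \<in> carrier S" and c: "c \<in> carrier C" for s c
  proof -
    have "comul C (s \<triangleright>\<^bsub>C\<^esub> c) = rlift S C C (rtensor S C C) (\<lambda>x y. rpure S C C (s \<triangleright>\<^bsub>C\<^esub> x) (y \<triangleleft>\<^bsub>C\<^esub> \<one>\<^bsub>S\<^esub>)) (comul C c)"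
      using C.comul_S[OF s c S.one_closed] s c by (simp add: C.S_part.ract_one)
    also have "\<dots> = rlift S C C (rtensor S C C) (\<lambda>x y. rpure S C C (s \<triangleright>\<^bsub>C\<^esub> x) y) (comul C c)"
      by (subst tlift_cong) (simp_all add: C.S_part.ract_one)
    finally show ?thesis by (simp add: bitensor_def Let_def rmodule.defs bimodule.defs)
  qed
  then show "llin S C (bitensor S C C) (comul C)" by (simp add: llin_def comul_additive)
  have "comul C (c \<triangleleft>\<^bsub>C\<^esub> s) = comul C c \<triangleleft>\<^bsub>rtensor S C C\<^esub> s" if s: "s \<in> carrier S" and c: "c \<in> carrier C" for s c
  proof -
    have "comul C (c \<triangleleft>\<^bsub>C\<^esub> s) = rlift S C C (rtensor S C C) (\<lambda>x y. rpure S C C (\<one>\<^bsub>S\<^esub> \<triangleright>\<^bsub>C\<^esub> x) (y \<triangleleft>\<^bsub>C\<^esub> s)) (comul C c)"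
      using C.comul_S[OF S.one_closed c s] s c by (simp add: C.S_part.lact_one)
    also have "\<dots> = rlift S C C (rtensor S C C) (\<lambda>x y. rpure S C C x (y \<triangleleft>\<^bsub>C\<^esub> s)) (comul C c)"
      by (subst tlift_cong) (simp_all add: C.S_part.lact_one)
    finally show ?thesis by (simp add: rt_ract_eq[OF C_mod(1,2) C_bimod])
  qed
  then show "rlin S C (bitensor S C C) (comul C)" by (simp add: rlin_def comul_additive)
qed

text \<open>Each one-sided rule comes from the two-sided axiom with \<one> for the other scalar. In
  terms of \<open>mapC\<close> and \<open>mapR\<close> the rules can be chained without opening the
  lifts again.\<close>

lemma comul_R:
  assumes r: "r \<in> carrier R" and c: "c \<in> carrier C"
  shows "comul C (r \<unrhd>\<^bsub>C\<^esub> c) = mapR C (lactR C r) (comul C c)"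
    and "comul C (c \<unlhd>\<^bsub>C\<^esub> r) = mapC C C (\<lambda>c. c \<unlhd>\<^bsub>C\<^esub> r) (comul C c)"
    and "mapC C C (lactR C r) (comul C c) = mapR C (\<lambda>c. c \<unlhd>\<^bsub>C\<^esub> r) (comul C c)"
proof -
  have 1: "comul C (r \<unrhd>\<^bsub>C\<^esub> c) = rlift S C C (rtensor S C C) (\<lambda>x y. rpure S C C (x \<unlhd>\<^bsub>C\<^esub> \<one>\<^bsub>R\<^esub>) (r \<unrhd>\<^bsub>C\<^esub> y)) (comul C c)"
    using C.comul_R[OF r c R.one_closed] r c by (simp add: R_act)
  show "comul C (r \<unrhd>\<^bsub>C\<^esub> c) = mapR C (lactR C r) (comul C c)"
    unfolding 1 rtensor_map_def by (subst tlift_cong) (simp_all add: R_act)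
  have 2: "comul C (c \<unlhd>\<^bsub>C\<^esub> r) = rlift S C C (rtensor S C C) (\<lambda>x y. rpure S C C (x \<unlhd>\<^bsub>C\<^esub> r) (\<one>\<^bsub>R\<^esub> \<unrhd>\<^bsub>C\<^esub> y)) (comul C c)"
    using C.comul_R[OF R.one_closed c r] r c by (simp add: R_act)
  show "comul C (c \<unlhd>\<^bsub>C\<^esub> r) = mapC C C (\<lambda>c. c \<unlhd>\<^bsub>C\<^esub> r) (comul C c)"
    unfolding 2 rtensor_map_def by (subst tlift_cong) (simp_all add: R_act)
  show "mapC C C (lactR C r) (comul C c) = mapR C (\<lambda>c. c \<unlhd>\<^bsub>C\<^esub> r) (comul C c)"
    using C.comul_balanced[OF r c] by (simp add: rtensor_map_def)
qed

section \<open>Contractions with the counit\<close>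

text \<open>Through these maps $R$ acts on a comodule.\<close>

definition mu :: "('u, 'n) rmodule_scheme \<Rightarrow> 'u \<Rightarrow> 'u \<Rightarrow> 'u" where
  "mu N r = rlift S N C N (\<lambda>n c. n \<triangleleft>\<^bsub>N\<^esub> counit C (r \<unrhd>\<^bsub>C\<^esub> c))"

lemma mu:
  assumes N: "right_module S N" and r: "r \<in> carrier R"
  shows mu_rlin: "rlin S (rtensor S N C) N (mu N r)"
    and mu_pure: "\<lbrakk>n \<in> carrier N; c \<in> carrier C\<rbrakk> \<Longrightarrow> mu N r (pu N n c) = n \<triangleleft>\<^bsub>N\<^esub> counit C (r \<unrhd>\<^bsub>C\<^esub> c)"
proof -
  interpret N: right_module S N by (rule N)
  have 1: "biadditive N C N (\<lambda>n c. n \<triangleleft>\<^bsub>N\<^esub> counit C (r \<unrhd>\<^bsub>C\<^esub> c))"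
    using r by (intro biadditiveI)
      (simp_all add: N.ract_closed N.ract_add R_act additive_add[OF counit_additive] N.ract_add_scalar)
  have 2: "n \<triangleleft>\<^bsub>N\<^esub> s \<triangleleft>\<^bsub>N\<^esub> counit C (r \<unrhd>\<^bsub>C\<^esub> c) = n \<triangleleft>\<^bsub>N\<^esub> counit C (r \<unrhd>\<^bsub>C\<^esub> (s \<triangleright>\<^bsub>C\<^esub> c))"
    if "n \<in> carrier N" "s \<in> carrier S" "c \<in> carrier C" for n s c
    using r that by (simp add: C.lact_lactR[symmetric] counit_act N.ract_mult)
  show p: "\<lbrakk>n \<in> carrier N; c \<in> carrier C\<rbrakk> \<Longrightarrow> mu N r (pu N n c) = n \<triangleleft>\<^bsub>N\<^esub> counit C (r \<unrhd>\<^bsub>C\<^esub> c)" for n c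
    unfolding mu_def by (rule rlift_pure[OF N C_mod(2) N.M.abelian_group_axioms 1, OF 2])
  have a: "additive (rtensor S N C) N (mu N r)"
    unfolding mu_def by (rule rlift_additive[OF N C_mod(2) N.M.abelian_group_axioms 1, OF 2])
  show "rlin S (rtensor S N C) N (mu N r)"
    by (rule rt_rlin[OF N C_mod(2) C_bimod N a])
      (use r in \<open>simp add: p C.ract_lactR[symmetric] counit_act N.ract_mult\<close>)
qed

text \<open>Contraction with \<epsilon> uses only the S-action, which f respects.\<close>

lemma mu_natural:
  assumes N: "right_module S N" and N': "right_module S N'" and f: "rlin S N N' f" and r: "r \<in> carrier R"
    and z: "z \<in> carrier (rtensor S N C)"
  shows "f (mu N r z) = mu N' r (mapC N N' f z)"
  by (rule NC_eq[OF N rlin_additive[OF rlin_compose[OF mu_rlin[OF N r] f]]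
      rlin_additive[OF rlin_compose[OF mapC_rlin[OF N N' f] mu_rlin[OF N' r]]] _ z])
    (use r in \<open>simp add: mu_pure[OF N r] mu_pure[OF N' r] mapC_pure[OF N N' f] rlin_closed[OF f] rlin_ract[OF f]\<close>)

lemma mu_mapR:
  assumes N: "right_module S N" and r: "r \<in> carrier R" "r' \<in> carrier R" and z: "z \<in> carrier (rtensor S N C)"
  shows "mu N r (mapR N (lactR C r') z) = mu N (r \<otimes>\<^bsub>R\<^esub> r') z"
  by (rule NC_eq[OF N additive_compose[OF mapR_additive[OF N lactR_lin(1)] rlin_additive[OF mu_rlin[OF N r(1)]]]
      rlin_additive[OF mu_rlin[OF N]] _ z])
    (use r in \<open>simp_all add: mu_pure[OF N] mapR_pure[OF N lactR_lin(1)] R_act\<close>)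

text \<open>This is right counitality for r c, since \<delta>(r c) = c_(1) \<otimes> r
  c_(2).\<close>

lemma mu_comul: "\<lbrakk>r \<in> carrier R; c \<in> carrier C\<rbrakk> \<Longrightarrow> mu C r (comul C c) = r \<unrhd>\<^bsub>C\<^esub> c"
proof -
  have one: "mu C \<one>\<^bsub>R\<^esub> (comul C c) = c" if "c \<in> carrier C" for c
    using C.counital_right[OF that] unfolding mu_def by (subst tlift_cong) (simp_all add: R_act)
  assume "r \<in> carrier R" "c \<in> carrier C"
  with one[of "r \<unrhd>\<^bsub>C\<^esub> c"] show ?thesis
    by (simp add: comul_R mu_mapR[OF C_mod(1)])
qed

text \<open>The counterpart of \<open>mu\<close> on C, in which \<epsilon> contracts the left tensor
  factor instead of the right one.\<close>

definition nu :: "'u \<Rightarrow> 'u \<Rightarrow> 'u" where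
  "nu r = rlift S C C C (\<lambda>c c'. counit C (r \<unrhd>\<^bsub>C\<^esub> c) \<triangleright>\<^bsub>C\<^esub> c')"

lemma nu:
  assumes r: "r \<in> carrier R"
  shows nu_additive: "additive (rtensor S C C) C (nu r)"
    and nu_pure: "\<lbrakk>c \<in> carrier C; c' \<in> carrier C\<rbrakk> \<Longrightarrow> nu r (pu C c c') = counit C (r \<unrhd>\<^bsub>C\<^esub> c) \<triangleright>\<^bsub>C\<^esub> c'"
proof -
  have 1: "biadditive C C C (\<lambda>c c'. counit C (r \<unrhd>\<^bsub>C\<^esub> c) \<triangleright>\<^bsub>C\<^esub> c')"
    using r by (intro biadditiveI)
      (simp_all add: R_act additive_add[OF counit_additive] C.S_part.lact_add C.S_part.lact_add_scalar)
  have 2: "counit C (r \<unrhd>\<^bsub>C\<^esub> (c \<triangleleft>\<^bsub>C\<^esub> s)) \<triangleright>\<^bsub>C\<^esub> c' = counit C (r \<unrhd>\<^bsub>C\<^esub> c) \<triangleright>\<^bsub>C\<^esub> s \<triangleright>\<^bsub>C\<^esub> c'"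
    if "c \<in> carrier C" "s \<in> carrier S" "c' \<in> carrier C" for c s c'
    using r that by (simp add: C.ract_lactR[symmetric] counit_act C.S_part.lact_mult)
  show "additive (rtensor S C C) C (nu r)"
    unfolding nu_def by (rule rlift_additive[OF C_mod(1,2,3) 1, OF 2])
  show "\<lbrakk>c \<in> carrier C; c' \<in> carrier C\<rbrakk> \<Longrightarrow> nu r (pu C c c') = counit C (r \<unrhd>\<^bsub>C\<^esub> c) \<triangleright>\<^bsub>C\<^esub> c'"
    unfolding nu_def by (rule rlift_pure[OF C_mod(1,2,3) 1, OF 2])
qed

text \<open>This is left counitality for c r, since \<delta>(c r) = c_(1) r \<otimes> c_(2) and
  \<epsilon>(r c) = \<epsilon>(c r).\<close>

lemma nu_comul:
  assumes r: "r \<in> carrier R" and c: "c \<in> carrier C"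
  shows "nu r (comul C c) = c \<unlhd>\<^bsub>C\<^esub> r"
proof -
  have one: "nu \<one>\<^bsub>R\<^esub> (comul C c) = c" if "c \<in> carrier C" for c
    using C.counital_left[OF that] unfolding nu_def by (subst tlift_cong) (simp_all add: R_act)
  have "nu r t = nu \<one>\<^bsub>R\<^esub> (mapC C C (\<lambda>c. c \<unlhd>\<^bsub>C\<^esub> r) t)" if "t \<in> carrier (rtensor S C C)" for t
    by (rule NC_eq[OF C_mod(1) nu_additive[OF r] additive_compose[OF rlin_additive[OF mapC_rlin[OF C_mod(1) C_mod(1) ractR_lin(2)[OF r]]]
        nu_additive[OF R.one_closed]] _ that])
      (use r in \<open>simp add: nu_pure mapC_pure[OF C_mod(1) C_mod(1) ractR_lin(2)] R_act C.counit_R\<close>)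
  then show ?thesis using one[of "c \<unlhd>\<^bsub>C\<^esub> r"] r c by (simp add: comul_R)
qed

text \<open>The map $n \otimes c \mapsto (n \otimes c_{(1)}) \otimes c_{(2)}$.\<close>

definition split :: "('u, 'n) rmodule_scheme \<Rightarrow> 'u \<Rightarrow> 'u" where
  "split N z = rassoc S N C C (rtensor_map S N C N (bitensor S C C) (\<lambda>x. x) (comul C) z)"

lemma split:
  assumes N: "right_module S N"
  shows split_rlin: "rlin S (rtensor S N C) (rtensor S (rtensor S N C) C) (split N)"
    and split_pure: "\<lbrakk>n \<in> carrier N; c \<in> carrier C\<rbrakk>
      \<Longrightarrow> split N (pu N n c) = rassoc S N C C (rpure S N (bitensor S C C) n (comul C c))"
proof -
  have CC: "bimod S S (bitensor S C C)" by (rule bt_bimod[OF C_bimod C_bimod])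
  then have CCl: "left_module S (bitensor S C C)" by (simp add: bimod_def)
  show "rlin S (rtensor S N C) (rtensor S (rtensor S N C) C) (split N)"
    unfolding split_def
    by (rule rlin_compose[OF rtensor_map_rlin[OF N C_mod(2) N CCl rlin_id comul_lin(1) C_bimod CC comul_lin(2)]
          rassoc_rlin[OF N C_bimod C_bimod]])
  show "\<lbrakk>n \<in> carrier N; c \<in> carrier C\<rbrakk>
      \<Longrightarrow> split N (pu N n c) = rassoc S N C C (rpure S N (bitensor S C C) n (comul C c))"
    unfolding split_def by (simp add: rtensor_map_pure[OF N C_mod(2) N CCl rlin_id comul_lin(1)])
qed

lemma rassoc_C:
  assumes N: "right_module S N" and n: "n \<in> carrier N"
  shows "additive (rtensor S C C) (rtensor S (rtensor S N C) C) (\<lambda>t. rassoc S N C C (rpure S N (bitensor S C C) n t))"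
    and "\<lbrakk>c \<in> carrier C; c' \<in> carrier C\<rbrakk>
      \<Longrightarrow> rassoc S N C C (rpure S N (bitensor S C C) n (pu C c c')) = pu (rtensor S N C) (pu N n c) c'"
proof -
  have "left_module S (bitensor S C C)" using bt_bimod[OF C_bimod C_bimod] by (simp add: bimod_def)
  then have "additive (rtensor S C C) (rtensor S N (bitensor S C C)) (rpure S N (bitensor S C C) n)"
    using rpure_biadditive[OF N] n by (force simp: biadditive_def)
  then show "additive (rtensor S C C) (rtensor S (rtensor S N C) C) (\<lambda>t. rassoc S N C C (rpure S N (bitensor S C C) n t))"
    by (rule additive_compose[OF _ rlin_additive[OF rassoc_rlin[OF N C_bimod C_bimod]]])
qed (simp add: rassoc_pure[OF N C_bimod C_bimod n])

text \<open>How consequences of coassociativity are tested. \<open>split\<close> inserts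
  \<delta>(c), which is not pure, so h is first compared on all of C \<otimes> C with an auxiliary
  map \<open>g n\<close>, where pure tensors suffice, and \<open>g n\<close> is evaluated at
  \<delta>(c) afterwards.\<close>

lemma split_eq:
  assumes N: "right_module S N" and h: "additive (rtensor S (rtensor S N C) C) G h"
    and g: "\<And>n. n \<in> carrier N \<Longrightarrow> additive (rtensor S C C) G (g n)"
    and h': "additive (rtensor S N C) G h'"
    and hg: "\<And>n c c'. \<lbrakk>n \<in> carrier N; c \<in> carrier C; c' \<in> carrier C\<rbrakk> \<Longrightarrow> h (pu (rtensor S N C) (pu N n c) c') = g n (pu C c c')"
    and g': "\<And>n c. \<lbrakk>n \<in> carrier N; c \<in> carrier C\<rbrakk> \<Longrightarrow> g n (comul C c) = h' (pu N n c)"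
    and z: "z \<in> carrier (rtensor S N C)"
  shows "h (split N z) = h' z"
proof (rule NC_eq[OF N additive_compose[OF rlin_additive[OF split_rlin[OF N]] h] h' _ z])
  fix n c assume n: "n \<in> carrier N" and c: "c \<in> carrier C"
  have "h (rassoc S N C C (rpure S N (bitensor S C C) n (comul C c))) = g n (comul C c)"
    by (rule NC_eq[OF C_mod(1) additive_compose[OF rassoc_C(1)[OF N n] h] g[OF n] _ comul_closed[OF c]])
      (simp add: rassoc_C(2)[OF N n] hg n)
  then show "h (split N (pu N n c)) = h' (pu N n c)" by (simp add: split_pure[OF N n c] g' n c)
qed

text \<open>f touches only the first tensor factor and \<delta> only the others.\<close>

lemma split_natural:
  assumes N: "right_module S N" and N': "right_module S N'" and f: "rlin S N N' f" and z: "z \<in> carrier (rtensor S N C)"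
  shows "split N' (mapC N N' f z) = mapC (rtensor S N C) (rtensor S N' C) (mapC N N' f) (split N z)"
proof (rule split_eq[symmetric, OF N _ rassoc_C(1)[OF N' rlin_closed[OF f]] _ _ _ z])
  note f' = mapC_rlin[OF N N' f]
  show "additive (rtensor S (rtensor S N C) C) (rtensor S (rtensor S N' C) C) (mapC (rtensor S N C) (rtensor S N' C) (mapC N N' f))"
    by (rule rlin_additive[OF mapC_rlin[OF NC_mod[OF N] NC_mod[OF N'] f']])
  show "additive (rtensor S N C) (rtensor S (rtensor S N' C) C) (\<lambda>z. split N' (mapC N N' f z))"
    by (rule rlin_additive[OF rlin_compose[OF f' split_rlin[OF N']]])
qed (simp_all add: mapC_pure[OF NC_mod[OF N] NC_mod[OF N'] mapC_rlin[OF N N' f]] mapC_pure[OF N N' f] pu_closed[OF N]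
    rassoc_C(2)[OF N' rlin_closed[OF f]] split_pure[OF N' rlin_closed[OF f]])

text \<open>Counitality becomes the case r = \<one> of \<open>mu\<close>, in other words the unit
  law for the action of R.\<close>

lemma comodule_iff: "coalgebroid_comodule S C (X, \<xi>) \<longleftrightarrow>
     right_module S X \<and> \<xi> \<in> rhom S X (rtensor S X C) \<and>
     (\<forall>x \<in> carrier X. mapC X (rtensor S X C) \<xi> (\<xi> x) = split X (\<xi> x)) \<and>
     (\<forall>x \<in> carrier X. mu X \<one>\<^bsub>R\<^esub> (\<xi> x) = x)"
proof -
  have "rlift S X C X (\<lambda>x c. x \<triangleleft>\<^bsub>X\<^esub> counit C c) = mu X \<one>\<^bsub>R\<^esub>"
    unfolding mu_def by (rule tlift_cong) (simp add: R_act)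
  then show ?thesis by (simp add: coalgebroid_comodule_def split_def)
qed

section \<open>The bimodule structure of a comodule\<close>

context
  fixes X :: "'u rmodule" and \<xi> :: "'u \<Rightarrow> 'u"
  assumes comodule: "coalgebroid_comodule S C (X, \<xi>)"
begin

lemma X_mod: "right_module S X" and \<xi>_hom: "\<xi> \<in> rhom S X (rtensor S X C)"
  and \<xi>_coassoc: "x \<in> carrier X \<Longrightarrow> mapC X (rtensor S X C) \<xi> (\<xi> x) = split X (\<xi> x)"
  and \<xi>_counit: "x \<in> carrier X \<Longrightarrow> mu X \<one>\<^bsub>R\<^esub> (\<xi> x) = x"
  using comodule by (auto simp: comodule_iff)

lemma \<xi>_rlin: "rlin S X (rtensor S X C) \<xi>"
  by (rule rhom_rlin[OF \<xi>_hom])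

interpretation X: right_module S X by (rule X_mod)

definition act where "act r x = mu X r (\<xi> x)"

lemma act_rlin: "r \<in> carrier R \<Longrightarrow> rlin S X X (act r)"
  unfolding act_def by (rule rlin_compose[OF \<xi>_rlin mu_rlin[OF X_mod]])

text \<open>By naturality of \<open>mu\<close> and coassociativity the left side is the sum of x_(0)
  \<otimes> x_(1) \<epsilon>(r x_(2)), and \<open>mu_comul\<close> contracts the last two factors to
  r x_(1).\<close>

lemma \<xi>_act:
  assumes r: "r \<in> carrier R" and x: "x \<in> carrier X"
  shows "\<xi> (act r x) = mapR X (lactR C r) (\<xi> x)"
proof -
  have XC: "right_module S (rtensor S X C)" by (rule NC_mod[OF X_mod])
  have "\<xi> (act r x) = mu (rtensor S X C) r (mapC X (rtensor S X C) \<xi> (\<xi> x))"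
    unfolding act_def by (rule mu_natural[OF X_mod XC \<xi>_rlin r rlin_closed[OF \<xi>_rlin x]])
  also have "\<dots> = mu (rtensor S X C) r (split X (\<xi> x))" by (simp add: \<xi>_coassoc x)
  also have "\<dots> = mapR X (lactR C r) (\<xi> x)"
  proof (rule split_eq[where g = "\<lambda>n t. pu X n (mu C r t)", OF X_mod rlin_additive[OF mu_rlin[OF XC r]] _ mapR_additive[OF X_mod lactR_lin(1)[OF r]] _ _ rlin_closed[OF \<xi>_rlin x]])
    show "additive (rtensor S C C) (rtensor S X C) (\<lambda>t. pu X n (mu C r t))" if "n \<in> carrier X" for n
      using that by (intro additiveI)
        (simp_all add: pu_closed[OF X_mod] pu_add[OF X_mod] rlin_closed[OF mu_rlin[OF C_mod(1) r]] rlin_add[OF mu_rlin[OF C_mod(1) r]])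
  qed (use r in \<open>simp_all add: mu_pure[OF XC] mu_pure[OF C_mod(1)] mu_comul pu_closed[OF X_mod] pu_ract[OF X_mod] mapR_pure[OF X_mod lactR_lin(1)]\<close>)
  finally show ?thesis .
qed

text \<open>The same with \<epsilon> on the middle factor: x_(0) \<epsilon>(r x_(1)) \<otimes> x_(2)
  equals x_(0) \<otimes> \<epsilon>(r x_(1)) x_(2), and \<open>nu_comul\<close> applies. Thus \<xi>
  takes values in a product of Takeuchi type; this is what later allows y to be balanced in
  A.\<close>

lemma act_\<xi>:
  assumes r: "r \<in> carrier R" and x: "x \<in> carrier X"
  shows "mapC X X (act r) (\<xi> x) = mapR X (\<lambda>c. c \<unlhd>\<^bsub>C\<^esub> r) (\<xi> x)"
proof -
  have XC: "right_module S (rtensor S X C)" by (rule NC_mod[OF X_mod])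
  note m = mu_rlin[OF X_mod r]
  have "mapC X X (act r) (\<xi> x) = mapC (rtensor S X C) X (mu X r) (mapC X (rtensor S X C) \<xi> (\<xi> x))"
    unfolding act_def by (rule mapC_comp[symmetric, OF X_mod XC X_mod \<xi>_rlin m rlin_closed[OF \<xi>_rlin x]])
  also have "\<dots> = mapC (rtensor S X C) X (mu X r) (split X (\<xi> x))" by (simp add: \<xi>_coassoc x)
  also have "\<dots> = mapR X (\<lambda>c. c \<unlhd>\<^bsub>C\<^esub> r) (\<xi> x)"
  proof (rule split_eq[where g = "\<lambda>n t. pu X n (nu r t)", OF X_mod rlin_additive[OF mapC_rlin[OF XC X_mod m]] _ mapR_additive[OF X_mod ractR_lin(1)[OF r]] _ _ rlin_closed[OF \<xi>_rlin x]])
    show "additive (rtensor S C C) (rtensor S X C) (\<lambda>t. pu X n (nu r t))" if "n \<in> carrier X" for n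
      using that by (intro additiveI)
        (simp_all add: pu_closed[OF X_mod] pu_add[OF X_mod] additive_closed[OF nu_additive[OF r]] additive_add[OF nu_additive[OF r]])
  qed (use r in \<open>simp_all add: mapC_pure[OF XC X_mod m] mu_pure[OF X_mod] nu_pure nu_comul pu_closed[OF X_mod] pu_balanced[OF X_mod] mapR_pure[OF X_mod ractR_lin(1)]\<close>)
  finally show ?thesis .
qed

definition Xb :: "'u bimodule" where "Xb = rmodule.extend X (bimodule.fields act)"

lemma Xb_simps [simp]:
  "carrier Xb = carrier X" "(\<oplus>\<^bsub>Xb\<^esub>) = (\<oplus>\<^bsub>X\<^esub>)" "\<zero>\<^bsub>Xb\<^esub> = \<zero>\<^bsub>X\<^esub>" "ract Xb = ract X" "lact Xb = act"
  by (simp_all add: Xb_def rmodule.defs bimodule.defs)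

text \<open>Associativity of the action follows from \<open>\<xi>_act\<close>, the unit law from
  counitality, and compatibility with S from the linearity of each map \<open>act r\<close>.\<close>

lemma Xb_bimod: "bimod R S Xb"
proof -
  interpret Xb: abelian_group Xb
    by (rule same_group_abelian[OF _ X.M.abelian_group_axioms]) (simp add: same_group_def)
  note al = rlin_closed[OF act_rlin] rlin_add[OF act_rlin] rlin_ract[OF act_rlin]
  have \<xi>c: "x \<in> carrier X \<Longrightarrow> \<xi> x \<in> carrier (rtensor S X C)" for x by (rule rlin_closed[OF \<xi>_rlin])
  have mult: "act (r \<otimes>\<^bsub>R\<^esub> r') x = act r (act r' x)" if "r \<in> carrier R" "r' \<in> carrier R" "x \<in> carrier X" for r r' x
    using that by (simp add: act_def[of r] act_def[of "r \<otimes>\<^bsub>R\<^esub> r'"] \<xi>_act mu_mapR[OF X_mod] \<xi>c)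
  have plus: "act (r \<oplus>\<^bsub>R\<^esub> r') x = act r x \<oplus>\<^bsub>X\<^esub> act r' x" if r: "r \<in> carrier R" "r' \<in> carrier R" and x: "x \<in> carrier X" for r r' x
    unfolding act_def
    by (rule NC_eq[OF X_mod rlin_additive[OF mu_rlin[OF X_mod]] additive_sum_maps[OF rlin_additive[OF mu_rlin[OF X_mod r(1)]]
          rlin_additive[OF mu_rlin[OF X_mod r(2)]] X.M.abelian_group_axioms] _ \<xi>c[OF x]])
      (use r in \<open>simp_all add: mu_pure[OF X_mod] R_act additive_add[OF counit_additive] X.ract_add_scalar\<close>)
  have "left_module R Xb"
    by unfold_locales (simp_all add: al mult plus, simp add: act_def \<xi>_counit)
  moreover have "right_module S Xb"
    by unfold_locales (simp_all add: X.ract_closed X.ract_add X.ract_add_scalar X.ract_mult X.ract_one)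
  ultimately show ?thesis by (simp add: bimod_def al)
qed

text \<open>A scalar acts on C alike through R and through S, \<epsilon> is S-linear, and scalars
  are central in S.\<close>

lemma Xb_central: "\<lbrakk>a \<in> carrier k; x \<in> carrier X\<rbrakk> \<Longrightarrow> act (scal R a) x = x \<triangleleft>\<^bsub>X\<^esub> scal S a"
proof -
  assume a: "a \<in> carrier k" and x: "x \<in> carrier X"
  have sc: "scal R a \<in> carrier R" "scal S a \<in> carrier S"
    using a by (simp_all add: scal_def R.smult_closed S.smult_closed)
  have comm: "scal S a \<otimes>\<^bsub>S\<^esub> s = s \<otimes>\<^bsub>S\<^esub> scal S a" if "s \<in> carrier S" for s
    using a that by (simp add: scal_def S.smult_mult_left S.smult_mult_right)
  have add: "additive X X (\<lambda>x. x \<triangleleft>\<^bsub>X\<^esub> scal S a)"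
    using sc by (intro additiveI) (simp_all add: X.ract_closed X.ract_add)
  have "mu X (scal R a) (\<xi> x) = mu X \<one>\<^bsub>R\<^esub> (\<xi> x) \<triangleleft>\<^bsub>X\<^esub> scal S a"
    by (rule NC_eq[OF X_mod rlin_additive[OF mu_rlin[OF X_mod sc(1)]]
          additive_compose[OF rlin_additive[OF mu_rlin[OF X_mod R.one_closed]] add] _ rlin_closed[OF \<xi>_rlin x]])
      (use a sc in \<open>simp add: mu_pure[OF X_mod] R_act C.k_actions_agree counit_act comm X.ract_mult\<close>)
  then show ?thesis by (simp add: act_def \<xi>_counit x)
qed

end

end

section \<open>Equivalences of categories\<close>

text \<open>Full faithfulness together with essential surjectivity.\<close>

definition weak_equivalence :: "('o, 'm) cat \<Rightarrow> ('p, 'n) cat \<Rightarrow> ('o, 'm, 'p, 'n) ftor \<Rightarrow> bool" where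
  "weak_equivalence A B F \<longleftrightarrow> cat_functor A B F \<and>
     (\<forall>x \<in> Obj A. \<forall>y \<in> Obj A. bij_betw (fhom F x y) (Hom A x y) (Hom B (fob F x) (fob F y))) \<and>
     (\<forall>b \<in> Obj B. \<exists>a \<in> Obj A. \<exists>e. is_iso B (fob F a) b e)"

text \<open>Choose for every b an object \<open>g0 b\<close> with an isomorphism \<open>e b\<close>
  from its image to b, and let G act on maps by conjugation with these isomorphisms followed by the
  inverse of F on hom-sets. That G is again a weak equivalence allows inverses to be composed with
  further ones.\<close>

lemma weak_equivalence_inverse:
  assumes F: "weak_equivalence A B F"
  obtains G where "weak_equivalence B A G"
    and "naturally_isomorphic A A (comp_ftor G F) id_ftor"
    and "naturally_isomorphic B B (comp_ftor F G) id_ftor"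
proof -
  interpret F: cat_functor A B F using F by (simp add: weak_equivalence_def)
  have "\<forall>b \<in> Obj B. \<exists>a e d. a \<in> Obj A \<and> e \<in> Hom B (fob F a) b \<and> d \<in> Hom B b (fob F a) \<and>
    Cmp B (fob F a) b (fob F a) d e = Idn B (fob F a) \<and> Cmp B b (fob F a) b e d = Idn B b"
    using F unfolding weak_equivalence_def is_iso_def by metis
  then obtain g0 e d where g0: "\<And>b. b \<in> Obj B \<Longrightarrow> g0 b \<in> Obj A"
    and ed: "\<And>b. b \<in> Obj B \<Longrightarrow> e b \<in> Hom B (fob F (g0 b)) b" "\<And>b. b \<in> Obj B \<Longrightarrow> d b \<in> Hom B b (fob F (g0 b))"
    and de: "\<And>b. b \<in> Obj B \<Longrightarrow> Cmp B (fob F (g0 b)) b (fob F (g0 b)) (d b) (e b) = Idn B (fob F (g0 b))"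
      "\<And>b. b \<in> Obj B \<Longrightarrow> Cmp B b (fob F (g0 b)) b (e b) (d b) = Idn B b"
    by metis
  note ob = F.fob_closed g0
  have de': "Cmp B w b (fob F (g0 b)) (d b) (Cmp B w (fob F (g0 b)) b (e b) f) = f"
    if "b \<in> Obj B" "w \<in> Obj B" "f \<in> Hom B w (fob F (g0 b))" for b w f
    using that ob ed de by (simp add: F.cod.Cmp_assoc[symmetric] F.cod.Cmp_Idn_left)
  have ed': "Cmp B w (fob F (g0 b)) b (e b) (Cmp B w b (fob F (g0 b)) (d b) f) = f"
    if "b \<in> Obj B" "w \<in> Obj B" "f \<in> Hom B w b" for b w f
    using that ob ed de by (simp add: F.cod.Cmp_assoc[symmetric] F.cod.Cmp_Idn_left)
  let ?i = "\<lambda>x y. inv_into (Hom A x y) (fhom F x y)"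
  have bij: "bij_betw (fhom F x y) (Hom A x y) (Hom B (fob F x) (fob F y))" if "x \<in> Obj A" "y \<in> Obj A" for x y
    using F that by (simp add: weak_equivalence_def)
  have i_cl: "?i x y h \<in> Hom A x y" and Fi: "fhom F x y (?i x y h) = h"
    if "x \<in> Obj A" "y \<in> Obj A" "h \<in> Hom B (fob F x) (fob F y)" for x y h
    using bij_betw_imp_surj_on[OF bij[OF that(1,2)]] that(3) by (metis inv_into_into, metis f_inv_into_f)
  have inj: "f = f'" if "x \<in> Obj A" "y \<in> Obj A" "f \<in> Hom A x y" "f' \<in> Hom A x y" "fhom F x y f = fhom F x y f'" for x y f f'
    using bij_betw_imp_inj_on[OF bij[OF that(1,2)]] that(3-5) by (simp add: inj_on_def)
  \<comment> \<open>\<open>h\<close> conjugated by the chosen isomorphisms: the map in the image of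
    F whose preimage G takes.\<close>
  define c where "c b b' h = Cmp B (fob F (g0 b)) b' (fob F (g0 b')) (d b') (Cmp B (fob F (g0 b)) b b' h (e b))" for b b' h
  have c_cl: "c b b' h \<in> Hom B (fob F (g0 b)) (fob F (g0 b'))" if "b \<in> Obj B" "b' \<in> Obj B" "h \<in> Hom B b b'" for b b' h
    unfolding c_def using that ob ed by (simp add: F.cod.Cmp_closed)
  define G where "G = \<lparr>fob = g0, fhom = (\<lambda>b b' h. ?i (g0 b) (g0 b') (c b b' h))\<rparr>"
  have [simp]: "fob G = g0" by (simp add: G_def)
  have G_cl: "fhom G b b' h \<in> Hom A (g0 b) (g0 b')" and FG: "fhom F (g0 b) (g0 b') (fhom G b b' h) = c b b' h"
    if "b \<in> Obj B" "b' \<in> Obj B" "h \<in> Hom B b b'" for b b' h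
    using i_cl[OF g0[OF that(1)] g0[OF that(2)] c_cl[OF that]] Fi[OF g0[OF that(1)] g0[OF that(2)] c_cl[OF that]]
    by (simp_all add: G_def)
  have G: "cat_functor B A G"
  proof
    fix b assume b: "b \<in> Obj B"
    show "fob G b \<in> Obj A" using g0 b by simp
    have "fhom G b b (Idn B b) = Idn A (g0 b)"
      by (rule inj[OF g0[OF b] g0[OF b]])
        (use b g0 in \<open>simp_all add: G_cl FG F.cod.Idn_closed F.dom.Idn_closed F.fhom_Idn c_def F.cod.Cmp_Idn_left ob ed de\<close>)
    then show "fhom G b b (Idn B b) = Idn A (fob G b)" by simp
  next
    fix x y f assume "x \<in> Obj B" "y \<in> Obj B" "f \<in> Hom B x y"
    then show "fhom G x y f \<in> Hom A (fob G x) (fob G y)" by (simp add: G_cl)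
  next
    fix x y z f g assume *: "x \<in> Obj B" "y \<in> Obj B" "z \<in> Obj B" "f \<in> Hom B x y" "g \<in> Hom B y z"
    have gf: "Cmp B x y z g f \<in> Hom B x z" using * by (simp add: F.cod.Cmp_closed)
    have "fhom G x z (Cmp B x y z g f) = Cmp A (g0 x) (g0 y) (g0 z) (fhom G y z g) (fhom G x y f)"
    proof (rule inj[OF g0[OF *(1)] g0[OF *(3)]])
      show "fhom F (g0 x) (g0 z) (fhom G x z (Cmp B x y z g f)) =
        fhom F (g0 x) (g0 z) (Cmp A (g0 x) (g0 y) (g0 z) (fhom G y z g) (fhom G x y f))"
        using * gf by (simp add: FG G_cl F.fhom_Cmp ob c_def F.cod.Cmp_assoc F.cod.Cmp_closed ed ed')
    qed (use * gf in \<open>simp_all add: G_cl F.dom.Cmp_closed g0\<close>)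
    then show "fhom G x z (Cmp B x y z g f) = Cmp A (fob G x) (fob G y) (fob G z) (fhom G y z g) (fhom G x y f)" by simp
  qed
  have iso2: "naturally_isomorphic B B (comp_ftor F G) id_ftor"
    unfolding naturally_isomorphic_def
  proof (intro bexI[of _ "restrict e (Obj B)"] ballI)
    show "restrict e (Obj B) \<in> nat_trans B B (comp_ftor F G) id_ftor"
      by (auto simp: nat_trans_def comp_ftor_def id_ftor_def ed FG c_def ed' ob F.cod.Cmp_closed)
    show "is_iso B (fob (comp_ftor F G) b) (fob id_ftor b) (restrict e (Obj B) b)" if "b \<in> Obj B" for b
      using that ed de by (auto simp: is_iso_def comp_ftor_def id_ftor_def intro: bexI[of _ "d b"])
  qed
  define t where "t a = ?i (g0 (fob F a)) a (e (fob F a))" for a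
  define t' where "t' a = ?i a (g0 (fob F a)) (d (fob F a))" for a
  have t: "t a \<in> Hom A (g0 (fob F a)) a" "fhom F (g0 (fob F a)) a (t a) = e (fob F a)"
    and t': "t' a \<in> Hom A a (g0 (fob F a))" "fhom F a (g0 (fob F a)) (t' a) = d (fob F a)" if "a \<in> Obj A" for a
    unfolding t_def t'_def using i_cl Fi ob ed that by simp_all
  have t_iso: "is_iso A (g0 (fob F a)) a (t a)" if a: "a \<in> Obj A" for a
  proof -
    have "Cmp A (g0 (fob F a)) a (g0 (fob F a)) (t' a) (t a) = Idn A (g0 (fob F a))"
      by (rule inj[of "g0 (fob F a)" "g0 (fob F a)"]) (use a in \<open>simp_all add: ob t t' F.dom.Cmp_closed F.dom.Idn_closed F.fhom_Cmp F.fhom_Idn de\<close>)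
    moreover have "Cmp A a (g0 (fob F a)) a (t a) (t' a) = Idn A a"
      by (rule inj[of a a]) (use a in \<open>simp_all add: ob t t' F.dom.Cmp_closed F.dom.Idn_closed F.fhom_Cmp F.fhom_Idn de\<close>)
    ultimately show ?thesis using t(1)[OF a] t'(1)[OF a] by (auto simp: is_iso_def)
  qed
  have iso1: "naturally_isomorphic A A (comp_ftor G F) id_ftor"
    unfolding naturally_isomorphic_def
  proof (intro bexI[of _ "restrict t (Obj A)"] ballI)
    have "Cmp A (g0 (fob F x)) x y f (t x) = Cmp A (g0 (fob F x)) (g0 (fob F y)) y (t y) (fhom G (fob F x) (fob F y) (fhom F x y f))"
      if "x \<in> Obj A" "y \<in> Obj A" "f \<in> Hom A x y" for x y f
      by (rule inj[of "g0 (fob F x)" y]) (use that in \<open>simp_all add: ob t G_cl FG F.fhom_closed F.dom.Cmp_closed F.fhom_Cmp c_def ed' ed F.cod.Cmp_closed\<close>)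
    then show "restrict t (Obj A) \<in> nat_trans A A (comp_ftor G F) id_ftor"
      by (auto simp: nat_trans_def comp_ftor_def id_ftor_def t)
    show "is_iso A (fob (comp_ftor G F) a) (fob id_ftor a) (restrict t (Obj A) a)" if "a \<in> Obj A" for a
      using t_iso[OF that] that by (simp add: comp_ftor_def id_ftor_def)
  qed
  have "bij_betw (fhom G x y) (Hom B x y) (Hom A (g0 x) (g0 y))" if x: "x \<in> Obj B" and y: "y \<in> Obj B" for x y
  \<comment> \<open>The inverse of G on maps is conjugation in the opposite direction, applied after
    F.\<close>
  proof (rule bij_betwI[where g = "\<lambda>f. Cmp B x (fob F (g0 y)) y (e y) (Cmp B x (fob F (g0 x)) (fob F (g0 y)) (fhom F (g0 x) (g0 y) f) (d x))"])
    show "fhom G x y \<in> Hom B x y \<rightarrow> Hom A (g0 x) (g0 y)" using x y by (simp add: G_cl)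
    show "(\<lambda>f. Cmp B x (fob F (g0 y)) y (e y) (Cmp B x (fob F (g0 x)) (fob F (g0 y)) (fhom F (g0 x) (g0 y) f) (d x)))
      \<in> Hom A (g0 x) (g0 y) \<rightarrow> Hom B x y"
      using x y by (auto simp: F.cod.Cmp_closed ob ed F.fhom_closed)
  next
    fix h assume h: "h \<in> Hom B x y"
    show "Cmp B x (fob F (g0 y)) y (e y) (Cmp B x (fob F (g0 x)) (fob F (g0 y)) (fhom F (g0 x) (g0 y) (fhom G x y h)) (d x)) = h"
      using x y h by (simp add: FG c_def F.cod.Cmp_assoc F.cod.Cmp_closed ob ed ed' de F.cod.Cmp_Idn_right)
  next
    fix f assume f: "f \<in> Hom A (g0 x) (g0 y)"
    let ?h = "Cmp B x (fob F (g0 y)) y (e y) (Cmp B x (fob F (g0 x)) (fob F (g0 y)) (fhom F (g0 x) (g0 y) f) (d x))"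
    have h: "?h \<in> Hom B x y" using x y f by (simp add: F.cod.Cmp_closed ob ed F.fhom_closed)
    show "fhom G x y ?h = f"
      by (rule inj[OF g0[OF x] g0[OF y] G_cl[OF x y h] f])
        (use x y f h in \<open>simp add: FG c_def F.cod.Cmp_assoc F.cod.Cmp_closed F.fhom_closed ob ed de' de F.cod.Cmp_Idn_right\<close>)
  qed
  then have "weak_equivalence B A G"
    using G t_iso ob by (fastforce simp: weak_equivalence_def)
  then show ?thesis using that iso1 iso2 by blast
qed

lemma weak_equivalence_equivalent: "weak_equivalence A B F \<Longrightarrow> equivalent_categories A B"
  unfolding equivalent_categories_def by (metis weak_equivalence_inverse weak_equivalence_def)

lemma equivalent_categories_sym: "equivalent_categories A B \<Longrightarrow> equivalent_categories B A"
  unfolding equivalent_categories_def by blast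

lemma weak_equivalence_comp:
  assumes F: "weak_equivalence A B F" and G: "weak_equivalence B D G"
  shows "weak_equivalence A D (comp_ftor G F)"
proof -
  interpret F: cat_functor A B F using F by (simp add: weak_equivalence_def)
  interpret G: cat_functor B D G using G by (simp add: weak_equivalence_def)
  have "cat_functor A D (comp_ftor G F)"
    by unfold_locales (simp_all add: F.fob_closed G.fob_closed F.fhom_closed G.fhom_closed F.fhom_Idn G.fhom_Idn F.fhom_Cmp G.fhom_Cmp)
  moreover have "bij_betw (fhom (comp_ftor G F) x y) (Hom A x y) (Hom D (fob (comp_ftor G F) x) (fob (comp_ftor G F) y))"
    if "x \<in> Obj A" "y \<in> Obj A" for x y
    using bij_betw_trans[of "fhom F x y" "Hom A x y" "Hom B (fob F x) (fob F y)" "fhom G (fob F x) (fob F y)"] F G that F.fob_closed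
    by (simp add: weak_equivalence_def comp_def comp_ftor_def)
  moreover have "\<exists>a \<in> Obj A. \<exists>e. is_iso D (fob (comp_ftor G F) a) z e" if z: "z \<in> Obj D" for z
  proof -
    obtain b u where b: "b \<in> Obj B" "is_iso D (fob G b) z u" using G z by (auto simp: weak_equivalence_def)
    obtain a v where a: "a \<in> Obj A" "is_iso B (fob F a) b v" using F b by (auto simp: weak_equivalence_def)
    obtain u' v' where u: "u \<in> Hom D (fob G b) z" "u' \<in> Hom D z (fob G b)" "Cmp D (fob G b) z (fob G b) u' u = Idn D (fob G b)" "Cmp D z (fob G b) z u u' = Idn D z"
      and v: "v \<in> Hom B (fob F a) b" "v' \<in> Hom B b (fob F a)" "Cmp B (fob F a) b (fob F a) v' v = Idn B (fob F a)" "Cmp B b (fob F a) b v v' = Idn B b"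
      using a b by (auto simp: is_iso_def)
    let ?x = "fob G (fob F a)" and ?y = "fob G b"
    let ?V = "fhom G (fob F a) b v" and ?V' = "fhom G b (fob F a) v'"
    note ob = F.fob_closed[OF a(1)] b(1) z G.fob_closed[OF b(1)] G.fob_closed[OF F.fob_closed[OF a(1)]]
    have V: "?V \<in> Hom D ?x ?y" "?V' \<in> Hom D ?y ?x" using ob v by (simp_all add: G.fhom_closed)
    have VV: "Cmp D ?x ?y ?x ?V' ?V = Idn D ?x" "Cmp D ?y ?x ?y ?V ?V' = Idn D ?y"
      using ob v by (simp_all add: G.fhom_Cmp[symmetric] G.fhom_Idn)
    have "Cmp D ?x z ?x (Cmp D z ?y ?x ?V' u') (Cmp D ?x ?y z u ?V) = Cmp D ?x ?y ?x ?V' (Cmp D ?x ?y ?y (Cmp D ?y z ?y u' u) ?V)"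
      using ob u(1,2) V by (simp add: G.cod.Cmp_assoc G.cod.Cmp_closed)
    also have "\<dots> = Idn D ?x" using ob u V VV by (simp add: G.cod.Cmp_Idn_left)
    finally have 1: "Cmp D ?x z ?x (Cmp D z ?y ?x ?V' u') (Cmp D ?x ?y z u ?V) = Idn D ?x" .
    have "Cmp D z ?x z (Cmp D ?x ?y z u ?V) (Cmp D z ?y ?x ?V' u') = Cmp D z ?y z u (Cmp D z ?y ?y (Cmp D ?y ?x ?y ?V ?V') u')"
      using ob u(1,2) V by (simp add: G.cod.Cmp_assoc G.cod.Cmp_closed)
    also have "\<dots> = Idn D z" using ob u V VV by (simp add: G.cod.Cmp_Idn_left)
    finally have "is_iso D ?x z (Cmp D ?x ?y z u ?V)"
      unfolding is_iso_def using 1 ob u V by (auto intro!: bexI[of _ "Cmp D z ?y ?x ?V' u'"] simp: G.cod.Cmp_closed)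
    then show ?thesis using a(1) by auto
  qed
  ultimately show ?thesis by (simp add: weak_equivalence_def)
qed

text \<open>The comparison runs through D: forwards along the one functor, then back along a chosen
  inverse of the other.\<close>

lemma equivalent_via:
  assumes "weak_equivalence A D F" "weak_equivalence B D G"
  shows "equivalent_categories A B"
proof -
  obtain G' where "weak_equivalence D B G'"
    using weak_equivalence_inverse[OF assms(2)] by metis
  from weak_equivalence_comp[OF assms(1) this] show ?thesis
    by (rule weak_equivalence_equivalent)
qed

section \<open>A common form of the two kinds of comodules\<close>

text \<open>Both an opmonoidal comodule and an oplax morphism consist of maps $Y(A * M) \to Y(A) \mathbin{\#} M$,
  where $A * M$ is \<^term>\<open>star A M\<close>, generated by elements $a * m$ (\<^term>\<open>sp A M a m\<close>), and
  $N \mathbin{\#} M$ is \<^term>\<open>sharp N M\<close>, generated by elements $n \mathbin{\#} m \mathbin{\#} c$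
  (\<^term>\<open>shp N M n m c\<close>).  In the former case the modules \<^term>\<open>M\<close> are $R$-bimodules,
  $A * M = A \otimes_R M$ and $N \mathbin{\#} M = N \otimes_S F(M)$; in the latter they are right
  $R$-modules, $A * M = A \otimes M$ and $N \mathbin{\#} M = (N \otimes M) \otimes_{S \otimes R} C$.
  The set \<^term>\<open>Z\<close> consists of the scalars over which $A * M$ is balanced, which act on \<^term>\<open>M\<close>
  from the left by \<^term>\<open>la M\<close>, and \<^term>\<open>M0\<close> is freely generated by \<^term>\<open>u0\<close>, so that
  \<^term>\<open>N\<close> $\#$ \<^term>\<open>M0\<close> is $N \otimes_S C$ by way of \<^term>\<open>kap N\<close>.\<close>

locale comodule_scheme = coalgebroid_setting k R S C
  for k :: "'k ring" and R S :: "('k, 'u) module" and C :: "'u coalg" +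
  fixes Z :: "'u set"
    and IOb :: "('u, 'x) rmodule_scheme set"
    and ihom :: "('u, 'x) rmodule_scheme \<Rightarrow> ('u, 'x) rmodule_scheme \<Rightarrow> ('u \<Rightarrow> 'u) set"
    and la :: "('u, 'x) rmodule_scheme \<Rightarrow> 'u \<Rightarrow> 'u \<Rightarrow> 'u"
    and star :: "'u rmodule \<Rightarrow> ('u, 'x) rmodule_scheme \<Rightarrow> 'u rmodule"
    and sp :: "'u rmodule \<Rightarrow> ('u, 'x) rmodule_scheme \<Rightarrow> 'u \<Rightarrow> 'u \<Rightarrow> 'u"
    and smap :: "'u rmodule \<Rightarrow> ('u, 'x) rmodule_scheme \<Rightarrow> 'u rmodule \<Rightarrow> ('u, 'x) rmodule_scheme
      \<Rightarrow> ('u \<Rightarrow> 'u) \<Rightarrow> ('u \<Rightarrow> 'u) \<Rightarrow> 'u \<Rightarrow> 'u"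
    and istar :: "('u, 'x) rmodule_scheme \<Rightarrow> ('u, 'x) rmodule_scheme \<Rightarrow> ('u, 'x) rmodule_scheme"
    and ip :: "('u, 'x) rmodule_scheme \<Rightarrow> ('u, 'x) rmodule_scheme \<Rightarrow> 'u \<Rightarrow> 'u \<Rightarrow> 'u"
    and sassoc :: "'u rmodule \<Rightarrow> ('u, 'x) rmodule_scheme \<Rightarrow> ('u, 'x) rmodule_scheme \<Rightarrow> 'u \<Rightarrow> 'u"
    and iunit :: "('u, 'x) rmodule_scheme"
    and srunit :: "'u rmodule \<Rightarrow> 'u \<Rightarrow> 'u"
    and sharp :: "'u rmodule \<Rightarrow> ('u, 'x) rmodule_scheme \<Rightarrow> 'u rmodule"
    and shp :: "'u rmodule \<Rightarrow> ('u, 'x) rmodule_scheme \<Rightarrow> 'u \<Rightarrow> 'u \<Rightarrow> 'u \<Rightarrow> 'u"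
    and shmap :: "'u rmodule \<Rightarrow> ('u, 'x) rmodule_scheme \<Rightarrow> 'u rmodule \<Rightarrow> ('u, 'x) rmodule_scheme
      \<Rightarrow> ('u \<Rightarrow> 'u) \<Rightarrow> ('u \<Rightarrow> 'u) \<Rightarrow> 'u \<Rightarrow> 'u"
    and sh2 :: "'u rmodule \<Rightarrow> ('u, 'x) rmodule_scheme \<Rightarrow> ('u, 'x) rmodule_scheme \<Rightarrow> 'u \<Rightarrow> 'u"
    and sh0 :: "'u rmodule \<Rightarrow> 'u \<Rightarrow> 'u"
    and M0 :: "('u, 'x) rmodule_scheme" and u0 :: 'u
    and kap :: "'u rmodule \<Rightarrow> 'u \<Rightarrow> 'u"
  assumes Z_sub: "Z \<subseteq> carrier R"
    and IOb_mod: "M \<in> IOb \<Longrightarrow> right_module R M"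
    and la_closed: "\<lbrakk>M \<in> IOb; r \<in> Z; m \<in> carrier M\<rbrakk> \<Longrightarrow> la M r m \<in> carrier M"
    and ihom_sub: "\<lbrakk>M \<in> IOb; M' \<in> IOb; g \<in> ihom M M'\<rbrakk> \<Longrightarrow> g \<in> rhom R M M'"
    and ihom_id: "M \<in> IOb \<Longrightarrow> (\<lambda>m \<in> carrier M. m) \<in> ihom M M"
    and star_mod: "\<lbrakk>right_module R A; M \<in> IOb\<rbrakk> \<Longrightarrow> right_module R (star A M)"
    and sp_biadd: "\<lbrakk>right_module R A; M \<in> IOb\<rbrakk> \<Longrightarrow> biadditive A M (star A M) (sp A M)"
    and sp_ract: "\<lbrakk>right_module R A; M \<in> IOb; a \<in> carrier A; m \<in> carrier M; r \<in> carrier R\<rbrakk>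
      \<Longrightarrow> sp A M a m \<triangleleft>\<^bsub>star A M\<^esub> r = sp A M a (m \<triangleleft>\<^bsub>M\<^esub> r)"
    and star_eq: "\<And>A M (G :: 'u rmodule) h h' z. \<lbrakk>right_module R A; M \<in> IOb; additive (star A M) G h; additive (star A M) G h';
        \<And>a m. \<lbrakk>a \<in> carrier A; m \<in> carrier M\<rbrakk> \<Longrightarrow> h (sp A M a m) = h' (sp A M a m); z \<in> carrier (star A M)\<rbrakk>
      \<Longrightarrow> h z = h' z"
    and star_lift: "\<And>A M (G :: 'u rmodule) f. \<lbrakk>right_module R A; M \<in> IOb; abelian_group G; biadditive A M G f;
        \<And>a r m. \<lbrakk>a \<in> carrier A; r \<in> Z; m \<in> carrier M\<rbrakk> \<Longrightarrow> f (a \<triangleleft>\<^bsub>A\<^esub> r) m = f a (la M r m)\<rbrakk>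
      \<Longrightarrow> \<exists>h. additive (star A M) G h \<and> (\<forall>a \<in> carrier A. \<forall>m \<in> carrier M. h (sp A M a m) = f a m)"
    and smap_hom: "\<lbrakk>right_module R A; right_module R A'; M \<in> IOb; M' \<in> IOb; f \<in> rhom R A A'; g \<in> ihom M M'\<rbrakk>
      \<Longrightarrow> smap A M A' M' f g \<in> rhom R (star A M) (star A' M')"
    and smap_sp: "\<lbrakk>right_module R A; right_module R A'; M \<in> IOb; M' \<in> IOb; f \<in> rhom R A A'; g \<in> ihom M M';
        a \<in> carrier A; m \<in> carrier M\<rbrakk> \<Longrightarrow> smap A M A' M' f g (sp A M a m) = sp A' M' (f a) (g m)"
    and istar_ob: "\<lbrakk>M \<in> IOb; M' \<in> IOb\<rbrakk> \<Longrightarrow> istar M M' \<in> IOb"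
    and ip_closed: "\<lbrakk>M \<in> IOb; M' \<in> IOb; m \<in> carrier M; m' \<in> carrier M'\<rbrakk> \<Longrightarrow> ip M M' m m' \<in> carrier (istar M M')"
    and ip_eq: "\<And>M M' (G :: 'u rmodule) h h' z. \<lbrakk>M \<in> IOb; M' \<in> IOb; additive (istar M M') G h; additive (istar M M') G h';
        \<And>m m'. \<lbrakk>m \<in> carrier M; m' \<in> carrier M'\<rbrakk> \<Longrightarrow> h (ip M M' m m') = h' (ip M M' m m'); z \<in> carrier (istar M M')\<rbrakk>
      \<Longrightarrow> h z = h' z"
    and sassoc_hom: "\<lbrakk>right_module R A; M \<in> IOb; M' \<in> IOb\<rbrakk>
      \<Longrightarrow> sassoc A M M' \<in> rhom R (star A (istar M M')) (star (star A M) M')"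
    and sassoc_sp: "\<lbrakk>right_module R A; M \<in> IOb; M' \<in> IOb; a \<in> carrier A; m \<in> carrier M; m' \<in> carrier M'\<rbrakk>
      \<Longrightarrow> sassoc A M M' (sp A (istar M M') a (ip M M' m m')) = sp (star A M) M' (sp A M a m) m'"
    and iunit_ob: "iunit \<in> IOb"
    and iunit_carrier: "carrier iunit = carrier R"
    and srunit_hom: "right_module R A \<Longrightarrow> srunit A \<in> rhom R (star A iunit) A"
    and srunit_sp: "\<lbrakk>right_module R A; a \<in> carrier A; r \<in> carrier R\<rbrakk> \<Longrightarrow> srunit A (sp A iunit a r) = a \<triangleleft>\<^bsub>A\<^esub> r"
    and sharp_mod: "\<lbrakk>right_module S N; M \<in> IOb\<rbrakk> \<Longrightarrow> right_module S (sharp N M)"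
    and shp_biadd: "\<lbrakk>right_module S N; M \<in> IOb; m \<in> carrier M\<rbrakk> \<Longrightarrow> biadditive N C (sharp N M) (\<lambda>n c. shp N M n m c)"
    and shp_add: "\<lbrakk>right_module S N; M \<in> IOb; n \<in> carrier N; m \<in> carrier M; m' \<in> carrier M; c \<in> carrier C\<rbrakk>
      \<Longrightarrow> shp N M n (m \<oplus>\<^bsub>M\<^esub> m') c = shp N M n m c \<oplus>\<^bsub>sharp N M\<^esub> shp N M n m' c"
    and shp_ract: "\<lbrakk>right_module S N; M \<in> IOb; n \<in> carrier N; m \<in> carrier M; c \<in> carrier C; s \<in> carrier S\<rbrakk>
      \<Longrightarrow> shp N M n m c \<triangleleft>\<^bsub>sharp N M\<^esub> s = shp N M n m (c \<triangleleft>\<^bsub>C\<^esub> s)"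
    and shp_S: "\<lbrakk>right_module S N; M \<in> IOb; n \<in> carrier N; m \<in> carrier M; c \<in> carrier C; s \<in> carrier S\<rbrakk>
      \<Longrightarrow> shp N M (n \<triangleleft>\<^bsub>N\<^esub> s) m c = shp N M n m (s \<triangleright>\<^bsub>C\<^esub> c)"
    and shp_R: "\<lbrakk>right_module S N; M \<in> IOb; n \<in> carrier N; m \<in> carrier M; c \<in> carrier C; r \<in> carrier R\<rbrakk>
      \<Longrightarrow> shp N M n (m \<triangleleft>\<^bsub>M\<^esub> r) c = shp N M n m (r \<unrhd>\<^bsub>C\<^esub> c)"
    and shp_Z: "\<lbrakk>right_module S N; M \<in> IOb; n \<in> carrier N; m \<in> carrier M; c \<in> carrier C; r \<in> Z\<rbrakk>
      \<Longrightarrow> shp N M n (la M r m) c = shp N M n m (c \<unlhd>\<^bsub>C\<^esub> r)"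
    and sharp_eq: "\<And>N M (G :: 'u rmodule) h h' z. \<lbrakk>right_module S N; M \<in> IOb; additive (sharp N M) G h; additive (sharp N M) G h';
        \<And>n m c. \<lbrakk>n \<in> carrier N; m \<in> carrier M; c \<in> carrier C\<rbrakk> \<Longrightarrow> h (shp N M n m c) = h' (shp N M n m c);
        z \<in> carrier (sharp N M)\<rbrakk> \<Longrightarrow> h z = h' z"
    and shmap_hom: "\<lbrakk>right_module S N; right_module S N'; M \<in> IOb; M' \<in> IOb; f \<in> rhom S N N'; g \<in> ihom M M'\<rbrakk>
      \<Longrightarrow> rlin S (sharp N M) (sharp N' M') (shmap N M N' M' f g)"
    and shmap_shp: "\<lbrakk>right_module S N; right_module S N'; M \<in> IOb; M' \<in> IOb; f \<in> rhom S N N'; g \<in> ihom M M';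
        n \<in> carrier N; m \<in> carrier M; c \<in> carrier C\<rbrakk> \<Longrightarrow> shmap N M N' M' f g (shp N M n m c) = shp N' M' (f n) (g m) c"
    and sh2_additive: "\<lbrakk>right_module S N; M \<in> IOb; M' \<in> IOb\<rbrakk>
      \<Longrightarrow> additive (sharp N (istar M M')) (sharp (sharp N M) M') (sh2 N M M')"
    and sh2_shp: "\<lbrakk>right_module S N; M \<in> IOb; M' \<in> IOb; n \<in> carrier N; m \<in> carrier M; m' \<in> carrier M'; c \<in> carrier C\<rbrakk>
      \<Longrightarrow> sh2 N M M' (shp N (istar M M') n (ip M M' m m') c)
        = rlift S C C (sharp (sharp N M) M') (\<lambda>c1 c2. shp (sharp N M) M' (shp N M n m c1) m' c2) (comul C c)"
    and sh0_additive: "right_module S N \<Longrightarrow> additive (sharp N iunit) N (sh0 N)"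
    and sh0_shp: "\<lbrakk>right_module S N; n \<in> carrier N; r \<in> carrier R; c \<in> carrier C\<rbrakk>
      \<Longrightarrow> sh0 N (shp N iunit n r c) = n \<triangleleft>\<^bsub>N\<^esub> counit C (r \<unrhd>\<^bsub>C\<^esub> c)"
    and M0_ob: "M0 \<in> IOb" and u0: "u0 \<in> carrier M0"
    and M0_free: "\<lbrakk>M \<in> IOb; m \<in> carrier M\<rbrakk> \<Longrightarrow> \<exists>g \<in> ihom M0 M. g u0 = m"
    and shp_M0: "\<And>N n m c. \<lbrakk>right_module S N; n \<in> carrier N; m \<in> carrier M0; c \<in> carrier C\<rbrakk>
      \<Longrightarrow> \<exists>c' \<in> carrier C. shp N M0 n m c = shp N M0 n u0 c'"
    and kap_rlin: "right_module S N \<Longrightarrow> rlin S (sharp N M0) (rtensor S N C) (kap N)"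
    and kap_shp: "\<lbrakk>right_module S N; n \<in> carrier N; c \<in> carrier C\<rbrakk> \<Longrightarrow> kap N (shp N M0 n u0 c) = pu N n c"
begin

section \<open>Basic maps into N # M\<close>

lemma sp_closed: "\<lbrakk>right_module R A; M \<in> IOb; a \<in> carrier A; m \<in> carrier M\<rbrakk> \<Longrightarrow> sp A M a m \<in> carrier (star A M)"
  using biadditive_closed[OF sp_biadd] .

lemma shp_closed: "\<lbrakk>right_module S N; M \<in> IOb; n \<in> carrier N; m \<in> carrier M; c \<in> carrier C\<rbrakk> \<Longrightarrow> shp N M n m c \<in> carrier (sharp N M)"
  using biadditive_closed[OF shp_biadd] .

text \<open>An element m fixes a map from the tensor product of N and C over S to N # M; for m =
  \<open>u0\<close> it is inverse to \<open>kap N\<close>. Every value of y on generators has the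
  form of \<open>lam\<close> applied to a transported coaction.\<close>

definition lam where "lam N M m = rlift S N C (sharp N M) (\<lambda>n c. shp N M n m c)"

lemma lam:
  assumes N: "right_module S N" and M: "M \<in> IOb" and m: "m \<in> carrier M"
  shows lam_rlin: "rlin S (rtensor S N C) (sharp N M) (lam N M m)"
    and lam_pure: "\<lbrakk>n \<in> carrier N; c \<in> carrier C\<rbrakk> \<Longrightarrow> lam N M m (pu N n c) = shp N M n m c"
proof -
  have bal: "shp N M (n \<triangleleft>\<^bsub>N\<^esub> s) m c = shp N M n m (s \<triangleright>\<^bsub>C\<^esub> c)" if "n \<in> carrier N" "s \<in> carrier S" "c \<in> carrier C" for n s c
    by (rule shp_S[OF N M that(1) m that(3,2)])
  note sm = sharp_mod[OF N M]
  note l = rlift[OF N C_mod(2) right_module_abelian[OF sm] shp_biadd[OF N M m], OF bal, folded lam_def]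
  show p: "\<lbrakk>n \<in> carrier N; c \<in> carrier C\<rbrakk> \<Longrightarrow> lam N M m (pu N n c) = shp N M n m c" for n c
    using l(3) by blast
  have a: "additive (rtensor S N C) (sharp N M) (lam N M m)" using l(2) by blast
  show "rlin S (rtensor S N C) (sharp N M) (lam N M m)"
    by (rule rt_rlin[OF N C_mod(2) C_bimod sm a]) (simp add: p shp_ract[OF N M _ m])
qed

lemma lam_closed: "\<lbrakk>right_module S N; M \<in> IOb; m \<in> carrier M; z \<in> carrier (rtensor S N C)\<rbrakk> \<Longrightarrow> lam N M m z \<in> carrier (sharp N M)"
  using rlin_closed[OF lam_rlin] .

lemma lam_add:
  assumes N: "right_module S N" and M: "M \<in> IOb" and m: "m \<in> carrier M" "m' \<in> carrier M" and z: "z \<in> carrier (rtensor S N C)"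
  shows "lam N M (m \<oplus>\<^bsub>M\<^esub> m') z = lam N M m z \<oplus>\<^bsub>sharp N M\<^esub> lam N M m' z"
proof -
  interpret M: right_module R M by (rule IOb_mod[OF M])
  have mm: "m \<oplus>\<^bsub>M\<^esub> m' \<in> carrier M" using m by simp
  show ?thesis
    by (rule NC_eq[OF N rlin_additive[OF lam_rlin[OF N M mm]] additive_sum_maps[OF rlin_additive[OF lam_rlin[OF N M m(1)]]
        rlin_additive[OF lam_rlin[OF N M m(2)]] right_module_abelian[OF sharp_mod[OF N M]]] _ z])
      (simp add: lam_pure[OF N M mm] lam_pure[OF N M m(1)] lam_pure[OF N M m(2)] shp_add[OF N M _ m])
qed

text \<open>Actions on m are traded for actions on the coefficient in C. This is where the two
  R-actions on C meet the actions on M.\<close>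

lemma lam_mapR:
  assumes N: "right_module S N" and M: "M \<in> IOb" and m: "m \<in> carrier M" and z: "z \<in> carrier (rtensor S N C)"
  shows "r \<in> carrier R \<Longrightarrow> lam N M (m \<triangleleft>\<^bsub>M\<^esub> r) z = lam N M m (mapR N (lactR C r) z)"
    and "r \<in> Z \<Longrightarrow> lam N M (la M r m) z = lam N M m (mapR N (\<lambda>c. c \<unlhd>\<^bsub>C\<^esub> r) z)"
proof -
  interpret M: right_module R M by (rule IOb_mod[OF M])
  note L = lam_rlin[OF N M] and P = lam_pure[OF N M]
  assume r: "r \<in> carrier R"
  have mr: "m \<triangleleft>\<^bsub>M\<^esub> r \<in> carrier M" using m r by (rule M.ract_closed)
  show "lam N M (m \<triangleleft>\<^bsub>M\<^esub> r) z = lam N M m (mapR N (lactR C r) z)"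
    by (rule NC_eq[OF N rlin_additive[OF L[OF mr]] additive_compose[OF mapR_additive[OF N lactR_lin(1)[OF r]] rlin_additive[OF L[OF m]]] _ z])
      (simp add: P[OF mr] P[OF m] mapR_pure[OF N lactR_lin(1)[OF r]] shp_R[OF N M _ m _ r] r)
next
  note L = lam_rlin[OF N M] and P = lam_pure[OF N M]
  assume rZ: "r \<in> Z"
  then have r: "r \<in> carrier R" using Z_sub by blast
  have mr: "la M r m \<in> carrier M" using la_closed[OF M rZ m] .
  show "lam N M (la M r m) z = lam N M m (mapR N (\<lambda>c. c \<unlhd>\<^bsub>C\<^esub> r) z)"
    by (rule NC_eq[OF N rlin_additive[OF L[OF mr]] additive_compose[OF mapR_additive[OF N ractR_lin(1)[OF r]] rlin_additive[OF L[OF m]]] _ z])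
      (simp add: P[OF mr] P[OF m] mapR_pure[OF N ractR_lin(1)[OF r]] shp_Z[OF N M _ m _ rZ] r)
qed

text \<open>Maps on N and on M leave the coefficient in C alone. Naturality of y will be read off
  from this.\<close>

lemma lam_shmap:
  assumes N: "right_module S N" and N': "right_module S N'" and M: "M \<in> IOb" and M': "M' \<in> IOb"
    and f: "f \<in> rhom S N N'" and g: "g \<in> ihom M M'" and m: "m \<in> carrier M" and z: "z \<in> carrier (rtensor S N C)"
  shows "shmap N M N' M' f g (lam N M m z) = lam N' M' (g m) (mapC N N' f z)"
proof -
  note fl = rhom_rlin[OF f]
  have gm: "g m \<in> carrier M'" by (rule rlin_closed[OF rhom_rlin[OF ihom_sub[OF M M' g]] m])
  show ?thesis
    by (rule NC_eq[OF N rlin_additive[OF rlin_compose[OF lam_rlin[OF N M m] shmap_hom[OF N N' M M' f g]]]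
        rlin_additive[OF rlin_compose[OF mapC_rlin[OF N N' fl] lam_rlin[OF N' M' gm]]] _ z])
      (simp add: lam_pure[OF N M m] lam_pure[OF N' M' gm] mapC_pure[OF N N' fl] shmap_shp[OF N N' M M' f g _ m] rlin_closed[OF fl])
qed

lemma lam_shmap_id:
  assumes N: "right_module S N" and N': "right_module S N'" and M: "M \<in> IOb"
    and f: "f \<in> rhom S N N'" and m: "m \<in> carrier M" and z: "z \<in> carrier (rtensor S N C)"
  shows "shmap N M N' M f (\<lambda>m \<in> carrier M. m) (lam N M m z) = lam N' M m (mapC N N' f z)"
  using lam_shmap[OF N N' M M f ihom_id[OF M] m z] m by simp

text \<open>The constraint of # splits the coefficient by \<delta>, so on the image of
  \<open>lam\<close> it amounts to two applications of \<open>lam\<close> after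
  \<open>split\<close>. Thereby the coherence axiom for y is translated into
  coassociativity.\<close>

lemma lam_sh2:
  assumes N: "right_module S N" and M: "M \<in> IOb" and M': "M' \<in> IOb" and m: "m \<in> carrier M" and m': "m' \<in> carrier M'"
    and z: "z \<in> carrier (rtensor S N C)"
  shows "sh2 N M M' (lam N (istar M M') (ip M M' m m') z)
    = lam (sharp N M) M' m' (mapC (rtensor S N C) (sharp N M) (lam N M m) (split N z))"
proof -
  note NC = NC_mod[OF N] and NM = sharp_mod[OF N M] and MM = istar_ob[OF M M'] and mm = ip_closed[OF M M' m m']
  note L = lam_rlin[OF N M m] and L' = lam_rlin[OF NM M' m'] and P = lam_pure[OF N M m] and P' = lam_pure[OF NM M' m']
  let ?G = "sharp (sharp N M) M'"
  let ?f = "\<lambda>n c1 c2. shp (sharp N M) M' (shp N M n m c1) m' c2"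
  have G: "abelian_group ?G" by (rule right_module_abelian[OF sharp_mod[OF NM M']])
  have 1: "biadditive C C ?G (?f n)" if n: "n \<in> carrier N" for n
    by (intro biadditiveI)
      (simp_all add: n m m' shp_closed[OF N M] shp_closed[OF NM M'] biadditive_add_left[OF shp_biadd[OF NM M' m']]
        biadditive_add_right[OF shp_biadd[OF NM M' m']] biadditive_add_right[OF shp_biadd[OF N M m]])
  have 2: "?f n (c1 \<triangleleft>\<^bsub>C\<^esub> s) c2 = ?f n c1 (s \<triangleright>\<^bsub>C\<^esub> c2)"
    if "n \<in> carrier N" "c1 \<in> carrier C" "s \<in> carrier S" "c2 \<in> carrier C" for n c1 s c2
    using that m m' by (simp add: shp_ract[OF N M, symmetric] shp_S[OF NM M'] shp_closed[OF N M])
  show ?thesis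
  proof (rule split_eq[symmetric, where g = "\<lambda>n. rlift S C C ?G (?f n)", OF N _ _ _ _ _ z])
    show "additive (rtensor S (rtensor S N C) C) ?G (\<lambda>z. lam (sharp N M) M' m' (mapC (rtensor S N C) (sharp N M) (lam N M m) z))"
      by (rule rlin_additive[OF rlin_compose[OF mapC_rlin[OF NC NM L] L']])
    show "additive (rtensor S C C) ?G (rlift S C C ?G (?f n))" if "n \<in> carrier N" for n
      by (rule rlift_additive[OF C_mod(1,2) G 1[OF that], OF 2[OF that]])
    show "additive (rtensor S N C) ?G (\<lambda>z. sh2 N M M' (lam N (istar M M') (ip M M' m m') z))"
      by (rule additive_compose[OF rlin_additive[OF lam_rlin[OF N MM mm]] sh2_additive[OF N M M']])
    fix n c assume n: "n \<in> carrier N" and c: "c \<in> carrier C"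
    show "rlift S C C ?G (?f n) (comul C c) = sh2 N M M' (lam N (istar M M') (ip M M' m m') (pu N n c))"
      by (simp add: lam_pure[OF N MM mm n c] sh2_shp[OF N M M' n m m' c])
    fix c' assume c': "c' \<in> carrier C"
    have "rlift S C C ?G (?f n) (pu C c c') = ?f n c c'"
      by (rule rlift_pure[OF C_mod(1,2) G 1[OF n], OF 2[OF n] c c'])
    then show "lam (sharp N M) M' m' (mapC (rtensor S N C) (sharp N M) (lam N M m) (pu (rtensor S N C) (pu N n c) c')) =
         rlift S C C ?G (?f n) (pu C c c')"
      by (simp add: mapC_pure[OF NC NM L] pu_closed[OF N] n c c' P P' shp_closed[OF N M n m c])
  qed
qed

text \<open>The unit constraint pairs the coefficient with \<epsilon>, exactly as the action of R on
  a comodule does; thereby the counit axiom for y is translated into a statement about this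
  action.\<close>

lemma lam_sh0:
  assumes N: "right_module S N" and r: "r \<in> carrier R" and z: "z \<in> carrier (rtensor S N C)"
  shows "sh0 N (lam N iunit r z) = mu N r z"
proof -
  have r': "r \<in> carrier iunit" using r by (simp add: iunit_carrier)
  show ?thesis
    by (rule NC_eq[OF N additive_compose[OF rlin_additive[OF lam_rlin[OF N iunit_ob r']] sh0_additive[OF N]]
          rlin_additive[OF mu_rlin[OF N r]] _ z])
      (simp add: lam_pure[OF N iunit_ob r'] sh0_shp[OF N _ r] mu_pure[OF N r])
qed

lemma kap_lam:
  assumes N: "right_module S N" and z: "z \<in> carrier (rtensor S N C)"
  shows "kap N (lam N M0 u0 z) = z"
  by (rule NC_eq[OF N rlin_additive[OF rlin_compose[OF lam_rlin[OF N M0_ob u0] kap_rlin[OF N]]] additive_id _ z])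
    (simp add: lam_pure[OF N M0_ob u0] kap_shp[OF N])

text \<open>By \<open>shp_M0\<close> a generator with arbitrary m can be rewritten with
  \<open>u0\<close>, where \<open>kap_shp\<close> gives the value.\<close>

lemma lam_kap:
  assumes N: "right_module S N" and w: "w \<in> carrier (sharp N M0)"
  shows "lam N M0 u0 (kap N w) = w"
proof (rule sharp_eq[OF N M0_ob rlin_additive[OF rlin_compose[OF kap_rlin[OF N] lam_rlin[OF N M0_ob u0]]] additive_id _ w])
  fix n m c assume n: "n \<in> carrier N" and "m \<in> carrier M0" "c \<in> carrier C"
  then obtain c' where c': "c' \<in> carrier C" "shp N M0 n m c = shp N M0 n u0 c'"
    using shp_M0[OF N] by blast
  then show "lam N M0 u0 (kap N (shp N M0 n m c)) = shp N M0 n m c"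
    using n by (simp add: kap_shp[OF N] lam_pure[OF N M0_ob u0])
qed

lemma lam_inj:
  "\<lbrakk>right_module S N; z \<in> carrier (rtensor S N C); z' \<in> carrier (rtensor S N C); lam N M0 u0 z = lam N M0 u0 z'\<rbrakk> \<Longrightarrow> z = z'"
  using kap_lam by metis

text \<open>The common shape of \<open>opmon_comodule\<close> and \<open>oplax_morphism\<close>. The
  unit axiom has the form in which it is stated for oplax morphisms.\<close>

definition diagonal :: "'u mod_ftor \<times> ('u rmodule \<Rightarrow> ('u, 'x) rmodule_scheme \<Rightarrow> 'u \<Rightarrow> 'u) \<Rightarrow> bool" where
  "diagonal = (\<lambda>(Y, y).
     cat_functor (RMod R) (RMod S) Y \<and>
     (\<forall>A \<in> Obj (RMod R). \<forall>M \<in> IOb. y A M \<in> rhom S (fob Y (star A M)) (sharp (fob Y A) M)) \<and>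
     (\<forall>A \<in> Obj (RMod R). \<forall>A' \<in> Obj (RMod R). \<forall>M \<in> IOb. \<forall>M' \<in> IOb.
        \<forall>f \<in> rhom R A A'. \<forall>g \<in> ihom M M'. \<forall>z \<in> carrier (fob Y (star A M)).
          shmap (fob Y A) M (fob Y A') M' (fhom Y A A' f) g (y A M z)
        = y A' M' (fhom Y (star A M) (star A' M') (smap A M A' M' f g) z)) \<and>
     (\<forall>A \<in> Obj (RMod R). \<forall>M \<in> IOb. \<forall>M' \<in> IOb. \<forall>z \<in> carrier (fob Y (star A (istar M M'))).
          shmap (fob Y (star A M)) M' (sharp (fob Y A) M) M' (y A M) (\<lambda>m \<in> carrier M'. m)
            (y (star A M) M' (fhom Y (star A (istar M M')) (star (star A M) M') (sassoc A M M') z))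
        = sh2 (fob Y A) M M' (y A (istar M M') z)) \<and>
     (\<forall>A \<in> Obj (RMod R). \<forall>z \<in> carrier (fob Y (star A iunit)).
        sh0 (fob Y A) (y A iunit z) = fhom Y (star A iunit) A (srunit A) z))"

definition diagonals :: "('u mod_ftor \<times> ('u rmodule \<Rightarrow> ('u, 'x) rmodule_scheme \<Rightarrow> 'u \<Rightarrow> 'u), 'u rmodule \<Rightarrow> 'u \<Rightarrow> 'u) cat" where
  "diagonals = \<lparr>
     Obj = {(Y, y). diagonal (Y, y) \<and> cocontinuous_linear_functor k R S Y},
     Hom = (\<lambda>(Y, y) (Y', y'). {t \<in> nat_trans (RMod R) (RMod S) Y Y'.
        \<forall>A \<in> Obj (RMod R). \<forall>M \<in> IOb. \<forall>z \<in> carrier (fob Y (star A M)).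
          y' A M (t (star A M) z) = shmap (fob Y A) M (fob Y' A) M (t A) (\<lambda>m \<in> carrier M. m) (y A M z)}),
     Idn = (\<lambda>(Y, y). \<lambda>A \<in> Obj (RMod R). Idn (RMod S) (fob Y A)),
     Cmp = (\<lambda>(Y, y) (Y', y') (Y'', y'') u t. \<lambda>A \<in> Obj (RMod R).
        Cmp (RMod S) (fob Y A) (fob Y' A) (fob Y'' A) (u A) (t A))\<rparr>"

end

lemma nat_trans_RMod:
  "t \<in> nat_trans (RMod R) (RMod S) Y Y' \<longleftrightarrow> t \<in> extensional {A. right_module R A} \<and>
     (\<forall>A. right_module R A \<longrightarrow> t A \<in> rhom S (fob Y A) (fob Y' A)) \<and>
     (\<forall>A B. right_module R A \<longrightarrow> right_module R B \<longrightarrow> (\<forall>f \<in> rhom R A B.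
        compose (carrier (fob Y A)) (fhom Y' A B f) (t A) = compose (carrier (fob Y A)) (t B) (fhom Y A B f)))"
  by (auto simp: nat_trans_def)

section \<open>Composition in the categories to be compared\<close>

context comodule_scheme
begin

lemma shmap_id:
  assumes N: "right_module S N" and M: "M \<in> IOb" and z: "z \<in> carrier (sharp N M)"
  shows "shmap N M N M (\<lambda>n \<in> carrier N. n) (\<lambda>m \<in> carrier M. m) z = z"
  by (rule sharp_eq[OF N M rlin_additive[OF shmap_hom[OF N N M M rhom_id[OF N] ihom_id[OF M]]] additive_id _ z])
    (simp add: shmap_shp[OF N N M M rhom_id[OF N] ihom_id[OF M]])

lemma shmap_comp:
  assumes N: "right_module S N" and N': "right_module S N'" and N'': "right_module S N''" and M: "M \<in> IOb"
    and f: "f \<in> rhom S N N'" and g: "g \<in> rhom S N' N''" and z: "z \<in> carrier (sharp N M)"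
  shows "shmap N' M N'' M g (\<lambda>m \<in> carrier M. m) (shmap N M N' M f (\<lambda>m \<in> carrier M. m) z)
    = shmap N M N'' M (compose (carrier N) g f) (\<lambda>m \<in> carrier M. m) z"
proof -
  note i = ihom_id[OF M] and gf = rhom_compose[OF N f g]
  note s = shmap_hom[OF N N' M M f i] shmap_hom[OF N' N'' M M g i] shmap_hom[OF N N'' M M gf i]
  show ?thesis
    by (rule sharp_eq[OF N M rlin_additive[OF rlin_compose[OF s(1,2)]] rlin_additive[OF s(3)] _ z])
      (simp add: shmap_shp[OF N N' M M f i] shmap_shp[OF N' N'' M M g i] shmap_shp[OF N N'' M M gf i]
        compose_eq rlin_closed[OF rhom_rlin[OF f]])
qed

lemma diagonals_simps:
  "Obj diagonals = {(Y, y). diagonal (Y, y) \<and> cocontinuous_linear_functor k R S Y}"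
  "Hom diagonals (Y, y) (Y', y') = {t \<in> nat_trans (RMod R) (RMod S) Y Y'.
     \<forall>A. right_module R A \<longrightarrow> (\<forall>M \<in> IOb. \<forall>z \<in> carrier (fob Y (star A M)).
       y' A M (t (star A M) z) = shmap (fob Y A) M (fob Y' A) M (t A) (\<lambda>m \<in> carrier M. m) (y A M z))}"
  "Idn diagonals (Y, y) = (\<lambda>A \<in> {A. right_module R A}. \<lambda>x \<in> carrier (fob Y A). x)"
  "Cmp diagonals (Y, y) (Y', y') (Y'', y'') u t = (\<lambda>A \<in> {A. right_module R A}. compose (carrier (fob Y A)) (u A) (t A))"
  by (simp_all add: diagonals_def)

lemma diagonal_hom: "\<lbrakk>diagonal (Y, y); right_module R A; M \<in> IOb\<rbrakk> \<Longrightarrow> y A M \<in> rhom S (fob Y (star A M)) (sharp (fob Y A) M)"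
  by (simp add: diagonal_def)

lemma diagonal_fob: "\<lbrakk>diagonal (Y, y); right_module R A\<rbrakk> \<Longrightarrow> right_module S (fob Y A)"
  using cat_functor.fob_closed[of "RMod R" "RMod S" Y A] by (simp add: diagonal_def)

lemma diagonal_natural:
  "\<lbrakk>diagonal (Y, y); right_module R A; right_module R A'; M \<in> IOb; M' \<in> IOb; f \<in> rhom R A A'; g \<in> ihom M M';
     z \<in> carrier (fob Y (star A M))\<rbrakk>
   \<Longrightarrow> shmap (fob Y A) M (fob Y A') M' (fhom Y A A' f) g (y A M z)
     = y A' M' (fhom Y (star A M) (star A' M') (smap A M A' M' f g) z)"
  unfolding diagonal_def by simp

lemma diagonal_coassoc:
  "\<lbrakk>diagonal (Y, y); right_module R A; M \<in> IOb; M' \<in> IOb; z \<in> carrier (fob Y (star A (istar M M')))\<rbrakk>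
   \<Longrightarrow> shmap (fob Y (star A M)) M' (sharp (fob Y A) M) M' (y A M) (\<lambda>m \<in> carrier M'. m)
       (y (star A M) M' (fhom Y (star A (istar M M')) (star (star A M) M') (sassoc A M M') z))
     = sh2 (fob Y A) M M' (y A (istar M M') z)"
  unfolding diagonal_def by simp

lemma diagonal_counit:
  "\<lbrakk>diagonal (Y, y); right_module R A; z \<in> carrier (fob Y (star A iunit))\<rbrakk>
   \<Longrightarrow> sh0 (fob Y A) (y A iunit z) = fhom Y (star A iunit) A (srunit A) z"
  unfolding diagonal_def by simp

lemma nat_trans_Idn:
  assumes "cat_functor (RMod R) (RMod S) Y"
  shows "(\<lambda>A \<in> {A. right_module R A}. \<lambda>x \<in> carrier (fob Y A). x) \<in> nat_trans (RMod R) (RMod S) Y Y"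
proof -
  interpret Y: cat_functor "RMod R" "RMod S" Y by fact
  have "right_module S (fob Y A)" if "right_module R A" for A using Y.fob_closed that by simp
  moreover have "compose (carrier (fob Y A)) (fhom Y A B f) (\<lambda>x \<in> carrier (fob Y A). x) =
      compose (carrier (fob Y A)) (\<lambda>x \<in> carrier (fob Y B). x) (fhom Y A B f)"
    if "right_module R A" "right_module R B" "f \<in> rhom R A B" for A B f
    using Y.cod.Cmp_Idn_left[of "fob Y A" "fob Y B" "fhom Y A B f"] Y.cod.Cmp_Idn_right[of "fob Y A" "fob Y B" "fhom Y A B f"]
      Y.fob_closed Y.fhom_closed that by simp
  ultimately show ?thesis by (simp add: nat_trans_RMod rhom_id)
qed

lemma nat_trans_Cmp:
  assumes "cat_functor (RMod R) (RMod S) Y" "cat_functor (RMod R) (RMod S) Y'" "cat_functor (RMod R) (RMod S) Y''"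
    and t: "t \<in> nat_trans (RMod R) (RMod S) Y Y'" and u: "u \<in> nat_trans (RMod R) (RMod S) Y' Y''"
  shows "(\<lambda>A \<in> {A. right_module R A}. compose (carrier (fob Y A)) (u A) (t A)) \<in> nat_trans (RMod R) (RMod S) Y Y''"
proof -
  interpret Y: cat_functor "RMod R" "RMod S" Y by fact
  interpret Y': cat_functor "RMod R" "RMod S" Y' by fact
  interpret Y'': cat_functor "RMod R" "RMod S" Y'' by fact
  have Ym: "right_module S (fob Y A)" "right_module S (fob Y' A)" "right_module S (fob Y'' A)" if "right_module R A" for A
    using Y.fob_closed Y'.fob_closed Y''.fob_closed that by auto
  have th: "t A \<in> rhom S (fob Y A) (fob Y' A)" "u A \<in> rhom S (fob Y' A) (fob Y'' A)" if "right_module R A" for A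
    using t u that by (auto simp: nat_trans_RMod)
  have "compose (carrier (fob Y A)) (fhom Y'' A B f) (compose (carrier (fob Y A)) (u A) (t A)) =
      compose (carrier (fob Y A)) (compose (carrier (fob Y B)) (u B) (t B)) (fhom Y A B f)"
    if A: "right_module R A" and B: "right_module R B" and f: "f \<in> rhom R A B" for A B f
  proof (rule extensionalityI[of _ "carrier (fob Y A)"])
    fix x assume x: "x \<in> carrier (fob Y A)"
    have tx: "t A x \<in> carrier (fob Y' A)" by (rule rlin_closed[OF rhom_rlin[OF th(1)[OF A]] x])
    have "fhom Y A B f \<in> rhom S (fob Y A) (fob Y B)" using Y.fhom_closed[of A B f] A B f by simp
    then have fx: "fhom Y A B f x \<in> carrier (fob Y B)" by (rule rlin_closed[OF rhom_rlin x])
    have "compose (carrier (fob Y A)) (fhom Y' A B f) (t A) x = compose (carrier (fob Y A)) (t B) (fhom Y A B f) x"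
      "compose (carrier (fob Y' A)) (fhom Y'' A B f) (u A) (t A x) = compose (carrier (fob Y' A)) (u B) (fhom Y' A B f) (t A x)"
      using t u A B f by (simp_all add: nat_trans_RMod)
    then show "compose (carrier (fob Y A)) (fhom Y'' A B f) (compose (carrier (fob Y A)) (u A) (t A)) x =
      compose (carrier (fob Y A)) (compose (carrier (fob Y B)) (u B) (t B)) (fhom Y A B f) x"
      using x tx fx by (simp add: compose_eq)
  qed auto
  then show ?thesis by (simp add: nat_trans_RMod rhom_compose[OF Ym(1) th])
qed

lemma category_diagonals: "category diagonals"
proof (unfold_locales, goal_cases)
  case (1 x)
  obtain Y y where x: "x = (Y, y)" by (cases x)
  with 1 have Y: "diagonal (Y, y)" by (simp add: diagonals_simps)
  have Yf: "cat_functor (RMod R) (RMod S) Y" using Y by (simp add: diagonal_def)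
  show ?case
    using nat_trans_Idn[OF Yf] rlin_closed[OF rhom_rlin[OF diagonal_hom[OF Y]]]
    by (simp add: x diagonals_simps star_mod shmap_id[OF diagonal_fob[OF Y]])
next
  case (2 x y z f g)
  obtain Y a Y' a' Y'' a'' where xyz: "x = (Y, a)" "y = (Y', a')" "z = (Y'', a'')" by (metis surj_pair)
  have Y: "diagonal (Y, a)" "diagonal (Y', a')" "diagonal (Y'', a'')" using 2(1-3) by (simp_all add: xyz diagonals_simps)
  have Yf: "cat_functor (RMod R) (RMod S) Y" "cat_functor (RMod R) (RMod S) Y'" "cat_functor (RMod R) (RMod S) Y''"
    using Y by (simp_all add: diagonal_def)
  have f: "f \<in> nat_trans (RMod R) (RMod S) Y Y'" and g: "g \<in> nat_trans (RMod R) (RMod S) Y' Y''"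
    using 2(4,5) by (simp_all add: xyz diagonals_simps)
  have fg: "f A \<in> rhom S (fob Y A) (fob Y' A)" "g A \<in> rhom S (fob Y' A) (fob Y'' A)" if "right_module R A" for A
    using f g that by (auto simp: nat_trans_RMod)
  have "a'' A M (compose (carrier (fob Y (star A M))) (g (star A M)) (f (star A M)) z) =
      shmap (fob Y A) M (fob Y'' A) M (compose (carrier (fob Y A)) (g A) (f A)) (\<lambda>m \<in> carrier M. m) (a A M z)"
    if A: "right_module R A" and M: "M \<in> IOb" and z: "z \<in> carrier (fob Y (star A M))" for A M z
  proof -
    have fz: "f (star A M) z \<in> carrier (fob Y' (star A M))"
      by (rule rlin_closed[OF rhom_rlin[OF fg(1)[OF star_mod[OF A M]]] z])
    have az: "a A M z \<in> carrier (sharp (fob Y A) M)" by (rule rlin_closed[OF rhom_rlin[OF diagonal_hom[OF Y(1) A M]] z])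
    show ?thesis
      using 2(4,5) A M z fz
      by (simp add: xyz diagonals_simps compose_eq shmap_comp[OF diagonal_fob[OF Y(1) A] diagonal_fob[OF Y(2) A] diagonal_fob[OF Y(3) A] M fg[OF A] az])
  qed
  then show ?case using nat_trans_Cmp[OF Yf f g] by (simp add: xyz diagonals_simps star_mod)
next
  case (3 x y f)
  obtain Y a Y' a' where xy: "x = (Y, a)" "y = (Y', a')" by (metis surj_pair)
  have Y: "diagonal (Y, a)" "diagonal (Y', a')" using 3(1,2) by (simp_all add: xy diagonals_simps)
  have f: "f \<in> nat_trans (RMod R) (RMod S) Y Y'" using 3(3) by (simp add: xy diagonals_simps)
  have "compose (carrier (fob Y A)) (\<lambda>x \<in> carrier (fob Y' A). x) (f A) = f A" if "right_module R A" for A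
    using category.Cmp_Idn_left[OF category_RMod, of "fob Y A" S "fob Y' A" "f A"] f diagonal_fob[OF Y(1) that] diagonal_fob[OF Y(2) that] that
    by (simp add: nat_trans_RMod)
  then show ?case
    using f by (intro extensionalityI[of _ "{A. right_module R A}"]) (auto simp: xy diagonals_simps nat_trans_RMod)
next
  case (4 x y f)
  obtain Y a Y' a' where xy: "x = (Y, a)" "y = (Y', a')" by (metis surj_pair)
  have Y: "diagonal (Y, a)" "diagonal (Y', a')" using 4(1,2) by (simp_all add: xy diagonals_simps)
  have f: "f \<in> nat_trans (RMod R) (RMod S) Y Y'" using 4(3) by (simp add: xy diagonals_simps)
  have "compose (carrier (fob Y A)) (f A) (\<lambda>x \<in> carrier (fob Y A). x) = f A" if "right_module R A" for A
    using category.Cmp_Idn_right[OF category_RMod, of "fob Y A" S "fob Y' A" "f A"] f diagonal_fob[OF Y(1) that] diagonal_fob[OF Y(2) that] that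
    by (simp add: nat_trans_RMod)
  then show ?case
    using f by (intro extensionalityI[of _ "{A. right_module R A}"]) (auto simp: xy diagonals_simps nat_trans_RMod)
next
  case (5 w x y z f g h)
  obtain Y0 a0 Y1 a1 Y2 a2 Y3 a3 where xy: "w = (Y0, a0)" "x = (Y1, a1)" "y = (Y2, a2)" "z = (Y3, a3)" by (metis surj_pair)
  have "f A x \<in> carrier (fob Y1 A)" if "right_module R A" "x \<in> carrier (fob Y0 A)" for A x
  proof -
    have "f A \<in> rhom S (fob Y0 A) (fob Y1 A)"
      using 5(5) that(1) by (simp add: xy diagonals_simps nat_trans_RMod)
    then show ?thesis by (rule rlin_closed[OF rhom_rlin that(2)])
  qed
  then show ?case
    by (auto simp: xy diagonals_simps fun_eq_iff restrict_def compose_def)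
qed

lemma comodules_simps:
  "Obj (coalgebroid_comodules S C) = {X\<xi>. coalgebroid_comodule S C X\<xi>}"
  "Hom (coalgebroid_comodules S C) (X, \<xi>) (X', \<xi>') = {f \<in> rhom S X X'. \<forall>x \<in> carrier X. \<xi>' (f x) = mapC X X' f (\<xi> x)}"
  "Idn (coalgebroid_comodules S C) (X, \<xi>) = (\<lambda>x \<in> carrier X. x)"
  "Cmp (coalgebroid_comodules S C) (X, \<xi>) (X', \<xi>') (X'', \<xi>'') g f = compose (carrier X) g f"
  by (simp_all add: coalgebroid_comodules_def)

lemma category_comodules: "category (coalgebroid_comodules S C)"
proof (unfold_locales, goal_cases)
  case (1 x)
  obtain X \<xi> where x: "x = (X, \<xi>)" by (cases x)
  with 1 have X: "coalgebroid_comodule S C (X, \<xi>)" by (simp add: comodules_simps)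
  have "mapC X X (\<lambda>x \<in> carrier X. x) (\<xi> x) = \<xi> x" if "x \<in> carrier X" for x
    using mapC_id[OF X_mod[OF X] rlin_closed[OF \<xi>_rlin[OF X] that]]
    by (subst mapC_cong[where g = "\<lambda>n. n"]) auto
  then show ?case by (simp add: x comodules_simps rhom_id[OF X_mod[OF X]])
next
  case (2 x y z f g)
  obtain X \<xi> X' \<xi>' X'' \<xi>'' where xyz: "x = (X, \<xi>)" "y = (X', \<xi>')" "z = (X'', \<xi>'')" by (metis surj_pair)
  have X: "coalgebroid_comodule S C (X, \<xi>)" "coalgebroid_comodule S C (X', \<xi>')" "coalgebroid_comodule S C (X'', \<xi>'')"
    using 2(1-3) by (simp_all add: xyz comodules_simps)
  note m = X_mod[OF X(1)] X_mod[OF X(2)] X_mod[OF X(3)]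
  have f: "f \<in> rhom S X X'" "\<And>x. x \<in> carrier X \<Longrightarrow> \<xi>' (f x) = mapC X X' f (\<xi> x)"
    and g: "g \<in> rhom S X' X''" "\<And>x. x \<in> carrier X' \<Longrightarrow> \<xi>'' (g x) = mapC X' X'' g (\<xi>' x)"
    using 2(4,5) by (simp_all add: xyz comodules_simps)
  have "\<xi>'' (compose (carrier X) g f x) = mapC X X'' (compose (carrier X) g f) (\<xi> x)" if x: "x \<in> carrier X" for x
  proof -
    have "\<xi>'' (compose (carrier X) g f x) = mapC X' X'' g (mapC X X' f (\<xi> x))"
      using x f g rlin_closed[OF rhom_rlin[OF f(1)] x] by (simp add: compose_eq)
    also have "\<dots> = mapC X X'' (\<lambda>x. g (f x)) (\<xi> x)"
      by (rule mapC_comp[OF m rhom_rlin[OF f(1)] rhom_rlin[OF g(1)] rlin_closed[OF \<xi>_rlin[OF X(1)] x]])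
    also have "\<dots> = mapC X X'' (compose (carrier X) g f) (\<xi> x)"
      by (rule mapC_cong) (simp add: compose_eq)
    finally show ?thesis .
  qed
  then show ?case by (simp add: xyz comodules_simps rhom_compose[OF m(1) f(1) g(1)])
next
  case (3 x y f)
  obtain X \<xi> X' \<xi>' where xy: "x = (X, \<xi>)" "y = (X', \<xi>')" by (metis surj_pair)
  show ?case
    using category.Cmp_Idn_left[OF category_RMod, of X S X' f] 3 by (simp add: xy comodules_simps comodule_iff)
next
  case (4 x y f)
  obtain X \<xi> X' \<xi>' where xy: "x = (X, \<xi>)" "y = (X', \<xi>')" by (metis surj_pair)
  show ?case
    using category.Cmp_Idn_right[OF category_RMod, of X S X' f] 4 by (simp add: xy comodules_simps comodule_iff)
next
  case (5 w x y z f g h)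
  obtain X0 a0 X1 a1 X2 a2 X3 a3 where xy: "w = (X0, a0)" "x = (X1, a1)" "y = (X2, a2)" "z = (X3, a3)" by (metis surj_pair)
  show ?case
    using category.Cmp_assoc[OF category_RMod, of X0 S X1 X2 X3 f g h] 5 by (simp add: xy comodules_simps comodule_iff)
qed

section \<open>The coaction on Y(R)\<close>

definition xi0 :: "'u mod_ftor \<Rightarrow> ('u rmodule \<Rightarrow> ('u, 'x) rmodule_scheme \<Rightarrow> 'u \<Rightarrow> 'u) \<Rightarrow> 'u \<Rightarrow> 'u" where
  "xi0 Y y x = y Reg M0 (fhom Y Reg (star Reg M0) (iota R (star Reg M0) (sp Reg M0 \<one>\<^bsub>R\<^esub> u0)) x)"

definition xi :: "'u mod_ftor \<Rightarrow> ('u rmodule \<Rightarrow> ('u, 'x) rmodule_scheme \<Rightarrow> 'u \<Rightarrow> 'u) \<Rightarrow> 'u \<Rightarrow> 'u" where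
  "xi Y y = (\<lambda>x \<in> carrier (fob Y Reg). kap (fob Y Reg) (xi0 Y y x))"

lemma sp_one_closed: "M \<in> IOb \<Longrightarrow> m \<in> carrier M \<Longrightarrow> sp Reg M \<one>\<^bsub>R\<^esub> m \<in> carrier (star Reg M)"
  using sp_closed[OF Reg] by simp

lemma iota_at_one: "\<lbrakk>right_module R A; a \<in> carrier A\<rbrakk> \<Longrightarrow> iota R A a \<one>\<^bsub>R\<^esub> = a"
  by (simp add: iota_def right_module.ract_one)

context
  fixes Y y
  assumes Yy: "(Y, y) \<in> Obj diagonals"
begin

lemma d: "diagonal (Y, y)" and clf: "cocontinuous_linear_functor k R S Y"
  using Yy by (simp_all add: diagonals_simps)

interpretation W: watts k R S Y
  by unfold_locales (rule clf)

lemma watts_Y: "watts k R S Y" by (rule W.watts_axioms)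

abbreviation (input) "X \<equiv> fob Y Reg"

lemma Xm: "right_module S X" by (rule W.Y_mod[OF Reg])

lemma y_lin: "\<lbrakk>right_module R A; M \<in> IOb\<rbrakk> \<Longrightarrow> rlin S (fob Y (star A M)) (sharp (fob Y A) M) (y A M)"
  by (rule rhom_rlin[OF diagonal_hom[OF d]])

lemma xi0_rlin: "rlin S X (sharp X M0) (xi0 Y y)"
  unfolding xi0_def
  by (rule rlin_compose[OF W.Y_iota[OF star_mod[OF Reg M0_ob] sp_one_closed[OF M0_ob u0]] y_lin[OF Reg M0_ob]])

lemma xi_hom: "xi Y y \<in> rhom S X (rtensor S X C)"
  unfolding xi_def by (rule rlin_restrict[OF Xm rlin_compose[OF xi0_rlin kap_rlin[OF Xm]]])

lemma xi_closed: "x \<in> carrier X \<Longrightarrow> xi Y y x \<in> carrier (rtensor S X C)"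
  by (rule rlin_closed[OF rhom_rlin[OF xi_hom]])

lemma lam_xi: "x \<in> carrier X \<Longrightarrow> lam X M0 u0 (xi Y y x) = xi0 Y y x"
  using lam_kap[OF Xm rlin_closed[OF xi0_rlin]] by (simp add: xi_def)

text \<open>The map \<^term>\<open>y\<close> is determined by the coaction, by naturality along the maps $R \to A$ and
  \<^term>\<open>M0\<close> $\to$ \<^term>\<open>M\<close>.\<close>

lemma y_formula:
  assumes A: "right_module R A" and M: "M \<in> IOb" and a: "a \<in> carrier A" and m: "m \<in> carrier M" and x: "x \<in> carrier X"
  shows "y A M (fhom Y Reg (star A M) (iota R (star A M) (sp A M a m)) x)
    = lam (fob Y A) M m (mapC X (fob Y A) (fhom Y Reg A (iota R A a)) (xi Y y x))"
proof -
  obtain g where g: "g \<in> ihom M0 M" "g u0 = m" using M0_free[OF M m] by blast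
  let ?f = "iota R A a" and ?w = "sp Reg M0 \<one>\<^bsub>R\<^esub> u0"
  note f = iota_rhom[OF A a] and sR = star_mod[OF Reg M0_ob] and sA = star_mod[OF A M]
  note sm = smap_hom[OF Reg A M0_ob M f g(1)]
  have "smap Reg M0 A M ?f g ?w = sp A M a m"
    using smap_sp[OF Reg A M0_ob M f g(1) _ u0, of "\<one>\<^bsub>R\<^esub>"] by (simp add: iota_at_one[OF A a] g(2))
  then have "fhom Y Reg (star A M) (iota R (star A M) (sp A M a m)) x
      = fhom Y (star Reg M0) (star A M) (smap Reg M0 A M ?f g) (fhom Y Reg (star Reg M0) (iota R (star Reg M0) ?w) x)"
    using W.Y_iota_comp[OF sR sA sm sp_one_closed[OF M0_ob u0] x] by simp
  also have "y A M \<dots> = shmap X M0 (fob Y A) M (fhom Y Reg A ?f) g (y Reg M0 (fhom Y Reg (star Reg M0) (iota R (star Reg M0) ?w) x))"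
    using diagonal_natural[OF d Reg A M0_ob M f g(1) rlin_closed[OF W.Y_iota[OF sR sp_one_closed[OF M0_ob u0]] x]] by simp
  also have "\<dots> = shmap X M0 (fob Y A) M (fhom Y Reg A ?f) g (lam X M0 u0 (xi Y y x))"
    by (simp add: lam_xi x xi0_def)
  also have "\<dots> = lam (fob Y A) M m (mapC X (fob Y A) (fhom Y Reg A ?f) (xi Y y x))"
    using lam_shmap[OF Xm W.Y_mod[OF A] M0_ob M W.Y_hom[OF Reg A f] g(1) u0 xi_closed[OF x]] by (simp add: g(2))
  finally show ?thesis .
qed

lemma mapC_Y_one: "z \<in> carrier (rtensor S X C) \<Longrightarrow> mapC X X (fhom Y Reg Reg (iota R Reg \<one>\<^bsub>R\<^esub>)) z = z"
  using mapC_id[OF Xm] by (subst mapC_cong[where g = "\<lambda>n. n"]) (auto simp: W.Y_iota_one)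

text \<open>This is the counit axiom for y at the image of x under Y(iota_w), where w = 1 * r. The
  right unitor sends w to r, which gives the left side; \<open>lam_sh0\<close> turns the other side
  into the contraction of the coaction.\<close>

lemma xi_act:
  assumes r: "r \<in> carrier R" and x: "x \<in> carrier X"
  shows "fhom Y Reg Reg (iota R Reg r) x = mu X r (xi Y y x)"
proof -
  have r': "r \<in> carrier iunit" and one: "\<one>\<^bsub>R\<^esub> \<in> carrier Reg" using r by (simp_all add: iunit_carrier)
  note s = star_mod[OF Reg iunit_ob] and w = sp_one_closed[OF iunit_ob r']
  let ?z = "fhom Y Reg (star Reg iunit) (iota R (star Reg iunit) (sp Reg iunit \<one>\<^bsub>R\<^esub> r)) x"
  have z: "?z \<in> carrier (fob Y (star Reg iunit))" by (rule rlin_closed[OF W.Y_iota[OF s w] x])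
  have "sh0 X (y Reg iunit ?z) = fhom Y (star Reg iunit) Reg (srunit Reg) ?z"
    by (rule diagonal_counit[OF d Reg z])
  also have "\<dots> = fhom Y Reg Reg (iota R Reg r) x"
    using W.Y_iota_comp[OF s Reg srunit_hom[OF Reg] w x] srunit_sp[OF Reg one r] r by simp
  finally show ?thesis
    unfolding y_formula[OF Reg iunit_ob one r' x] mapC_Y_one[OF xi_closed[OF x]] lam_sh0[OF Xm r xi_closed[OF x]] by simp
qed

text \<open>Coassociativity is the coherence axiom for y at R, M0 and M0, evaluated at the generator
  given by 1, u0 and u0. Counitality is \<open>xi_act\<close> for r = \<one>.\<close>

lemma xi_comodule: "coalgebroid_comodule S C (X, xi Y y)"
  unfolding comodule_iff
proof (intro conjI ballI Xm xi_hom)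
  fix x assume x: "x \<in> carrier X"
  show "mu X \<one>\<^bsub>R\<^esub> (xi Y y x) = x"
    using xi_act[OF R.one_closed x] W.Y_iota_one[OF x] by simp
  note xx = xi_closed[OF x] and one = R.one_closed[folded regular_rmodule_simps(1)[of R]]
  note XC = NC_mod[OF Xm] and XM = sharp_mod[OF Xm M0_ob] and L = lam_rlin[OF Xm M0_ob u0] and xl = rhom_rlin[OF xi_hom]
  note MM = istar_ob[OF M0_ob M0_ob] and uu = ip_closed[OF M0_ob M0_ob u0 u0]
  note s1 = star_mod[OF Reg MM] and s2 = star_mod[OF Reg M0_ob] and s3 = star_mod[OF star_mod[OF Reg M0_ob] M0_ob]
  note w = sp_one_closed[OF MM uu] and w1 = sp_one_closed[OF M0_ob u0]
  let ?w = "sp Reg (istar M0 M0) \<one>\<^bsub>R\<^esub> (ip M0 M0 u0 u0)" and ?w1 = "sp Reg M0 \<one>\<^bsub>R\<^esub> u0"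
  let ?z = "fhom Y Reg (star Reg (istar M0 M0)) (iota R (star Reg (istar M0 M0)) ?w) x"
  let ?i = "fhom Y Reg (star Reg M0) (iota R (star Reg M0) ?w1)"
  have z: "?z \<in> carrier (fob Y (star Reg (istar M0 M0)))" by (rule rlin_closed[OF W.Y_iota[OF s1 w] x])
  note i = W.Y_hom[OF Reg s2 iota_rhom[OF s2 w1]]
  \<comment> \<open>The associator maps the generator to the one bracketed the other way, so that
    \<open>y_formula\<close> describes both sides of the axiom.\<close>
  have "fhom Y (star Reg (istar M0 M0)) (star (star Reg M0) M0) (sassoc Reg M0 M0) ?z
      = fhom Y Reg (star (star Reg M0) M0) (iota R (star (star Reg M0) M0) (sp (star Reg M0) M0 ?w1 u0)) x"
    using W.Y_iota_comp[OF s1 s3 sassoc_hom[OF Reg M0_ob M0_ob] w x] sassoc_sp[OF Reg M0_ob M0_ob one u0 u0] by simp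
  then have "shmap (fob Y (star Reg M0)) M0 (sharp X M0) M0 (y Reg M0) (\<lambda>m \<in> carrier M0. m)
      (lam (fob Y (star Reg M0)) M0 u0 (mapC X (fob Y (star Reg M0)) ?i (xi Y y x))) = sh2 X M0 M0 (y Reg (istar M0 M0) ?z)"
    using diagonal_coassoc[OF d Reg M0_ob M0_ob z] by (simp only: y_formula[OF s2 M0_ob w1 u0 x])
  also have "\<dots> = sh2 X M0 M0 (lam X (istar M0 M0) (ip M0 M0 u0 u0) (xi Y y x))"
    by (simp only: y_formula[OF Reg MM one uu x] mapC_Y_one[OF xx])
  also have "\<dots> = lam (sharp X M0) M0 u0 (mapC (rtensor S X C) (sharp X M0) (lam X M0 u0) (split X (xi Y y x)))"
    by (rule lam_sh2[OF Xm M0_ob M0_ob u0 u0 xx])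
  also have "shmap (fob Y (star Reg M0)) M0 (sharp X M0) M0 (y Reg M0) (\<lambda>m \<in> carrier M0. m)
      (lam (fob Y (star Reg M0)) M0 u0 (mapC X (fob Y (star Reg M0)) ?i (xi Y y x)))
    = lam (sharp X M0) M0 u0 (mapC X (sharp X M0) (\<lambda>n. y Reg M0 (?i n)) (xi Y y x))"
    unfolding lam_shmap_id[OF W.Y_mod[OF s2] XM M0_ob diagonal_hom[OF d Reg M0_ob] u0 rlin_closed[OF mapC_rlin[OF Xm W.Y_mod[OF s2] rhom_rlin[OF i]] xx]]
    by (simp only: mapC_comp[OF Xm W.Y_mod[OF s2] XM rhom_rlin[OF i] y_lin[OF Reg M0_ob] xx])
  also have "mapC X (sharp X M0) (\<lambda>n. y Reg M0 (?i n)) (xi Y y x) = mapC X (sharp X M0) (\<lambda>n. lam X M0 u0 (xi Y y n)) (xi Y y x)"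
    by (rule mapC_cong) (simp add: lam_xi xi0_def)
  also have "\<dots> = mapC (rtensor S X C) (sharp X M0) (lam X M0 u0) (mapC X (rtensor S X C) (xi Y y) (xi Y y x))"
    by (rule mapC_comp[symmetric, OF Xm XC XM xl L xx])
  finally have eq: "lam (sharp X M0) M0 u0 (mapC (rtensor S X C) (sharp X M0) (lam X M0 u0) (mapC X (rtensor S X C) (xi Y y) (xi Y y x)))
    = lam (sharp X M0) M0 u0 (mapC (rtensor S X C) (sharp X M0) (lam X M0 u0) (split X (xi Y y x)))" .
  let ?a = "mapC X (rtensor S X C) (xi Y y) (xi Y y x)" and ?b = "split X (xi Y y x)"
  have ab: "?a \<in> carrier (rtensor S (rtensor S X C) C)" "?b \<in> carrier (rtensor S (rtensor S X C) C)"
    using rlin_closed[OF mapC_rlin[OF Xm XC xl] xx] rlin_closed[OF split_rlin[OF Xm] xx] by auto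
  \<comment> \<open>Both sides carry the injective map \<open>lam\<close> twice: the outer copy is
    cancelled here, the inner one below by applying \<open>kap\<close> in the first factor.\<close>
  have "mapC (rtensor S X C) (sharp X M0) (lam X M0 u0) ?a = mapC (rtensor S X C) (sharp X M0) (lam X M0 u0) ?b"
    by (rule lam_inj[OF XM _ _ eq]) (use rlin_closed[OF mapC_rlin[OF XC XM L]] ab in auto)
  moreover have "mapC (sharp X M0) (rtensor S X C) (kap X) (mapC (rtensor S X C) (sharp X M0) (lam X M0 u0) c) = c"
    if c: "c \<in> carrier (rtensor S (rtensor S X C) C)" for c
    unfolding mapC_comp[OF XC XM XC L kap_rlin[OF Xm] c]
    by (subst mapC_cong[where g = "\<lambda>n. n"]) (auto simp: kap_lam[OF Xm] mapC_id[OF XC c])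
  ultimately show "?a = ?b" using ab by metis
qed

end

section \<open>Full faithfulness of evaluation at R\<close>

definition E where
  "E = \<lparr>fob = (\<lambda>(Y, y). (fob Y Reg, xi Y y)), fhom = (\<lambda>_ _ t. t Reg)\<rparr>"

lemma E_simps [simp]: "fob E (Y, y) = (fob Y Reg, xi Y y)" "fhom E Yy Yy' t = t Reg"
  by (simp_all add: E_def)

context
  fixes Y y Y' y'
  assumes Yy: "(Y, y) \<in> Obj diagonals" and Yy': "(Y', y') \<in> Obj diagonals"
begin

interpretation W: watts k R S Y by (rule watts_Y[OF Yy])
interpretation W': watts k R S Y' by (rule watts_Y[OF Yy'])

lemma hom_iff: "t \<in> Hom diagonals (Y, y) (Y', y') \<longleftrightarrow> t \<in> nat_trans (RMod R) (RMod S) Y Y' \<and>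
    (\<forall>A. right_module R A \<longrightarrow> (\<forall>M \<in> IOb. \<forall>z \<in> carrier (fob Y (star A M)).
       y' A M (t (star A M) z) = shmap (fob Y A) M (fob Y' A) M (t A) (\<lambda>m \<in> carrier M. m) (y A M z)))"
  by (simp add: diagonals_simps)

lemma nat_iota:
  fixes A :: "'u rmodule"
  assumes t: "t \<in> nat_trans (RMod R) (RMod S) Y Y'" and A: "right_module R A" and a: "a \<in> carrier A" and x: "x \<in> carrier (fob Y Reg)"
  shows "t A (fhom Y Reg A (iota R A a) x) = fhom Y' Reg A (iota R A a) (t Reg x)"
proof -
  have "compose (carrier (fob Y Reg)) (fhom Y' Reg A (iota R A a)) (t Reg) x = compose (carrier (fob Y Reg)) (t A) (fhom Y Reg A (iota R A a)) x"
    using t Reg A iota_rhom[OF A a] by (simp add: nat_trans_RMod)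
  then show ?thesis by (simp add: compose_eq[OF x])
qed

text \<open>Compatibility of t with y at R and M0 says that the two sides agree after
  \<open>lam\<close> with \<open>u0\<close>, which is injective.\<close>

lemma E_hom:
  assumes t: "t \<in> Hom diagonals (Y, y) (Y', y')"
  shows "t Reg \<in> Hom (coalgebroid_comodules S C) (fob E (Y, y)) (fob E (Y', y'))"
proof -
  let ?X = "fob Y Reg" and ?X' = "fob Y' Reg"
  have tn: "t \<in> nat_trans (RMod R) (RMod S) Y Y'" using t by (simp add: hom_iff)
  have tR: "t Reg \<in> rhom S ?X ?X'" using tn Reg by (simp add: nat_trans_RMod)
  note tl = rhom_rlin[OF tR]
  note s = star_mod[OF Reg M0_ob] and w = sp_one_closed[OF M0_ob u0]
  have "xi Y' y' (t Reg x) = mapC ?X ?X' (t Reg) (xi Y y x)" if x: "x \<in> carrier ?X" for x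
  proof (rule lam_inj[OF Xm[OF Yy']])
    have tx: "t Reg x \<in> carrier ?X'" by (rule rlin_closed[OF tl x])
    show "xi Y' y' (t Reg x) \<in> carrier (rtensor S ?X' C)" by (rule xi_closed[OF Yy' tx])
    show "mapC ?X ?X' (t Reg) (xi Y y x) \<in> carrier (rtensor S ?X' C)"
      by (rule rlin_closed[OF mapC_rlin[OF Xm[OF Yy] Xm[OF Yy'] tl] xi_closed[OF Yy x]])
    have z: "fhom Y Reg (star Reg M0) (iota R (star Reg M0) (sp Reg M0 \<one>\<^bsub>R\<^esub> u0)) x \<in> carrier (fob Y (star Reg M0))"
      by (rule rlin_closed[OF W.Y_iota[OF s w] x])
    have "lam ?X' M0 u0 (xi Y' y' (t Reg x)) = y' Reg M0 (t (star Reg M0) (fhom Y Reg (star Reg M0) (iota R (star Reg M0) (sp Reg M0 \<one>\<^bsub>R\<^esub> u0)) x))"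
      unfolding lam_xi[OF Yy' tx] nat_iota[OF tn s w x] xi0_def ..
    also have "\<dots> = shmap ?X M0 ?X' M0 (t Reg) (\<lambda>m \<in> carrier M0. m) (xi0 Y y x)"
      using t Reg M0_ob z by (simp add: hom_iff xi0_def)
    also have "\<dots> = lam ?X' M0 u0 (mapC ?X ?X' (t Reg) (xi Y y x))"
      unfolding lam_xi[OF Yy x, symmetric] by (rule lam_shmap_id[OF Xm[OF Yy] Xm[OF Yy'] M0_ob tR u0 xi_closed[OF Yy x]])
    finally show "lam ?X' M0 u0 (xi Y' y' (t Reg x)) = lam ?X' M0 u0 (mapC ?X ?X' (t Reg) (xi Y y x))" .
  qed
  with tR show ?thesis by (simp add: comodules_simps)
qed

text \<open>Naturality along the maps iota_a determines t on the generators of Y(A) from its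
  component at R.\<close>

lemma E_faithful:
  assumes t: "t \<in> nat_trans (RMod R) (RMod S) Y Y'" and t': "t' \<in> nat_trans (RMod R) (RMod S) Y Y'" and eq: "t Reg = t' Reg"
  shows "t = t'"
proof (rule extensionalityI[of _ "{A. right_module R A}"])
  fix A :: "'u rmodule" assume "A \<in> {A. right_module R A}"
  then have A: "right_module R A" by simp
  have tA: "t A \<in> rhom S (fob Y A) (fob Y' A)" "t' A \<in> rhom S (fob Y A) (fob Y' A)"
    using t t' A by (simp_all add: nat_trans_RMod)
  show "t A = t' A"
    by (rule rhom_ext[OF tA], rule W.watts_eq[OF A W'.Y_mod[OF A] rhom_rlin[OF tA(1)] rhom_rlin[OF tA(2)]])
      (simp_all add: nat_iota[OF t A] nat_iota[OF t' A] eq)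
qed (use t t' in \<open>simp_all add: nat_trans_RMod\<close>)

text \<open>By \<open>xi_act\<close> the R-actions coming from Y and Y' are given by the coactions,
  so a comodule map f commutes with them. Hence the prescription Y(iota_a)(x) -> Y'(iota_a)(f x)
  respects the relations of \<open>watts_exists\<close> and extends to every Y(A).\<close>

lemma E_full:
  assumes f: "f \<in> Hom (coalgebroid_comodules S C) (fob E (Y, y)) (fob E (Y', y'))"
  obtains t where "t \<in> Hom diagonals (Y, y) (Y', y')" "t Reg = f"
proof -
  let ?X = "fob Y Reg" and ?X' = "fob Y' Reg"
  note X = Xm[OF Yy] and X' = Xm[OF Yy']
  have fh: "f \<in> rhom S ?X ?X'" and f\<xi>: "\<And>x. x \<in> carrier ?X \<Longrightarrow> xi Y' y' (f x) = mapC ?X ?X' f (xi Y y x)"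
    using f by (simp_all add: comodules_simps)
  note fl = rhom_rlin[OF fh]
  have f_act: "f (fhom Y Reg Reg (iota R Reg r) x) = fhom Y' Reg Reg (iota R Reg r) (f x)"
    if "r \<in> carrier R" "x \<in> carrier ?X" for r x
    using that by (simp add: xi_act[OF Yy] xi_act[OF Yy'] rlin_closed[OF fl] f\<xi> mu_natural[OF X X' fl] xi_closed[OF Yy])
  have ex: "\<exists>h. h \<in> rhom S (fob Y A) (fob Y' A) \<and>
      (\<forall>a \<in> carrier A. \<forall>x \<in> carrier ?X. h (fhom Y Reg A (iota R A a) x) = fhom Y' Reg A (iota R A a) (f x))"
    if A: "right_module R A" for A
  proof -
    note Y'A = W'.Y_mod[OF A]
    have 1: "biadditive A ?X (fob Y' A) (\<lambda>a x. fhom Y' Reg A (iota R A a) (f x))"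
      by (intro biadditiveI) (simp_all add: rlin_closed[OF fl] rlin_add[OF fl] rlin_closed[OF W'.Y_iota[OF A]]
          rlin_add[OF W'.Y_iota[OF A]] W'.Y_iota_add[OF A])
    have 2: "fhom Y' Reg A (iota R A a) (f (x \<triangleleft>\<^bsub>?X\<^esub> s)) = fhom Y' Reg A (iota R A a) (f x) \<triangleleft>\<^bsub>fob Y' A\<^esub> s"
      if "a \<in> carrier A" "x \<in> carrier ?X" "s \<in> carrier S" for a x s
      using that by (simp add: rlin_ract[OF fl] rlin_ract[OF W'.Y_iota[OF A]] rlin_closed[OF fl])
    have 3: "fhom Y' Reg A (iota R A (a \<triangleleft>\<^bsub>A\<^esub> r)) (f x) = fhom Y' Reg A (iota R A a) (f (fhom Y Reg Reg (iota R Reg r) x))"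
      if "a \<in> carrier A" "r \<in> carrier R" "x \<in> carrier ?X" for a r x
      using that by (simp add: W'.Y_iota_ract[OF A] rlin_closed[OF fl] f_act)
    obtain h where "h \<in> rhom S (fob Y A) (fob Y' A)"
      "\<And>a x. \<lbrakk>a \<in> carrier A; x \<in> carrier ?X\<rbrakk> \<Longrightarrow> h (fhom Y Reg A (iota R A a) x) = fhom Y' Reg A (iota R A a) (f x)"
      using W.watts_exists[OF A Y'A 1, OF 2 3] by blast
    then show ?thesis by blast
  qed
  then obtain t0 where t0: "\<And>A. right_module R A \<Longrightarrow> t0 A \<in> rhom S (fob Y A) (fob Y' A)"
    and t0_iota: "\<And>A a x. \<lbrakk>right_module R A; a \<in> carrier A; x \<in> carrier ?X\<rbrakk> \<Longrightarrow> t0 A (fhom Y Reg A (iota R A a) x) = fhom Y' Reg A (iota R A a) (f x)"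
    by metis
  define t where "t = (\<lambda>A \<in> {A. right_module R A}. t0 A)"
  have tA: "t A = t0 A" if "right_module R A" for A using that by (simp add: t_def)
  note tl = rhom_rlin[OF t0]
  have "compose (carrier (fob Y A)) (fhom Y' A B g) (t0 A) = compose (carrier (fob Y A)) (t0 B) (fhom Y A B g)"
    if A: "right_module R A" and B: "right_module R B" and g: "g \<in> rhom R A B" for A B g
  proof (rule extensionalityI[of _ "carrier (fob Y A)"])
    fix z assume z: "z \<in> carrier (fob Y A)"
    have "fhom Y' A B g (t0 A z) = t0 B (fhom Y A B g z)"
    proof (rule W.watts_eq[OF A W'.Y_mod[OF B] rlin_compose[OF tl[OF A] rhom_rlin[OF W'.Y_hom[OF A B g]]]
          rlin_compose[OF rhom_rlin[OF W.Y_hom[OF A B g]] tl[OF B]] _ z])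
      fix a x assume a: "a \<in> carrier A" and x: "x \<in> carrier ?X"
      have ga: "g a \<in> carrier B" by (rule rlin_closed[OF rhom_rlin[OF g] a])
      show "fhom Y' A B g (t0 A (fhom Y Reg A (iota R A a) x)) = t0 B (fhom Y A B g (fhom Y Reg A (iota R A a) x))"
        unfolding t0_iota[OF A a x] W.Y_iota_comp[OF A B g a x] t0_iota[OF B ga x]
        by (rule W'.Y_iota_comp[OF A B g a rlin_closed[OF fl x]])
    qed
    with z show "compose (carrier (fob Y A)) (fhom Y' A B g) (t0 A) z = compose (carrier (fob Y A)) (t0 B) (fhom Y A B g) z"
      by (simp add: compose_eq)
  qed auto
  then have tn: "t \<in> nat_trans (RMod R) (RMod S) Y Y'"
    using t0 by (simp add: nat_trans_RMod tA) (simp add: t_def)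
  have "y' A M (t0 (star A M) z) = shmap (fob Y A) M (fob Y' A) M (t0 A) (\<lambda>m \<in> carrier M. m) (y A M z)"
    if A: "right_module R A" and M: "M \<in> IOb" and z: "z \<in> carrier (fob Y (star A M))" for A M z
  proof -
    note sA = star_mod[OF A M] and YA = W.Y_mod[OF A] and Y'A = W'.Y_mod[OF A]
    note sh = shmap_hom[OF YA Y'A M M t0[OF A] ihom_id[OF M]]
    note l1 = rlin_compose[OF tl[OF sA] y_lin[OF Yy' A M]] and l2 = rlin_compose[OF y_lin[OF Yy A M] sh]
    note N = sharp_mod[OF Y'A M]
    \<comment> \<open>Two rounds of generators: first those of Y(A * M) indexed by w in A * M, then,
      by additivity in w, the elements a * m, for which \<open>y_formula\<close> is
      available.\<close>
    show ?thesis
    proof (rule W.watts_eq[OF sA N l1 l2 _ z])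
      fix w x assume w: "w \<in> carrier (star A M)" and x: "x \<in> carrier ?X"
      have add: "additive (star A M) (fob Y (star A M)) (\<lambda>w. fhom Y Reg (star A M) (iota R (star A M) w) x)"
        by (intro additiveI) (simp_all add: rlin_closed[OF W.Y_iota[OF sA]] W.Y_iota_add[OF sA] x)
      show "y' A M (t0 (star A M) (fhom Y Reg (star A M) (iota R (star A M) w) x))
        = shmap (fob Y A) M (fob Y' A) M (t0 A) (\<lambda>m \<in> carrier M. m) (y A M (fhom Y Reg (star A M) (iota R (star A M) w) x))"
      proof (rule star_eq[OF A M additive_compose[OF add rlin_additive[OF l1]] additive_compose[OF add rlin_additive[OF l2]] _ w])
        fix a m assume a: "a \<in> carrier A" and m: "m \<in> carrier M"
        note fx = rlin_closed[OF fl x] and xx = xi_closed[OF Yy x]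
        note i = W.Y_iota[OF A a] and i' = W'.Y_iota[OF A a]
        have "y' A M (t0 (star A M) (fhom Y Reg (star A M) (iota R (star A M) (sp A M a m)) x))
          = lam (fob Y' A) M m (mapC ?X' (fob Y' A) (fhom Y' Reg A (iota R A a)) (mapC ?X ?X' f (xi Y y x)))"
          unfolding t0_iota[OF sA sp_closed[OF A M a m] x] y_formula[OF Yy' A M a m fx] f\<xi>[OF x] ..
        also have "\<dots> = lam (fob Y' A) M m (mapC (fob Y A) (fob Y' A) (t0 A) (mapC ?X (fob Y A) (fhom Y Reg A (iota R A a)) (xi Y y x)))"
          unfolding mapC_comp[OF X X' Y'A fl i' xx] mapC_comp[OF X YA Y'A i tl[OF A] xx]
          by (rule arg_cong[of _ _ "lam (fob Y' A) M m"], rule mapC_cong) (simp add: t0_iota[OF A a])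
        also have "\<dots> = shmap (fob Y A) M (fob Y' A) M (t0 A) (\<lambda>m \<in> carrier M. m) (y A M (fhom Y Reg (star A M) (iota R (star A M) (sp A M a m)) x))"
          unfolding y_formula[OF Yy A M a m x]
          by (rule lam_shmap_id[symmetric, OF YA Y'A M t0[OF A] m rlin_closed[OF mapC_rlin[OF X YA i] xx]])
        finally show "y' A M (t0 (star A M) (fhom Y Reg (star A M) (iota R (star A M) (sp A M a m)) x)) =
          shmap (fob Y A) M (fob Y' A) M (t0 A) (\<lambda>m \<in> carrier M. m) (y A M (fhom Y Reg (star A M) (iota R (star A M) (sp A M a m)) x))" .
      qed
    qed
  qed
  with tn have t: "t \<in> Hom diagonals (Y, y) (Y', y')" by (simp add: hom_iff tA star_mod)
  have "t Reg = f"
  proof (rule rhom_ext[of _ S ?X ?X' _ ?X'])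
    show "t Reg \<in> rhom S ?X ?X'" using t0[OF Reg] by (simp add: tA Reg)
    show "f \<in> rhom S ?X ?X'" by (rule fh)
    fix x assume x: "x \<in> carrier ?X"
    \<comment> \<open>iota of \<one> is the identity of R, so the value prescribed there is that of
      f.\<close>
    have "t0 Reg (fhom Y Reg Reg (iota R Reg \<one>\<^bsub>R\<^esub>) x) = fhom Y' Reg Reg (iota R Reg \<one>\<^bsub>R\<^esub>) (f x)"
      by (rule t0_iota[OF Reg _ x]) simp
    then show "t Reg x = f x" by (simp add: tA Reg W.Y_iota_one x W'.Y_iota_one rlin_closed[OF fl x])
  qed
  with t show ?thesis using that by blast
qed

end

lemma E_functor: "cat_functor diagonals (coalgebroid_comodules S C) E"
proof -
  interpret dom: category diagonals by (rule category_diagonals)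
  interpret cod: category "coalgebroid_comodules S C" by (rule category_comodules)
  show ?thesis
  proof (unfold_locales, goal_cases)
    case (1 x)
    then show ?case by (cases x) (simp add: comodules_simps xi_comodule)
  next
    case (2 x y f)
    then show ?case using E_hom by (cases x; cases y) auto
  next
    case (3 x)
    then show ?case by (cases x) (simp add: comodules_simps diagonals_simps Reg)
  next
    case (4 x y z f g)
    then show ?case by (cases x; cases y; cases z) (simp add: comodules_simps diagonals_simps Reg)
  qed
qed

lemma E_bij:
  assumes "x \<in> Obj diagonals" "y \<in> Obj diagonals"
  shows "bij_betw (fhom E x y) (Hom diagonals x y) (Hom (coalgebroid_comodules S C) (fob E x) (fob E y))"
proof -
  obtain Y a Y' a' where xy: "x = (Y, a)" "y = (Y', a')" by (metis surj_pair)
  note ob = assms[unfolded xy]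
  show ?thesis
    unfolding bij_betw_def xy
  proof
    show "inj_on (fhom E (Y, a) (Y', a')) (Hom diagonals (Y, a) (Y', a'))"
      by (rule inj_onI) (use E_faithful[OF ob] hom_iff[OF ob] in auto)
    show "fhom E (Y, a) (Y', a') ` Hom diagonals (Y, a) (Y', a') = Hom (coalgebroid_comodules S C) (fob E (Y, a)) (fob E (Y', a'))"
    proof
      show "fhom E (Y, a) (Y', a') ` Hom diagonals (Y, a) (Y', a') \<subseteq> Hom (coalgebroid_comodules S C) (fob E (Y, a)) (fob E (Y', a'))"
        using E_hom[OF ob] by (simp only: E_simps image_subset_iff) blast
      show "Hom (coalgebroid_comodules S C) (fob E (Y, a)) (fob E (Y', a')) \<subseteq> fhom E (Y, a) (Y', a') ` Hom diagonals (Y, a) (Y', a')"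
      proof
        fix f assume "f \<in> Hom (coalgebroid_comodules S C) (fob E (Y, a)) (fob E (Y', a'))"
        then obtain t where "t \<in> Hom diagonals (Y, a) (Y', a')" "t Reg = f" by (rule E_full[OF ob])
        then show "f \<in> fhom E (Y, a) (Y', a') ` Hom diagonals (Y, a) (Y', a')" by (metis E_simps(2) image_eqI)
      qed
    qed
  qed
qed

end

section \<open>Essential surjectivity: the functor built from a comodule\<close>

context comodule_scheme
begin

context
  fixes X :: "'u rmodule" and \<xi> :: "'u \<Rightarrow> 'u"
  assumes X\<xi>: "coalgebroid_comodule S C (X, \<xi>)"
begin

abbreviation (input) "XB \<equiv> Xb X \<xi>"
abbreviation (input) "Y \<equiv> tensor_ftor R XB"
abbreviation (input) "YX A \<equiv> rtensor R A XB"
abbreviation (input) "tp A \<equiv> rpure R A XB"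

lemmas Xm' = X_mod[OF X\<xi>] and bX = Xb_bimod[OF X\<xi>] and \<xi>l = \<xi>_rlin[OF X\<xi>] and simpX = Xb_simps[OF X\<xi>]

lemma lX: "left_module R XB" using bX by (simp add: bimod_def)

lemma \<xi>c: "x \<in> carrier X \<Longrightarrow> \<xi> x \<in> carrier (rtensor S X C)"
  by (rule rlin_closed[OF \<xi>l])

lemma YX_mod: "right_module R A \<Longrightarrow> right_module S (YX A)"
  by (rule rt_right_module[OF _ lX bX])

lemma tp:
  assumes A: "right_module R A"
  shows tp_closed: "\<lbrakk>a \<in> carrier A; x \<in> carrier X\<rbrakk> \<Longrightarrow> tp A a x \<in> carrier (YX A)"
    and tp_add: "\<lbrakk>a \<in> carrier A; a' \<in> carrier A; x \<in> carrier X\<rbrakk> \<Longrightarrow> tp A (a \<oplus>\<^bsub>A\<^esub> a') x = tp A a x \<oplus>\<^bsub>YX A\<^esub> tp A a' x"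
      "\<lbrakk>a \<in> carrier A; x \<in> carrier X; x' \<in> carrier X\<rbrakk> \<Longrightarrow> tp A a (x \<oplus>\<^bsub>X\<^esub> x') = tp A a x \<oplus>\<^bsub>YX A\<^esub> tp A a x'"
    and tp_balanced: "\<lbrakk>a \<in> carrier A; r \<in> carrier R; x \<in> carrier X\<rbrakk> \<Longrightarrow> tp A (a \<triangleleft>\<^bsub>A\<^esub> r) x = tp A a (act X \<xi> r x)"
    and tp_ract: "\<lbrakk>a \<in> carrier A; x \<in> carrier X; s \<in> carrier S\<rbrakk> \<Longrightarrow> tp A a x \<triangleleft>\<^bsub>YX A\<^esub> s = tp A a (x \<triangleleft>\<^bsub>X\<^esub> s)"
  using rpure_closed[OF A lX] rpure_add[OF A lX] rpure_balanced[OF A lX] rt_ract_pure[OF A lX bX]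
  by (simp_all add: simpX)

lemma tp_rlin: "right_module R A \<Longrightarrow> a \<in> carrier A \<Longrightarrow> rlin S X (YX A) (tp A a)"
  by (intro rlinI additiveI) (simp_all add: tp_closed tp_add tp_ract)

lemma YX_eq:
  assumes A: "right_module R A" and "additive (YX A) G h" "additive (YX A) G h'"
    and "\<And>a x. \<lbrakk>a \<in> carrier A; x \<in> carrier X\<rbrakk> \<Longrightarrow> h (tp A a x) = h' (tp A a x)" "z \<in> carrier (YX A)"
  shows "h z = h' z"
  using rt_hom_eq[OF A lX assms(2,3)] assms(4,5) by (simp add: simpX)

lemma Ymap:
  assumes "right_module R A" "right_module R B" "f \<in> rhom R A B"
  shows Ymap_rlin: "rlin S (YX A) (YX B) (fhom Y A B f)"
    and Ymap_tp: "\<lbrakk>a \<in> carrier A; x \<in> carrier X\<rbrakk> \<Longrightarrow> fhom Y A B f (tp A a x) = tp B (f a) x"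
  using rhom_rlin[OF tensor_map_rhom[OF bX assms]] tensor_map_pure[OF bX assms] by (simp_all add: simpX)

text \<open>The intended value of y at (a * m) \<otimes> x, namely the sum of (a \<otimes> x_(0)) #
  m # x_(1).\<close>

definition B where "B A M a m x = lam (YX A) M m (mapC X (YX A) (tp A a) (\<xi> x))"

context
  fixes A :: "'u rmodule" and M :: "('u, 'x) rmodule_scheme"
  assumes A: "right_module R A" and M: "M \<in> IOb"
begin

lemmas YA = YX_mod[OF A] and NM = sharp_mod[OF YX_mod[OF A] M] and sA = star_mod[OF A M]

lemma Cl: "a \<in> carrier A \<Longrightarrow> rlin S (rtensor S X C) (rtensor S (YX A) C) (mapC X (YX A) (tp A a))"
  by (rule mapC_rlin[OF Xm' YA tp_rlin[OF A]])

lemma Cc: "\<lbrakk>a \<in> carrier A; x \<in> carrier X\<rbrakk> \<Longrightarrow> mapC X (YX A) (tp A a) (\<xi> x) \<in> carrier (rtensor S (YX A) C)"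
  by (rule rlin_closed[OF Cl \<xi>c])

lemma C_add:
  assumes a: "a \<in> carrier A" "a' \<in> carrier A" and z: "z \<in> carrier (rtensor S X C)"
  shows "mapC X (YX A) (tp A (a \<oplus>\<^bsub>A\<^esub> a')) z = mapC X (YX A) (tp A a) z \<oplus>\<^bsub>rtensor S (YX A) C\<^esub> mapC X (YX A) (tp A a') z"
proof -
  interpret A: right_module R A by (rule A)
  have aa: "a \<oplus>\<^bsub>A\<^esub> a' \<in> carrier A" using a by simp
  note P = mapC_pure[OF Xm' YA tp_rlin[OF A]]
  show ?thesis
    by (rule NC_eq[OF Xm' rlin_additive[OF Cl[OF aa]] additive_sum_maps[OF rlin_additive[OF Cl[OF a(1)]] rlin_additive[OF Cl[OF a(2)]]
          right_module_abelian[OF NC_mod[OF YA]]] _ z])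
      (simp add: P[OF aa] P[OF a(1)] P[OF a(2)] tp_add[OF A] a pu_add[OF YA] tp_closed[OF A])
qed

lemma B_closed: "\<lbrakk>a \<in> carrier A; m \<in> carrier M; x \<in> carrier X\<rbrakk> \<Longrightarrow> B A M a m x \<in> carrier (sharp (YX A) M)"
  unfolding B_def by (rule lam_closed[OF YA M _ Cc])

lemma B_rlin: "\<lbrakk>a \<in> carrier A; m \<in> carrier M\<rbrakk> \<Longrightarrow> rlin S X (sharp (YX A) M) (B A M a m)"
  unfolding B_def by (rule rlin_compose[OF rlin_compose[OF \<xi>l Cl] lam_rlin[OF YA M]])

lemma B_biadditive: "x \<in> carrier X \<Longrightarrow> biadditive A M (sharp (YX A) M) (\<lambda>a m. B A M a m x)"
  by (rule biadditiveI)
    (simp_all add: B_closed, simp_all add: B_def C_add \<xi>c rlin_add[OF lam_rlin[OF YA M]] Cc lam_add[OF YA M])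

text \<open>The first rule rests on \<open>\<xi>_act\<close>, the second on the exchange rule
  \<open>act_\<xi>\<close>. Both end in an action on the coefficient x_(1), which
  \<open>lam_mapR\<close> identifies with the action on m.\<close>

lemma B_balanced:
  assumes a: "a \<in> carrier A" and m: "m \<in> carrier M" and x: "x \<in> carrier X"
  shows "r \<in> carrier R \<Longrightarrow> B A M a (m \<triangleleft>\<^bsub>M\<^esub> r) x = B A M a m (act X \<xi> r x)"
    and "r \<in> Z \<Longrightarrow> B A M (a \<triangleleft>\<^bsub>A\<^esub> r) m x = B A M a (la M r m) x"
proof -
  assume r: "r \<in> carrier R"
  show "B A M a (m \<triangleleft>\<^bsub>M\<^esub> r) x = B A M a m (act X \<xi> r x)"
    unfolding B_def lam_mapR(1)[OF YA M m Cc[OF a x] r] \<xi>_act[OF X\<xi> r x]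
    by (simp only: mapC_mapR[OF Xm' YA tp_rlin[OF A a] lactR_lin(1)[OF r] \<xi>c[OF x]])
next
  assume rZ: "r \<in> Z"
  then have r: "r \<in> carrier R" using Z_sub by blast
  have "mapC X (YX A) (tp A (a \<triangleleft>\<^bsub>A\<^esub> r)) (\<xi> x) = mapC X (YX A) (\<lambda>x. tp A a (act X \<xi> r x)) (\<xi> x)"
    by (rule mapC_cong) (simp add: tp_balanced[OF A a r])
  also have "\<dots> = mapC X (YX A) (tp A a) (mapC X X (act X \<xi> r) (\<xi> x))"
    by (rule mapC_comp[symmetric, OF Xm' Xm' YA act_rlin[OF X\<xi> r] tp_rlin[OF A a] \<xi>c[OF x]])
  also have "\<dots> = mapR (YX A) (\<lambda>c. c \<unlhd>\<^bsub>C\<^esub> r) (mapC X (YX A) (tp A a) (\<xi> x))"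
    by (simp only: act_\<xi>[OF X\<xi> r x] mapC_mapR[OF Xm' YA tp_rlin[OF A a] ractR_lin(1)[OF r] \<xi>c[OF x]])
  finally show "B A M (a \<triangleleft>\<^bsub>A\<^esub> r) m x = B A M a (la M r m) x"
    unfolding B_def lam_mapR(2)[OF YA M m Cc[OF a x] rZ] by simp
qed

lemma H_exists:
  assumes x: "x \<in> carrier X"
  shows "\<exists>h. additive (star A M) (sharp (YX A) M) h \<and> (\<forall>a \<in> carrier A. \<forall>m \<in> carrier M. h (sp A M a m) = B A M a m x)"
  by (rule star_lift[OF A M right_module_abelian[OF NM] B_biadditive[OF x]])
    (simp add: B_balanced(2)[OF _ _ x])

end

text \<open>The scheme asserts that lifts out of A * M exist without naming them, hence the
  choice.\<close>

definition H where
  "H A M x = (SOME h. additive (star A M) (sharp (YX A) M) h \<and>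
     (\<forall>a \<in> carrier A. \<forall>m \<in> carrier M. h (sp A M a m) = B A M a m x))"

definition yX where
  "yX A M = rlift R (star A M) XB (sharp (YX A) M) (\<lambda>w x. H A M x w)"

context
  fixes A :: "'u rmodule" and M :: "('u, 'x) rmodule_scheme"
  assumes A: "right_module R A" and M: "M \<in> IOb"
begin

interpretation Xr: right_module S X by (rule Xm')
interpretation N: right_module S "sharp (YX A) M" by (rule NM[OF A M])

lemma H: "x \<in> carrier X \<Longrightarrow> additive (star A M) (sharp (YX A) M) (H A M x)"
  "\<lbrakk>x \<in> carrier X; a \<in> carrier A; m \<in> carrier M\<rbrakk> \<Longrightarrow> H A M x (sp A M a m) = B A M a m x"
  using someI_ex[OF H_exists[OF A M], of x] unfolding H_def by blast+

lemma H_add: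
  assumes x: "x \<in> carrier X" "x' \<in> carrier X" and w: "w \<in> carrier (star A M)"
  shows "H A M (x \<oplus>\<^bsub>X\<^esub> x') w = H A M x w \<oplus>\<^bsub>sharp (YX A) M\<^esub> H A M x' w"
  by (rule star_eq[OF A M H(1)[OF Xr.M.a_closed[OF x]] additive_sum_maps[OF H(1)[OF x(1)] H(1)[OF x(2)] N.M.abelian_group_axioms] _ w])
    (use x in \<open>simp add: H(2) rlin_add[OF B_rlin[OF A M]]\<close>)

text \<open>The first part of \<open>B_balanced\<close>, extended by additivity from the elements a
  * m to all of A * M.\<close>

lemma H_balanced:
  assumes x: "x \<in> carrier X" and r: "r \<in> carrier R" and w: "w \<in> carrier (star A M)"
  shows "H A M x (w \<triangleleft>\<^bsub>star A M\<^esub> r) = H A M (act X \<xi> r x) w"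
proof -
  interpret s: right_module R "star A M" by (rule star_mod[OF A M])
  interpret M: right_module R M by (rule IOb_mod[OF M])
  have ax: "act X \<xi> r x \<in> carrier X" by (rule rlin_closed[OF act_rlin[OF X\<xi> r] x])
  have "additive (star A M) (star A M) (\<lambda>w. w \<triangleleft>\<^bsub>star A M\<^esub> r)"
    using r by (intro additiveI) (simp_all add: s.ract_closed s.ract_add)
  then show ?thesis
    by (rule star_eq[OF A M additive_compose[OF _ H(1)[OF x]] H(1)[OF ax] _ w])
      (simp add: sp_ract[OF A M _ _ r] H(2)[OF x] H(2)[OF ax] M.ract_closed r B_balanced(1)[OF A M _ _ x r])
qed

lemma H_ract:
  assumes x: "x \<in> carrier X" and s: "s \<in> carrier S" and w: "w \<in> carrier (star A M)"
  shows "H A M (x \<triangleleft>\<^bsub>X\<^esub> s) w = H A M x w \<triangleleft>\<^bsub>sharp (YX A) M\<^esub> s"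
proof -
  have "additive (sharp (YX A) M) (sharp (YX A) M) (\<lambda>n. n \<triangleleft>\<^bsub>sharp (YX A) M\<^esub> s)"
    using s by (intro additiveI) (simp_all add: N.ract_closed N.ract_add)
  note add = additive_compose[OF H(1)[OF x] this]
  show ?thesis
    by (rule star_eq[OF A M H(1)[OF Xr.ract_closed[OF x s]] add _ w])
      (simp add: H(2)[OF x] H(2)[OF Xr.ract_closed[OF x s]] rlin_ract[OF B_rlin[OF A M] x s])
qed

lemma yX:
  shows yX_hom: "yX A M \<in> rhom S (YX (star A M)) (sharp (YX A) M)"
    and yX_tp: "\<lbrakk>w \<in> carrier (star A M); x \<in> carrier X\<rbrakk> \<Longrightarrow> yX A M (tp (star A M) w x) = H A M x w"
proof -
  note sA = star_mod[OF A M]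
  have 1: "biadditive (star A M) XB (sharp (YX A) M) (\<lambda>w x. H A M x w)"
    by (rule biadditiveI) (simp_all add: simpX additive_closed[OF H(1)] additive_add[OF H(1)] H_add)
  have 2: "H A M x (w \<triangleleft>\<^bsub>star A M\<^esub> r) = H A M (r \<triangleright>\<^bsub>XB\<^esub> x) w"
    if "w \<in> carrier (star A M)" "r \<in> carrier R" "x \<in> carrier XB" for w r x
    using that by (simp add: simpX H_balanced)
  note l = rlift[where f = "\<lambda>w x. H A M x w", OF sA lX N.M.abelian_group_axioms 1, OF 2, folded yX_def]
  have a: "additive (YX (star A M)) (sharp (YX A) M) (yX A M)" using l(2) by blast
  have e: "yX A M \<in> extensional (carrier (YX (star A M)))" using l(1) by blast
  show p: "\<lbrakk>w \<in> carrier (star A M); x \<in> carrier X\<rbrakk> \<Longrightarrow> yX A M (tp (star A M) w x) = H A M x w" for w x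
    using l(3)[of w x] by (simp add: simpX)
  have "rlin S (YX (star A M)) (sharp (YX A) M) (yX A M)"
    by (rule rt_rlin[OF sA lX bX N.right_module_axioms a]) (simp add: simpX p H_ract Xr.ract_closed)
  with e show "yX A M \<in> rhom S (YX (star A M)) (sharp (YX A) M)" by (simp add: rhom_iff)
qed

lemma yX_sp: "\<lbrakk>a \<in> carrier A; m \<in> carrier M; x \<in> carrier X\<rbrakk> \<Longrightarrow> yX A M (tp (star A M) (sp A M a m) x) = B A M a m x"
  by (simp add: yX_tp sp_closed[OF A M] H(2))

text \<open>The axioms for \<open>yX\<close> are checked by means of this on the elements (a * m)
  \<otimes> x, where \<open>yX_sp\<close> gives explicit values.\<close>

lemma YX_star_eq:
  fixes G :: "'u rmodule"
  assumes h: "additive (YX (star A M)) G h" "additive (YX (star A M)) G h'"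
    and eq: "\<And>a m x. \<lbrakk>a \<in> carrier A; m \<in> carrier M; x \<in> carrier X\<rbrakk>
      \<Longrightarrow> h (tp (star A M) (sp A M a m) x) = h' (tp (star A M) (sp A M a m) x)"
    and z: "z \<in> carrier (YX (star A M))"
  shows "h z = h' z"
proof (rule YX_eq[OF star_mod[OF A M] h _ z])
  fix w x assume w: "w \<in> carrier (star A M)" and x: "x \<in> carrier X"
  have "additive (star A M) (YX (star A M)) (\<lambda>w. tp (star A M) w x)"
    using x by (intro additiveI) (simp_all add: tp_closed[OF star_mod[OF A M]] tp_add[OF star_mod[OF A M]])
  from star_eq[OF A M additive_compose[OF this h(1)] additive_compose[OF this h(2)] eq w] x
  show "h (tp (star A M) w x) = h' (tp (star A M) w x)" by blast
qed

end

text \<open>The functor carries a \<otimes> x_(0) to f a \<otimes> x_(0), the map on # carries m to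
  g m, and the coefficient x_(1) stays.\<close>

lemma B_shmap:
  assumes A: "right_module R A" and A': "right_module R A'" and M: "M \<in> IOb" and M': "M' \<in> IOb"
    and f: "f \<in> rhom R A A'" and g: "g \<in> ihom M M'" and a: "a \<in> carrier A" and m: "m \<in> carrier M" and x: "x \<in> carrier X"
  shows "shmap (YX A) M (YX A') M' (fhom Y A A' f) g (B A M a m x) = B A' M' (f a) (g m) x"
proof -
  note YA = YX_mod[OF A] and YA' = YX_mod[OF A']
  have Yf: "fhom Y A A' f \<in> rhom S (YX A) (YX A')" using tensor_map_rhom[OF bX A A' f] by simp
  have "shmap (YX A) M (YX A') M' (fhom Y A A' f) g (B A M a m x)
      = lam (YX A') M' (g m) (mapC (YX A) (YX A') (fhom Y A A' f) (mapC X (YX A) (tp A a) (\<xi> x)))"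
    unfolding B_def by (rule lam_shmap[OF YA YA' M M' Yf g m Cc[OF A M a x]])
  also have "\<dots> = lam (YX A') M' (g m) (mapC X (YX A') (\<lambda>n. fhom Y A A' f (tp A a n)) (\<xi> x))"
    by (simp only: mapC_comp[OF Xm' YA YA' tp_rlin[OF A a] rhom_rlin[OF Yf] \<xi>c[OF x]])
  also have "\<dots> = B A' M' (f a) (g m) x"
    unfolding B_def by (rule arg_cong[of _ _ "lam (YX A') M' (g m)"], rule mapC_cong) (simp only: Ymap_tp[OF A A' f a])
  finally show ?thesis .
qed

text \<open>Both sides are the sum of ((a \<otimes> x_(0)) # m # x_(1)) # m' # x_(2). On the left
  the three components arise by applying \<xi> twice, on the right by applying \<delta> to the
  coefficient, and coassociativity of \<xi> equates them.\<close>

lemma B_coassoc: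
  assumes A: "right_module R A" and M: "M \<in> IOb" and M': "M' \<in> IOb"
    and a: "a \<in> carrier A" and m: "m \<in> carrier M" and m': "m' \<in> carrier M'" and x: "x \<in> carrier X"
  shows "shmap (YX (star A M)) M' (sharp (YX A) M) M' (yX A M) (\<lambda>m \<in> carrier M'. m) (B (star A M) M' (sp A M a m) m' x)
    = sh2 (YX A) M M' (B A (istar M M') a (ip M M' m m') x)"
proof -
  note YA = YX_mod[OF A] and sA = star_mod[OF A M] and YsA = YX_mod[OF star_mod[OF A M]] and N = sharp_mod[OF YX_mod[OF A] M]
  note XC = NC_mod[OF Xm'] and YC = NC_mod[OF YX_mod[OF A]]
  note w = sp_closed[OF A M a m] and y = yX_hom[OF A M]
  note t = tp_rlin[OF A a] and tt = mapC_rlin[OF Xm' YA tp_rlin[OF A a]] and L = lam_rlin[OF YA M m]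
  have "shmap (YX (star A M)) M' (sharp (YX A) M) M' (yX A M) (\<lambda>m \<in> carrier M'. m) (B (star A M) M' (sp A M a m) m' x)
      = lam (sharp (YX A) M) M' m' (mapC (YX (star A M)) (sharp (YX A) M) (yX A M) (mapC X (YX (star A M)) (tp (star A M) (sp A M a m)) (\<xi> x)))"
    unfolding B_def by (rule lam_shmap_id[OF YsA N M' y m' Cc[OF sA M' w x]])
  also have "\<dots> = lam (sharp (YX A) M) M' m' (mapC X (sharp (YX A) M) (\<lambda>n. yX A M (tp (star A M) (sp A M a m) n)) (\<xi> x))"
    by (simp only: mapC_comp[OF Xm' YsA N tp_rlin[OF sA w] rhom_rlin[OF y] \<xi>c[OF x]])
  also have "mapC X (sharp (YX A) M) (\<lambda>n. yX A M (tp (star A M) (sp A M a m) n)) (\<xi> x)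
      = mapC X (sharp (YX A) M) (\<lambda>n. lam (YX A) M m (mapC X (YX A) (tp A a) (\<xi> n))) (\<xi> x)"
    by (rule mapC_cong) (simp add: yX_sp[OF A M a m] B_def)
  also have "\<dots> = mapC (rtensor S X C) (sharp (YX A) M) (\<lambda>z. lam (YX A) M m (mapC X (YX A) (tp A a) z)) (mapC X (rtensor S X C) \<xi> (\<xi> x))"
    by (rule mapC_comp[symmetric, OF Xm' XC N \<xi>l rlin_compose[OF tt L] \<xi>c[OF x]])
  also have "\<dots> = mapC (rtensor S X C) (sharp (YX A) M) (\<lambda>z. lam (YX A) M m (mapC X (YX A) (tp A a) z)) (split X (\<xi> x))"
    by (simp only: \<xi>_coassoc[OF X\<xi> x])
  also have "\<dots> = mapC (rtensor S (YX A) C) (sharp (YX A) M) (lam (YX A) M m)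
      (mapC (rtensor S X C) (rtensor S (YX A) C) (mapC X (YX A) (tp A a)) (split X (\<xi> x)))"
    by (rule mapC_comp[symmetric, OF XC YC N tt L rlin_closed[OF split_rlin[OF Xm'] \<xi>c[OF x]]])
  also have "\<dots> = mapC (rtensor S (YX A) C) (sharp (YX A) M) (lam (YX A) M m) (split (YX A) (mapC X (YX A) (tp A a) (\<xi> x)))"
    by (simp only: split_natural[OF Xm' YA t \<xi>c[OF x]])
  also have "lam (sharp (YX A) M) M' m' \<dots> = sh2 (YX A) M M' (B A (istar M M') a (ip M M' m m') x)"
    unfolding B_def by (rule lam_sh2[symmetric, OF YA M M' m m' Cc[OF A M a x]])
  finally show ?thesis .
qed

lemma yX_diagonal: "diagonal (Y, yX)"
  unfolding diagonal_def split_conv RMod_simps mem_Collect_eq tensor_ftor_simps(1)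
proof (intro conjI ballI)
  show "cat_functor (RMod R) (RMod S) Y" by (rule tensor_cat_functor[OF bX])
next
  fix A :: "'u rmodule" and M assume "A \<in> {A. right_module R A}" "M \<in> IOb"
  then show "yX A M \<in> rhom S (YX (star A M)) (sharp (YX A) M)" by (simp add: yX_hom)
next
  fix A A' :: "'u rmodule" and M M' f g z assume "A \<in> {A. right_module R A}" "A' \<in> {A. right_module R A}" and M: "M \<in> IOb" and M': "M' \<in> IOb"
    and f: "f \<in> rhom R A A'" and g: "g \<in> ihom M M'" and z: "z \<in> carrier (YX (star A M))"
  then have A: "right_module R A" and A': "right_module R A'" by auto
  have Yf: "fhom Y A A' f \<in> rhom S (YX A) (YX A')" using tensor_map_rhom[OF bX A A' f] by simp
  note sm = smap_hom[OF A A' M M' f g]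
  note gl = rhom_rlin[OF ihom_sub[OF M M' g]]
  show "shmap (YX A) M (YX A') M' (fhom Y A A' f) g (yX A M z) = yX A' M' (fhom Y (star A M) (star A' M') (smap A M A' M' f g) z)"
  proof (rule YX_star_eq[OF A M rlin_additive[OF rlin_compose[OF rhom_rlin[OF yX_hom[OF A M]] shmap_hom[OF YX_mod[OF A] YX_mod[OF A'] M M' Yf g]]]
        rlin_additive[OF rlin_compose[OF Ymap_rlin[OF star_mod[OF A M] star_mod[OF A' M'] sm] rhom_rlin[OF yX_hom[OF A' M']]]] _ z])
    fix a m x assume a: "a \<in> carrier A" and m: "m \<in> carrier M" and x: "x \<in> carrier X"
    have "fhom Y (star A M) (star A' M') (smap A M A' M' f g) (tp (star A M) (sp A M a m) x) = tp (star A' M') (sp A' M' (f a) (g m)) x"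
      by (simp only: Ymap_tp[OF star_mod[OF A M] star_mod[OF A' M'] sm sp_closed[OF A M a m] x] smap_sp[OF A A' M M' f g a m])
    then show "shmap (YX A) M (YX A') M' (fhom Y A A' f) g (yX A M (tp (star A M) (sp A M a m) x))
      = yX A' M' (fhom Y (star A M) (star A' M') (smap A M A' M' f g) (tp (star A M) (sp A M a m) x))"
      by (simp only: yX_sp[OF A M a m x] B_shmap[OF A A' M M' f g a m x]
          yX_sp[OF A' M' rlin_closed[OF rhom_rlin[OF f] a] rlin_closed[OF gl m] x])
  qed
next
  fix A :: "'u rmodule" and M M' z assume "A \<in> {A. right_module R A}" and M: "M \<in> IOb" and M': "M' \<in> IOb" and z: "z \<in> carrier (YX (star A (istar M M')))"
  then have A: "right_module R A" by simp
  note MM = istar_ob[OF M M'] and YA = YX_mod[OF A] and sA = star_mod[OF A M] and YsA = YX_mod[OF star_mod[OF A M]]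
    and N = sharp_mod[OF YX_mod[OF A] M] and as = sassoc_hom[OF A M M'] and ssA = star_mod[OF star_mod[OF A M] M']
  let ?h = "\<lambda>z. shmap (YX (star A M)) M' (sharp (YX A) M) M' (yX A M) (\<lambda>m \<in> carrier M'. m)
      (yX (star A M) M' (fhom Y (star A (istar M M')) (star (star A M) M') (sassoc A M M') z))"
  let ?h' = "\<lambda>z. sh2 (YX A) M M' (yX A (istar M M') z)"
  have h: "additive (YX (star A (istar M M'))) (sharp (sharp (YX A) M) M') ?h"
    by (rule rlin_additive[OF rlin_compose[OF rlin_compose[OF Ymap_rlin[OF star_mod[OF A MM] ssA as] rhom_rlin[OF yX_hom[OF sA M']]]
          shmap_hom[OF YsA N M' M' yX_hom[OF A M] ihom_id[OF M']]]])
  have h': "additive (YX (star A (istar M M'))) (sharp (sharp (YX A) M) M') ?h'"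
    by (rule additive_compose[OF rlin_additive[OF rhom_rlin[OF yX_hom[OF A MM]]] sh2_additive[OF YA M M']])
  show "?h z = ?h' z"
  proof (rule YX_star_eq[OF A MM h h' _ z])
    fix a v x assume a: "a \<in> carrier A" and v: "v \<in> carrier (istar M M')" and x: "x \<in> carrier X"
    \<comment> \<open>\<open>v\<close> runs over all of \<open>istar M M'\<close>; additivity in
      \<open>v\<close> reduces the claim to the generators \<open>ip M M' m m'\<close>.\<close>
    have ad: "additive (istar M M') (YX (star A (istar M M'))) (\<lambda>v. tp (star A (istar M M')) (sp A (istar M M') a v) x)"
      using a x by (intro additiveI) (simp_all add: tp_closed[OF star_mod[OF A MM]] tp_add[OF star_mod[OF A MM]] sp_closed[OF A MM]
          biadditive_add_right[OF sp_biadd[OF A MM]])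
    show "?h (tp (star A (istar M M')) (sp A (istar M M') a v) x) = ?h' (tp (star A (istar M M')) (sp A (istar M M') a v) x)"
    proof (rule ip_eq[OF M M' additive_compose[OF ad h] additive_compose[OF ad h'] _ v])
      fix m m' assume m: "m \<in> carrier M" and m': "m' \<in> carrier M'"
      note mm = ip_closed[OF M M' m m']
      show "?h (tp (star A (istar M M')) (sp A (istar M M') a (ip M M' m m')) x)
        = ?h' (tp (star A (istar M M')) (sp A (istar M M') a (ip M M' m m')) x)"
        by (simp only: Ymap_tp[OF star_mod[OF A MM] ssA as sp_closed[OF A MM a mm] x] sassoc_sp[OF A M M' a m m']
            yX_sp[OF sA M' sp_closed[OF A M a m] m' x] yX_sp[OF A MM a mm x] B_coassoc[OF A M M' a m m' x])
    qed
  qed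
next
  fix A :: "'u rmodule" and z assume "A \<in> {A. right_module R A}" and z: "z \<in> carrier (YX (star A iunit))"
  then have A: "right_module R A" by simp
  note I = iunit_ob and YA = YX_mod[OF A] and sr = srunit_hom[OF A]
  show "sh0 (YX A) (yX A iunit z) = fhom Y (star A iunit) A (srunit A) z"
  proof (rule YX_star_eq[OF A I additive_compose[OF rlin_additive[OF rhom_rlin[OF yX_hom[OF A I]]] sh0_additive[OF YA]]
        rlin_additive[OF Ymap_rlin[OF star_mod[OF A I] A sr]] _ z])
    fix a r x assume a: "a \<in> carrier A" and r': "r \<in> carrier iunit" and x: "x \<in> carrier X"
    then have r: "r \<in> carrier R" by (simp add: iunit_carrier)
    \<comment> \<open>The unit constraint turns the coaction into the action r x, and the balanced
      tensor product exchanges a \<otimes> r x with a r \<otimes> x, the image under the right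
      unitor.\<close>
    have "sh0 (YX A) (B A iunit a r x) = mu (YX A) r (mapC X (YX A) (tp A a) (\<xi> x))"
      unfolding B_def by (rule lam_sh0[OF YA r Cc[OF A I a x]])
    also have "\<dots> = tp A a (act X \<xi> r x)"
      unfolding act_def[OF X\<xi>] by (rule mu_natural[symmetric, OF Xm' YA tp_rlin[OF A a] r \<xi>c[OF x]])
    also have "\<dots> = fhom Y (star A iunit) A (srunit A) (tp (star A iunit) (sp A iunit a r) x)"
      by (simp only: Ymap_tp[OF star_mod[OF A I] A sr sp_closed[OF A I a r'] x] srunit_sp[OF A a r] tp_balanced[OF A a r x])
    finally show "sh0 (YX A) (yX A iunit (tp (star A iunit) (sp A iunit a r) x)) = fhom Y (star A iunit) A (srunit A) (tp (star A iunit) (sp A iunit a r) x)"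
      by (simp only: yX_sp[OF A I a r' x])
  qed
qed

lemma yX_ob: "(Y, yX) \<in> Obj diagonals"
proof -
  have "cocontinuous R S Y"
    unfolding cocontinuous_def using tensor_colimit[OF bX] by simp
  moreover have "k_linear k R S Y"
    by (rule tensor_k_linear[OF bX R.k_algebra_axioms S.k_algebra_axioms]) (simp add: simpX Xb_central[OF X\<xi>])
  ultimately show ?thesis
    using yX_diagonal tensor_cat_functor[OF bX] by (simp add: diagonals_simps cocontinuous_linear_functor_def)
qed

text \<open>Over R, tensoring R with X gives back X by x -> 1 \<otimes> x. That this map respects
  the coactions is read off from the value of \<open>yX\<close> at the generator given by 1, u0 and
  x.\<close>

lemma E_preimage: "\<exists>e. is_iso (coalgebroid_comodules S C) (fob E (Y, yX)) (X, \<xi>) e"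
proof -
  let ?RX = "YX Reg" and ?\<xi> = "xi Y yX"
  note ob = yX_ob
  have co: "coalgebroid_comodule S C (?RX, ?\<xi>)" using xi_comodule[OF ob] by simp
  have RX: "right_module S ?RX" by (rule YX_mod[OF Reg])
  interpret Xr: right_module S X by (rule Xm')
  have one: "\<one>\<^bsub>R\<^esub> \<in> carrier Reg" by simp
  define \<phi> where "\<phi> = (\<lambda>x \<in> carrier X. tp Reg \<one>\<^bsub>R\<^esub> x)"
  have \<phi>: "\<phi> \<in> rhom S X ?RX" unfolding \<phi>_def by (rule rlin_restrict[OF Xm' tp_rlin[OF Reg one]])
  define e where "e = rlift R Reg XB X (\<lambda>r x. act X \<xi> r x)"
  note al = act_rlin[OF X\<xi>]
  interpret Xl: left_module R XB by (rule lX)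
  have 1: "biadditive Reg XB X (\<lambda>r x. act X \<xi> r x)"
    using Xl.lact_add_scalar by (intro biadditiveI) (simp_all add: simpX rlin_closed[OF al] rlin_add[OF al])
  have 2: "act X \<xi> (q \<triangleleft>\<^bsub>Reg\<^esub> r) x = act X \<xi> q (r \<triangleright>\<^bsub>XB\<^esub> x)" if "q \<in> carrier Reg" "r \<in> carrier R" "x \<in> carrier XB" for q r x
    using that Xl.lact_mult by (simp add: simpX)
  note l = rlift[where f = "\<lambda>r x. act X \<xi> r x", OF Reg lX Xr.M.abelian_group_axioms 1, OF 2, folded e_def]
  have ea: "additive ?RX X e" using l(2) by blast
  have ee: "e \<in> extensional (carrier ?RX)" using l(1) by blast
  have ep: "e (tp Reg r x) = act X \<xi> r x" if "r \<in> carrier R" "x \<in> carrier X" for r x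
    using l(3)[of r x] that by (simp add: simpX)
  have el: "rlin S ?RX X e"
    by (rule rt_rlin[OF Reg lX bX Xm' ea]) (simp add: simpX ep Xr.ract_closed rlin_ract[OF al])
  have e: "e \<in> rhom S ?RX X" using ee el by (simp add: rhom_iff)
  have e\<phi>: "e (\<phi> x) = x" if "x \<in> carrier X" for x
    using that Xl.lact_one by (simp add: \<phi>_def ep simpX)
  have \<phi>e: "\<phi> (e z) = z" if z: "z \<in> carrier ?RX" for z
  proof (rule YX_eq[OF Reg additive_compose[OF ea rlin_additive[OF rhom_rlin[OF \<phi>]]] additive_id _ z])
    fix r x assume r: "r \<in> carrier Reg" and x: "x \<in> carrier X"
    then have r: "r \<in> carrier R" by simp
    have "tp Reg r x = tp Reg (\<one>\<^bsub>R\<^esub> \<triangleleft>\<^bsub>Reg\<^esub> r) x" using r by simp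
    also have "\<dots> = tp Reg \<one>\<^bsub>R\<^esub> (act X \<xi> r x)" by (rule tp_balanced[OF Reg one r x])
    finally have t: "tp Reg r x = tp Reg \<one>\<^bsub>R\<^esub> (act X \<xi> r x)" .
    have "\<phi> (e (tp Reg r x)) = tp Reg \<one>\<^bsub>R\<^esub> (act X \<xi> r x)"
      by (simp only: ep[OF r x] \<phi>_def restrict_apply'[OF rlin_closed[OF al[OF r] x]])
    then show "\<phi> (e (tp Reg r x)) = tp Reg r x" by (rule trans[OF _ t[symmetric]])
  qed
  have \<phi>\<xi>: "?\<xi> (\<phi> x) = mapC X ?RX \<phi> (\<xi> x)" if x: "x \<in> carrier X" for x
  proof (rule lam_inj[OF RX])
    note s = star_mod[OF Reg M0_ob] and w = sp_one_closed[OF M0_ob u0]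
    have \<phi>x: "\<phi> x \<in> carrier ?RX" by (rule rlin_closed[OF rhom_rlin[OF \<phi>] x])
    show "?\<xi> (\<phi> x) \<in> carrier (rtensor S ?RX C)" using xi_closed[OF ob] \<phi>x by simp
    show "mapC X ?RX \<phi> (\<xi> x) \<in> carrier (rtensor S ?RX C)"
      by (rule rlin_closed[OF mapC_rlin[OF Xm' RX rhom_rlin[OF \<phi>]] \<xi>c[OF x]])
    have "lam ?RX M0 u0 (?\<xi> (\<phi> x)) = xi0 Y yX (\<phi> x)"
      using lam_xi[OF ob] \<phi>x by simp
    also have "\<dots> = yX Reg M0 (tp (star Reg M0) (sp Reg M0 \<one>\<^bsub>R\<^esub> u0) x)"
      unfolding xi0_def \<phi>_def restrict_apply'[OF x] Ymap_tp[OF Reg s iota_rhom[OF s w] one x] iota_at_one[OF s w] ..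
    also have "\<dots> = lam ?RX M0 u0 (mapC X ?RX (tp Reg \<one>\<^bsub>R\<^esub>) (\<xi> x))"
      by (simp only: yX_sp[OF Reg M0_ob one u0 x] B_def)
    also have "mapC X ?RX (tp Reg \<one>\<^bsub>R\<^esub>) (\<xi> x) = mapC X ?RX \<phi> (\<xi> x)"
      by (rule mapC_cong) (simp add: \<phi>_def)
    finally show "lam ?RX M0 u0 (?\<xi> (\<phi> x)) = lam ?RX M0 u0 (mapC X ?RX \<phi> (\<xi> x))" .
  qed
  have e\<xi>: "\<xi> (e z) = mapC ?RX X e (?\<xi> z)" if z: "z \<in> carrier ?RX" for z
  proof -
    have ez: "e z \<in> carrier X" by (rule rlin_closed[OF el z])
    have "mapC ?RX X e (?\<xi> z) = mapC ?RX X e (mapC X ?RX \<phi> (\<xi> (e z)))"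
      using \<phi>\<xi>[OF ez] \<phi>e[OF z] by simp
    also have "\<dots> = mapC X X (\<lambda>x. e (\<phi> x)) (\<xi> (e z))"
      by (rule mapC_comp[OF Xm' RX Xm' rhom_rlin[OF \<phi>] el \<xi>c[OF ez]])
    also have "\<dots> = mapC X X (\<lambda>x. x) (\<xi> (e z))" by (rule mapC_cong) (rule e\<phi>)
    also have "\<dots> = \<xi> (e z)" by (rule mapC_id[OF Xm' \<xi>c[OF ez]])
    finally show ?thesis by simp
  qed
  have "compose (carrier ?RX) \<phi> e = (\<lambda>z \<in> carrier ?RX. z)" "compose (carrier X) e \<phi> = (\<lambda>x \<in> carrier X. x)"
    by (auto simp: compose_def restrict_def fun_eq_iff \<phi>e e\<phi>)
  then show ?thesis
    using e e\<xi> \<phi> \<phi>\<xi> unfolding is_iso_def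
    by (intro exI[of _ e] conjI bexI[of _ \<phi>]) (simp_all add: comodules_simps)
qed

end

theorem E_weak_equivalence: "weak_equivalence diagonals (coalgebroid_comodules S C) E"
  unfolding weak_equivalence_def
proof (intro conjI ballI E_functor E_bij)
  fix b assume "b \<in> Obj (coalgebroid_comodules S C)"
  then obtain X \<xi> where b: "b = (X, \<xi>)" "coalgebroid_comodule S C (X, \<xi>)"
    by (cases b) (simp add: comodules_simps)
  show "\<exists>a \<in> Obj diagonals. \<exists>e. is_iso (coalgebroid_comodules S C) (fob E a) b e"
    unfolding b(1) using yX_ob[OF b(2)] E_preimage[OF b(2)] by blast
qed

end

section \<open>Tensor products over the ground ring\<close>

text \<open>Shared by \<open>odot\<close>, \<open>dot\<close> and \<open>F_ob\<close>, whose right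
  actions all come from the second factor. The hypothesis \<open>bal\<close> says that acting on
  this factor respects the relations in \<rho>.\<close>

lemma right_action:
  fixes A :: "('u, 'a) ring_scheme" and B :: "('u, 'b) rmodule_scheme" and T :: "('u, 't) rmodule_scheme"
    and U :: "('u, 'r) ring_scheme"
  assumes bt: "balanced_tensor A B \<rho>" and B: "right_module U B" and T: "same_group (tens \<rho> A B) T"
    and act: "\<And>t s. t \<triangleleft>\<^bsub>T\<^esub> s = tlift \<rho> A B (tens \<rho> A B) (\<lambda>a b. pure \<rho> A B a (b \<triangleleft>\<^bsub>B\<^esub> s)) t"
    and bal: "\<And>a b a' b' s. \<lbrakk>((a, b), (a', b')) \<in> \<rho>; s \<in> carrier U\<rbrakk> \<Longrightarrow> pure \<rho> A B a (b \<triangleleft>\<^bsub>B\<^esub> s) = pure \<rho> A B a' (b' \<triangleleft>\<^bsub>B\<^esub> s)"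
  shows right_action_module: "right_module U T"
    and right_action_pure: "\<lbrakk>a \<in> carrier A; b \<in> carrier B; s \<in> carrier U\<rbrakk> \<Longrightarrow> pure \<rho> A B a b \<triangleleft>\<^bsub>T\<^esub> s = pure \<rho> A B a (b \<triangleleft>\<^bsub>B\<^esub> s)"
proof -
  interpret bt: balanced_tensor A B \<rho> by (rule bt)
  interpret B: right_module U B by (rule B)
  have eq: "carrier T = carrier (tens \<rho> A B)" "(\<oplus>\<^bsub>T\<^esub>) = (\<oplus>\<^bsub>tens \<rho> A B\<^esub>)" using T by (simp_all add: same_group_def)
  interpret T: abelian_group T by (rule same_group_abelian[OF T bt.abelian_tens])
  have 1: "biadditive A B (tens \<rho> A B) (\<lambda>a b. pure \<rho> A B a (b \<triangleleft>\<^bsub>B\<^esub> s))" if "s \<in> carrier U" for s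
    using that by (intro biadditiveI) (simp_all add: bt.pure_closed bt.pure_add_left bt.pure_add_right B.ract_closed B.ract_add)
  have add: "additive (tens \<rho> A B) (tens \<rho> A B) (\<lambda>t. t \<triangleleft>\<^bsub>T\<^esub> s)" if "s \<in> carrier U" for s
    unfolding act by (rule bt.tlift_additive[OF bt.abelian_tens 1[OF that] bal[OF _ that]])
  have p: "pure \<rho> A B a b \<triangleleft>\<^bsub>T\<^esub> s = pure \<rho> A B a (b \<triangleleft>\<^bsub>B\<^esub> s)" if "s \<in> carrier U" "a \<in> carrier A" "b \<in> carrier B" for a b s
    unfolding act by (rule bt.tlift_pure[OF bt.abelian_tens 1[OF that(1)] bal[OF _ that(1)] that(2,3)])
  then show "\<lbrakk>a \<in> carrier A; b \<in> carrier B; s \<in> carrier U\<rbrakk> \<Longrightarrow> pure \<rho> A B a b \<triangleleft>\<^bsub>T\<^esub> s = pure \<rho> A B a (b \<triangleleft>\<^bsub>B\<^esub> s)"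
    by blast
  show "right_module U T"
  proof
    fix m r r' assume "m \<in> carrier T" and r: "r \<in> carrier U" "r' \<in> carrier U"
    then have m: "m \<in> carrier (tens \<rho> A B)" by (simp add: eq)
    show "m \<triangleleft>\<^bsub>T\<^esub> (r \<oplus>\<^bsub>U\<^esub> r') = m \<triangleleft>\<^bsub>T\<^esub> r \<oplus>\<^bsub>T\<^esub> m \<triangleleft>\<^bsub>T\<^esub> r'"
      unfolding eq
      by (rule bt.tens_hom_eq[OF add additive_sum_maps[OF add add bt.abelian_tens] _ m])
        (use r in \<open>simp_all add: p B.ract_add_scalar bt.pure_add_right B.ract_closed\<close>)
    show "m \<triangleleft>\<^bsub>T\<^esub> (r \<otimes>\<^bsub>U\<^esub> r') = m \<triangleleft>\<^bsub>T\<^esub> r \<triangleleft>\<^bsub>T\<^esub> r'"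
      by (rule bt.tens_hom_eq[OF add additive_compose[OF add add] _ m])
        (use r in \<open>simp_all add: p B.ract_mult B.ract_closed\<close>)
  next
    fix m assume "m \<in> carrier T"
    then have m: "m \<in> carrier (tens \<rho> A B)" by (simp add: eq)
    show "m \<triangleleft>\<^bsub>T\<^esub> \<one>\<^bsub>U\<^esub> = m"
      by (rule bt.tens_hom_eq[OF add additive_id _ m]) (simp_all add: p B.ract_one)
  qed (auto simp: eq additive_closed[OF add] additive_add[OF add])
qed

lemma scal:
  assumes "k_algebra k T" "a \<in> carrier k"
  shows scal_closed: "scal T a \<in> carrier T"
    and scal_central: "r \<in> carrier T \<Longrightarrow> scal T a \<otimes>\<^bsub>T\<^esub> r = r \<otimes>\<^bsub>T\<^esub> scal T a"
proof -
  interpret T: k_algebra k T by fact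
  show "scal T a \<in> carrier T" "r \<in> carrier T \<Longrightarrow> scal T a \<otimes>\<^bsub>T\<^esub> r = r \<otimes>\<^bsub>T\<^esub> scal T a"
    using assms(2) by (simp_all add: scal_def T.smult_closed T.smult_mult_left T.smult_mult_right)
qed

context universe
begin

context
  fixes k :: "'k ring" and T U :: "('k, 'u) module" and M :: "('u, 'm) rmodule_scheme" and N :: "('u, 'n) rmodule_scheme"
  assumes kT: "k_algebra k T" and kU: "k_algebra k U" and M: "right_module T M" and N: "right_module U N"
begin

interpretation M: right_module T M by (rule M)
interpretation N: right_module U N by (rule N)

lemma kt_balanced: "balanced_tensor M N (over_k k T U M N)"
  by unfold_locales (auto simp: over_k_def M.ract_closed N.ract_closed scal_closed[OF kT] scal_closed[OF kU])

interpretation B: balanced_tensor M N "over_k k T U M N" by (rule kt_balanced)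

lemmas kt_abelian = B.abelian_tens and kpure_closed = B.pure_closed and kpure_add = B.pure_add_left B.pure_add_right
  and kt_eq = B.tens_hom_eq and kt_induct = B.tens_induct

lemma kpure_bal:
  "\<lbrakk>m \<in> carrier M; a \<in> carrier k; n \<in> carrier N\<rbrakk>
    \<Longrightarrow> kpure k T U M N (m \<triangleleft>\<^bsub>M\<^esub> scal T a) n = kpure k T U M N m (n \<triangleleft>\<^bsub>N\<^esub> scal U a)"
  by (rule B.pure_balanced) (unfold over_k_def, blast)

lemma klift:
  assumes G: "abelian_group G" and f: "biadditive M N G f"
    and bal: "\<And>m a n. \<lbrakk>m \<in> carrier M; a \<in> carrier k; n \<in> carrier N\<rbrakk> \<Longrightarrow> f (m \<triangleleft>\<^bsub>M\<^esub> scal T a) n = f m (n \<triangleleft>\<^bsub>N\<^esub> scal U a)"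
  shows klift_extensional: "klift k T U M N G f \<in> extensional (carrier (ktens k T U M N))"
    and klift_additive: "additive (ktens k T U M N) G (klift k T U M N G f)"
    and klift_pure: "\<lbrakk>m \<in> carrier M; n \<in> carrier N\<rbrakk> \<Longrightarrow> klift k T U M N G f (kpure k T U M N m n) = f m n"
proof -
  have b: "f a b = f a' b'" if "((a, b), (a', b')) \<in> over_k k T U M N" for a b a' b'
    using that bal by (auto simp: over_k_def)
  show "klift k T U M N G f \<in> extensional (carrier (ktens k T U M N))"
    "additive (ktens k T U M N) G (klift k T U M N G f)"
    "\<lbrakk>m \<in> carrier M; n \<in> carrier N\<rbrakk> \<Longrightarrow> klift k T U M N G f (kpure k T U M N m n) = f m n"
    using B.tlift_extensional[OF G f b] B.tlift_additive[OF G f b] B.tlift_pure[OF G f b] by blast+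
qed

end

end

lemma same_group_odot: "same_group (ktens k R R A B) (odot k R A B)"
  by (simp add: odot_def Let_def same_group_def ring.defs)

lemma odot_simps [simp]:
  "carrier (odot k R A B) = carrier (ktens k R R A B)" "(\<oplus>\<^bsub>odot k R A B\<^esub>) = (\<oplus>\<^bsub>ktens k R R A B\<^esub>)"
  "\<zero>\<^bsub>odot k R A B\<^esub> = \<zero>\<^bsub>ktens k R R A B\<^esub>"
  using same_group_odot[of k R A B] by (simp_all add: same_group_def)

lemma additive_odot [simp]:
  "additive (odot k R A B) G f = additive (ktens k R R A B) G f"
  "additive G' (odot k R A B) g = additive G' (ktens k R R A B) g"
  "biadditive M N (odot k R A B) h = biadditive M N (ktens k R R A B) h"
  "tlift \<rho> M N (odot k R A B) h' = tlift \<rho> M N (ktens k R R A B) h'"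
  using same_group_additive[OF same_group_odot] same_group_biadditive[OF same_group_odot] same_group_tlift[OF same_group_odot] by metis+

section \<open>The skew monoidal structure on Mod-R\<close>

context two_algebras
begin

lemma kR: "k_algebra k R" and kS: "k_algebra k S"
  by (rule R.k_algebra_axioms, rule S.k_algebra_axioms)

abbreviation kp where "kp \<equiv> kpure k R R"

context
  fixes A B :: "'u rmodule"
  assumes A: "right_module R A" and B: "right_module R B"
begin

interpretation A: right_module R A by (rule A)
interpretation B: right_module R B by (rule B)

lemma odot: shows odot_module: "right_module R (odot k R A B)"
  and odot_ract: "\<lbrakk>a \<in> carrier A; b \<in> carrier B; r \<in> carrier R\<rbrakk> \<Longrightarrow> kp A B a b \<triangleleft>\<^bsub>odot k R A B\<^esub> r = kp A B a (b \<triangleleft>\<^bsub>B\<^esub> r)"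
proof -
  have act: "t \<triangleleft>\<^bsub>odot k R A B\<^esub> s = klift k R R A B (ktens k R R A B) (\<lambda>a b. kp A B a (b \<triangleleft>\<^bsub>B\<^esub> s)) t" for t s
    by (simp add: odot_def Let_def ring.defs rmodule.defs)
  \<comment> \<open>A scalar of k commutes with s in R, so it can still cross the tensor sign after
    s has acted.\<close>
  have bal: "kp A B a (b \<triangleleft>\<^bsub>B\<^esub> s) = kp A B a' (b' \<triangleleft>\<^bsub>B\<^esub> s)"
    if rel: "((a, b), (a', b')) \<in> over_k k R R A B" and s: "s \<in> carrier R" for a b a' b' s
  proof -
    obtain q where "a = a' \<triangleleft>\<^bsub>A\<^esub> scal R q" "b' = b \<triangleleft>\<^bsub>B\<^esub> scal R q" "q \<in> carrier k" "a' \<in> carrier A" "b \<in> carrier B"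
      using rel unfolding over_k_def by blast
    with s show ?thesis
      by (simp add: kpure_bal[OF kR kR A B] B.ract_closed B.ract_mult[symmetric] scal_closed[OF kR] scal_central[OF kR])
  qed
  show "right_module R (odot k R A B)"
    by (rule right_action_module[OF kt_balanced[OF kR kR A B] B same_group_odot act bal])
  show "\<lbrakk>a \<in> carrier A; b \<in> carrier B; r \<in> carrier R\<rbrakk> \<Longrightarrow> kp A B a b \<triangleleft>\<^bsub>odot k R A B\<^esub> r = kp A B a (b \<triangleleft>\<^bsub>B\<^esub> r)"
    by (rule right_action_pure[OF kt_balanced[OF kR kR A B] B same_group_odot act bal])
qed

lemma odot_rlin:
  assumes "right_module R N" "additive (ktens k R R A B) N h"
    and "\<And>a b r. \<lbrakk>a \<in> carrier A; b \<in> carrier B; r \<in> carrier R\<rbrakk> \<Longrightarrow> h (kp A B a (b \<triangleleft>\<^bsub>B\<^esub> r)) = h (kp A B a b) \<triangleleft>\<^bsub>N\<^esub> r"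
  shows "rlin R (odot k R A B) N h"
proof (rule rlinI)
  interpret N: right_module R N by fact
  interpret O: right_module R "odot k R A B" by (rule odot_module)
  show "additive (odot k R A B) N h" using assms(2) by simp
  fix z r assume z: "z \<in> carrier (odot k R A B)" and r: "r \<in> carrier R"
  have "additive N N (\<lambda>n. n \<triangleleft>\<^bsub>N\<^esub> r)" using r by (intro additiveI) (simp_all add: N.ract_closed N.ract_add)
  note 1 = additive_compose[OF assms(2) this]
  have "additive (ktens k R R A B) (ktens k R R A B) (\<lambda>z. z \<triangleleft>\<^bsub>odot k R A B\<^esub> r)"
    using r O.ract_closed O.ract_add by (intro additiveI) simp_all
  note 2 = additive_compose[OF this assms(2)]
  show "h (z \<triangleleft>\<^bsub>odot k R A B\<^esub> r) = h z \<triangleleft>\<^bsub>N\<^esub> r"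
    by (rule kt_eq[OF kR kR A B 2 1]) (use z r in \<open>simp_all add: odot_ract assms(3)\<close>)
qed

end

lemma odot_runit:
  assumes A: "right_module R A"
  shows odot_runit_hom: "odot_runit k R A \<in> rhom R (odot k R A Reg) A"
    and odot_runit_pure: "\<lbrakk>a \<in> carrier A; r \<in> carrier R\<rbrakk> \<Longrightarrow> odot_runit k R A (kp A Reg a r) = a \<triangleleft>\<^bsub>A\<^esub> r"
proof -
  interpret A: right_module R A by (rule A)
  have 1: "biadditive A Reg A (\<lambda>a r. a \<triangleleft>\<^bsub>A\<^esub> r)"
    by (intro biadditiveI) (simp_all add: A.ract_closed A.ract_add A.ract_add_scalar)
  have 2: "a \<triangleleft>\<^bsub>A\<^esub> scal R q \<triangleleft>\<^bsub>A\<^esub> r = a \<triangleleft>\<^bsub>A\<^esub> (r \<triangleleft>\<^bsub>Reg\<^esub> scal R q)" if "a \<in> carrier A" "q \<in> carrier k" "r \<in> carrier Reg" for a q r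
    using that by (simp add: A.ract_mult[symmetric] scal_closed[OF kR] scal_central[OF kR])
  note l = klift[where f = "\<lambda>a r. a \<triangleleft>\<^bsub>A\<^esub> r", OF kR kR A Reg A.M.abelian_group_axioms 1, OF 2, folded odot_runit_def]
  have e: "odot_runit k R A \<in> extensional (carrier (ktens k R R A Reg))" using l(1) by blast
  have a: "additive (ktens k R R A Reg) A (odot_runit k R A)" using l(2) by blast
  show p: "\<lbrakk>a \<in> carrier A; r \<in> carrier R\<rbrakk> \<Longrightarrow> odot_runit k R A (kp A Reg a r) = a \<triangleleft>\<^bsub>A\<^esub> r" for a r
    using l(3)[of a r] by simp
  have "rlin R (odot k R A Reg) A (odot_runit k R A)"
    by (rule odot_rlin[OF A Reg A a]) (simp add: p A.ract_mult)
  then show "odot_runit k R A \<in> rhom R (odot k R A Reg) A"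
    using e by (simp add: rhom_iff)
qed

lemma odot_map:
  assumes A: "right_module R A" and B: "right_module R B" and A': "right_module R A'" and B': "right_module R B'"
    and f: "rlin R A A' f" and g: "rlin R B B' g"
  shows odot_map_hom: "odot_map k R A B A' B' f g \<in> rhom R (odot k R A B) (odot k R A' B')"
    and odot_map_pure: "\<lbrakk>a \<in> carrier A; b \<in> carrier B\<rbrakk> \<Longrightarrow> odot_map k R A B A' B' f g (kp A B a b) = kp A' B' (f a) (g b)"
proof -
  note P = kpure_closed[OF kR kR A' B'] kpure_add[OF kR kR A' B']
  have 1: "biadditive A B (odot k R A' B') (\<lambda>a b. kp A' B' (f a) (g b))"
    unfolding additive_odot by (intro biadditiveI) (simp_all add: P rlin_closed[OF f] rlin_closed[OF g] rlin_add[OF f] rlin_add[OF g])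
  have 2: "kp A' B' (f (a \<triangleleft>\<^bsub>A\<^esub> scal R q)) (g b) = kp A' B' (f a) (g (b \<triangleleft>\<^bsub>B\<^esub> scal R q))"
    if "a \<in> carrier A" "q \<in> carrier k" "b \<in> carrier B" for a q b
    using that by (simp add: rlin_ract[OF f] rlin_ract[OF g] scal_closed[OF kR] kpure_bal[OF kR kR A' B'] rlin_closed[OF f] rlin_closed[OF g])
  have O: "right_module R (odot k R A' B')" by (rule odot_module[OF A' B'])
  note l = klift[OF kR kR A B right_module_abelian[OF O] 1, OF 2, folded odot_map_def]
  have e: "odot_map k R A B A' B' f g \<in> extensional (carrier (ktens k R R A B))" using l(1) by blast
  have a: "additive (ktens k R R A B) (odot k R A' B') (odot_map k R A B A' B' f g)" using l(2) by blast
  show p: "\<lbrakk>a \<in> carrier A; b \<in> carrier B\<rbrakk> \<Longrightarrow> odot_map k R A B A' B' f g (kp A B a b) = kp A' B' (f a) (g b)" for a b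
    using l(3)[of a b] by blast
  have "rlin R (odot k R A B) (odot k R A' B') (odot_map k R A B A' B' f g)"
    by (rule odot_rlin[OF A B O a])
      (simp add: p right_module.ract_closed[OF B] odot_ract[OF A' B'] rlin_ract[OF g] rlin_closed[OF f] rlin_closed[OF g])
  with e show "odot_map k R A B A' B' f g \<in> rhom R (odot k R A B) (odot k R A' B')" by (simp add: rhom_iff)
qed

text \<open>Two nested lifts, as for \<open>rassoc\<close>. A scalar on a passes to b and from there
  to b', because \<open>odot k R A B\<close> carries the action of its second factor.\<close>

lemma odot_assoc:
  assumes A: "right_module R A" and B: "right_module R B" and B': "right_module R B'"
  shows odot_assoc_hom: "odot_assoc k R A B B' \<in> rhom R (odot k R A (odot k R B B')) (odot k R (odot k R A B) B')"
    and odot_assoc_pure: "\<lbrakk>a \<in> carrier A; b \<in> carrier B; b' \<in> carrier B'\<rbrakk>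
      \<Longrightarrow> odot_assoc k R A B B' (kp A (odot k R B B') a (kp B B' b b')) = kp (odot k R A B) B' (kp A B a b) b'"
proof -
  interpret A: right_module R A by (rule A)
  interpret B: right_module R B by (rule B)
  interpret B': right_module R B' by (rule B')
  have AB: "right_module R (odot k R A B)" and BB: "right_module R (odot k R B B')"
    by (rule odot_module[OF A B], rule odot_module[OF B B'])
  have T: "right_module R (odot k R (odot k R A B) B')" by (rule odot_module[OF AB B'])
  note Tab = right_module_abelian[OF T]
  let ?T = "odot k R (odot k R A B) B'"
  let ?f = "\<lambda>a b b'. kp (odot k R A B) B' (kp A B a b) b'"
  let ?l = "\<lambda>a. klift k R R B B' ?T (?f a)"
  note P = kpure_closed[OF kR kR A B] kpure_closed[OF kR kR AB B', unfolded odot_simps] kpure_add[OF kR kR A B]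
    kpure_add[OF kR kR AB B', unfolded odot_simps]
  note sc = scal_closed[OF kR]
  have 1: "biadditive B B' ?T (?f a)" if "a \<in> carrier A" for a
    unfolding additive_odot using that by (intro biadditiveI) (simp_all add: P)
  have 2: "?f a (b \<triangleleft>\<^bsub>B\<^esub> scal R q) b' = ?f a b (b' \<triangleleft>\<^bsub>B'\<^esub> scal R q)"
    if "a \<in> carrier A" "b \<in> carrier B" "q \<in> carrier k" "b' \<in> carrier B'" for a b q b'
    using that by (simp add: odot_ract[OF A B, symmetric] sc kpure_bal[OF kR kR AB B'] P)
  have l: "additive (ktens k R R B B') ?T (?l a)" "b \<in> carrier B \<Longrightarrow> b' \<in> carrier B' \<Longrightarrow> ?l a (kp B B' b b') = ?f a b b'"
    if "a \<in> carrier A" for a b b'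
    using klift_additive[OF kR kR B B' Tab 1[OF that], OF 2[OF that]] klift_pure[OF kR kR B B' Tab 1[OF that], OF 2[OF that]] by blast+
  have 3: "biadditive A (odot k R B B') ?T ?l"
  proof (intro biadditiveI)
    fix a a' z assume *: "a \<in> carrier A" "a' \<in> carrier A" "z \<in> carrier (odot k R B B')"
    then have z: "z \<in> carrier (ktens k R R B B')" and aa: "a \<oplus>\<^bsub>A\<^esub> a' \<in> carrier A" by simp_all
    show "?l (a \<oplus>\<^bsub>A\<^esub> a') z = ?l a z \<oplus>\<^bsub>?T\<^esub> ?l a' z"
      by (rule kt_eq[OF kR kR B B' l(1)[OF aa] additive_sum_maps[OF l(1)[OF *(1)] l(1)[OF *(2)] Tab] _ z])
        (use *(1,2) in \<open>simp_all add: l(2)[OF aa] l(2)[OF *(1)] l(2)[OF *(2)] P del: additive_odot\<close>)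
  qed (use additive_closed[OF l(1)] additive_add[OF l(1)] in simp_all)
  have 4: "?l (a \<triangleleft>\<^bsub>A\<^esub> scal R q) z = ?l a (z \<triangleleft>\<^bsub>odot k R B B'\<^esub> scal R q)"
    if *: "a \<in> carrier A" "q \<in> carrier k" "z \<in> carrier (odot k R B B')" for a q z
  proof -
    have z: "z \<in> carrier (ktens k R R B B')" using *(3) by simp
    have aq: "a \<triangleleft>\<^bsub>A\<^esub> scal R q \<in> carrier A" using * by (simp add: A.ract_closed sc)
    have "additive (ktens k R R B B') (ktens k R R B B') (\<lambda>z. z \<triangleleft>\<^bsub>odot k R B B'\<^esub> scal R q)"
      using right_module.ract_closed[OF BB] right_module.ract_add[OF BB] sc[OF *(2)] by (intro additiveI) simp_all
    then show ?thesis
      by (rule kt_eq[OF kR kR B B' l(1)[OF aq] additive_compose[OF _ l(1)[OF *(1)]] _ z])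
        (use *(1,2) in \<open>simp_all add: l(2)[OF aq] l(2)[OF *(1)] odot_ract[OF B B'] sc B'.ract_closed B.ract_closed
          kpure_bal[OF kR kR A B] kpure_bal[OF kR kR AB B', symmetric] odot_ract[OF A B] P del: additive_odot\<close>)
  qed
  note L = klift[where f = ?l, OF kR kR A BB Tab 3, OF 4, folded odot_assoc_def[of k R A B B', unfolded Let_def]]
  have e: "odot_assoc k R A B B' \<in> extensional (carrier (ktens k R R A (odot k R B B')))" using L(1) by blast
  have a: "additive (ktens k R R A (odot k R B B')) ?T (odot_assoc k R A B B')" using L(2) by blast
  have p: "odot_assoc k R A B B' (kp A (odot k R B B') a z) = ?l a z" if "a \<in> carrier A" "z \<in> carrier (ktens k R R B B')" for a z
    using L(3)[of a z] that by (simp only: odot_simps)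
  then show "\<lbrakk>a \<in> carrier A; b \<in> carrier B; b' \<in> carrier B'\<rbrakk>
      \<Longrightarrow> odot_assoc k R A B B' (kp A (odot k R B B') a (kp B B' b b')) = kp (odot k R A B) B' (kp A B a b) b'" for a b b'
    by (simp add: l(2) kpure_closed[OF kR kR B B'] del: additive_odot)
  have ll: "rlin R (odot k R B B') ?T (?l a)" if "a \<in> carrier A" for a
    by (rule odot_rlin[OF B B' T l(1)[OF that]])
      (use that in \<open>simp add: l(2) B'.ract_closed odot_ract[OF AB B'] P del: additive_odot\<close>)
  have "rlin R (odot k R A (odot k R B B')) ?T (odot_assoc k R A B B')"
    by (rule odot_rlin[OF A BB T a])
      (use rlin_ract[OF ll] right_module.ract_closed[OF BB] in \<open>simp add: p del: additive_odot\<close>)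
  with e show "odot_assoc k R A B B' \<in> rhom R (odot k R A (odot k R B B')) (odot k R (odot k R A B) B')"
    by (simp add: rhom_iff)
qed

end

section \<open>The oplax actegory of a coalgebroid\<close>

lemma same_group_dot: "same_group (tens (over_SR k S R C M N) (ktens k S R M N) C) (dot k S R C M N)"
  by (simp add: dot_def Let_def same_group_def ring.defs)

context coalgebroid_setting
begin

abbreviation ks where "ks \<equiv> kpure k S R"
abbreviation KT where "KT \<equiv> ktens k S R"
abbreviation Dot where "Dot \<equiv> dot k S R C"
abbreviation ap where "ap \<equiv> apure k S R C"
abbreviation dp where "dp N M n m c \<equiv> ap N M (ks N M n m) c"

context
  fixes N M :: "'u rmodule"
  assumes N: "right_module S N" and M: "right_module R M"
begin

interpretation N: right_module S N by (rule N)
interpretation M: right_module R M by (rule M)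

lemmas KTp = kpure_closed[OF kS kR N M] kpure_add[OF kS kR N M]

text \<open>The actions of s and r commute with scalars of k, which are central in S and in R, so
  they descend to the tensor product over k.\<close>

lemma SR_act:
  assumes s: "s \<in> carrier S" and r: "r \<in> carrier R"
  shows SR_act_additive: "additive (KT N M) (KT N M) (SR_act k S R N M s r)"
    and SR_act_pure: "\<lbrakk>n \<in> carrier N; m \<in> carrier M\<rbrakk> \<Longrightarrow> SR_act k S R N M s r (ks N M n m) = ks N M (n \<triangleleft>\<^bsub>N\<^esub> s) (m \<triangleleft>\<^bsub>M\<^esub> r)"
proof -
  have 1: "biadditive N M (KT N M) (\<lambda>n m. ks N M (n \<triangleleft>\<^bsub>N\<^esub> s) (m \<triangleleft>\<^bsub>M\<^esub> r))"
    using s r by (intro biadditiveI) (simp_all add: KTp N.ract_closed M.ract_closed N.ract_add M.ract_add)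
  have 2: "ks N M (n \<triangleleft>\<^bsub>N\<^esub> scal S q \<triangleleft>\<^bsub>N\<^esub> s) (m \<triangleleft>\<^bsub>M\<^esub> r) = ks N M (n \<triangleleft>\<^bsub>N\<^esub> s) (m \<triangleleft>\<^bsub>M\<^esub> scal R q \<triangleleft>\<^bsub>M\<^esub> r)"
    if "n \<in> carrier N" "q \<in> carrier k" "m \<in> carrier M" for n q m
  proof -
    have "n \<triangleleft>\<^bsub>N\<^esub> scal S q \<triangleleft>\<^bsub>N\<^esub> s = n \<triangleleft>\<^bsub>N\<^esub> s \<triangleleft>\<^bsub>N\<^esub> scal S q" "m \<triangleleft>\<^bsub>M\<^esub> scal R q \<triangleleft>\<^bsub>M\<^esub> r = m \<triangleleft>\<^bsub>M\<^esub> r \<triangleleft>\<^bsub>M\<^esub> scal R q"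
      using that s r by (simp_all add: N.ract_mult[symmetric] M.ract_mult[symmetric] scal_closed[OF kS] scal_closed[OF kR]
          scal_central[OF kS] scal_central[OF kR])
    then show ?thesis using that s r by (simp add: kpure_bal[OF kS kR N M] N.ract_closed M.ract_closed)
  qed
  show "additive (KT N M) (KT N M) (SR_act k S R N M s r)"
    unfolding SR_act_def by (rule klift_additive[OF kS kR N M kt_abelian[OF kS kR N M] 1, OF 2])
  show "\<lbrakk>n \<in> carrier N; m \<in> carrier M\<rbrakk> \<Longrightarrow> SR_act k S R N M s r (ks N M n m) = ks N M (n \<triangleleft>\<^bsub>N\<^esub> s) (m \<triangleleft>\<^bsub>M\<^esub> r)"
    unfolding SR_act_def by (rule klift_pure[OF kS kR N M kt_abelian[OF kS kR N M] 1, OF 2])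
qed

lemma over_SR_D:
  assumes "((t, c), (t', c')) \<in> over_SR k S R C N M"
  obtains s r where "t = SR_act k S R N M s r t'" "c' = s \<triangleright>\<^bsub>C\<^esub> (r \<unrhd>\<^bsub>C\<^esub> c)" "s \<in> carrier S" "r \<in> carrier R" "t' \<in> carrier (KT N M)" "c \<in> carrier C"
  using assms unfolding over_SR_def by blast

lemma dot_balanced: "balanced_tensor (KT N M) C (over_SR k S R C N M)"
proof -
  interpret kt: abelian_group "KT N M" by (rule kt_abelian[OF kS kR N M])
  show ?thesis
    by unfold_locales (auto elim!: over_SR_D simp: over_SR_def additive_closed[OF SR_act_additive])
qed

interpretation D: balanced_tensor "KT N M" C "over_SR k S R C N M" by (rule dot_balanced)

lemma dot_eqs:
  "carrier (tens (over_SR k S R C N M) (KT N M) C) = carrier (Dot N M)"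
  "(\<oplus>\<^bsub>tens (over_SR k S R C N M) (KT N M) C\<^esub>) = (\<oplus>\<^bsub>Dot N M\<^esub>)"
  using same_group_dot[of k S R C N M] by (simp_all add: same_group_def)

lemma ap_closed: "\<lbrakk>t \<in> carrier (KT N M); c \<in> carrier C\<rbrakk> \<Longrightarrow> ap N M t c \<in> carrier (Dot N M)"
  using D.pure_closed by (simp add: dot_eqs)

lemma ap_add:
  "\<lbrakk>t \<in> carrier (KT N M); t' \<in> carrier (KT N M); c \<in> carrier C\<rbrakk> \<Longrightarrow> ap N M (t \<oplus>\<^bsub>KT N M\<^esub> t') c = ap N M t c \<oplus>\<^bsub>Dot N M\<^esub> ap N M t' c"
  "\<lbrakk>t \<in> carrier (KT N M); c \<in> carrier C; c' \<in> carrier C\<rbrakk> \<Longrightarrow> ap N M t (c \<oplus>\<^bsub>C\<^esub> c') = ap N M t c \<oplus>\<^bsub>Dot N M\<^esub> ap N M t c'"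
  using D.pure_add_left D.pure_add_right by (simp_all add: dot_eqs)

lemma ap_bal: "\<lbrakk>t \<in> carrier (KT N M); s \<in> carrier S; r \<in> carrier R; c \<in> carrier C\<rbrakk>
    \<Longrightarrow> ap N M (SR_act k S R N M s r t) c = ap N M t (s \<triangleright>\<^bsub>C\<^esub> (r \<unrhd>\<^bsub>C\<^esub> c))"
  by (rule D.pure_balanced) (unfold over_SR_def, blast)

lemma dot: shows dot_module: "right_module S (Dot N M)"
  and dot_ract: "\<lbrakk>t \<in> carrier (KT N M); c \<in> carrier C; s \<in> carrier S\<rbrakk> \<Longrightarrow> ap N M t c \<triangleleft>\<^bsub>Dot N M\<^esub> s = ap N M t (c \<triangleleft>\<^bsub>C\<^esub> s)"
proof -
  have act: "t \<triangleleft>\<^bsub>Dot N M\<^esub> s = tlift (over_SR k S R C N M) (KT N M) C (tens (over_SR k S R C N M) (KT N M) C) (\<lambda>a b. ap N M a (b \<triangleleft>\<^bsub>C\<^esub> s)) t" for t s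
    by (simp add: dot_def Let_def ring.defs rmodule.defs)
  have bal: "ap N M t (c \<triangleleft>\<^bsub>C\<^esub> s) = ap N M t' (c' \<triangleleft>\<^bsub>C\<^esub> s)"
    if rel: "((t, c), (t', c')) \<in> over_SR k S R C N M" and s: "s \<in> carrier S" for t c t' c' s
  proof -
    obtain q r where "t = SR_act k S R N M q r t'" "c' = q \<triangleright>\<^bsub>C\<^esub> (r \<unrhd>\<^bsub>C\<^esub> c)" "q \<in> carrier S" "r \<in> carrier R" "t' \<in> carrier (KT N M)" "c \<in> carrier C"
      using rel by (rule over_SR_D)
    then show ?thesis using s C.S_part.actions_commute by (simp add: ap_bal C.ract_lactR)
  qed
  show "right_module S (Dot N M)"
    by (rule right_action_module[OF dot_balanced C_mod(1) same_group_dot act bal])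
  show "\<lbrakk>t \<in> carrier (KT N M); c \<in> carrier C; s \<in> carrier S\<rbrakk> \<Longrightarrow> ap N M t c \<triangleleft>\<^bsub>Dot N M\<^esub> s = ap N M t (c \<triangleleft>\<^bsub>C\<^esub> s)"
    by (rule right_action_pure[OF dot_balanced C_mod(1) same_group_dot act bal])
qed

lemma dp_closed: "\<lbrakk>n \<in> carrier N; m \<in> carrier M; c \<in> carrier C\<rbrakk> \<Longrightarrow> dp N M n m c \<in> carrier (Dot N M)"
  by (simp add: ap_closed KTp)

text \<open>The relation for s \<otimes> r with one of the two scalars equal to \<one>.\<close>

lemma dp_act:
  assumes "n \<in> carrier N" "m \<in> carrier M" "c \<in> carrier C"
  shows "s \<in> carrier S \<Longrightarrow> dp N M (n \<triangleleft>\<^bsub>N\<^esub> s) m c = dp N M n m (s \<triangleright>\<^bsub>C\<^esub> c)"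
    and "r \<in> carrier R \<Longrightarrow> dp N M n (m \<triangleleft>\<^bsub>M\<^esub> r) c = dp N M n m (r \<unrhd>\<^bsub>C\<^esub> c)"
  using ap_bal[of "ks N M n m" s "\<one>\<^bsub>R\<^esub>" c] ap_bal[of "ks N M n m" "\<one>\<^bsub>S\<^esub>" r c] assms
  by (simp_all add: KTp SR_act_pure N.ract_one M.ract_one R_act C.S_part.lact_one)

lemma dp_ract: "\<lbrakk>n \<in> carrier N; m \<in> carrier M; c \<in> carrier C; s \<in> carrier S\<rbrakk> \<Longrightarrow> dp N M n m c \<triangleleft>\<^bsub>Dot N M\<^esub> s = dp N M n m (c \<triangleleft>\<^bsub>C\<^esub> s)"
  by (simp add: dot_ract KTp)

lemma alift:
  assumes G: "abelian_group G" and f: "biadditive (KT N M) C G f"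
    and bal: "\<And>t s r c. \<lbrakk>t \<in> carrier (KT N M); s \<in> carrier S; r \<in> carrier R; c \<in> carrier C\<rbrakk>
      \<Longrightarrow> f (SR_act k S R N M s r t) c = f t (s \<triangleright>\<^bsub>C\<^esub> (r \<unrhd>\<^bsub>C\<^esub> c))"
  shows alift_additive: "additive (Dot N M) G (alift k S R C N M G f)"
    and alift_pure: "\<lbrakk>t \<in> carrier (KT N M); c \<in> carrier C\<rbrakk> \<Longrightarrow> alift k S R C N M G f (ap N M t c) = f t c"
proof -
  have b: "f t c = f t' c'" if "((t, c), (t', c')) \<in> over_SR k S R C N M" for t c t' c'
    using that by (auto elim!: over_SR_D simp: bal)
  show "additive (Dot N M) G (alift k S R C N M G f)"
    using D.tlift_additive[OF G f b] by (simp add: same_group_additive[OF same_group_dot])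
  show "\<lbrakk>t \<in> carrier (KT N M); c \<in> carrier C\<rbrakk> \<Longrightarrow> alift k S R C N M G f (ap N M t c) = f t c"
    using D.tlift_pure[OF G f b] by blast
qed

lemma dot_eq:
  assumes h: "additive (Dot N M) G h" "additive (Dot N M) G h'"
    and eq: "\<And>n m c. \<lbrakk>n \<in> carrier N; m \<in> carrier M; c \<in> carrier C\<rbrakk> \<Longrightarrow> h (dp N M n m c) = h' (dp N M n m c)"
    and z: "z \<in> carrier (Dot N M)"
  shows "h z = h' z"
proof (rule D.tens_hom_eq)
  show "additive (tens (over_SR k S R C N M) (KT N M) C) G h" "additive (tens (over_SR k S R C N M) (KT N M) C) G h'"
    using h by (simp_all add: same_group_additive[OF same_group_dot])
  fix t c assume t: "t \<in> carrier (KT N M)" and c: "c \<in> carrier C"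
  have "additive (KT N M) (Dot N M) (\<lambda>t. ap N M t c)"
    using c by (intro additiveI) (simp_all add: ap_closed ap_add)
  from kt_eq[OF kS kR N M additive_compose[OF this h(1)] additive_compose[OF this h(2)] eq t] c
  show "h (ap N M t c) = h' (ap N M t c)" by blast
qed (use z in \<open>simp add: dot_eqs\<close>)

text \<open>Balancedness over k for the inner lift follows from \<open>f_S\<close> and
  \<open>f_R\<close>, as a scalar acts on C alike through S and through R; the relation for s
  \<otimes> r is the composite of the one-sided ones. The lifted term has the form in which
  \<open>act0\<close>, \<open>act2\<close> and \<open>kapD\<close> are written.\<close>

lemma dot_lift:
  assumes G: "abelian_group G" and f: "\<And>c. c \<in> carrier C \<Longrightarrow> biadditive N M G (\<lambda>n m. f n m c)"
    and f_add: "\<And>n m c c'. \<lbrakk>n \<in> carrier N; m \<in> carrier M; c \<in> carrier C; c' \<in> carrier C\<rbrakk>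
      \<Longrightarrow> f n m (c \<oplus>\<^bsub>C\<^esub> c') = f n m c \<oplus>\<^bsub>G\<^esub> f n m c'"
    and f_S: "\<And>n m c s. \<lbrakk>n \<in> carrier N; m \<in> carrier M; c \<in> carrier C; s \<in> carrier S\<rbrakk>
      \<Longrightarrow> f (n \<triangleleft>\<^bsub>N\<^esub> s) m c = f n m (s \<triangleright>\<^bsub>C\<^esub> c)"
    and f_R: "\<And>n m c r. \<lbrakk>n \<in> carrier N; m \<in> carrier M; c \<in> carrier C; r \<in> carrier R\<rbrakk>
      \<Longrightarrow> f n (m \<triangleleft>\<^bsub>M\<^esub> r) c = f n m (r \<unrhd>\<^bsub>C\<^esub> c)"
  shows dot_lift_additive: "additive (Dot N M) G (alift k S R C N M G (\<lambda>t c. klift k S R N M G (\<lambda>n m. f n m c) t))"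
    and dot_lift_pure: "\<lbrakk>n \<in> carrier N; m \<in> carrier M; c \<in> carrier C\<rbrakk>
      \<Longrightarrow> alift k S R C N M G (\<lambda>t c. klift k S R N M G (\<lambda>n m. f n m c) t) (dp N M n m c) = f n m c"
proof -
  have kb: "f (n \<triangleleft>\<^bsub>N\<^esub> scal S q) m c = f n (m \<triangleleft>\<^bsub>M\<^esub> scal R q) c"
    if "c \<in> carrier C" "n \<in> carrier N" "q \<in> carrier k" "m \<in> carrier M" for c n q m
    using that by (simp add: f_S f_R scal_closed[OF kS] scal_closed[OF kR] C.k_actions_agree)
  let ?l = "\<lambda>c. klift k S R N M G (\<lambda>n m. f n m c)"
  have l: "additive (KT N M) G (?l c)" "\<lbrakk>n \<in> carrier N; m \<in> carrier M\<rbrakk> \<Longrightarrow> ?l c (ks N M n m) = f n m c" if "c \<in> carrier C" for c n m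
    using klift_additive[OF kS kR N M G f[OF that], OF kb[OF that]] klift_pure[OF kS kR N M G f[OF that], OF kb[OF that]] by blast+
  have 1: "biadditive (KT N M) C G (\<lambda>t c. ?l c t)"
  proof (intro biadditiveI)
    fix t c c' assume t: "t \<in> carrier (KT N M)" and c: "c \<in> carrier C" "c' \<in> carrier C"
    then have cc: "c \<oplus>\<^bsub>C\<^esub> c' \<in> carrier C" using abelian_group.a_group[OF C_mod(3)] C.S_part.M.a_closed by simp
    show "?l (c \<oplus>\<^bsub>C\<^esub> c') t = ?l c t \<oplus>\<^bsub>G\<^esub> ?l c' t"
      by (rule kt_eq[OF kS kR N M l(1)[OF cc] additive_sum_maps[OF l(1)[OF c(1)] l(1)[OF c(2)] G] _ t])
        (simp add: l(2)[OF cc] l(2)[OF c(1)] l(2)[OF c(2)] f_add c)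
  qed (simp_all add: additive_closed[OF l(1)] additive_add[OF l(1)])
  have 2: "?l c (SR_act k S R N M s r t) = ?l (s \<triangleright>\<^bsub>C\<^esub> (r \<unrhd>\<^bsub>C\<^esub> c)) t"
    if t: "t \<in> carrier (KT N M)" and s: "s \<in> carrier S" and r: "r \<in> carrier R" and c: "c \<in> carrier C" for t s r c
  proof -
    have src: "s \<triangleright>\<^bsub>C\<^esub> (r \<unrhd>\<^bsub>C\<^esub> c) \<in> carrier C" using s r c by simp
    show ?thesis
      by (rule kt_eq[OF kS kR N M additive_compose[OF SR_act_additive[OF s r] l(1)[OF c]] l(1)[OF src] _ t])
        (use s r c in \<open>simp add: SR_act_pure[OF s r] l(2)[OF c] l(2)[OF src] N.ract_closed M.ract_closed f_S f_R C.lact_lactR[symmetric]\<close>)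
  qed
  show "additive (Dot N M) G (alift k S R C N M G (\<lambda>t c. ?l c t))"
    by (rule alift_additive[OF G 1, OF 2])
  show "\<lbrakk>n \<in> carrier N; m \<in> carrier M; c \<in> carrier C\<rbrakk> \<Longrightarrow> alift k S R C N M G (\<lambda>t c. ?l c t) (dp N M n m c) = f n m c"
    using alift_pure[OF G 1, OF 2, of "ks N M n m" c] by (simp add: KTp l(2))
qed

lemma dot_rlin:
  assumes G: "right_module S G" and h: "additive (Dot N M) G h"
    and s: "\<And>n m c s. \<lbrakk>n \<in> carrier N; m \<in> carrier M; c \<in> carrier C; s \<in> carrier S\<rbrakk>
      \<Longrightarrow> h (dp N M n m (c \<triangleleft>\<^bsub>C\<^esub> s)) = h (dp N M n m c) \<triangleleft>\<^bsub>G\<^esub> s"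
  shows "rlin S (Dot N M) G h"
proof (rule rlinI[OF h])
  interpret D: right_module S "Dot N M" by (rule dot_module)
  interpret G: right_module S G by (rule G)
  fix z s assume z: "z \<in> carrier (Dot N M)" and s': "s \<in> carrier S"
  have 1: "additive (Dot N M) (Dot N M) (\<lambda>z. z \<triangleleft>\<^bsub>Dot N M\<^esub> s)" "additive G G (\<lambda>z. z \<triangleleft>\<^bsub>G\<^esub> s)"
    using s' by (intro additiveI; simp add: D.ract_closed D.ract_add G.ract_closed G.ract_add)+
  show "h (z \<triangleleft>\<^bsub>Dot N M\<^esub> s) = h z \<triangleleft>\<^bsub>G\<^esub> s"
    by (rule dot_eq[OF additive_compose[OF 1(1) h] additive_compose[OF h 1(2)] _ z]) (simp add: dp_ract s s')
qed

end

end

lemma actegory_of_simps: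
  "act_ob (actegory_of k R S C) = dot k S R C"
  "act_map (actegory_of k R S C) M N M' N' f g = alift k S R C M N (dot k S R C M' N')
       (\<lambda>t c. apure k S R C M' N' (klift k S R M N (ktens k S R M' N') (\<lambda>m n. kpure k S R M' N' (f m) (g n)) t) c)"
  "act2 (actegory_of k R S C) M N P = alift k S R C M (odot k R N P) (dot k S R C (dot k S R C M N) P) (\<lambda>t c.
         klift k S R M (odot k R N P) (dot k S R C (dot k S R C M N) P) (\<lambda>m u.
           klift k R R N P (dot k S R C (dot k S R C M N) P) (\<lambda>n p. rlift S C C (dot k S R C (dot k S R C M N) P)
           (\<lambda>c1 c2. apure k S R C (dot k S R C M N) P
             (kpure k S R (dot k S R C M N) P (apure k S R C M N (kpure k S R M N m n) c1) p) c2)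
           (comul C c)) u) t)"
  "act0 (actegory_of k R S C) M = alift k S R C M (regular_rmodule R) M (\<lambda>t c.
       klift k S R M (regular_rmodule R) M (\<lambda>m r. m \<triangleleft>\<^bsub>M\<^esub> counit C (r \<unrhd>\<^bsub>C\<^esub> c)) t)"
  by (simp_all add: actegory_of_def Let_def)

section \<open>Structure maps of the actegory\<close>

context coalgebroid_setting
begin

abbreviation "Act \<equiv> actegory_of k R S C"

text \<open>The map that f and g induce on the tensor product over k commutes with the action of s
  \<otimes> r, so it descends to the product over S \<otimes> R.\<close>

lemma act_map:
  assumes N: "right_module S N" and M: "right_module R M" and N': "right_module S N'" and M': "right_module R M'"
    and f: "f \<in> rhom S N N'" and g: "g \<in> rhom R M M'"
  shows act_map_rlin: "rlin S (Dot N M) (Dot N' M') (act_map Act N M N' M' f g)"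
    and act_map_pure: "\<lbrakk>n \<in> carrier N; m \<in> carrier M; c \<in> carrier C\<rbrakk> \<Longrightarrow> act_map Act N M N' M' f g (dp N M n m c) = dp N' M' (f n) (g m) c"
proof -
  note fl = rhom_rlin[OF f] and gl = rhom_rlin[OF g]
  note fc = rlin_closed[OF fl] and gc = rlin_closed[OF gl]
  interpret D': right_module S "Dot N' M'" by (rule dot_module[OF N' M'])
  interpret Nr: right_module S N by (rule N)
  interpret Mr: right_module R M by (rule M)
  let ?K = "klift k S R N M (KT N' M') (\<lambda>n m. ks N' M' (f n) (g m))"
  have 1: "biadditive N M (KT N' M') (\<lambda>n m. ks N' M' (f n) (g m))"
    by (intro biadditiveI) (simp_all add: fc gc rlin_add[OF fl] rlin_add[OF gl] KTp[OF N' M'])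
  have 2: "ks N' M' (f (n \<triangleleft>\<^bsub>N\<^esub> scal S q)) (g m) = ks N' M' (f n) (g (m \<triangleleft>\<^bsub>M\<^esub> scal R q))"
    if "n \<in> carrier N" "q \<in> carrier k" "m \<in> carrier M" for n q m
    using that by (simp add: rlin_ract[OF fl] rlin_ract[OF gl] scal_closed[OF kS] scal_closed[OF kR] kpure_bal[OF kS kR N' M'] fc gc)
  note Kab = kt_abelian[OF kS kR N' M']
  have K: "additive (KT N M) (KT N' M') ?K" by (rule klift_additive[OF kS kR N M Kab 1, OF 2])
  have Kp: "?K (ks N M n m) = ks N' M' (f n) (g m)" if "n \<in> carrier N" "m \<in> carrier M" for n m
    by (rule klift_pure[OF kS kR N M Kab 1, OF 2 that])
  have K_SR: "?K (SR_act k S R N M s r t) = SR_act k S R N' M' s r (?K t)"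
    if s: "s \<in> carrier S" and r: "r \<in> carrier R" and t: "t \<in> carrier (KT N M)" for s r t
    by (rule kt_eq[OF kS kR N M additive_compose[OF SR_act_additive[OF N M s r] K] additive_compose[OF K SR_act_additive[OF N' M' s r]] _ t])
      (use s r in \<open>simp add: Kp SR_act_pure[OF N M s r] SR_act_pure[OF N' M' s r] Nr.ract_closed Mr.ract_closed fc gc rlin_ract[OF fl] rlin_ract[OF gl]\<close>)
  have 3: "biadditive (KT N M) C (Dot N' M') (\<lambda>t c. ap N' M' (?K t) c)"
    by (intro biadditiveI) (simp_all add: ap_closed[OF N' M'] ap_add[OF N' M'] additive_closed[OF K] additive_add[OF K])
  have 4: "ap N' M' (?K (SR_act k S R N M s r t)) c = ap N' M' (?K t) (s \<triangleright>\<^bsub>C\<^esub> (r \<unrhd>\<^bsub>C\<^esub> c))"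
    if "t \<in> carrier (KT N M)" "s \<in> carrier S" "r \<in> carrier R" "c \<in> carrier C" for t s r c
    using that by (simp add: K_SR ap_bal[OF N' M'] additive_closed[OF K])
  have a: "additive (Dot N M) (Dot N' M') (act_map Act N M N' M' f g)"
    unfolding actegory_of_simps by (rule alift_additive[OF N M D'.M.abelian_group_axioms 3, OF 4])
  show p: "\<lbrakk>n \<in> carrier N; m \<in> carrier M; c \<in> carrier C\<rbrakk> \<Longrightarrow> act_map Act N M N' M' f g (dp N M n m c) = dp N' M' (f n) (g m) c" for n m c
    unfolding actegory_of_simps using alift_pure[OF N M D'.M.abelian_group_axioms 3, OF 4, of "ks N M n m" c]
    by (simp add: KTp[OF N M] Kp)
  show "rlin S (Dot N M) (Dot N' M') (act_map Act N M N' M' f g)"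
    by (rule dot_rlin[OF N M D'.right_module_axioms a]) (simp add: p dp_ract[OF N' M'] fc gc)
qed

lemma act0:
  assumes N: "right_module S N"
  shows act0_additive: "additive (Dot N Reg) N (act0 Act N)"
    and act0_pure: "\<lbrakk>n \<in> carrier N; r \<in> carrier R; c \<in> carrier C\<rbrakk> \<Longrightarrow> act0 Act N (dp N Reg n r c) = n \<triangleleft>\<^bsub>N\<^esub> counit C (r \<unrhd>\<^bsub>C\<^esub> c)"
proof -
  interpret Nr: right_module S N by (rule N)
  let ?f = "\<lambda>n r c. n \<triangleleft>\<^bsub>N\<^esub> counit C (r \<unrhd>\<^bsub>C\<^esub> c)"
  note ca = additive_add[OF counit_additive]
  have 1: "biadditive N Reg N (\<lambda>n r. ?f n r c)" if "c \<in> carrier C" for c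
    using that by (intro biadditiveI) (simp_all add: Nr.ract_closed Nr.ract_add R_act ca Nr.ract_add_scalar)
  have 2: "?f n r (c \<oplus>\<^bsub>C\<^esub> c') = ?f n r c \<oplus>\<^bsub>N\<^esub> ?f n r c'"
    if "n \<in> carrier N" "r \<in> carrier Reg" "c \<in> carrier C" "c' \<in> carrier C" for n r c c'
    using that by (simp add: R_act ca Nr.ract_add_scalar)
  have 3: "?f (n \<triangleleft>\<^bsub>N\<^esub> s) r c = ?f n r (s \<triangleright>\<^bsub>C\<^esub> c)"
    if "n \<in> carrier N" "r \<in> carrier Reg" "c \<in> carrier C" "s \<in> carrier S" for n r c s
    using that by (simp add: C.lact_lactR[symmetric] counit_act Nr.ract_mult)
  have 4: "?f n (r \<triangleleft>\<^bsub>Reg\<^esub> q) c = ?f n r (q \<unrhd>\<^bsub>C\<^esub> c)"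
    if "n \<in> carrier N" "r \<in> carrier Reg" "c \<in> carrier C" "q \<in> carrier R" for n r c q
    using that by (simp add: R_act)
  show "additive (Dot N Reg) N (act0 Act N)"
    unfolding actegory_of_simps by (rule dot_lift_additive[where f = ?f, OF N Reg Nr.M.abelian_group_axioms 1, OF _ 2 3 4])
  show "\<lbrakk>n \<in> carrier N; r \<in> carrier R; c \<in> carrier C\<rbrakk> \<Longrightarrow> act0 Act N (dp N Reg n r c) = ?f n r c"
    unfolding actegory_of_simps by (rule dot_lift_pure[where f = ?f, OF N Reg Nr.M.abelian_group_axioms 1, OF _ 2 3 4]) simp_all
qed

lemma lactR_scal: "\<lbrakk>q \<in> carrier k; c \<in> carrier C\<rbrakk> \<Longrightarrow> scal R q \<unrhd>\<^bsub>C\<^esub> c = c \<triangleleft>\<^bsub>C\<^esub> scal S q"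
  by (simp add: C.k_actions_agree C.S_part.k_central)

lemma ractR_scal: "\<lbrakk>q \<in> carrier k; c \<in> carrier C\<rbrakk> \<Longrightarrow> c \<unlhd>\<^bsub>C\<^esub> scal R q = scal R q \<unrhd>\<^bsub>C\<^esub> c"
  using C.R_part.k_central by simp

text \<open>Bundles the conditions for lifting out of the tensor product of C with itself over S.
  They recur for each function that is applied to the components of \<delta>(c).\<close>

definition CC_balanced where
  "CC_balanced G f \<longleftrightarrow> biadditive C C G f \<and>
     (\<forall>c \<in> carrier C. \<forall>s \<in> carrier S. \<forall>c' \<in> carrier C. f (c \<triangleleft>\<^bsub>C\<^esub> s) c' = f c (s \<triangleright>\<^bsub>C\<^esub> c'))"

text \<open>Equations between balanced functions pass to their lifts at arbitrary tensors, in
  particular at \<delta>(c). \<open>CC_balanced_map\<close> handles a change by an additive map,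
  such as an action on one of the factors.\<close>

lemma CC_balanced:
  assumes G: "abelian_group G" and f: "CC_balanced G f"
  shows CC_balanced_additive: "additive (rtensor S C C) G (rlift S C C G f)"
    and CC_balanced_pure: "\<lbrakk>c \<in> carrier C; c' \<in> carrier C\<rbrakk> \<Longrightarrow> rlift S C C G f (pu C c c') = f c c'"
    and CC_balanced_add: "\<lbrakk>CC_balanced G f1; CC_balanced G f2;
        \<And>c c'. \<lbrakk>c \<in> carrier C; c' \<in> carrier C\<rbrakk> \<Longrightarrow> f c c' = f1 c c' \<oplus>\<^bsub>G\<^esub> f2 c c'; t \<in> carrier (rtensor S C C)\<rbrakk>
      \<Longrightarrow> rlift S C C G f t = rlift S C C G f1 t \<oplus>\<^bsub>G\<^esub> rlift S C C G f2 t"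
    and CC_balanced_map: "\<lbrakk>CC_balanced G f1; additive (rtensor S C C) (rtensor S C C) h;
        \<And>c c'. \<lbrakk>c \<in> carrier C; c' \<in> carrier C\<rbrakk> \<Longrightarrow> f c c' = rlift S C C G f1 (h (pu C c c')); t \<in> carrier (rtensor S C C)\<rbrakk>
      \<Longrightarrow> rlift S C C G f t = rlift S C C G f1 (h t)"
proof -
  have l: "additive (rtensor S C C) G (rlift S C C G f)" "\<lbrakk>c \<in> carrier C; c' \<in> carrier C\<rbrakk> \<Longrightarrow> rlift S C C G f (pu C c c') = f c c'"
    if "CC_balanced G f" for f c c'
    using rlift_additive[OF C_mod(1,2) G, of f] rlift_pure[OF C_mod(1,2) G, of f c c'] that by (simp_all add: CC_balanced_def)
  show "additive (rtensor S C C) G (rlift S C C G f)"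
    "\<lbrakk>c \<in> carrier C; c' \<in> carrier C\<rbrakk> \<Longrightarrow> rlift S C C G f (pu C c c') = f c c'" for c c'
    by (rule l[OF f])+
  show "rlift S C C G f t = rlift S C C G f1 t \<oplus>\<^bsub>G\<^esub> rlift S C C G f2 t"
    if "CC_balanced G f1" "CC_balanced G f2" "\<And>c c'. \<lbrakk>c \<in> carrier C; c' \<in> carrier C\<rbrakk> \<Longrightarrow> f c c' = f1 c c' \<oplus>\<^bsub>G\<^esub> f2 c c'"
      "t \<in> carrier (rtensor S C C)" for f1 f2 t
    by (rule NC_eq[OF C_mod(1) l(1)[OF f] additive_sum_maps[OF l(1)[OF that(1)] l(1)[OF that(2)] G] _ that(4)])
      (simp add: l(2)[OF f] l(2)[OF that(1)] l(2)[OF that(2)] that(3))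
  show "rlift S C C G f t = rlift S C C G f1 (h t)"
    if "CC_balanced G f1" "additive (rtensor S C C) (rtensor S C C) h"
      "\<And>c c'. \<lbrakk>c \<in> carrier C; c' \<in> carrier C\<rbrakk> \<Longrightarrow> f c c' = rlift S C C G f1 (h (pu C c c'))" "t \<in> carrier (rtensor S C C)" for f1 h t
    by (rule NC_eq[OF C_mod(1) l(1)[OF f] additive_compose[OF that(2) l(1)[OF that(1)]] _ that(4)])
      (simp only: l(2)[OF f] that(3))
qed

text \<open>The map is made of four nested lifts. Linearity and balancedness of the innermost
  function of c_(1) and c_(2) are passed outwards through \<open>CC_balanced\<close>, and
  \<open>dot_lift\<close> supplies the outer two lifts.\<close>

lemma act2:
  assumes N: "right_module S N" and M: "right_module R M" and P: "right_module R P"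
  shows act2_additive: "additive (Dot N (odot k R M P)) (Dot (Dot N M) P) (act2 Act N M P)"
    and act2_pure: "\<lbrakk>n \<in> carrier N; m \<in> carrier M; p \<in> carrier P; c \<in> carrier C\<rbrakk>
      \<Longrightarrow> act2 Act N M P (dp N (odot k R M P) n (kp M P m p) c)
        = rlift S C C (Dot (Dot N M) P) (\<lambda>c1 c2. dp (Dot N M) P (dp N M n m c1) p c2) (comul C c)"
proof -
  interpret Nr: right_module S N by (rule N)
  interpret Mr: right_module R M by (rule M)
  interpret Pr: right_module R P by (rule P)
  note NM = dot_module[OF N M] and MP = odot_module[OF M P]
  let ?T = "Dot (Dot N M) P"
  have T: "abelian_group ?T" by (rule right_module_abelian[OF dot_module[OF NM P]])
  let ?b = "\<lambda>n m p c1 c2. dp (Dot N M) P (dp N M n m c1) p c2"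
  let ?g = "\<lambda>n m p. rlift S C C ?T (?b n m p)"
  note dpa = KTp[OF N M] KTp[OF NM P] ap_add[OF N M] ap_add[OF NM P] ap_closed[OF N M] ap_closed[OF NM P]
  have bal: "CC_balanced ?T (?b n m p)" if "n \<in> carrier N" "m \<in> carrier M" "p \<in> carrier P" for n m p
    unfolding CC_balanced_def using that
    by (intro conjI biadditiveI ballI) (simp_all add: dpa dp_ract[OF N M, symmetric] dp_act(1)[OF NM P] dp_closed[OF N M])
  have g: "additive (rtensor S C C) ?T (?g n m p)" if "n \<in> carrier N" "m \<in> carrier M" "p \<in> carrier P" for n m p
    by (rule CC_balanced_additive[OF T bal[OF that]])
  have gp: "?g n m p (pu C c c') = ?b n m p c c'" if "n \<in> carrier N" "m \<in> carrier M" "p \<in> carrier P" "c \<in> carrier C" "c' \<in> carrier C" for n m p c c'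
    by (rule CC_balanced_pure[OF T bal[OF that(1-3)] that(4,5)])
  have g_n: "?g (n \<oplus>\<^bsub>N\<^esub> n') m p t = ?g n m p t \<oplus>\<^bsub>?T\<^esub> ?g n' m p t"
    if "n \<in> carrier N" "n' \<in> carrier N" "m \<in> carrier M" "p \<in> carrier P" "t \<in> carrier (rtensor S C C)" for n n' m p t
    by (rule CC_balanced_add[OF T bal bal bal]) (use that in \<open>simp_all add: dpa\<close>)
  have g_m: "?g n (m \<oplus>\<^bsub>M\<^esub> m') p t = ?g n m p t \<oplus>\<^bsub>?T\<^esub> ?g n m' p t"
    if "n \<in> carrier N" "m \<in> carrier M" "m' \<in> carrier M" "p \<in> carrier P" "t \<in> carrier (rtensor S C C)" for n m m' p t
    by (rule CC_balanced_add[OF T bal bal bal]) (use that in \<open>simp_all add: dpa\<close>)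
  have g_p: "?g n m (p \<oplus>\<^bsub>P\<^esub> p') t = ?g n m p t \<oplus>\<^bsub>?T\<^esub> ?g n m p' t"
    if "n \<in> carrier N" "m \<in> carrier M" "p \<in> carrier P" "p' \<in> carrier P" "t \<in> carrier (rtensor S C C)" for n m p p' t
    by (rule CC_balanced_add[OF T bal bal bal]) (use that in \<open>simp_all add: dpa\<close>)
  \<comment> \<open>The scalar moves from m to c_(1), becomes a right S-action on the inner product,
    crosses to c_(2), and from there goes to p.\<close>
  have g_bal: "?g n (m \<triangleleft>\<^bsub>M\<^esub> scal R q) p t = ?g n m (p \<triangleleft>\<^bsub>P\<^esub> scal R q) t"
    if n: "n \<in> carrier N" and m: "m \<in> carrier M" and q: "q \<in> carrier k" and p: "p \<in> carrier P" and t: "t \<in> carrier (rtensor S C C)" for n m q p t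
  proof -
    note sR = scal_closed[OF kR q] and sS = scal_closed[OF kS q]
    have mq: "m \<triangleleft>\<^bsub>M\<^esub> scal R q \<in> carrier M" and pq: "p \<triangleleft>\<^bsub>P\<^esub> scal R q \<in> carrier P"
      using m p sR by (simp_all add: Mr.ract_closed Pr.ract_closed)
    show ?thesis
    proof (rule NC_eq[OF C_mod(1) g[OF n mq p] g[OF n m pq] _ t])
      fix c c' assume c: "c \<in> carrier C" "c' \<in> carrier C"
      have "?b n (m \<triangleleft>\<^bsub>M\<^esub> scal R q) p c c' = dp (Dot N M) P (dp N M n m c \<triangleleft>\<^bsub>Dot N M\<^esub> scal S q) p c'"
        using n m p c q by (simp add: dp_act(2)[OF N M _ _ _ sR] lactR_scal dp_ract[OF N M _ _ _ sS])
      also have "\<dots> = ?b n m (p \<triangleleft>\<^bsub>P\<^esub> scal R q) c c'"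
        using n m p c q by (simp add: dp_act(1)[OF NM P _ _ _ sS] dp_act(2)[OF NM P _ _ _ sR] dp_closed[OF N M] C.k_actions_agree)
      finally show "?g n (m \<triangleleft>\<^bsub>M\<^esub> scal R q) p (pu C c c') = ?g n m (p \<triangleleft>\<^bsub>P\<^esub> scal R q) (pu C c c')"
        by (simp only: gp[OF n mq p c] gp[OF n m pq c])
    qed
  qed
  let ?l = "\<lambda>n u c. klift k R R M P ?T (\<lambda>m p. ?g n m p (comul C c)) u"
  have l1: "biadditive M P ?T (\<lambda>m p. ?g n m p (comul C c))" if "n \<in> carrier N" "c \<in> carrier C" for n c
    using that by (intro biadditiveI) (simp_all add: additive_closed[OF g] g_m g_p)
  have l2: "?g n (m \<triangleleft>\<^bsub>M\<^esub> scal R q) p (comul C c) = ?g n m (p \<triangleleft>\<^bsub>P\<^esub> scal R q) (comul C c)"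
    if "n \<in> carrier N" "c \<in> carrier C" "m \<in> carrier M" "q \<in> carrier k" "p \<in> carrier P" for n c m q p
    using that by (simp add: g_bal)
  have l: "additive (ktens k R R M P) ?T (\<lambda>u. ?l n u c)" if "n \<in> carrier N" "c \<in> carrier C" for n c
    by (rule klift_additive[OF kR kR M P T l1[OF that], OF l2[OF that]])
  have lp: "?l n (kp M P m p) c = ?g n m p (comul C c)" if "n \<in> carrier N" "c \<in> carrier C" "m \<in> carrier M" "p \<in> carrier P" for n m p c
    by (rule klift_pure[OF kR kR M P T l1[OF that(1,2)], OF l2[OF that(1,2)] that(3,4)])
  note kteq = kt_eq[OF kR kR M P]
  have f1: "biadditive N (odot k R M P) ?T (\<lambda>n u. ?l n u c)" if c: "c \<in> carrier C" for c
  proof (intro biadditiveI)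
    fix n n' u assume n: "n \<in> carrier N" "n' \<in> carrier N" and "u \<in> carrier (odot k R M P)"
    then have u: "u \<in> carrier (ktens k R R M P)" and nn: "n \<oplus>\<^bsub>N\<^esub> n' \<in> carrier N" by simp_all
    show "?l (n \<oplus>\<^bsub>N\<^esub> n') u c = ?l n u c \<oplus>\<^bsub>?T\<^esub> ?l n' u c"
      by (rule kteq[OF l[OF nn c] additive_sum_maps[OF l[OF n(1) c] l[OF n(2) c] T] _ u])
        (simp add: lp nn n c g_n)
  qed (use c in \<open>simp_all add: additive_closed[OF l] additive_add[OF l]\<close>)
  have f2: "?l n u (c \<oplus>\<^bsub>C\<^esub> c') = ?l n u c \<oplus>\<^bsub>?T\<^esub> ?l n u c'"
    if n: "n \<in> carrier N" and u: "u \<in> carrier (odot k R M P)" and c: "c \<in> carrier C" "c' \<in> carrier C" for n u c c'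
  proof -
    have cc: "c \<oplus>\<^bsub>C\<^esub> c' \<in> carrier C" using c C.S_part.M.a_closed by simp
    show ?thesis
    proof (rule kteq[OF l[OF n cc] additive_sum_maps[OF l[OF n c(1)] l[OF n c(2)] T]])
      fix m p assume m: "m \<in> carrier M" and p: "p \<in> carrier P"
      have "?g n m p (comul C (c \<oplus>\<^bsub>C\<^esub> c')) = ?g n m p (comul C c) \<oplus>\<^bsub>?T\<^esub> ?g n m p (comul C c')"
        using c by (simp add: additive_add[OF comul_additive] additive_add[OF g[OF n m p]])
      then show "?l n (kp M P m p) (c \<oplus>\<^bsub>C\<^esub> c') = ?l n (kp M P m p) c \<oplus>\<^bsub>?T\<^esub> ?l n (kp M P m p) c'"
        by (simp only: lp[OF n cc m p] lp[OF n c(1) m p] lp[OF n c(2) m p])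
    qed (use u in simp)
  qed
  \<comment> \<open>Left S-linearity of \<delta>: s acts on c_(1), from where it moves to n.\<close>
  have f3: "?l (n \<triangleleft>\<^bsub>N\<^esub> s) u c = ?l n u (s \<triangleright>\<^bsub>C\<^esub> c)"
    if n: "n \<in> carrier N" and u: "u \<in> carrier (odot k R M P)" and c: "c \<in> carrier C" and s: "s \<in> carrier S" for n u c s
  proof -
    have ns: "n \<triangleleft>\<^bsub>N\<^esub> s \<in> carrier N" and sc: "s \<triangleright>\<^bsub>C\<^esub> c \<in> carrier C" using n c s by (simp_all add: Nr.ract_closed)
    have cs: "comul C (s \<triangleright>\<^bsub>C\<^esub> c) = s \<triangleright>\<^bsub>bitensor S C C\<^esub> comul C c" using comul_lin(1) s c by (simp add: llin_def)
    have gs: "?g (n \<triangleleft>\<^bsub>N\<^esub> s) m p t = ?g n m p (s \<triangleright>\<^bsub>bitensor S C C\<^esub> t)"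
      if "m \<in> carrier M" "p \<in> carrier P" "t \<in> carrier (rtensor S C C)" for m p t
      by (rule CC_balanced_map[OF T bal[OF ns that(1,2)] bal[OF n that(1,2)] bt_lact_additive[OF C_bimod C_bimod s] _ that(3)])
        (use that(1,2) n s in \<open>simp add: gp bt_lact_pure[OF C_bimod C_bimod] dp_act(1)[OF N M]\<close>)
    show ?thesis
    proof (rule kteq[OF l[OF ns c] l[OF n sc]])
      fix m p assume m: "m \<in> carrier M" and p: "p \<in> carrier P"
      show "?l (n \<triangleleft>\<^bsub>N\<^esub> s) (kp M P m p) c = ?l n (kp M P m p) (s \<triangleright>\<^bsub>C\<^esub> c)"
        unfolding lp[OF ns c m p] lp[OF n sc m p] unfolding cs by (rule gs[OF m p comul_closed[OF c]])
    qed (use u in simp)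
  qed
  \<comment> \<open>R acts on m \<otimes> p through p, which matches \<delta>(r c) = c_(1) \<otimes>
    r c_(2).\<close>
  have f4: "?l n (u \<triangleleft>\<^bsub>odot k R M P\<^esub> r) c = ?l n u (r \<unrhd>\<^bsub>C\<^esub> c)"
    if n: "n \<in> carrier N" and u: "u \<in> carrier (odot k R M P)" and c: "c \<in> carrier C" and r: "r \<in> carrier R" for n u c r
  proof -
    have u': "u \<in> carrier (ktens k R R M P)" and rc: "r \<unrhd>\<^bsub>C\<^esub> c \<in> carrier C" using u c r by simp_all
    have "additive (ktens k R R M P) (ktens k R R M P) (\<lambda>u. u \<triangleleft>\<^bsub>odot k R M P\<^esub> r)"
      using right_module.ract_closed[OF MP] right_module.ract_add[OF MP] r by (intro additiveI) simp_all
    note 1 = additive_compose[OF this l[OF n c]]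
    have gr: "?g n m (p \<triangleleft>\<^bsub>P\<^esub> r) t = ?g n m p (mapR C (lactR C r) t)"
      if "m \<in> carrier M" "p \<in> carrier P" "t \<in> carrier (rtensor S C C)" for m p t
      by (rule CC_balanced_map[OF T bal[OF n that(1) Pr.ract_closed[OF that(2) r]] bal[OF n that(1,2)]
            mapR_additive[OF C_mod(1) lactR_lin(1)[OF r]] _ that(3)])
        (use that(1,2) n r in \<open>simp add: gp mapR_pure[OF C_mod(1) lactR_lin(1)] dp_act(2)[OF NM P] dp_closed[OF N M]\<close>)
    show ?thesis
    proof (rule kteq[OF 1 l[OF n rc] _ u'])
      fix m p assume m: "m \<in> carrier M" and p: "p \<in> carrier P"
      show "?l n (kp M P m p \<triangleleft>\<^bsub>odot k R M P\<^esub> r) c = ?l n (kp M P m p) (r \<unrhd>\<^bsub>C\<^esub> c)"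
        unfolding odot_ract[OF M P m p r] lp[OF n c m Pr.ract_closed[OF p r]] lp[OF n rc m p]
        unfolding comul_R(1)[OF r c] by (rule gr[OF m p comul_closed[OF c]])
    qed
  qed
  note L = dot_lift_additive[where f = ?l, OF N MP T f1, OF _ f2 f3 f4] dot_lift_pure[where f = ?l, OF N MP T f1, OF _ f2 f3 f4]
  show "additive (Dot N (odot k R M P)) ?T (act2 Act N M P)"
    unfolding actegory_of_simps by (rule L(1))
  show "\<lbrakk>n \<in> carrier N; m \<in> carrier M; p \<in> carrier P; c \<in> carrier C\<rbrakk>
      \<Longrightarrow> act2 Act N M P (dp N (odot k R M P) n (kp M P m p) c) = ?g n m p (comul C c)" for n m p c
    unfolding actegory_of_simps using L(2)[of n "kp M P m p" c] by (simp add: lp kpure_closed[OF kR kR M P])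
qed

text \<open>Identifies the action of the module R on N with the tensor product of N and C over S, by
  absorbing r into the coefficient. It is the comparison map \<open>kap\<close> of the scheme for
  \<open>M0\<close> = R.\<close>

definition kapD where
  "kapD N = alift k S R C N Reg (rtensor S N C) (\<lambda>t c. klift k S R N Reg (rtensor S N C) (\<lambda>n r. pu N n (r \<unrhd>\<^bsub>C\<^esub> c)) t)"

lemma kapD:
  assumes N: "right_module S N"
  shows kapD_rlin: "rlin S (Dot N Reg) (rtensor S N C) (kapD N)"
    and kapD_pure: "\<lbrakk>n \<in> carrier N; r \<in> carrier R; c \<in> carrier C\<rbrakk> \<Longrightarrow> kapD N (dp N Reg n r c) = pu N n (r \<unrhd>\<^bsub>C\<^esub> c)"
proof -
  note NC = NC_mod[OF N]
  let ?f = "\<lambda>n r c. pu N n (r \<unrhd>\<^bsub>C\<^esub> c)"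
  have 1: "biadditive N Reg (rtensor S N C) (\<lambda>n r. ?f n r c)" if "c \<in> carrier C" for c
    using that by (intro biadditiveI) (simp_all add: pu_closed[OF N] pu_add[OF N] R_act)
  have 2: "?f n r (c \<oplus>\<^bsub>C\<^esub> c') = ?f n r c \<oplus>\<^bsub>rtensor S N C\<^esub> ?f n r c'"
    if "n \<in> carrier N" "r \<in> carrier Reg" "c \<in> carrier C" "c' \<in> carrier C" for n r c c'
    using that by (simp add: pu_add[OF N] R_act)
  have 3: "?f (n \<triangleleft>\<^bsub>N\<^esub> s) r c = ?f n r (s \<triangleright>\<^bsub>C\<^esub> c)"
    if "n \<in> carrier N" "r \<in> carrier Reg" "c \<in> carrier C" "s \<in> carrier S" for n r c s
    using that by (simp add: pu_balanced[OF N] C.lact_lactR)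
  have 4: "?f n (r \<triangleleft>\<^bsub>Reg\<^esub> q) c = ?f n r (q \<unrhd>\<^bsub>C\<^esub> c)"
    if "n \<in> carrier N" "r \<in> carrier Reg" "c \<in> carrier C" "q \<in> carrier R" for n r c q
    using that by (simp add: R_act)
  note L = dot_lift_additive[where f = ?f, OF N Reg right_module_abelian[OF NC] 1, OF _ 2 3 4, folded kapD_def]
    dot_lift_pure[where f = ?f, OF N Reg right_module_abelian[OF NC] 1, OF _ 2 3 4, folded kapD_def]
  have a: "additive (Dot N Reg) (rtensor S N C) (kapD N)" by (rule L(1))
  show p: "\<lbrakk>n \<in> carrier N; r \<in> carrier R; c \<in> carrier C\<rbrakk> \<Longrightarrow> kapD N (dp N Reg n r c) = ?f n r c" for n r c
    using L(2)[of n r c] by simp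
  show "rlin S (Dot N Reg) (rtensor S N C) (kapD N)"
    by (rule dot_rlin[OF N Reg NC a]) (simp add: p pu_ract[OF N] C.ract_lactR)
qed

text \<open>A * M is here a tensor product over k, so \<open>Z\<close> consists of the scalars of k,
  and these act on M through its right action. As a right module, R is free on \<one>.\<close>

lemma oplax_scheme:
  "comodule_scheme k R S C (scal R ` carrier k) {M. right_module R M} (rhom R) (\<lambda>M r m. m \<triangleleft>\<^bsub>M\<^esub> r)
    (odot k R) (kpure k R R) (odot_map k R) (odot k R) (kpure k R R) (odot_assoc k R) Reg (odot_runit k R)
    Dot (\<lambda>N M n m c. dp N M n m c) (act_map Act) (act2 Act) (act0 Act) Reg \<one>\<^bsub>R\<^esub> kapD"
proof (intro comodule_scheme.intro comodule_scheme_axioms.intro coalgebroid_setting_axioms, goal_cases)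
  case 1 show ?case using scal_closed[OF kR] by auto
next
  case (2 M) then show ?case by simp
next
  case (3 M r m) then show ?case using scal_closed[OF kR] by (auto intro: right_module.ract_closed)
next
  case (4 M M' g) then show ?case by simp
next
  case (5 M) then show ?case by (simp add: rhom_id)
next
  case (6 A M) then show ?case by (simp add: odot_module)
next
  case (7 A M)
  then have A: "right_module R A" and M: "right_module R M" by auto
  show ?case unfolding additive_odot by (intro biadditiveI) (simp_all add: kpure_closed[OF kR kR A M] kpure_add[OF kR kR A M])
next
  case (8 A M a m r) then show ?case by (simp add: odot_ract)
next
  case (9 A M G h h' z)
  then show ?case using kt_eq[OF kR kR, of A M G h h' z] by simp
next
  case (10 A M G f)
  then have A: "right_module R A" and M: "right_module R M" by auto
  have bal: "f (a \<triangleleft>\<^bsub>A\<^esub> scal R q) m = f a (m \<triangleleft>\<^bsub>M\<^esub> scal R q)" if "a \<in> carrier A" "q \<in> carrier k" "m \<in> carrier M" for a q m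
    using 10(5) that by simp
  show ?case
    using klift_additive[OF kR kR A M 10(3,4) bal] klift_pure[OF kR kR A M 10(3,4) bal]
    by (intro exI[of _ "klift k R R A M G f"]) simp
next
  case (11 A A' M M' f g) then show ?case by (simp add: odot_map_hom rhom_rlin)
next
  case (12 A A' M M' f g a m) then show ?case by (simp add: odot_map_pure rhom_rlin)
next
  case (13 M M') then show ?case by (simp add: odot_module)
next
  case (14 M M' m m') then show ?case by (simp add: kpure_closed[OF kR kR])
next
  case (15 M M' G h h' z)
  then show ?case using kt_eq[OF kR kR, of M M' G h h' z] by simp
next
  case (16 A M M') then show ?case by (simp add: odot_assoc_hom)
next
  case (17 A M M' a m m') then show ?case by (simp add: odot_assoc_pure)
next
  case 18 show ?case by (simp add: Reg)
next
  case 19 show ?case by simp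
next
  case (20 A) then show ?case by (rule odot_runit_hom)
next
  case (21 A a r) then show ?case by (rule odot_runit_pure)
next
  case (22 N M) then show ?case by (simp add: dot_module)
next
  case (23 N M m)
  then have N: "right_module S N" and M: "right_module R M" by auto
  show ?case using 23(3) by (intro biadditiveI) (simp_all add: dp_closed[OF N M] ap_add[OF N M] KTp[OF N M])
next
  case (24 N M n m m' c)
  then have N: "right_module S N" and M: "right_module R M" by auto
  show ?case using 24(3-6) by (simp add: ap_add[OF N M] KTp[OF N M])
next
  case (25 N M n m c s) then show ?case by (simp add: dp_ract)
next
  case (26 N M n m c s) then show ?case by (simp add: dp_act)
next
  case (27 N M n m c r) then show ?case by (simp add: dp_act)
next
  case (28 N M n m c r) then show ?case by (auto simp: dp_act scal_closed[OF kR] ractR_scal)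
next
  case (29 N M G h h' z)
  then show ?case using dot_eq[of N M G h h' z] by simp
next
  case (30 N N' M M' f g) then show ?case by (simp add: act_map_rlin)
next
  case (31 N N' M M' f g n m c) then show ?case by (simp add: act_map_pure)
next
  case (32 N M M') then show ?case by (simp add: act2_additive)
next
  case (33 N M M' n m m' c) then show ?case by (simp add: act2_pure)
next
  case (34 N) then show ?case by (rule act0_additive)
next
  case (35 N n r c) then show ?case by (rule act0_pure)
next
  case 36 show ?case by (simp add: Reg)
next
  case 37 show ?case by simp
next
  case (38 M m)
  then have M: "right_module R M" by simp
  show ?case by (rule bexI[OF _ iota_rhom[OF M 38(2)]]) (simp add: iota_def right_module.ract_one[OF M 38(2)])
next
  case (39 N n m c)
  then show ?case using dp_act(2)[OF 39(1) Reg 39(2) _ 39(4), of "\<one>\<^bsub>R\<^esub>" m]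
    by (intro bexI[of _ "m \<unrhd>\<^bsub>C\<^esub> c"]) simp_all
next
  case (40 N) then show ?case by (rule kapD_rlin)
next
  case (41 N n c) then show ?case by (simp add: kapD_pure R_act)
qed

theorem oplax_weak_equivalence:
  "\<exists>F. weak_equivalence (cocontinuous_oplax_morphisms k R S (self_actegory k R) Act) (coalgebroid_comodules S C) F"
proof -
  interpret sch: comodule_scheme k R S C "scal R ` carrier k" "{M. right_module R M}" "rhom R" "\<lambda>M r m. m \<triangleleft>\<^bsub>M\<^esub> r"
    "odot k R" "kpure k R R" "odot_map k R" "odot k R" "kpure k R R" "odot_assoc k R" Reg "odot_runit k R"
    Dot "\<lambda>N M n m c. dp N M n m c" "act_map Act" "act2 Act" "act0 Act" Reg "\<one>\<^bsub>R\<^esub>" kapD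
    by (rule oplax_scheme)
  \<comment> \<open>With these parameters the two categories coincide after unfolding, so nothing
    has to be transported.\<close>
  have "cocontinuous_oplax_morphisms k R S (self_actegory k R) Act = sch.diagonals"
    unfolding cocontinuous_oplax_morphisms_def oplax_morphism_def sch.diagonals_def sch.diagonal_def
    by (simp add: self_actegory_def actegory_of_simps(1))
  then show ?thesis using sch.E_weak_equivalence by auto
qed

end

section \<open>Comodules for the opmonoidal functor\<close>

text \<open>The bimodule axioms are equations between additive endomaps, so they may be tested on
  any set G that determines such maps.\<close>

lemma bimod_generated:
  fixes T :: "('u, 't) bimodule_scheme" and V :: "('u, 'v) ring_scheme" and U :: "('u, 'w) ring_scheme"
  assumes V: "ring V" and T: "right_module U T" and lact: "\<And>v. v \<in> carrier V \<Longrightarrow> additive T T (\<lambda>z. v \<triangleright>\<^bsub>T\<^esub> z)"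
    and gen: "\<And>h h' z. \<lbrakk>additive T T h; additive T T h'; \<And>z. z \<in> G \<Longrightarrow> h z = h' z; z \<in> carrier T\<rbrakk> \<Longrightarrow> h z = h' z"
    and act: "\<And>v v' z. \<lbrakk>v \<in> carrier V; v' \<in> carrier V; z \<in> G\<rbrakk> \<Longrightarrow> (v \<oplus>\<^bsub>V\<^esub> v') \<triangleright>\<^bsub>T\<^esub> z = (v \<triangleright>\<^bsub>T\<^esub> z) \<oplus>\<^bsub>T\<^esub> (v' \<triangleright>\<^bsub>T\<^esub> z)"
      "\<And>v v' z. \<lbrakk>v \<in> carrier V; v' \<in> carrier V; z \<in> G\<rbrakk> \<Longrightarrow> (v \<otimes>\<^bsub>V\<^esub> v') \<triangleright>\<^bsub>T\<^esub> z = v \<triangleright>\<^bsub>T\<^esub> v' \<triangleright>\<^bsub>T\<^esub> z"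
      "\<And>z. z \<in> G \<Longrightarrow> \<one>\<^bsub>V\<^esub> \<triangleright>\<^bsub>T\<^esub> z = z"
      "\<And>v u z. \<lbrakk>v \<in> carrier V; u \<in> carrier U; z \<in> G\<rbrakk> \<Longrightarrow> (v \<triangleright>\<^bsub>T\<^esub> z) \<triangleleft>\<^bsub>T\<^esub> u = v \<triangleright>\<^bsub>T\<^esub> (z \<triangleleft>\<^bsub>T\<^esub> u)"
  shows "bimod V U T"
proof -
  interpret V: ring V by (rule V)
  interpret T: right_module U T by (rule T)
  have ract: "additive T T (\<lambda>z. z \<triangleleft>\<^bsub>T\<^esub> u)" if "u \<in> carrier U" for u
    using that by (intro additiveI) (simp_all add: T.ract_closed T.ract_add)
  have "left_module V T"
  proof
    fix r r' z assume r: "r \<in> carrier V" "r' \<in> carrier V" and z: "z \<in> carrier T"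
    show "(r \<oplus>\<^bsub>V\<^esub> r') \<triangleright>\<^bsub>T\<^esub> z = (r \<triangleright>\<^bsub>T\<^esub> z) \<oplus>\<^bsub>T\<^esub> (r' \<triangleright>\<^bsub>T\<^esub> z)"
      by (rule gen[OF lact additive_sum_maps[OF lact lact T.M.abelian_group_axioms] _ z]) (use r in \<open>simp_all add: act\<close>)
    show "(r \<otimes>\<^bsub>V\<^esub> r') \<triangleright>\<^bsub>T\<^esub> z = r \<triangleright>\<^bsub>T\<^esub> r' \<triangleright>\<^bsub>T\<^esub> z"
      by (rule gen[OF lact additive_compose[OF lact lact] _ z]) (use r in \<open>simp_all add: act\<close>)
  next
    fix z assume z: "z \<in> carrier T"
    show "\<one>\<^bsub>V\<^esub> \<triangleright>\<^bsub>T\<^esub> z = z"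
      by (rule gen[OF lact additive_id _ z]) (simp_all add: act)
  qed (auto simp: additive_closed[OF lact] additive_add[OF lact])
  moreover have "(v \<triangleright>\<^bsub>T\<^esub> z) \<triangleleft>\<^bsub>T\<^esub> u = v \<triangleright>\<^bsub>T\<^esub> (z \<triangleleft>\<^bsub>T\<^esub> u)" if "v \<in> carrier V" "z \<in> carrier T" "u \<in> carrier U" for v z u
    by (rule gen[OF additive_compose[OF lact ract] additive_compose[OF ract lact] _ that(2)])
      (use that(1,3) in \<open>simp_all add: act\<close>)
  ultimately show ?thesis using T by (simp add: bimod_def)
qed

lemma k_bimoduleI:
  assumes "k_algebra k T" "k_algebra k U" "bimod T U M"
    and "\<And>a m. \<lbrakk>a \<in> carrier k; m \<in> carrier M\<rbrakk> \<Longrightarrow> scal T a \<triangleright>\<^bsub>M\<^esub> m = m \<triangleleft>\<^bsub>M\<^esub> scal U a"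
  shows "k_bimodule k T U M"
  using assms by (simp add: k_bimodule_def k_bimodule_axioms_def bimod_def)

lemma regular_bimodule_simps [simp]:
  "carrier (regular_bimodule T) = carrier T" "(\<oplus>\<^bsub>regular_bimodule T\<^esub>) = (\<oplus>\<^bsub>T\<^esub>)" "\<zero>\<^bsub>regular_bimodule T\<^esub> = \<zero>\<^bsub>T\<^esub>"
  "ract (regular_bimodule T) = (\<otimes>\<^bsub>T\<^esub>)" "lact (regular_bimodule T) = (\<otimes>\<^bsub>T\<^esub>)"
  by (simp_all add: regular_bimodule_def regular_rmodule_def ring.defs rmodule.defs bimodule.defs)

lemma same_group_regular: "same_group T (regular_bimodule T)"
  by (simp add: same_group_def)

lemma regular_bimodules:
  assumes "k_algebra k T"
  shows regular_k_bimodule: "k_bimodule k T T (regular_bimodule T)"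
    and regular_bimod: "bimod T T (regular_bimodule T)"
proof -
  interpret T: k_algebra k T by fact
  have a: "abelian_group (regular_bimodule T)"
    by (rule same_group_abelian[OF same_group_regular T.abelian_group_axioms])
  interpret B: abelian_group "regular_bimodule T" by (rule a)
  have l: "left_module T (regular_bimodule T)" and r: "right_module T (regular_bimodule T)"
    by (unfold_locales; simp add: T.l_distr T.r_distr T.m_assoc)+
  show b: "bimod T T (regular_bimodule T)" unfolding bimod_def using l r by (simp add: T.m_assoc)
  show "k_bimodule k T T (regular_bimodule T)"
    by (rule k_bimoduleI[OF assms assms b]) (simp add: scal_central[OF assms])
qed

lemma F_ob_simps:
  "same_group (tens (over_enveloping R M C) M C) (F_ob R C M)"
  "t \<triangleleft>\<^bsub>F_ob R C M\<^esub> s = elift R M C (tens (over_enveloping R M C) M C) (\<lambda>m c. epure R M C m (c \<triangleleft>\<^bsub>C\<^esub> s)) t"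
  "s \<triangleright>\<^bsub>F_ob R C M\<^esub> t = elift R M C (tens (over_enveloping R M C) M C) (\<lambda>m c. epure R M C m (s \<triangleright>\<^bsub>C\<^esub> c)) t"
  by (simp_all add: F_ob_def Let_def same_group_def ring.defs rmodule.defs bimodule.defs)

lemma opmon_of_simps:
  "fob (opmon_of R S C) = F_ob R C"
  "fhom (opmon_of R S C) M M' g = elift R M C (F_ob R C M') (\<lambda>m c. epure R M' C (g m) c)"
  "op2 (opmon_of R S C) M N = elift R (bitensor R M N) C (rtensor S (F_ob R C M) (F_ob R C N))
     (\<lambda>t c. rlift R M N (rtensor S (F_ob R C M) (F_ob R C N)) (\<lambda>m n. rlift S C C (rtensor S (F_ob R C M) (F_ob R C N))
         (\<lambda>c1 c2. rpure S (F_ob R C M) (F_ob R C N) (epure R M C m c1) (epure R N C n c2))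
         (comul C c)) t)"
  "op0 (opmon_of R S C) = elift R (regular_bimodule R) C S (\<lambda>r c. counit C (r \<unrhd>\<^bsub>C\<^esub> c))"
  by (simp_all add: opmon_of_def Let_def)

section \<open>The functor F and its constraints\<close>

context coalgebroid_setting
begin

abbreviation "Fo \<equiv> F_ob R C"
abbreviation "ep M \<equiv> epure R M C"

context
  fixes M :: "'u bimodule"
  assumes M: "bimod R R M"
begin

interpretation Ml: left_module R M using M by (simp add: bimod_def)
interpretation Mr: right_module R M using M by (simp add: bimod_def)

lemma over_enveloping_D:
  assumes "((a, b), (a', b')) \<in> over_enveloping R M C"
  shows "\<exists>r r'. r \<in> carrier R \<and> r' \<in> carrier R \<and> a' \<in> carrier M \<and> b \<in> carrier C \<and> a = (r \<triangleright>\<^bsub>M\<^esub> a') \<triangleleft>\<^bsub>M\<^esub> r' \<and> b' = (r' \<unrhd>\<^bsub>C\<^esub> b) \<unlhd>\<^bsub>C\<^esub> r"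
  using assms unfolding over_enveloping_def by blast

lemma F_balanced: "balanced_tensor M C (over_enveloping R M C)"
  by (unfold_locales) (auto simp: over_enveloping_def Ml.lact_closed Mr.ract_closed)

interpretation B: balanced_tensor M C "over_enveloping R M C" by (rule F_balanced)

lemma F_group: "carrier (tens (over_enveloping R M C) M C) = carrier (Fo M)"
    "(\<oplus>\<^bsub>tens (over_enveloping R M C) M C\<^esub>) = (\<oplus>\<^bsub>Fo M\<^esub>)"
  using F_ob_simps(1)[of R M C] by (simp_all add: same_group_def)

lemma ep_closed: "\<lbrakk>m \<in> carrier M; c \<in> carrier C\<rbrakk> \<Longrightarrow> ep M m c \<in> carrier (Fo M)"
  using B.pure_closed by (simp add: F_group)

lemmas ep_add = B.pure_add_left[unfolded F_group] B.pure_add_right[unfolded F_group]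

text \<open>The defining relation with one of its two scalars equal to \<one>.\<close>

lemma ep_R:
  assumes "m \<in> carrier M" "c \<in> carrier C" "r \<in> carrier R"
  shows "ep M (m \<triangleleft>\<^bsub>M\<^esub> r) c = ep M m (r \<unrhd>\<^bsub>C\<^esub> c)" "ep M (r \<triangleright>\<^bsub>M\<^esub> m) c = ep M m (c \<unlhd>\<^bsub>C\<^esub> r)"
proof -
  have "(((\<one>\<^bsub>R\<^esub> \<triangleright>\<^bsub>M\<^esub> m) \<triangleleft>\<^bsub>M\<^esub> r, c), (m, (r \<unrhd>\<^bsub>C\<^esub> c) \<unlhd>\<^bsub>C\<^esub> \<one>\<^bsub>R\<^esub>)) \<in> over_enveloping R M C"
    "(((r \<triangleright>\<^bsub>M\<^esub> m) \<triangleleft>\<^bsub>M\<^esub> \<one>\<^bsub>R\<^esub>, c), (m, (\<one>\<^bsub>R\<^esub> \<unrhd>\<^bsub>C\<^esub> c) \<unlhd>\<^bsub>C\<^esub> r)) \<in> over_enveloping R M C"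
    unfolding over_enveloping_def using assms R.one_closed by blast+
  from this[THEN B.pure_balanced] show "ep M (m \<triangleleft>\<^bsub>M\<^esub> r) c = ep M m (r \<unrhd>\<^bsub>C\<^esub> c)" "ep M (r \<triangleright>\<^bsub>M\<^esub> m) c = ep M m (c \<unlhd>\<^bsub>C\<^esub> r)"
    using assms by (simp_all add: R_act Ml.lact_one Mr.ract_one Ml.lact_closed)
qed

lemma elift:
  assumes G: "abelian_group G" and f: "biadditive M C G f"
    and bal: "\<And>m r c. \<lbrakk>m \<in> carrier M; r \<in> carrier R; c \<in> carrier C\<rbrakk> \<Longrightarrow> f (m \<triangleleft>\<^bsub>M\<^esub> r) c = f m (r \<unrhd>\<^bsub>C\<^esub> c)"
      "\<And>m r c. \<lbrakk>m \<in> carrier M; r \<in> carrier R; c \<in> carrier C\<rbrakk> \<Longrightarrow> f (r \<triangleright>\<^bsub>M\<^esub> m) c = f m (c \<unlhd>\<^bsub>C\<^esub> r)"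
  shows elift_additive: "additive (Fo M) G (elift R M C G f)"
    and elift_pure: "\<lbrakk>m \<in> carrier M; c \<in> carrier C\<rbrakk> \<Longrightarrow> elift R M C G f (ep M m c) = f m c"
proof -
  have b: "f a c = f a' c'" if "((a, c), (a', c')) \<in> over_enveloping R M C" for a c a' c'
    using over_enveloping_D[OF that] bal Ml.lact_closed by fastforce
  show "additive (Fo M) G (elift R M C G f)"
    using B.tlift_additive[OF G f b] same_group_additive(1)[OF F_ob_simps(1)] by blast
  show "\<lbrakk>m \<in> carrier M; c \<in> carrier C\<rbrakk> \<Longrightarrow> elift R M C G f (ep M m c) = f m c"
    by (rule B.tlift_pure[OF G f b])
qed

lemma F_eq:
  assumes "additive (Fo M) G h" "additive (Fo M) G h'"
    and "\<And>m c. \<lbrakk>m \<in> carrier M; c \<in> carrier C\<rbrakk> \<Longrightarrow> h (ep M m c) = h' (ep M m c)"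
    and "z \<in> carrier (Fo M)"
  shows "h z = h' z"
  using B.tens_hom_eq[of G h h' z] assms by (simp add: F_group same_group_additive(1)[OF F_ob_simps(1)])

lemma F: shows F_right_module: "right_module S (Fo M)"
  and ep_ract: "\<lbrakk>m \<in> carrier M; c \<in> carrier C; s \<in> carrier S\<rbrakk> \<Longrightarrow> ep M m c \<triangleleft>\<^bsub>Fo M\<^esub> s = ep M m (c \<triangleleft>\<^bsub>C\<^esub> s)"
proof -
  have bal: "ep M a (b \<triangleleft>\<^bsub>C\<^esub> s) = ep M a' (b' \<triangleleft>\<^bsub>C\<^esub> s)"
    if rel: "((a, b), (a', b')) \<in> over_enveloping R M C" and s: "s \<in> carrier S" for a b a' b' s
    using over_enveloping_D[OF rel] s by (auto simp: ep_R Ml.lact_closed C.ract_lactR[symmetric] C.ract_ractR)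
  show "right_module S (Fo M)"
    by (rule right_action_module[OF F_balanced C_mod(1) F_ob_simps(1,2) bal])
  show "\<lbrakk>m \<in> carrier M; c \<in> carrier C; s \<in> carrier S\<rbrakk> \<Longrightarrow> ep M m c \<triangleleft>\<^bsub>Fo M\<^esub> s = ep M m (c \<triangleleft>\<^bsub>C\<^esub> s)"
    by (rule right_action_pure[OF F_balanced C_mod(1) F_ob_simps(1,2) bal])
qed

text \<open>The left S-action on C commutes with both R-actions, so it descends to F(M).\<close>

lemma F_lact:
  assumes s: "s \<in> carrier S"
  shows F_lact_additive: "additive (Fo M) (Fo M) (\<lambda>z. s \<triangleright>\<^bsub>Fo M\<^esub> z)"
    and ep_lact: "\<lbrakk>m \<in> carrier M; c \<in> carrier C\<rbrakk> \<Longrightarrow> s \<triangleright>\<^bsub>Fo M\<^esub> ep M m c = ep M m (s \<triangleright>\<^bsub>C\<^esub> c)"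
proof -
  have 1: "biadditive M C (Fo M) (\<lambda>m c. ep M m (s \<triangleright>\<^bsub>C\<^esub> c))"
    using s by (intro biadditiveI) (simp_all add: ep_closed ep_add C.S_part.lact_add)
  have 2: "ep M (m \<triangleleft>\<^bsub>M\<^esub> r) (s \<triangleright>\<^bsub>C\<^esub> c) = ep M m (s \<triangleright>\<^bsub>C\<^esub> (r \<unrhd>\<^bsub>C\<^esub> c))"
    "ep M (r \<triangleright>\<^bsub>M\<^esub> m) (s \<triangleright>\<^bsub>C\<^esub> c) = ep M m (s \<triangleright>\<^bsub>C\<^esub> (c \<unlhd>\<^bsub>C\<^esub> r))"
    if "m \<in> carrier M" "r \<in> carrier R" "c \<in> carrier C" for m r c
    using that s by (simp_all add: ep_R C.lact_lactR C.lact_ractR)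
  have e: "s \<triangleright>\<^bsub>Fo M\<^esub> z = elift R M C (Fo M) (\<lambda>m c. ep M m (s \<triangleright>\<^bsub>C\<^esub> c)) z" for z
    unfolding F_ob_simps(3) by (simp only: same_group_tlift[OF F_ob_simps(1)])
  note a = right_module_abelian[OF F_right_module]
  show "additive (Fo M) (Fo M) (\<lambda>z. s \<triangleright>\<^bsub>Fo M\<^esub> z)"
    unfolding e by (rule elift_additive[OF a 1, OF 2])
  show "\<lbrakk>m \<in> carrier M; c \<in> carrier C\<rbrakk> \<Longrightarrow> s \<triangleright>\<^bsub>Fo M\<^esub> ep M m c = ep M m (s \<triangleright>\<^bsub>C\<^esub> c)"
    unfolding e by (rule elift_pure[OF a 1, OF 2])
qed

lemma F_bimod: "bimod S S (Fo M)"
proof (rule bimod_generated[where G = "{ep M m c |m c. m \<in> carrier M \<and> c \<in> carrier C}"])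
  fix h h' z assume "additive (Fo M) (Fo M) h" "additive (Fo M) (Fo M) h'"
    "\<And>z. z \<in> {ep M m c |m c. m \<in> carrier M \<and> c \<in> carrier C} \<Longrightarrow> h z = h' z" "z \<in> carrier (Fo M)"
  then show "h z = h' z" by (intro F_eq[of "Fo M" h h' z]) auto
qed (auto simp: F_right_module S.ring_axioms F_lact_additive ep_lact ep_ract ep_add C.S_part.lact_add_scalar
  C.S_part.lact_mult C.S_part.lact_one C.S_part.actions_commute)

lemma F_left_module: "left_module S (Fo M)"
  using F_bimod by (simp add: bimod_def)

lemma F_lin:
  assumes G: "bimod S S G" and h: "additive (Fo M) G h"
  shows F_llin: "(\<And>m c s. \<lbrakk>m \<in> carrier M; c \<in> carrier C; s \<in> carrier S\<rbrakk> \<Longrightarrow> h (ep M m (s \<triangleright>\<^bsub>C\<^esub> c)) = s \<triangleright>\<^bsub>G\<^esub> h (ep M m c)) \<Longrightarrow> llin S (Fo M) G h"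
    and F_rlin: "(\<And>m c s. \<lbrakk>m \<in> carrier M; c \<in> carrier C; s \<in> carrier S\<rbrakk> \<Longrightarrow> h (ep M m (c \<triangleleft>\<^bsub>C\<^esub> s)) = h (ep M m c) \<triangleleft>\<^bsub>G\<^esub> s) \<Longrightarrow> rlin S (Fo M) G h"
proof -
  interpret Gl: left_module S G using G by (simp add: bimod_def)
  interpret Gr: right_module S G using G by (simp add: bimod_def)
  interpret Fr: right_module S "Fo M" by (rule F_right_module)
  have a: "additive G G (\<lambda>z. s \<triangleright>\<^bsub>G\<^esub> z)" "additive G G (\<lambda>z. z \<triangleleft>\<^bsub>G\<^esub> s)" "additive (Fo M) (Fo M) (\<lambda>z. z \<triangleleft>\<^bsub>Fo M\<^esub> s)"
    if "s \<in> carrier S" for s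
    using that by (intro additiveI; simp add: Gl.lact_closed Gl.lact_add Gr.ract_closed Gr.ract_add Fr.ract_closed Fr.ract_add)+
  show "llin S (Fo M) G h" if *: "\<And>m c s. \<lbrakk>m \<in> carrier M; c \<in> carrier C; s \<in> carrier S\<rbrakk> \<Longrightarrow> h (ep M m (s \<triangleright>\<^bsub>C\<^esub> c)) = s \<triangleright>\<^bsub>G\<^esub> h (ep M m c)"
  proof -
    have "h (s \<triangleright>\<^bsub>Fo M\<^esub> z) = s \<triangleright>\<^bsub>G\<^esub> h z" if s: "s \<in> carrier S" and z: "z \<in> carrier (Fo M)" for s z
      by (rule F_eq[OF additive_compose[OF F_lact_additive[OF s] h] additive_compose[OF h a(1)[OF s]] _ z])
        (simp add: ep_lact s *)
    then show ?thesis using h by (simp add: llin_def)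
  qed
  show "rlin S (Fo M) G h" if *: "\<And>m c s. \<lbrakk>m \<in> carrier M; c \<in> carrier C; s \<in> carrier S\<rbrakk> \<Longrightarrow> h (ep M m (c \<triangleleft>\<^bsub>C\<^esub> s)) = h (ep M m c) \<triangleleft>\<^bsub>G\<^esub> s"
  proof -
    have "h (z \<triangleleft>\<^bsub>Fo M\<^esub> s) = h z \<triangleleft>\<^bsub>G\<^esub> s" if s: "s \<in> carrier S" and z: "z \<in> carrier (Fo M)" for s z
      by (rule F_eq[OF additive_compose[OF a(3)[OF s] h] additive_compose[OF h a(2)[OF s]] _ z])
        (simp add: ep_ract s *)
    then show ?thesis using h by (simp add: rlin_def)
  qed
qed

end

abbreviation "FF \<equiv> opmon_of R S C"

lemma F_hom:
  assumes M: "bimod R R M" and M': "bimod R R M'" and g: "g \<in> bihom R R M M'"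
  shows F_hom_pure: "\<lbrakk>m \<in> carrier M; c \<in> carrier C\<rbrakk> \<Longrightarrow> fhom FF M M' g (ep M m c) = ep M' (g m) c"
    and F_hom_llin: "llin S (Fo M) (Fo M') (fhom FF M M' g)"
    and F_hom_rlin: "rlin S (Fo M) (Fo M') (fhom FF M M' g)"
proof -
  have gr: "rlin R M M' g" and gl: "\<lbrakk>r \<in> carrier R; m \<in> carrier M\<rbrakk> \<Longrightarrow> g (r \<triangleright>\<^bsub>M\<^esub> m) = r \<triangleright>\<^bsub>M'\<^esub> g m" for r m
    using g by (auto simp: bihom_def rhom_rlin)
  note gc = rlin_closed[OF gr]
  have 1: "biadditive M C (Fo M') (\<lambda>m c. ep M' (g m) c)"
    by (intro biadditiveI) (simp_all add: ep_closed[OF M'] ep_add[OF M'] gc rlin_add[OF gr])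
  have 2: "ep M' (g (m \<triangleleft>\<^bsub>M\<^esub> r)) c = ep M' (g m) (r \<unrhd>\<^bsub>C\<^esub> c)" "ep M' (g (r \<triangleright>\<^bsub>M\<^esub> m)) c = ep M' (g m) (c \<unlhd>\<^bsub>C\<^esub> r)"
    if "m \<in> carrier M" "r \<in> carrier R" "c \<in> carrier C" for m r c
    using that by (simp_all add: ep_R[OF M'] rlin_ract[OF gr] gl gc)
  note a = right_module_abelian[OF F_right_module[OF M']]
  have ad: "additive (Fo M) (Fo M') (fhom FF M M' g)"
    unfolding opmon_of_simps by (rule elift_additive[OF M a 1, OF 2])
  show p: "\<lbrakk>m \<in> carrier M; c \<in> carrier C\<rbrakk> \<Longrightarrow> fhom FF M M' g (ep M m c) = ep M' (g m) c" for m c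
    unfolding opmon_of_simps by (rule elift_pure[OF M a 1, OF 2])
  show "llin S (Fo M) (Fo M') (fhom FF M M' g)"
    by (rule F_llin[OF M F_bimod[OF M'] ad]) (simp add: p ep_lact[OF M'] gc)
  show "rlin S (Fo M) (Fo M') (fhom FF M M' g)"
    by (rule F_rlin[OF M F_bimod[OF M'] ad]) (simp add: p ep_ract[OF M'] gc)
qed

text \<open>Balancedness for the right action on R is associativity of the R-action on C; for the
  left action it is the axiom \<epsilon>(r c) = \<epsilon>(c r).\<close>

lemma op0:
  shows op0_llin: "llin S (Fo (regular_bimodule R)) (regular_bimodule S) (op0 FF)"
    and op0_pure: "\<lbrakk>r \<in> carrier R; c \<in> carrier C\<rbrakk> \<Longrightarrow> op0 FF (ep (regular_bimodule R) r c) = counit C (r \<unrhd>\<^bsub>C\<^esub> c)"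
proof -
  note Rb = regular_bimod[OF kR]
  let ?f = "\<lambda>r c. counit C (r \<unrhd>\<^bsub>C\<^esub> c)"
  have 1: "biadditive (regular_bimodule R) C S ?f"
    by (intro biadditiveI) (simp_all add: R_act additive_add[OF counit_additive])
  have 2: "?f (m \<triangleleft>\<^bsub>regular_bimodule R\<^esub> r) c = ?f m (r \<unrhd>\<^bsub>C\<^esub> c)" "?f (r \<triangleright>\<^bsub>regular_bimodule R\<^esub> m) c = ?f m (c \<unlhd>\<^bsub>C\<^esub> r)"
    if "m \<in> carrier (regular_bimodule R)" "r \<in> carrier R" "c \<in> carrier C" for m r c
    using that by (simp_all add: R_act C.counit_R)
  have ad: "additive (Fo (regular_bimodule R)) (regular_bimodule S) (op0 FF)"
    unfolding opmon_of_simps same_group_additive(2)[OF same_group_regular, symmetric]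
    by (rule elift_additive[OF Rb S.abelian_group_axioms 1, OF 2])
  show p: "\<lbrakk>r \<in> carrier R; c \<in> carrier C\<rbrakk> \<Longrightarrow> op0 FF (ep (regular_bimodule R) r c) = ?f r c" for r c
    unfolding opmon_of_simps using elift_pure[OF Rb S.abelian_group_axioms 1, OF 2, of r c] by simp
  show "llin S (Fo (regular_bimodule R)) (regular_bimodule S) (op0 FF)"
    by (rule F_llin[OF Rb regular_bimod[OF kS] ad]) (simp add: p C.lact_lactR[symmetric] counit_act)
qed

text \<open>Each balancing condition uses one part of \<open>comul_R\<close>: the first for the
  right action on n, the second for the left action on m, the third for the tensor product of M and
  N over R.\<close>

lemma op2:
  assumes M: "bimod R R M" and N: "bimod R R N"
  defines "T \<equiv> rtensor S (Fo M) (Fo N)"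
  shows op2_llin: "llin S (Fo (bitensor R M N)) (bitensor S (Fo M) (Fo N)) (op2 FF M N)"
    and op2_pure: "\<lbrakk>m \<in> carrier M; n \<in> carrier N; c \<in> carrier C\<rbrakk>
      \<Longrightarrow> op2 FF M N (ep (bitensor R M N) (rpure R M N m n) c)
        = rlift S C C T (\<lambda>c1 c2. rpure S (Fo M) (Fo N) (ep M m c1) (ep N n c2)) (comul C c)"
proof -
  interpret Ml: left_module R M using M by (simp add: bimod_def)
  interpret Mr: right_module R M using M by (simp add: bimod_def)
  interpret Nl: left_module R N using N by (simp add: bimod_def)
  interpret Nr: right_module R N using N by (simp add: bimod_def)
  note MN = bt_bimod[OF M N] and rm = Mr.right_module_axioms Nl.left_module_axioms
  note FM = F_right_module[OF M] and FN = F_left_module[OF N] and FMb = F_bimod[OF M] and FNb = F_bimod[OF N]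
  have T: "abelian_group T" unfolding T_def by (rule rt_abelian[OF FM FN])
  let ?b = "\<lambda>m n c1 c2. rpure S (Fo M) (Fo N) (ep M m c1) (ep N n c2)"
  let ?g = "\<lambda>m n. rlift S C C T (?b m n)"
  note epa = ep_closed[OF M] ep_closed[OF N] ep_add[OF M] ep_add[OF N] rpure_closed[OF FM FN] rpure_add[OF FM FN]
  have bal: "CC_balanced T (?b m n)" if "m \<in> carrier M" "n \<in> carrier N" for m n
    unfolding CC_balanced_def T_def using that
    by (intro conjI biadditiveI ballI) (simp_all add: epa ep_ract[OF M, symmetric] ep_lact[OF N, symmetric] rpure_balanced[OF FM FN])
  have g: "additive (rtensor S C C) T (?g m n)" if "m \<in> carrier M" "n \<in> carrier N" for m n
    by (rule CC_balanced_additive[OF T bal[OF that]])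
  have gp: "?g m n (pu C c c') = ?b m n c c'" if "m \<in> carrier M" "n \<in> carrier N" "c \<in> carrier C" "c' \<in> carrier C" for m n c c'
    by (rule CC_balanced_pure[OF T bal[OF that(1,2)] that(3,4)])
  have g_m: "?g (m \<oplus>\<^bsub>M\<^esub> m') n t = ?g m n t \<oplus>\<^bsub>T\<^esub> ?g m' n t"
    if "m \<in> carrier M" "m' \<in> carrier M" "n \<in> carrier N" "t \<in> carrier (rtensor S C C)" for m m' n t
    by (rule CC_balanced_add[OF T bal bal bal]) (use that in \<open>simp_all add: epa T_def\<close>)
  have g_n: "?g m (n \<oplus>\<^bsub>N\<^esub> n') t = ?g m n t \<oplus>\<^bsub>T\<^esub> ?g m n' t"
    if "m \<in> carrier M" "n \<in> carrier N" "n' \<in> carrier N" "t \<in> carrier (rtensor S C C)" for m n n' t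
    by (rule CC_balanced_add[OF T bal bal bal]) (use that in \<open>simp_all add: epa T_def\<close>)
  let ?d = "comul C"
  \<comment> \<open>This is claimed at \<delta>(c) and not on all of C \<otimes> C: it comes from
    the axiom r c_(1) \<otimes> c_(2) = c_(1) \<otimes> c_(2) r.\<close>
  have g_bal: "?g (m \<triangleleft>\<^bsub>M\<^esub> r) n (?d c) = ?g m (r \<triangleright>\<^bsub>N\<^esub> n) (?d c)"
    if m: "m \<in> carrier M" and r: "r \<in> carrier R" and n: "n \<in> carrier N" and c: "c \<in> carrier C" for m r n c
  proof -
    have mr: "m \<triangleleft>\<^bsub>M\<^esub> r \<in> carrier M" and rn: "r \<triangleright>\<^bsub>N\<^esub> n \<in> carrier N"
      using m n r by (simp_all add: Mr.ract_closed Nl.lact_closed)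
    have "?g (m \<triangleleft>\<^bsub>M\<^esub> r) n (?d c) = ?g m n (mapC C C (lactR C r) (?d c))"
      by (rule CC_balanced_map[OF T bal[OF mr n] bal[OF m n] rlin_additive[OF mapC_rlin[OF C_mod(1) C_mod(1) lactR_lin(2)[OF r]]] _ comul_closed[OF c]])
        (simp add: mapC_pure[OF C_mod(1) C_mod(1) lactR_lin(2)[OF r]] gp m n r ep_R[OF M])
    moreover have "?g m (r \<triangleright>\<^bsub>N\<^esub> n) (?d c) = ?g m n (mapR C (\<lambda>c. c \<unlhd>\<^bsub>C\<^esub> r) (?d c))"
      by (rule CC_balanced_map[OF T bal[OF m rn] bal[OF m n] mapR_additive[OF C_mod(1) ractR_lin(1)[OF r]] _ comul_closed[OF c]])
        (simp add: mapR_pure[OF C_mod(1) ractR_lin(1)[OF r]] gp m n r ep_R[OF N])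
    ultimately show ?thesis by (simp only: comul_R(3)[OF r c])
  qed
  let ?l = "\<lambda>u c. rlift R M N T (\<lambda>m n. ?g m n (?d c)) u"
  have l1: "biadditive M N T (\<lambda>m n. ?g m n (?d c))" if "c \<in> carrier C" for c
    using that by (intro biadditiveI) (simp_all add: additive_closed[OF g] g_m g_n)
  have l: "additive (rtensor R M N) T (\<lambda>u. ?l u c)" if c: "c \<in> carrier C" for c
    by (rule rlift_additive[OF rm T l1[OF c] g_bal[OF _ _ _ c]])
  have lp: "?l (rpure R M N m n) c = ?g m n (?d c)" if c: "c \<in> carrier C" and "m \<in> carrier M" "n \<in> carrier N" for m n c
    by (rule rlift_pure[OF rm T l1[OF c] g_bal[OF _ _ _ c] that(2,3)])
  have f1: "biadditive (bitensor R M N) C T ?l"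
  proof (intro biadditiveI; (unfold bitensor_simps)?)
    fix u c c' assume u: "u \<in> carrier (rtensor R M N)" and c: "c \<in> carrier C" "c' \<in> carrier C"
    have cc: "c \<oplus>\<^bsub>C\<^esub> c' \<in> carrier C" using c C.S_part.M.a_closed by simp
    show "?l u (c \<oplus>\<^bsub>C\<^esub> c') = ?l u c \<oplus>\<^bsub>T\<^esub> ?l u c'"
    proof (rule rt_hom_eq[OF rm l[OF cc] additive_sum_maps[OF l[OF c(1)] l[OF c(2)] T] _ u])
      fix m n assume m: "m \<in> carrier M" and n: "n \<in> carrier N"
      have "?g m n (?d (c \<oplus>\<^bsub>C\<^esub> c')) = ?g m n (?d c) \<oplus>\<^bsub>T\<^esub> ?g m n (?d c')"
        using c by (simp add: additive_add[OF comul_additive] additive_add[OF g[OF m n]])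
      then show "?l (rpure R M N m n) (c \<oplus>\<^bsub>C\<^esub> c') = ?l (rpure R M N m n) c \<oplus>\<^bsub>T\<^esub> ?l (rpure R M N m n) c'"
        by (simp only: lp[OF cc m n] lp[OF c(1) m n] lp[OF c(2) m n])
    qed
  qed (simp_all add: additive_closed[OF l] additive_add[OF l])
  interpret MNr: right_module R "rtensor R M N" by (rule rt_right_module[OF rm N])
  have f2: "?l (u \<triangleleft>\<^bsub>bitensor R M N\<^esub> r) c = ?l u (r \<unrhd>\<^bsub>C\<^esub> c)"
    if u: "u \<in> carrier (bitensor R M N)" and r: "r \<in> carrier R" and c: "c \<in> carrier C" for u r c
  proof -
    have u': "u \<in> carrier (rtensor R M N)" and rc: "r \<unrhd>\<^bsub>C\<^esub> c \<in> carrier C" using u c r by simp_all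
    show ?thesis unfolding bitensor_simps
    proof (rule rt_hom_eq[OF rm additive_compose[OF rt_ract_additive[OF rm N r] l[OF c]] l[OF rc] _ u'])
      fix m n assume m: "m \<in> carrier M" and n: "n \<in> carrier N"
      have nr: "n \<triangleleft>\<^bsub>N\<^esub> r \<in> carrier N" using n r by (simp add: Nr.ract_closed)
      have "?g m (n \<triangleleft>\<^bsub>N\<^esub> r) (?d c) = ?g m n (mapR C (lactR C r) (?d c))"
        by (rule CC_balanced_map[OF T bal[OF m nr] bal[OF m n] mapR_additive[OF C_mod(1) lactR_lin(1)[OF r]] _ comul_closed[OF c]])
          (simp add: mapR_pure[OF C_mod(1) lactR_lin(1)[OF r]] gp m n r ep_R[OF N])
      then show "?l (rpure R M N m n \<triangleleft>\<^bsub>rtensor R M N\<^esub> r) c = ?l (rpure R M N m n) (r \<unrhd>\<^bsub>C\<^esub> c)"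
        unfolding rt_ract_pure[OF rm N r m n] lp[OF c m nr] lp[OF rc m n] unfolding comul_R(1)[OF r c] .
    qed
  qed
  have f3: "?l (r \<triangleright>\<^bsub>bitensor R M N\<^esub> u) c = ?l u (c \<unlhd>\<^bsub>C\<^esub> r)"
    if u: "u \<in> carrier (bitensor R M N)" and r: "r \<in> carrier R" and c: "c \<in> carrier C" for u r c
  proof -
    have u': "u \<in> carrier (rtensor R M N)" and cr: "c \<unlhd>\<^bsub>C\<^esub> r \<in> carrier C" using u c r by simp_all
    show ?thesis
    proof (rule rt_hom_eq[OF rm additive_compose[OF bt_lact_additive[OF M N r] l[OF c]] l[OF cr] _ u'])
      fix m n assume m: "m \<in> carrier M" and n: "n \<in> carrier N"
      have rm': "r \<triangleright>\<^bsub>M\<^esub> m \<in> carrier M" using m r by (simp add: Ml.lact_closed)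
      have "?g (r \<triangleright>\<^bsub>M\<^esub> m) n (?d c) = ?g m n (mapC C C (\<lambda>c. c \<unlhd>\<^bsub>C\<^esub> r) (?d c))"
        by (rule CC_balanced_map[OF T bal[OF rm' n] bal[OF m n] rlin_additive[OF mapC_rlin[OF C_mod(1) C_mod(1) ractR_lin(2)[OF r]]] _ comul_closed[OF c]])
          (simp add: mapC_pure[OF C_mod(1) C_mod(1) ractR_lin(2)[OF r]] gp m n r ep_R[OF M])
      then show "?l (r \<triangleright>\<^bsub>bitensor R M N\<^esub> rpure R M N m n) c = ?l (rpure R M N m n) (c \<unlhd>\<^bsub>C\<^esub> r)"
        unfolding bt_lact_pure[OF M N r m n] lp[OF c rm' n] lp[OF cr m n] unfolding comul_R(2)[OF r c] .
    qed
  qed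
  have ad: "additive (Fo (bitensor R M N)) T (op2 FF M N)"
    unfolding opmon_of_simps T_def[symmetric] by (rule elift_additive[where f = ?l, OF MN T f1 f2 f3])
  have p: "op2 FF M N (ep (bitensor R M N) u c) = ?l u c" if "u \<in> carrier (rtensor R M N)" "c \<in> carrier C" for u c
    unfolding opmon_of_simps T_def[symmetric] using elift_pure[where f = ?l, OF MN T f1 f2 f3, of u c] that by simp
  show "op2 FF M N (ep (bitensor R M N) (rpure R M N m n) c) = ?g m n (?d c)"
    if "m \<in> carrier M" "n \<in> carrier N" "c \<in> carrier C" for m n c
    unfolding p[OF rpure_closed[OF rm that(1,2)] that(3)] by (rule lp[OF that(3,1,2)])
  have "?l u (s \<triangleright>\<^bsub>C\<^esub> c) = s \<triangleright>\<^bsub>bitensor S (Fo M) (Fo N)\<^esub> ?l u c"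
    if u: "u \<in> carrier (rtensor R M N)" and c: "c \<in> carrier C" and s: "s \<in> carrier S" for u c s
  proof -
    have sc: "s \<triangleright>\<^bsub>C\<^esub> c \<in> carrier C" using s c by simp
    have sT: "additive T T (\<lambda>z. s \<triangleright>\<^bsub>bitensor S (Fo M) (Fo N)\<^esub> z)"
      unfolding T_def by (rule bt_lact_additive[OF FMb FNb s])
    have cs: "?d (s \<triangleright>\<^bsub>C\<^esub> c) = s \<triangleright>\<^bsub>bitensor S C C\<^esub> ?d c" using comul_lin(1) s c by (simp add: llin_def)
    show ?thesis
    proof (rule rt_hom_eq[OF rm l[OF sc] additive_compose[OF l[OF c] sT] _ u])
      fix m n assume m: "m \<in> carrier M" and n: "n \<in> carrier N"
      have "?g m n (s \<triangleright>\<^bsub>bitensor S C C\<^esub> ?d c) = s \<triangleright>\<^bsub>bitensor S (Fo M) (Fo N)\<^esub> ?g m n (?d c)"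
        by (rule NC_eq[OF C_mod(1) additive_compose[OF bt_lact_additive[OF C_bimod C_bimod s] g[OF m n]] additive_compose[OF g[OF m n] sT] _ comul_closed[OF c]])
          (simp add: bt_lact_pure[OF C_bimod C_bimod s] gp[OF m n] s bt_lact_pure[OF FMb FNb s] ep_closed[OF M m] ep_closed[OF N n] ep_lact[OF M s m])
      then show "?l (rpure R M N m n) (s \<triangleright>\<^bsub>C\<^esub> c) = s \<triangleright>\<^bsub>bitensor S (Fo M) (Fo N)\<^esub> ?l (rpure R M N m n) c"
        unfolding lp[OF sc m n] lp[OF c m n] unfolding cs .
    qed
  qed
  then show "llin S (Fo (bitensor R M N)) (bitensor S (Fo M) (Fo N)) (op2 FF M N)"
    by (intro F_llin[OF MN bt_bimod[OF FMb FNb]]) (use ad in \<open>simp_all add: p T_def\<close>)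
qed

section \<open>Central bimodules and the free one on a generator\<close>

lemma bitensor_k_bimodule:
  assumes M: "k_bimodule k R R M" and N: "k_bimodule k R R N"
  shows "k_bimodule k R R (bitensor R M N)"
proof (rule k_bimoduleI[OF kR kR])
  interpret M: k_bimodule k R R M by (rule M)
  interpret N: k_bimodule k R R N by (rule N)
  note b = k_bimodule_bimod[OF M] k_bimodule_bimod[OF N]
  note rm = M.right_module_axioms N.left_module_axioms
  show "bimod R R (bitensor R M N)" by (rule bt_bimod[OF b])
  fix q z assume q: "q \<in> carrier k" and "z \<in> carrier (bitensor R M N)"
  then have z: "z \<in> carrier (rtensor R M N)" by simp
  note s = scal_closed[OF kR q]
  show "scal R q \<triangleright>\<^bsub>bitensor R M N\<^esub> z = z \<triangleleft>\<^bsub>bitensor R M N\<^esub> scal R q"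
    unfolding bitensor_simps
    by (rule rt_hom_eq[OF rm bt_lact_additive[OF b s] rt_ract_additive[OF rm b(2) s] _ z])
      (use s q in \<open>simp add: bt_lact_pure[OF b s] rt_ract_pure[OF rm b(2) s] M.k_central rpure_balanced[OF rm] N.k_central\<close>)
qed

text \<open>R \<otimes> R over k with the outer actions: the free k-central R-bimodule on 1
  \<otimes> 1. The right action is the one of \<open>odot\<close>.\<close>

definition free_bimodule :: "'u bimodule" where
  "free_bimodule = rmodule.extend (odot k R Reg Reg)
     (bimodule.fields (\<lambda>r t. klift k R R Reg Reg (ktens k R R Reg Reg) (\<lambda>a b. kp Reg Reg (r \<otimes>\<^bsub>R\<^esub> a) b) t))"

lemma free_bimodule_simps [simp]:
  "carrier free_bimodule = carrier (ktens k R R Reg Reg)" "(\<oplus>\<^bsub>free_bimodule\<^esub>) = (\<oplus>\<^bsub>ktens k R R Reg Reg\<^esub>)"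
  "\<zero>\<^bsub>free_bimodule\<^esub> = \<zero>\<^bsub>ktens k R R Reg Reg\<^esub>" "ract free_bimodule = ract (odot k R Reg Reg)"
  by (simp_all add: free_bimodule_def rmodule.defs)

lemma same_group_free_bimodule: "same_group free_bimodule (ktens k R R Reg Reg)"
  by (simp add: same_group_def)

lemmas free_kt = kt_eq[OF kR kR Reg Reg] kt_abelian[OF kR kR Reg Reg]
lemmas free_kp = kpure_closed[OF kR kR Reg Reg] kpure_add[OF kR kR Reg Reg]

lemma free_ract: "\<lbrakk>a \<in> carrier R; b \<in> carrier R; r \<in> carrier R\<rbrakk> \<Longrightarrow> kp Reg Reg a b \<triangleleft>\<^bsub>free_bimodule\<^esub> r = kp Reg Reg a (b \<otimes>\<^bsub>R\<^esub> r)"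
  using odot_ract[OF Reg Reg] by simp

lemma free_lact:
  assumes r: "r \<in> carrier R"
  shows free_lact_additive: "additive (ktens k R R Reg Reg) (ktens k R R Reg Reg) (\<lambda>z. r \<triangleright>\<^bsub>free_bimodule\<^esub> z)"
    and free_lact_pure: "\<lbrakk>a \<in> carrier R; b \<in> carrier R\<rbrakk> \<Longrightarrow> r \<triangleright>\<^bsub>free_bimodule\<^esub> kp Reg Reg a b = kp Reg Reg (r \<otimes>\<^bsub>R\<^esub> a) b"
proof -
  have e: "r \<triangleright>\<^bsub>free_bimodule\<^esub> t = klift k R R Reg Reg (ktens k R R Reg Reg) (\<lambda>a b. kp Reg Reg (r \<otimes>\<^bsub>R\<^esub> a) b) t" for t
    by (simp add: free_bimodule_def rmodule.defs bimodule.defs)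
  have 1: "biadditive Reg Reg (ktens k R R Reg Reg) (\<lambda>a b. kp Reg Reg (r \<otimes>\<^bsub>R\<^esub> a) b)"
    using r free_kp by (intro biadditiveI) (simp_all add: R.r_distr)
  have 2: "kp Reg Reg (r \<otimes>\<^bsub>R\<^esub> (a \<triangleleft>\<^bsub>Reg\<^esub> scal R q)) b = kp Reg Reg (r \<otimes>\<^bsub>R\<^esub> a) (b \<triangleleft>\<^bsub>Reg\<^esub> scal R q)"
    if "a \<in> carrier Reg" "q \<in> carrier k" "b \<in> carrier Reg" for a q b
    using kpure_bal[OF kR kR Reg Reg, of "r \<otimes>\<^bsub>R\<^esub> a" q b] that r scal_closed[OF kR] by (simp add: R.m_assoc)
  show "additive (ktens k R R Reg Reg) (ktens k R R Reg Reg) (\<lambda>z. r \<triangleright>\<^bsub>free_bimodule\<^esub> z)"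
    unfolding e by (rule klift_additive[OF kR kR Reg Reg free_kt(2) 1 2])
  show "\<lbrakk>a \<in> carrier R; b \<in> carrier R\<rbrakk> \<Longrightarrow> r \<triangleright>\<^bsub>free_bimodule\<^esub> kp Reg Reg a b = kp Reg Reg (r \<otimes>\<^bsub>R\<^esub> a) b"
    unfolding e by (rule klift_pure[OF kR kR Reg Reg free_kt(2) 1 2]) simp_all
qed

lemma additive_free_bimodule:
  "additive free_bimodule G f = additive (ktens k R R Reg Reg) G f"
  "additive G' free_bimodule f' = additive G' (ktens k R R Reg Reg) f'"
  using same_group_additive[OF same_group_free_bimodule] by metis+

lemma free_bimodule:
  shows free_bimod: "bimod R R free_bimodule" and free_k_bimodule: "k_bimodule k R R free_bimodule"
proof -
  interpret O: right_module R "odot k R Reg Reg" by (rule odot_module[OF Reg Reg])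
  have ab: "abelian_group free_bimodule"
    by (rule same_group_abelian[OF _ O.M.abelian_group_axioms]) (simp add: same_group_def)
  interpret M0: abelian_group free_bimodule by (rule ab)
  have r: "right_module R free_bimodule"
    by unfold_locales (use O.ract_closed O.ract_add O.ract_add_scalar O.ract_mult O.ract_one in simp_all)
  show b: "bimod R R free_bimodule"
  proof (rule bimod_generated[where G = "{kp Reg Reg a b |a b. a \<in> carrier R \<and> b \<in> carrier R}", OF R.ring_axioms r])
    fix h h' z assume "additive free_bimodule free_bimodule h" "additive free_bimodule free_bimodule h'"
      "\<And>z. z \<in> {kp Reg Reg a b |a b. a \<in> carrier R \<and> b \<in> carrier R} \<Longrightarrow> h z = h' z" "z \<in> carrier free_bimodule"
    then show "h z = h' z" by (intro free_kt(1)[of "ktens k R R Reg Reg" h h' z]) (auto simp: additive_free_bimodule)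
  next
    fix v u z assume "v \<in> carrier R" "u \<in> carrier R" "z \<in> {kp Reg Reg a b |a b. a \<in> carrier R \<and> b \<in> carrier R}"
    then show "(v \<triangleright>\<^bsub>free_bimodule\<^esub> z) \<triangleleft>\<^bsub>free_bimodule\<^esub> u = v \<triangleright>\<^bsub>free_bimodule\<^esub> (z \<triangleleft>\<^bsub>free_bimodule\<^esub> u)"
      by (auto simp: free_ract free_lact_pure simp del: free_bimodule_simps)
  qed (use free_kp in \<open>auto simp: free_lact_additive additive_free_bimodule free_lact_pure R.l_distr R.m_assoc\<close>)
  show "k_bimodule k R R free_bimodule"
  proof (rule k_bimoduleI[OF kR kR b])
    fix q z assume q: "q \<in> carrier k" and z: "z \<in> carrier free_bimodule"
    note s = scal_closed[OF kR q]
    have a: "additive (ktens k R R Reg Reg) (ktens k R R Reg Reg) (\<lambda>z. z \<triangleleft>\<^bsub>free_bimodule\<^esub> scal R q)"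
      using right_module.ract_closed[OF r] right_module.ract_add[OF r] s by (intro additiveI) simp_all
    have p: "scal R q \<triangleright>\<^bsub>free_bimodule\<^esub> kp Reg Reg a b = kp Reg Reg a b \<triangleleft>\<^bsub>free_bimodule\<^esub> scal R q"
      if "a \<in> carrier Reg" "b \<in> carrier Reg" for a b
      using kpure_bal[OF kR kR Reg Reg, of a q b] that s q
      by (simp add: free_ract free_lact_pure scal_central[OF kR] del: free_bimodule_simps)
    show "scal R q \<triangleright>\<^bsub>free_bimodule\<^esub> z = z \<triangleleft>\<^bsub>free_bimodule\<^esub> scal R q"
      by (rule free_kt(1)[OF free_lact_additive[OF s] a p]) (use z in simp_all)
  qed
qed

end

lemma Bimod_simps [simp]: "Obj (Bimod k T U) = {M. k_bimodule k T U M}"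
  by (simp add: Bimod_def)

context universe
begin

text \<open>Besides supplying the unitor on both sides, its inverse makes it possible to restate the
  unit axiom of opmonoidal comodules along the unitor itself.\<close>

lemma runit:
  fixes T :: "('k, 'u) module" and X :: "('u, 'x) rmodule_scheme"
  assumes T: "k_algebra k T" and X: "right_module T X"
  shows runit_hom: "runit T X \<in> rhom T (rtensor T X (regular_bimodule T)) X"
    and runit_pure: "\<lbrakk>x \<in> carrier X; t \<in> carrier T\<rbrakk> \<Longrightarrow> runit T X (rpure T X (regular_bimodule T) x t) = x \<triangleleft>\<^bsub>X\<^esub> t"
    and runit_inv_hom: "runit_inv T X \<in> rhom T X (rtensor T X (regular_bimodule T))"
    and runit_runit_inv: "x \<in> carrier X \<Longrightarrow> runit T X (runit_inv T X x) = x"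
    and runit_inv_runit: "z \<in> carrier (rtensor T X (regular_bimodule T)) \<Longrightarrow> runit_inv T X (runit T X z) = z"
proof -
  interpret X: right_module T X by (rule X)
  note Tb = regular_bimod[OF T]
  then have Tl: "left_module T (regular_bimodule T)" by (simp add: bimod_def)
  note rt = rpure_closed[OF X Tl] rpure_add[OF X Tl] rpure_balanced[OF X Tl]
  let ?P = "rtensor T X (regular_bimodule T)"
  have 1: "biadditive X (regular_bimodule T) X (\<lambda>x r. x \<triangleleft>\<^bsub>X\<^esub> r)"
    by (intro biadditiveI) (simp_all add: X.ract_closed X.ract_add X.ract_add_scalar)
  note l = rlift[where f = "\<lambda>x r. x \<triangleleft>\<^bsub>X\<^esub> r", OF X Tl X.M.abelian_group_axioms 1, folded runit_def]
  have e: "runit T X \<in> extensional (carrier ?P)" and a: "additive ?P X (runit T X)"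
    by (rule l; simp add: X.ract_mult)+
  show p: "\<lbrakk>x \<in> carrier X; t \<in> carrier T\<rbrakk> \<Longrightarrow> runit T X (rpure T X (regular_bimodule T) x t) = x \<triangleleft>\<^bsub>X\<^esub> t" for x t
    using l(3)[of x t] by (simp add: X.ract_mult)
  have r: "rlin T ?P X (runit T X)"
    by (rule rt_rlin[OF X Tl Tb X a]) (simp add: p X.ract_mult)
  then show "runit T X \<in> rhom T ?P X" using e by (simp add: rhom_iff)
  have ia: "additive X ?P (\<lambda>x. rpure T X (regular_bimodule T) x \<one>\<^bsub>T\<^esub>)"
    by (intro additiveI) (simp_all add: rt)
  have "rlin T X ?P (\<lambda>x. rpure T X (regular_bimodule T) x \<one>\<^bsub>T\<^esub>)"
    by (rule rlinI[OF ia]) (simp add: rt rt_ract_pure[OF X Tl Tb])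
  then show ih: "runit_inv T X \<in> rhom T X ?P"
    unfolding runit_inv_def by (rule rlin_restrict[OF X])
  show "x \<in> carrier X \<Longrightarrow> runit T X (runit_inv T X x) = x" for x
    by (simp add: runit_inv_def p X.ract_one)
  show "z \<in> carrier ?P \<Longrightarrow> runit_inv T X (runit T X z) = z" for z
    by (rule rt_hom_eq[OF X Tl additive_compose[OF a rlin_additive[OF rhom_rlin[OF ih]]] additive_id])
      (simp_all add: p runit_inv_def X.ract_closed rt)
qed

end

section \<open>The instance for opmonoidal comodules\<close>

context coalgebroid_setting
begin

lemma ep_lin:
  assumes M: "bimod R R M" and m: "m \<in> carrier M"
  shows ep_llin: "llin S C (Fo M) (ep M m)" and ep_rlin: "rlin S C (Fo M) (ep M m)"
  using m by (auto simp: llin_def rlin_def ep_closed[OF M] ep_add[OF M] ep_lact[OF M] ep_ract[OF M] intro!: additiveI)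

text \<open>Both sides are additive in the element of C \<otimes> C at which they are formed, so
  they are compared at a general tensor t, by way of pure ones, before t becomes
  \<delta>(c).\<close>

lemma sharp_op2:
  assumes N: "right_module S N" and M: "bimod R R M" and M': "bimod R R M'"
    and n: "n \<in> carrier N" and m: "m \<in> carrier M" and m': "m' \<in> carrier M'" and c: "c \<in> carrier C"
  shows "rassoc S N (Fo M) (Fo M') (rpure S N (bitensor S (Fo M) (Fo M')) n
      (op2 FF M M' (ep (bitensor R M M') (rpure R M M' m m') c)))
    = rlift S C C (rtensor S (rtensor S N (Fo M)) (Fo M'))
        (\<lambda>c1 c2. rpure S (rtensor S N (Fo M)) (Fo M') (rpure S N (Fo M) n (ep M m c1)) (ep M' m' c2)) (comul C c)"
proof -
  note F1 = F_right_module[OF M] F_left_module[OF M] F_bimod[OF M]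
  note F2 = F_right_module[OF M'] F_left_module[OF M'] F_bimod[OF M']
  note NF = rt_right_module[OF N F1(2,3)]
  note b = bt_bimod[OF F1(3) F2(3)]
  then have bl: "left_module S (bitensor S (Fo M) (Fo M'))" by (simp add: bimod_def)
  let ?p = "\<lambda>c1. rpure S N (Fo M) n (ep M m c1)"
  have p: "rlin S C (rtensor S N (Fo M)) ?p"
    using n m by (auto simp: rlin_def rpure_closed[OF N F1(2)] rpure_add[OF N F1(2)] ep_closed[OF M] ep_add[OF M]
        rt_ract_pure[OF N F1(2,3)] ep_ract[OF M] intro!: additiveI)
  note ri = rtensor_map_additive[OF C_mod(1,2) F1(1) F2(2) ep_rlin[OF M m] ep_llin[OF M' m']]
    rtensor_map_pure[OF C_mod(1,2) F1(1) F2(2) ep_rlin[OF M m] ep_llin[OF M' m']]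
  note ro = rtensor_map_additive[OF C_mod(1,2) NF F2(2) p ep_llin[OF M' m']]
    rtensor_map_pure[OF C_mod(1,2) NF F2(2) p ep_llin[OF M' m']]
  have pn: "additive (rtensor S (Fo M) (Fo M')) (rtensor S N (bitensor S (Fo M) (Fo M'))) (rpure S N (bitensor S (Fo M) (Fo M')) n)"
    using rpure_biadditive[OF N bl] n by (simp add: biadditive_def)
  have "rassoc S N (Fo M) (Fo M') (rpure S N (bitensor S (Fo M) (Fo M')) n (rtensor_map S C C (Fo M) (Fo M') (ep M m) (ep M' m') t))
    = rtensor_map S C C (rtensor S N (Fo M)) (Fo M') ?p (ep M' m') t" if t: "t \<in> carrier (rtensor S C C)" for t
    by (rule NC_eq[OF C_mod(1) additive_compose[OF additive_compose[OF ri(1) pn] rlin_additive[OF rassoc_rlin[OF N F1(3) F2(3)]]] ro(1) _ t])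
      (simp add: ri(2) ro(2) rassoc_pure[OF N F1(3) F2(3)] n ep_closed[OF M m] ep_closed[OF M' m'])
  from this[OF comul_closed[OF c]] show ?thesis
    unfolding op2_pure[OF M M' m m' c] by (simp only: rtensor_map_def)
qed

abbreviation (input) "uu \<equiv> kp Reg Reg \<one>\<^bsub>R\<^esub> \<one>\<^bsub>R\<^esub>"

text \<open>The map a \<otimes> b -> a m b is balanced over k because M is k-central.\<close>

lemma free_bimodule_free:
  assumes M: "k_bimodule k R R M" and m: "m \<in> carrier M"
  shows "\<exists>g \<in> bihom R R free_bimodule M. g uu = m"
proof -
  interpret M: k_bimodule k R R M by (rule M)
  let ?f = "\<lambda>a b. (a \<triangleright>\<^bsub>M\<^esub> m) \<triangleleft>\<^bsub>M\<^esub> b"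
  let ?g = "klift k R R Reg Reg M ?f"
  have 1: "biadditive Reg Reg M ?f"
    using m by (intro biadditiveI) (simp_all add: M.ract_closed M.lact_closed M.ract_add M.ract_add_scalar M.lact_add_scalar)
  have 2: "?f (a \<triangleleft>\<^bsub>Reg\<^esub> scal R q) b = ?f a (b \<triangleleft>\<^bsub>Reg\<^esub> scal R q)"
    if "a \<in> carrier Reg" "q \<in> carrier k" "b \<in> carrier Reg" for a q b
  proof -
    note s = scal_closed[OF kR that(2)]
    have "?f (a \<otimes>\<^bsub>R\<^esub> scal R q) b = ((a \<triangleright>\<^bsub>M\<^esub> m) \<triangleleft>\<^bsub>M\<^esub> scal R q) \<triangleleft>\<^bsub>M\<^esub> b"
      using that s m by (simp add: M.lact_mult M.k_central M.actions_commute)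
    also have "\<dots> = ?f a (b \<otimes>\<^bsub>R\<^esub> scal R q)"
      using that s m by (simp add: M.ract_mult[symmetric] M.lact_closed scal_central[OF kR])
    finally show ?thesis by simp
  qed
  note l = klift[OF kR kR Reg Reg M.M.abelian_group_axioms 1 2]
  have e: "?g \<in> extensional (carrier free_bimodule)" using l(1) by simp
  have a: "additive (ktens k R R Reg Reg) M ?g" using l(2) by simp
  have p: "?g (kp Reg Reg a b) = ?f a b" if "a \<in> carrier R" "b \<in> carrier R" for a b using l(3)[of a b] that by simp
  have "rlin R (odot k R Reg Reg) M ?g"
    by (rule odot_rlin[OF Reg Reg M.right_module_axioms a]) (use m in \<open>simp add: p M.ract_mult M.lact_closed\<close>)
  then have r: "rlin R free_bimodule M ?g" by (simp add: rlin_def additive_free_bimodule)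
  have "additive M M (\<lambda>z. r \<triangleright>\<^bsub>M\<^esub> z)" if "r \<in> carrier R" for r
    using that by (intro additiveI) (simp_all add: M.lact_closed M.lact_add)
  then have "?g (r \<triangleright>\<^bsub>free_bimodule\<^esub> z) = r \<triangleright>\<^bsub>M\<^esub> ?g z" if "r \<in> carrier R" "z \<in> carrier (ktens k R R Reg Reg)" for r z
    by (intro free_kt(1)[OF additive_compose[OF free_lact_additive[OF that(1)] a] additive_compose[OF a] _ that(2)])
      (use that(1) m in \<open>simp_all add: free_lact_pure p M.lact_mult M.actions_commute M.lact_closed M.ract_closed\<close>)
  then have "?g \<in> bihom R R free_bimodule M" using e r by (simp add: bihom_def rhom_iff)
  moreover have "?g uu = m" using m by (simp add: p M.lact_one M.ract_one)
  ultimately show ?thesis by blast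
qed

text \<open>In F the element (a \<otimes> b) \<otimes> c equals (1 \<otimes> 1) \<otimes> b c a, and
  elements of the latter form are closed under addition.\<close>

lemma ep_free:
  assumes m: "m \<in> carrier free_bimodule" and c: "c \<in> carrier C"
  shows "\<exists>c' \<in> carrier C. ep free_bimodule m c = ep free_bimodule uu c'"
proof -
  interpret M0l: left_module R free_bimodule using free_bimod by (simp add: bimod_def)
  note u = free_kp(1)[of "\<one>\<^bsub>R\<^esub>" "\<one>\<^bsub>R\<^esub>"] and e = ep_add[OF free_bimod] ep_R[OF free_bimod]
  have "m \<in> carrier (ktens k R R Reg Reg)" using m by simp
  then show ?thesis
  proof (induction rule: kt_induct[OF kR kR Reg Reg, consumes 1, case_names pure add])
    case (pure a b)
    have "kp Reg Reg a b = (a \<triangleright>\<^bsub>free_bimodule\<^esub> uu) \<triangleleft>\<^bsub>free_bimodule\<^esub> b"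
      using pure by (simp add: free_lact_pure free_ract del: free_bimodule_simps)
    then have "ep free_bimodule (kp Reg Reg a b) c = ep free_bimodule uu ((b \<unrhd>\<^bsub>C\<^esub> c) \<unlhd>\<^bsub>C\<^esub> a)"
      using e(3)[of "a \<triangleright>\<^bsub>free_bimodule\<^esub> uu" c b] e(4)[of uu "b \<unrhd>\<^bsub>C\<^esub> c" a] M0l.lact_closed[of a uu] pure c u
      by (simp del: free_bimodule_simps(4))
    then show ?case using pure c by (intro bexI[of _ "(b \<unrhd>\<^bsub>C\<^esub> c) \<unlhd>\<^bsub>C\<^esub> a"]) simp_all
  next
    case (add v w)
    then obtain c1 c2 where c12: "c1 \<in> carrier C" "c2 \<in> carrier C" "ep free_bimodule v c = ep free_bimodule uu c1"
      "ep free_bimodule w c = ep free_bimodule uu c2" by blast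
    have "ep free_bimodule (v \<oplus>\<^bsub>free_bimodule\<^esub> w) c = ep free_bimodule v c \<oplus>\<^bsub>Fo free_bimodule\<^esub> ep free_bimodule w c"
      by (rule e(1)) (use add(1,2) c in simp_all)
    also have "\<dots> = ep free_bimodule uu (c1 \<oplus>\<^bsub>C\<^esub> c2)"
      unfolding c12(3,4) by (rule e(2)[symmetric]) (use u c12(1,2) in simp_all)
    finally show ?case using c12(1,2) C.S_part.M.a_closed[of c1 c2] by (intro bexI[of _ "c1 \<oplus>\<^bsub>C\<^esub> c2"]) simp_all
  qed
qed

text \<open>The canonical identification of F(R \<otimes> R) with C. The scalars a and b change
  sides because in F the left action on M is matched with the right action on C.\<close>

definition kapF where
  "kapF = elift R free_bimodule C C (\<lambda>t c. klift k R R Reg Reg C (\<lambda>a b. (b \<unrhd>\<^bsub>C\<^esub> c) \<unlhd>\<^bsub>C\<^esub> a) t)"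

lemma kapF:
  shows kapF_llin: "llin S (Fo free_bimodule) C kapF" and kapF_rlin: "rlin S (Fo free_bimodule) C kapF"
    and kapF_pure: "c \<in> carrier C \<Longrightarrow> kapF (ep free_bimodule uu c) = c"
proof -
  let ?f = "\<lambda>c a b. (b \<unrhd>\<^bsub>C\<^esub> c) \<unlhd>\<^bsub>C\<^esub> a"
  let ?l = "\<lambda>t c. klift k R R Reg Reg C (?f c) t"
  have 1: "biadditive Reg Reg C (?f c)" if "c \<in> carrier C" for c
    using that by (intro biadditiveI) (simp_all add: R_act)
  have 2: "?f c (a \<triangleleft>\<^bsub>Reg\<^esub> scal R q) b = ?f c a (b \<triangleleft>\<^bsub>Reg\<^esub> scal R q)"
    if "c \<in> carrier C" "a \<in> carrier Reg" "q \<in> carrier k" "b \<in> carrier Reg" for c a q b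
  proof -
    note s = scal_closed[OF kR that(3)]
    have "(b \<otimes>\<^bsub>R\<^esub> scal R q) \<unrhd>\<^bsub>C\<^esub> c = scal R q \<unrhd>\<^bsub>C\<^esub> (b \<unrhd>\<^bsub>C\<^esub> c)"
      using that s by (simp add: R_act(5)[symmetric] scal_central[OF kR])
    then show ?thesis using that s by (simp add: R_act(6) R_act(9) ractR_scal)
  qed
  note ab = C_mod(3)
  have l: "additive (ktens k R R Reg Reg) C (\<lambda>t. ?l t c)" if "c \<in> carrier C" for c
    by (rule klift_additive[OF kR kR Reg Reg ab 1[OF that] 2[OF that]])
  have lp: "?l (kp Reg Reg a b) c = ?f c a b" if "c \<in> carrier C" "a \<in> carrier R" "b \<in> carrier R" for a b c
    using klift_pure[OF kR kR Reg Reg ab 1[OF that(1)] 2[OF that(1)], of a b] that(2,3) by simp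
  \<comment> \<open>One pattern for four conditions, balancedness on two sides and linearity on two
    sides: an operation \<open>h\<close> on the element of R \<otimes> R corresponds to an operation
    \<open>g\<close> on the value as soon as it does so on pure tensors.\<close>
  have lt: "?l (h t) c = g (?l t c')"
    if t: "t \<in> carrier (ktens k R R Reg Reg)" and h: "additive (ktens k R R Reg Reg) (ktens k R R Reg Reg) h"
      and g: "additive C C g" and c: "c \<in> carrier C" "c' \<in> carrier C"
      and e: "\<And>a b. \<lbrakk>a \<in> carrier R; b \<in> carrier R\<rbrakk> \<Longrightarrow> ?l (h (kp Reg Reg a b)) c = g (?f c' a b)" for t h g c c'
    by (rule free_kt(1)[OF additive_compose[OF h l[OF c(1)]] additive_compose[OF l[OF c(2)] g] _ t])
      (use e in \<open>simp add: lp[OF c(2)]\<close>)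
  have f1: "biadditive free_bimodule C C ?l"
  proof (intro biadditiveI; (unfold free_bimodule_simps)?)
    fix t c c' assume t: "t \<in> carrier (ktens k R R Reg Reg)" and c: "c \<in> carrier C" "c' \<in> carrier C"
    have cc: "c \<oplus>\<^bsub>C\<^esub> c' \<in> carrier C" using c C.S_part.M.a_closed by simp
    show "?l t (c \<oplus>\<^bsub>C\<^esub> c') = ?l t c \<oplus>\<^bsub>C\<^esub> ?l t c'"
      by (rule free_kt(1)[OF l[OF cc] additive_sum_maps[OF l[OF c(1)] l[OF c(2)] ab] _ t])
        (use c cc in \<open>simp add: lp R_act(1,2)\<close>)
  qed (simp_all add: additive_closed[OF l] additive_add[OF l])
  interpret M0: right_module R free_bimodule using free_bimod by (simp add: bimod_def)
  have ra: "additive (ktens k R R Reg Reg) (ktens k R R Reg Reg) (\<lambda>t. t \<triangleleft>\<^bsub>free_bimodule\<^esub> r)" if "r \<in> carrier R" for r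
    using M0.ract_closed M0.ract_add that by (intro additiveI) simp_all
  have f2: "?l (t \<triangleleft>\<^bsub>free_bimodule\<^esub> r) c = ?l t (r \<unrhd>\<^bsub>C\<^esub> c)"
    if "t \<in> carrier free_bimodule" "r \<in> carrier R" "c \<in> carrier C" for t r c
    by (rule lt[of t "\<lambda>t. t \<triangleleft>\<^bsub>free_bimodule\<^esub> r" "\<lambda>x. x" c "r \<unrhd>\<^bsub>C\<^esub> c", OF _ ra additive_id])
      (use that in \<open>simp_all add: lp free_ract R_act(5) del: free_bimodule_simps(4)\<close>)
  have f3: "?l (r \<triangleright>\<^bsub>free_bimodule\<^esub> t) c = ?l t (c \<unlhd>\<^bsub>C\<^esub> r)"
    if "t \<in> carrier free_bimodule" "r \<in> carrier R" "c \<in> carrier C" for t r c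
    by (rule lt[of t "\<lambda>t. r \<triangleright>\<^bsub>free_bimodule\<^esub> t" "\<lambda>x. x" c "c \<unlhd>\<^bsub>C\<^esub> r", OF _ free_lact_additive additive_id])
      (use that in \<open>simp_all add: lp free_lact_pure R_act\<close>)
  have ad: "additive (Fo free_bimodule) C kapF"
    unfolding kapF_def by (rule elift_additive[where f = ?l, OF free_bimod ab f1 f2 f3])
  have p: "kapF (ep free_bimodule t c) = ?l t c" if "t \<in> carrier (ktens k R R Reg Reg)" "c \<in> carrier C" for t c
    unfolding kapF_def using elift_pure[where f = ?l, OF free_bimod ab f1 f2 f3, of t c] that by simp
  show "c \<in> carrier C \<Longrightarrow> kapF (ep free_bimodule uu c) = c" for c
    using free_kp(1)[of "\<one>\<^bsub>R\<^esub>" "\<one>\<^bsub>R\<^esub>"] by (simp add: p lp R_act)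
  show "llin S (Fo free_bimodule) C kapF"
  proof (rule F_llin[OF free_bimod C_bimod ad])
    fix t c s assume t: "t \<in> carrier free_bimodule" and c: "c \<in> carrier C" and s: "s \<in> carrier S"
    have g: "additive C C (\<lambda>x. s \<triangleright>\<^bsub>C\<^esub> x)" using s by (intro additiveI) (simp_all add: C.S_part.lact_add)
    have "?l t (s \<triangleright>\<^bsub>C\<^esub> c) = s \<triangleright>\<^bsub>C\<^esub> ?l t c"
      by (rule lt[of t "\<lambda>t. t" "\<lambda>x. s \<triangleright>\<^bsub>C\<^esub> x" "s \<triangleright>\<^bsub>C\<^esub> c" c, OF _ additive_id g])
        (use t c s in \<open>simp_all add: lp C.lact_lactR C.lact_ractR\<close>)
    then show "kapF (ep free_bimodule t (s \<triangleright>\<^bsub>C\<^esub> c)) = s \<triangleright>\<^bsub>C\<^esub> kapF (ep free_bimodule t c)"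
      using t c s by (simp add: p)
  qed
  show "rlin S (Fo free_bimodule) C kapF"
  proof (rule F_rlin[OF free_bimod C_bimod ad])
    fix t c s assume t: "t \<in> carrier free_bimodule" and c: "c \<in> carrier C" and s: "s \<in> carrier S"
    have g: "additive C C (\<lambda>x. x \<triangleleft>\<^bsub>C\<^esub> s)" using s by (intro additiveI) (simp_all add: C.S_part.ract_add)
    have "?l t (c \<triangleleft>\<^bsub>C\<^esub> s) = ?l t c \<triangleleft>\<^bsub>C\<^esub> s"
      by (rule lt[of t "\<lambda>t. t" "\<lambda>x. x \<triangleleft>\<^bsub>C\<^esub> s" "c \<triangleleft>\<^bsub>C\<^esub> s" c, OF _ additive_id g])
        (use t c s in \<open>simp_all add: lp C.ract_lactR[symmetric] C.ract_ractR\<close>)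
    then show "kapF (ep free_bimodule t (c \<triangleleft>\<^bsub>C\<^esub> s)) = kapF (ep free_bimodule t c) \<triangleleft>\<^bsub>C\<^esub> s"
      using t c s by (simp add: p)
  qed
qed

text \<open>A * M is here a tensor product over R, so \<open>Z\<close> is all of R and acts through
  the left action of the bimodule M. N # M is the tensor product of N and F(M) over S, and its
  constraints are those of F followed by reassociation and by the right unitor.\<close>

lemma opmon_scheme:
  "comodule_scheme k R S C (carrier R) {M. k_bimodule k R R M} (bihom R R) lact
    (rtensor R) (rpure R) (rtensor_map R) (bitensor R) (rpure R) (rassoc R) (regular_bimodule R) (runit R)
    (\<lambda>N M. rtensor S N (Fo M)) (\<lambda>N M n m c. rpure S N (Fo M) n (ep M m c))
    (\<lambda>N M N' M' f g. rtensor_map S N (Fo M) N' (Fo M') f (fhom FF M M' g))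
    (\<lambda>N M M' z. rassoc S N (Fo M) (Fo M') (rtensor_map S N (Fo (bitensor R M M')) N (bitensor S (Fo M) (Fo M')) (\<lambda>w. w) (op2 FF M M') z))
    (\<lambda>N z. runit S N (rtensor_map S N (Fo (regular_bimodule R)) N (regular_bimodule S) (\<lambda>w. w) (op0 FF) z))
    free_bimodule uu (\<lambda>N. rtensor_map S N (Fo free_bimodule) N C (\<lambda>n. n) kapF)"
proof -
  have b: "bimod R R M" and lm: "left_module R M" and rm: "right_module R M" if "M \<in> {M. k_bimodule k R R M}" for M :: "'u bimodule"
    using that k_bimodule_bimod[of k R R M] by (simp_all add: bimod_def)
  note Fl = F_left_module[OF b] and Fb = F_bimod[OF b]
  note bl = k_bimodule_bimod[OF bitensor_k_bimodule]
  note Rb = regular_bimod[OF kR] and Sb = regular_bimod[OF kS] and Fbi = F_bimod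
  show ?thesis
  proof (intro comodule_scheme.intro comodule_scheme_axioms.intro coalgebroid_setting_axioms, goal_cases)
    case 1 show ?case by simp
  next
    case (2 M) then show ?case by (rule rm)
  next
    case (3 M r m) show ?case by (rule left_module.lact_closed[OF lm[OF 3(1)] 3(2,3)])
  next
    case (4 M M' g) then show ?case by (simp add: bihom_def)
  next
    case (5 M) show ?case using left_module.lact_closed[OF lm[OF 5]] rhom_id[OF rm[OF 5]] by (simp add: bihom_def)
  next
    case (6 A M) show ?case by (rule rt_right_module[OF 6(1) lm[OF 6(2)] b[OF 6(2)]])
  next
    case (7 A M) show ?case by (rule rpure_biadditive[OF 7(1) lm[OF 7(2)]])
  next
    case (8 A M a m r) show ?case by (rule rt_ract_pure[OF 8(1) lm[OF 8(2)] b[OF 8(2)] 8(5,3,4)])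
  next
    case (9 A M G h h' z) show ?case by (rule rt_hom_eq[OF 9(1) lm[OF 9(2)] 9(3-6)])
  next
    case (10 A M G f)
    note l = rlift_additive[OF 10(1) lm[OF 10(2)] 10(3,4), OF 10(5)] rlift_pure[OF 10(1) lm[OF 10(2)] 10(3,4), OF 10(5)]
    show ?case by (intro exI[of _ "rlift R A M G f"] conjI ballI l)
  next
    case (11 A A' M M' f g)
    then have g: "rlin R M M' g" "llin R M M' g" using rlin_additive[OF rhom_rlin, of g R M M'] by (auto simp: bihom_def rhom_rlin llin_def)
    note * = 11(1) lm[OF 11(3)] 11(2) lm[OF 11(4)] rhom_rlin[OF 11(5)] g(2)
    show ?case unfolding rhom_iff
      by (intro conjI rtensor_map_extensional[OF *] rtensor_map_rlin[OF * b[OF 11(3)] b[OF 11(4)] g(1)])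
  next
    case (12 A A' M M' f g a m)
    then have g: "llin R M M' g" using rlin_additive[OF rhom_rlin, of g R M M'] by (auto simp: bihom_def llin_def)
    show ?case by (rule rtensor_map_pure[OF 12(1) lm[OF 12(3)] 12(2) lm[OF 12(4)] rhom_rlin[OF 12(5)] g 12(7,8)])
  next
    case (13 M M') then show ?case by (simp add: bitensor_k_bimodule)
  next
    case (14 M M' m m') show ?case unfolding bitensor_simps by (rule rpure_closed[OF rm[OF 14(1)] lm[OF 14(2)] 14(3,4)])
  next
    case (15 M M' G h h' z) show ?case by (rule rt_hom_eq[OF rm[OF 15(1)] lm[OF 15(2)] 15(3-6)[unfolded bitensor_simps additive_bitensor]])
  next
    case (16 A M M')
    note * = 16(1) b[OF 16(2)] b[OF 16(3)]
    show ?case unfolding rhom_iff by (intro conjI rassoc_extensional[OF *] rassoc_rlin[OF *])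
  next
    case (17 A M M' a m m') show ?case by (rule rassoc_pure[OF 17(1) b[OF 17(2)] b[OF 17(3)] 17(4-6)])
  next
    case 18 show ?case by (simp add: regular_k_bimodule[OF kR])
  next
    case 19 show ?case by simp
  next
    case (20 A) show ?case by (rule runit_hom[OF kR 20])
  next
    case (21 A a r) show ?case by (rule runit_pure[OF kR 21])
  next
    case (22 N M) show ?case by (rule rt_right_module[OF 22(1) Fl[OF 22(2)] Fb[OF 22(2)]])
  next
    case (23 N M m)
    note N = 23(1) and M = b[OF 23(2)] and F = Fl[OF 23(2)]
    show ?case using 23(3)
      by (intro biadditiveI) (simp_all add: rpure_closed[OF N F] rpure_add[OF N F] ep_closed[OF M] ep_add[OF M])
  next
    case (24 N M n m m' c)
    note N = 24(1) and M = b[OF 24(2)] and F = Fl[OF 24(2)]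
    show ?case using 24(3-6) by (simp add: rpure_add[OF N F] ep_closed[OF M] ep_add[OF M])
  next
    case (25 N M n m c s)
    note N = 25(1) and M = b[OF 25(2)] and F = Fl[OF 25(2)]
    show ?case using 25(3-6) by (simp add: rt_ract_pure[OF N F Fbi[OF M]] ep_closed[OF M] ep_ract[OF M])
  next
    case (26 N M n m c s)
    note N = 26(1) and M = b[OF 26(2)] and F = Fl[OF 26(2)]
    show ?case using 26(3-6) by (simp add: rpure_balanced[OF N F] ep_closed[OF M] ep_lact[OF M])
  next
    case (27 N M n m c r) then show ?case by (simp add: ep_R[OF b[OF 27(2)]])
  next
    case (28 N M n m c r) then show ?case by (simp add: ep_R[OF b[OF 28(2)]])
  next
    case (29 N M G h h' z)
    note N = 29(1) and M = b[OF 29(2)] and F = Fl[OF 29(2)]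
    show ?case
    proof (rule rt_hom_eq[OF N F 29(3,4) _ 29(6)])
      fix n w assume n: "n \<in> carrier N" and w: "w \<in> carrier (Fo M)"
      have a: "additive (Fo M) (rtensor S N (Fo M)) (rpure S N (Fo M) n)"
        using rpure_biadditive[OF N F] n by (simp add: biadditive_def)
      show "h (rpure S N (Fo M) n w) = h' (rpure S N (Fo M) n w)"
        by (rule F_eq[OF M additive_compose[OF a 29(3)] additive_compose[OF a 29(4)] 29(5)[OF n] w])
    qed
  next
    case (30 N N' M M' f g)
    note g = F_hom_llin[OF b[OF 30(3)] b[OF 30(4)] 30(6)] F_hom_rlin[OF b[OF 30(3)] b[OF 30(4)] 30(6)]
    show ?case
      by (rule rtensor_map_rlin[OF 30(1) Fl[OF 30(3)] 30(2) Fl[OF 30(4)] rhom_rlin[OF 30(5)] g(1) Fb[OF 30(3)] Fb[OF 30(4)] g(2)])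
  next
    case (31 N N' M M' f g n m c)
    note M = b[OF 31(3)] b[OF 31(4)]
    show ?case
      using rtensor_map_pure[OF 31(1) Fl[OF 31(3)] 31(2) Fl[OF 31(4)] rhom_rlin[OF 31(5)] F_hom_llin[OF M 31(6)] 31(7) ep_closed[OF M(1) 31(8,9)]]
      by (simp add: F_hom_pure[OF M 31(6,8,9)])
  next
    case (32 N M M')
    note M = b[OF 32(2)] b[OF 32(3)] and N = 32(1)
    note B = bt_bimod[OF M] and FB = bt_bimod[OF Fbi[OF M(1)] Fbi[OF M(2)]]
    have FBl: "left_module S (bitensor S (Fo M) (Fo M'))" using FB by (simp add: bimod_def)
    show ?case
      by (rule additive_compose[OF rtensor_map_additive[OF N F_left_module[OF B] N FBl rlin_id op2_llin[OF M]]
            rlin_additive[OF rassoc_rlin[OF N Fbi[OF M(1)] Fbi[OF M(2)]]]])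
  next
    case (33 N M M' n m m' c)
    note M = b[OF 33(2)] b[OF 33(3)] and N = 33(1)
    note B = bt_bimod[OF M] and FB = bt_bimod[OF Fbi[OF M(1)] Fbi[OF M(2)]]
    have FBl: "left_module S (bitensor S (Fo M) (Fo M'))" using FB by (simp add: bimod_def)
    have w: "rpure R M M' m m' \<in> carrier (bitensor R M M')"
      using rpure_closed[OF rm[OF 33(2)] lm[OF 33(3)] 33(5,6)] by simp
    show ?case
      unfolding rtensor_map_pure[OF N F_left_module[OF B] N FBl rlin_id op2_llin[OF M] 33(4) ep_closed[OF B w 33(7)]]
      by (rule sharp_op2[OF N M 33(4-7)])
  next
    case (34 N)
    have Sl: "left_module S (regular_bimodule S)" using Sb by (simp add: bimod_def)
    show ?case
      by (rule additive_compose[OF rtensor_map_additive[OF 34 F_left_module[OF Rb] 34 Sl rlin_id op0_llin]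
            rlin_additive[OF rhom_rlin[OF runit_hom[OF kS 34]]]])
  next
    case (35 N n r c)
    have Sl: "left_module S (regular_bimodule S)" using Sb by (simp add: bimod_def)
    have r: "r \<in> carrier (regular_bimodule R)" using 35(3) by simp
    show ?case
      unfolding rtensor_map_pure[OF 35(1) F_left_module[OF Rb] 35(1) Sl rlin_id op0_llin 35(2) ep_closed[OF Rb r 35(4)]]
      using 35 by (simp add: op0_pure runit_pure[OF kS])
  next
    case 36 show ?case by (simp add: free_k_bimodule)
  next
    case 37 show ?case by (simp add: free_kp(1))
  next
    case (38 M m) then show ?case by (intro free_bimodule_free) simp_all
  next
    case (39 N n m c) then show ?case using ep_free[of m c] by auto
  next
    case (40 N)
    show ?case
      by (rule rtensor_map_rlin[OF 40 F_left_module[OF free_bimod] 40 C_mod(2) rlin_id kapF_llin F_bimod[OF free_bimod] C_bimod kapF_rlin])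
  next
    case (41 N n c)
    have u: "uu \<in> carrier free_bimodule" by (simp add: free_kp(1))
    show ?case
      using rtensor_map_pure[OF 41(1) F_left_module[OF free_bimod] 41(1) C_mod(2) rlin_id kapF_llin 41(2) ep_closed[OF free_bimod u 41(3)]]
      by (simp add: kapF_pure[OF 41(3)])
  qed
qed

end

context coalgebroid_setting
begin

theorem opmon_weak_equivalence:
  "\<exists>F. weak_equivalence (cocontinuous_opmon_comodules k R S FF) (coalgebroid_comodules S C) F"
proof -
  interpret sch: comodule_scheme k R S C "carrier R" "{M. k_bimodule k R R M}" "bihom R R" lact
    "rtensor R" "rpure R" "rtensor_map R" "bitensor R" "rpure R" "rassoc R" "regular_bimodule R" "runit R"
    "\<lambda>N M. rtensor S N (Fo M)" "\<lambda>N M n m c. rpure S N (Fo M) n (ep M m c)"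
    "\<lambda>N M N' M' f g. rtensor_map S N (Fo M) N' (Fo M') f (fhom FF M M' g)"
    "\<lambda>N M M' z. rassoc S N (Fo M) (Fo M') (rtensor_map S N (Fo (bitensor R M M')) N (bitensor S (Fo M) (Fo M')) (\<lambda>w. w) (op2 FF M M') z)"
    "\<lambda>N z. runit S N (rtensor_map S N (Fo (regular_bimodule R)) N (regular_bimodule S) (\<lambda>w. w) (op0 FF) z)"
    free_bimodule uu "\<lambda>N. rtensor_map S N (Fo free_bimodule) N C (\<lambda>n. n) kapF"
    by (rule opmon_scheme)
  \<comment> \<open>The scheme has F applied to an identity where \<open>opmon_comodule\<close> has
    the identity map of F(M).\<close>
  have F_id: "fhom FF M M (\<lambda>m \<in> carrier M. m) w = w" if M: "k_bimodule k R R M" and w: "w \<in> carrier (Fo M)" for M w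
  proof -
    note b = k_bimodule_bimod[OF M]
    have i: "(\<lambda>m \<in> carrier M. m) \<in> bihom R R M M" using M by (intro sch.ihom_id) simp
    have "additive (Fo M) (Fo M) (fhom FF M M (\<lambda>m \<in> carrier M. m))" using F_hom_llin[OF b b i] by (simp add: llin_def)
    then show ?thesis by (rule F_eq[OF b _ additive_id _ w]) (simp add: F_hom_pure[OF b b i])
  qed
  have map_id: "rtensor_map S N (Fo M) N' (Fo M) f (fhom FF M M (\<lambda>m \<in> carrier M. m)) = rtensor_map S N (Fo M) N' (Fo M) f (\<lambda>w. w)"
    if "k_bimodule k R R M" for N N' :: "'u rmodule" and M f
    unfolding rtensor_map_def by (rule tlift_cong) (simp add: F_id[OF that])
  \<comment> \<open>\<open>opmon_comodule\<close> states the unit axiom along the inverse unitor,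
    \<open>diagonal\<close> along the unitor. The functor Y makes mutually inverse maps of them, so
    one form can be substituted into the other.\<close>
  have unit: "(\<forall>X \<in> {X. right_module R X}. \<forall>x \<in> carrier (fob Y X). s X (fhom Y X (rtensor R X (regular_bimodule R)) (runit_inv R X) x) = x)
    \<longleftrightarrow> (\<forall>X \<in> {X. right_module R X}. \<forall>z \<in> carrier (fob Y (rtensor R X (regular_bimodule R))).
        s X z = fhom Y (rtensor R X (regular_bimodule R)) X (runit R X) z)"
    if Y: "cat_functor (RMod R) (RMod S) Y" for Y :: "'u mod_ftor" and s
  proof (rule ball_cong[OF refl])
    interpret Y: cat_functor "RMod R" "RMod S" Y by (rule Y)
    fix X :: "'u rmodule" assume "X \<in> {X. right_module R X}"
    then have X: "right_module R X" by simp
    let ?P = "rtensor R X (regular_bimodule R)"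
    have P: "right_module R ?P" by (rule sch.star_mod[OF X sch.iunit_ob])
    note h = runit_hom[OF kR X] runit_inv_hom[OF kR X]
    have c: "fhom Y ?P X (runit R X) z \<in> carrier (fob Y X)" if "z \<in> carrier (fob Y ?P)" for z
      using Y.fhom_closed[of ?P X "runit R X"] X P h(1) that by (auto dest!: rhom_rlin rlin_closed)
    have c': "fhom Y X ?P (runit_inv R X) x \<in> carrier (fob Y ?P)" if "x \<in> carrier (fob Y X)" for x
      using Y.fhom_closed[of X ?P "runit_inv R X"] X P h(2) that by (auto dest!: rhom_rlin rlin_closed)
    have e: "compose (carrier X) (runit R X) (runit_inv R X) = (\<lambda>x \<in> carrier X. x)"
      "compose (carrier ?P) (runit_inv R X) (runit R X) = (\<lambda>z \<in> carrier ?P. z)"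
      by (auto simp: compose_def fun_eq_iff runit_runit_inv[OF kR X] runit_inv_runit[OF kR X])
    have 1: "fhom Y ?P X (runit R X) (fhom Y X ?P (runit_inv R X) x) = x" if x: "x \<in> carrier (fob Y X)" for x
      using fun_cong[OF Y.fhom_Cmp[of X ?P X "runit_inv R X" "runit R X"], of x] X P h x Y.fhom_Idn[of X]
      by (simp add: e compose_eq)
    have 2: "fhom Y X ?P (runit_inv R X) (fhom Y ?P X (runit R X) z) = z" if z: "z \<in> carrier (fob Y ?P)" for z
      using fun_cong[OF Y.fhom_Cmp[of ?P X ?P "runit R X" "runit_inv R X"], of z] X P h z Y.fhom_Idn[of ?P]
      by (simp add: e compose_eq)
    show "(\<forall>x \<in> carrier (fob Y X). s X (fhom Y X ?P (runit_inv R X) x) = x)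
      \<longleftrightarrow> (\<forall>z \<in> carrier (fob Y ?P). s X z = fhom Y ?P X (runit R X) z)"
    proof (intro iffI ballI)
      fix z assume *: "\<forall>x \<in> carrier (fob Y X). s X (fhom Y X ?P (runit_inv R X) x) = x" and z: "z \<in> carrier (fob Y ?P)"
      show "s X z = fhom Y ?P X (runit R X) z" using bspec[OF * c[OF z]] by (simp only: 2[OF z])
    next
      fix x assume *: "\<forall>z \<in> carrier (fob Y ?P). s X z = fhom Y ?P X (runit R X) z" and x: "x \<in> carrier (fob Y X)"
      show "s X (fhom Y X ?P (runit_inv R X) x) = x" using bspec[OF * c'[OF x]] by (simp only: 1[OF x])
    qed
  qed
  \<comment> \<open>Apart from the unit axiom, the two conjunctions differ by \<open>map_id\<close>
    only.\<close>
  have obj: "opmon_comodule k R S FF (Y, y) \<longleftrightarrow> sch.diagonal (Y, y)" for Y y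
    unfolding opmon_comodule_def sch.diagonal_def prod.case opmon_of_simps(1) RMod_simps(1) Bimod_simps
    by (intro conj_cong refl; (erule unit[of Y "\<lambda>X z. runit S (fob Y X) (rtensor_map S (fob Y X) (Fo (regular_bimodule R))
      (fob Y X) (regular_bimodule S) (\<lambda>w. w) (op0 FF) (y X (regular_bimodule R) z))"] | simp add: map_id))
  have "cocontinuous_opmon_comodules k R S FF = sch.diagonals"
    unfolding cocontinuous_opmon_comodules_def sch.diagonals_def obj by (simp add: map_id opmon_of_simps(1))
  then show ?thesis using sch.E_weak_equivalence by auto
qed

end

theorem theorem2p4:
  fixes k :: "'k ring" and R S :: "('k, 'u) module" and C :: "'u coalg"
  assumes "infinite (UNIV :: 'u set)"
    and "cring k" and "k_algebra k R" and "k_algebra k S"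
    and "coalgebroid k R S C"
  shows "equivalent_categories
           (coalgebroid_comodules S C)
           (cocontinuous_opmon_comodules k R S (opmon_of R S C)) \<and>
         equivalent_categories
           (coalgebroid_comodules S C)
           (cocontinuous_oplax_morphisms k R S (self_actegory k R) (actegory_of k R S C)) \<and>
         equivalent_categories
           (cocontinuous_opmon_comodules k R S (opmon_of R S C))
           (cocontinuous_oplax_morphisms k R S (self_actegory k R) (actegory_of k R S C))"
proof -
  interpret R: k_algebra k R by fact
  interpret S: k_algebra k S by fact
  interpret C: coalgebroid k R S C by fact
  interpret coalgebroid_setting k R S C
    by unfold_locales (fact assms(1))
  from opmon_weak_equivalence oplax_weak_equivalence obtain F G where
    "weak_equivalence (cocontinuous_opmon_comodules k R S (opmon_of R S C)) (coalgebroid_comodules S C) F"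
    "weak_equivalence (cocontinuous_oplax_morphisms k R S (self_actegory k R) (actegory_of k R S C)) (coalgebroid_comodules S C) G"
    by blast
  \<comment> \<open>Both functors end in comodules over C, so (i) is compared with (ii) and (iii)
    directly, and these two with each other through (i).\<close>
  then show ?thesis
    using equivalent_via weak_equivalence_equivalent equivalent_categories_sym by metis
qed

end
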